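(* Let $d$ be a positive integer, let $\Lambda$ be a $d$-representation-finite algebra over a field $k$ with $d$-cluster tilting module $\Pi$ (its $(d+1)$-preprojective algebra regarded as a right $\Lambda$-module), let $\Gamma=\operatorname{End}_\Lambda(\Pi)$, and fix a presentation $\Gamma\cong kQ_\Gamma/I_\Gamma$ by a quiver with relations, where the vertices of $Q_\Gamma$ are in bijection with the indecomposable direct summands $X$ of $\Pi$. Let $\widetilde{Q}_\Gamma$ be the quiver obtained from $Q_\Gamma$ by adding a new arrow $q_X:\tau_d^-(X)\to X$ for every indecomposable non-injective direct summand $X$ of $\Pi$. For each arrow $a:X\to Y$ of $Q_\Gamma$, define $r_a\in k\widetilde{Q}_\Gamma/(I_\Gamma)$ by $$r_a:=\begin{cases} aq_X-q_Y\tau_d^-(a) & \text{if } X \text{ and } Y \text{ are non-injective},\\ aq_X & \text{if } X \text{ is non-injective and } Y \text{ is injective},\\ 0 & \text{if } X\text{ is injective}.\end{cases}$$ Then the total $(d+1)$-preprojective algebra $\Psi=\Psi(\Lambda)$ of $\Lambda$ admits a $k$-algebra isomorphism $$\Psi\simeq k\widetilde{Q}_\Gamma/(I_\Gamma,\ r_a\mid a\in(Q_\Gamma)_1).$$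
   Context: All modules are finitely generated right modules, $D=\operatorname{Hom}_k(-,k)$, and the composition of morphisms $f:X\to Y$, $g:Y\to Z$ is $g\circ f$. The composition of arrows $a:i\to j$ and $b:j\to k$ in a quiver is denoted $ba$; $(Q_\Gamma)_1$ is the set of arrows of $Q_\Gamma$; parentheses denote the two-sided ideal generated. For a finite dimensional algebra $A$, $M\in\operatorname{mod}A$ is $d$-cluster tilting if $\operatorname{add}M=\{X\mid \operatorname{Ext}^i_A(M,X)=0\ \forall\,1\le i\le d-1\}=\{X\mid\operatorname{Ext}^i_A(X,M)=0\ \forall\,1\le i\le d-1\}$. A finite dimensional algebra $\Lambda$ is $d$-representation-finite if $\operatorname{gldim}\Lambda\le d$ and a $d$-cluster tilting $\Lambda$-module exists. The inverse $d$-Auslander-Reiten translation is $\tau_d^-:=\operatorname{Ext}^d_\Lambda(D\Lambda,-):\operatorname{mod}\Lambda\to\operatorname{mod}\Lambda$. For $X\in\operatorname{mod}\Lambda$, $\Psi_\Lambda^X:=\bigoplus_{i\ge0}\operatorname{Hom}_\Lambda(X,\tau_d^{-i}(X))$ is the graded algebra with multiplication $g\cdot f:=\tau_d^{-i}(g)\circ f$ for $f$ of degree $i$ and $g$ of degree $j$. The $(d+1)$-preprojective algebra of $\Lambda$ is $\Pi:=\Psi_\Lambda^\Lambda$, and the total $(d+1)$-preprojective algebra is $\Psi=\Psi(\Lambda):=\Psi_\Lambda^\Pi$ with $\Pi$ regarded as a right $\Lambda$-module. It is known that, for $\Lambda$ $d$-representation-finite, $\Pi$ regarded as a $\Lambda$-module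 gives the unique basic $d$-cluster tilting $\Lambda$-module. Vertices of $Q_\Gamma$ are identified with the indecomposable direct summands of $\Pi$, and an arrow $a:X\to Y$ of $Q_\Gamma$ with the corresponding morphism $X\to Y$. For an indecomposable non-injective summand $X$ of $\Pi$, $\tau_d^-(X)$ is again an indecomposable summand of $\Pi$, hence a vertex (up to identification along an isomorphism). For $X,Y$ non-injective, $\tau_d^-(a):\tau_d^-(X)\to\tau_d^-(Y)$ is the morphism obtained by applying the functor $\tau_d^-$ to $a$, viewed as an element of $\Gamma\cong kQ_\Gamma/I_\Gamma$ and mapped to $k\widetilde{Q}_\Gamma/(I_\Gamma)$. *)

theory Defs
  imports "Graph_Theory.Arc_Walk" "HOL-Algebra.QuotRing" "HOL-Algebra.Module"
begin

text \<open>
  Vector spaces over a field \<open>K\<close> and \<open>K\<close>-algebras use the record \<^type>\<open>module\<close> of HOL-Algebra.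
  For bare vector spaces its fields \<open>mult\<close> and \<open>one\<close> carry no meaning and are set to
  \<^term>\<open>undefined\<close>. All spaces of maps consist of extensional functions, so that equality of
  morphisms is equality in HOL.
\<close>

section \<open>Vector spaces and algebras\<close>

definition linear_maps ::
  "('k, 'z) ring_scheme \<Rightarrow> ('k, 'v, 'y) module_scheme \<Rightarrow> ('k, 'w, 'x) module_scheme \<Rightarrow> ('v \<Rightarrow> 'w) set"
  where "linear_maps K V W = {f \<in> carrier V \<rightarrow>\<^sub>E carrier W.
    (\<forall>x\<in>carrier V. \<forall>y\<in>carrier V. f (x \<oplus>\<^bsub>V\<^esub> y) = f x \<oplus>\<^bsub>W\<^esub> f y) \<and>
    (\<forall>c\<in>carrier K. \<forall>x\<in>carrier V. f (c \<odot>\<^bsub>V\<^esub> x) = c \<odot>\<^bsub>W\<^esub> f x)}"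

definition zero_map :: "('k, 'v, 'y) module_scheme \<Rightarrow> ('k, 'w, 'x) module_scheme \<Rightarrow> 'v \<Rightarrow> 'w"
  where "zero_map V W = (\<lambda>x\<in>carrier V. \<zero>\<^bsub>W\<^esub>)"

definition id_map :: "('k, 'v, 'y) module_scheme \<Rightarrow> 'v \<Rightarrow> 'v"
  where "id_map V = (\<lambda>x\<in>carrier V. x)"

definition base_field :: "('k, 'z) ring_scheme \<Rightarrow> ('k, 'k) module"
  where "base_field K = \<lparr>carrier = carrier K, mult = mult K, one = \<one>\<^bsub>K\<^esub>, zero = \<zero>\<^bsub>K\<^esub>, add = add K,
    smult = mult K\<rparr>"

text \<open>The space \<open>K\<^sup>n\<close>, realised as the sequences vanishing from index \<open>n\<close> on.\<close>

definition coord_space :: "('k, 'z) ring_scheme \<Rightarrow> nat \<Rightarrow> ('k, nat \<Rightarrow> 'k) module"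
  where "coord_space K n = \<lparr>
    carrier = {x. (\<forall>i<n. x i \<in> carrier K) \<and> (\<forall>i\<ge>n. x i = \<zero>\<^bsub>K\<^esub>)},
    mult = undefined, one = undefined,
    zero = (\<lambda>i. \<zero>\<^bsub>K\<^esub>),
    add = (\<lambda>x y i. x i \<oplus>\<^bsub>K\<^esub> y i),
    smult = (\<lambda>c x i. c \<otimes>\<^bsub>K\<^esub> x i)\<rparr>"

definition is_coord :: "('k, 'z) ring_scheme \<Rightarrow> ('k, 'v, 'y) module_scheme \<Rightarrow> ('v \<Rightarrow> nat \<Rightarrow> 'k) \<Rightarrow> bool"
  where "is_coord K V \<phi> \<longleftrightarrow> (\<exists>n. \<phi> \<in> linear_maps K V (coord_space K n) \<and>
    bij_betw \<phi> (carrier V) (carrier (coord_space K n)))"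

definition fin_dim :: "('k, 'z) ring_scheme \<Rightarrow> ('k, 'v, 'y) module_scheme \<Rightarrow> bool"
  where "fin_dim K V \<longleftrightarrow> (\<exists>\<phi>. is_coord K V \<phi>)"

locale k_algebra = module K A + A?: ring A for K (structure) and A (structure) +
  assumes smult_mult_left: "\<lbrakk>c \<in> carrier K; x \<in> carrier A; y \<in> carrier A\<rbrakk> \<Longrightarrow>
      (c \<odot>\<^bsub>A\<^esub> x) \<otimes>\<^bsub>A\<^esub> y = c \<odot>\<^bsub>A\<^esub> (x \<otimes>\<^bsub>A\<^esub> y)"
    and smult_mult_right: "\<lbrakk>c \<in> carrier K; x \<in> carrier A; y \<in> carrier A\<rbrakk> \<Longrightarrow>
      x \<otimes>\<^bsub>A\<^esub> (c \<odot>\<^bsub>A\<^esub> y) = c \<odot>\<^bsub>A\<^esub> (x \<otimes>\<^bsub>A\<^esub> y)"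

definition fd_algebra :: "('k, 'z) ring_scheme \<Rightarrow> ('k, 'a, 'y) module_scheme \<Rightarrow> bool"
  where "fd_algebra K A \<longleftrightarrow> field K \<and> k_algebra K A \<and> fin_dim K A"

definition alg_iso ::
  "('k, 'z) ring_scheme \<Rightarrow> ('k, 'a, 'y) module_scheme \<Rightarrow> ('k, 'b, 'x) module_scheme \<Rightarrow> ('a \<Rightarrow> 'b) set"
  where "alg_iso K A B = {f \<in> ring_iso A B.
    \<forall>c\<in>carrier K. \<forall>x\<in>carrier A. f (c \<odot>\<^bsub>A\<^esub> x) = c \<odot>\<^bsub>B\<^esub> f x}"

text \<open>
  The map of quotients induced by a map \<open>g\<close> on representatives; \<open>B\<close> is the subspace of the
  target \<open>C\<close> that is divided out and \<open>S\<close> is a coset in the source.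
\<close>

definition coset_map :: "('k, 'c, 'y) module_scheme \<Rightarrow> 'c set \<Rightarrow> ('b \<Rightarrow> 'c) \<Rightarrow> 'b set \<Rightarrow> 'c set"
  where "coset_map C B g S = (\<Union>s\<in>S. B +>\<^bsub>C\<^esub> g s)"

definition alg_quot :: "('k, 'a, 'y) module_scheme \<Rightarrow> 'a set \<Rightarrow> ('k, 'a set) module"
  where "alg_quot A J = (let R = A Quot J in
    \<lparr>carrier = carrier R, mult = mult R, one = one R, zero = zero R, add = add R,
     smult = (\<lambda>c. coset_map A J (\<lambda>x. c \<odot>\<^bsub>A\<^esub> x))\<rparr>)"


section \<open>Right modules\<close>

record ('k, 'a, 'm) rmod = "('k, 'm) module" + ract :: "'m \<Rightarrow> 'a \<Rightarrow> 'm"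

definition with_action :: "('k, 'm, 'y) module_scheme \<Rightarrow> ('m \<Rightarrow> 'a \<Rightarrow> 'm) \<Rightarrow> ('k, 'a, 'm) rmod"
  where "with_action V r = \<lparr>carrier = carrier V, mult = undefined, one = undefined,
    zero = \<zero>\<^bsub>V\<^esub>, add = add V, smult = smult V, ract = r\<rparr>"

definition right_module ::
  "('k, 'z) ring_scheme \<Rightarrow> ('k, 'a, 'y) module_scheme \<Rightarrow> ('k, 'a, 'm) rmod \<Rightarrow> bool"
  where "right_module K A M \<longleftrightarrow> module K M \<and>
    (\<forall>m\<in>carrier M. \<forall>a\<in>carrier A. ract M m a \<in> carrier M) \<and>
    (\<forall>a\<in>carrier A. (\<lambda>m\<in>carrier M. ract M m a) \<in> linear_maps K M M) \<and>
    (\<forall>m\<in>carrier M. (\<lambda>a\<in>carrier A. ract M m a) \<in> linear_maps K A M) \<and>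
    (\<forall>m\<in>carrier M. ract M m \<one>\<^bsub>A\<^esub> = m) \<and>
    (\<forall>m\<in>carrier M. \<forall>a\<in>carrier A. \<forall>b\<in>carrier A.
      ract M (ract M m a) b = ract M m (a \<otimes>\<^bsub>A\<^esub> b))"

definition right_submodule ::
  "('k, 'z) ring_scheme \<Rightarrow> ('k, 'a, 'y) module_scheme \<Rightarrow> ('k, 'a, 'm) rmod \<Rightarrow> 'm set \<Rightarrow> bool"
  where "right_submodule K A M N \<longleftrightarrow> submodule N K M \<and>
    (\<forall>m\<in>N. \<forall>a\<in>carrier A. ract M m a \<in> N)"

definition fg_module ::
  "('k, 'z) ring_scheme \<Rightarrow> ('k, 'a, 'y) module_scheme \<Rightarrow> ('k, 'a, 'm) rmod \<Rightarrow> bool"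
  where "fg_module K A M \<longleftrightarrow> right_module K A M \<and>
    (\<exists>S\<subseteq>carrier M. finite S \<and> (\<forall>N. right_submodule K A M N \<and> S \<subseteq> N \<longrightarrow> N = carrier M))"

definition Hom ::
  "('k, 'z) ring_scheme \<Rightarrow> ('k, 'a, 'y) module_scheme \<Rightarrow> ('k, 'a, 'm) rmod \<Rightarrow> ('k, 'a, 'n) rmod \<Rightarrow>
    ('m \<Rightarrow> 'n) set"
  where "Hom K A M N = {f \<in> linear_maps K M N.
    \<forall>m\<in>carrier M. \<forall>a\<in>carrier A. f (ract M m a) = ract N (f m) a}"

definition mod_iso ::
  "('k, 'z) ring_scheme \<Rightarrow> ('k, 'a, 'y) module_scheme \<Rightarrow> ('k, 'a, 'm) rmod \<Rightarrow> ('k, 'a, 'n) rmod \<Rightarrow>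
    ('m \<Rightarrow> 'n) set"
  where "mod_iso K A M N = {f \<in> Hom K A M N. bij_betw f (carrier M) (carrier N)}"

definition End_algebra ::
  "('k, 'z) ring_scheme \<Rightarrow> ('k, 'a, 'y) module_scheme \<Rightarrow> ('k, 'a, 'm) rmod \<Rightarrow> ('k, 'm \<Rightarrow> 'm) module"
  where "End_algebra K A M = \<lparr>carrier = Hom K A M M,
    mult = compose (carrier M), one = id_map M,
    zero = zero_map M M,
    add = (\<lambda>f g. \<lambda>x\<in>carrier M. f x \<oplus>\<^bsub>M\<^esub> g x),
    smult = (\<lambda>c f. \<lambda>x\<in>carrier M. c \<odot>\<^bsub>M\<^esub> f x)\<rparr>"

definition direct_sum :: "'i set \<Rightarrow> ('i \<Rightarrow> ('k, 'a, 'm) rmod) \<Rightarrow> ('k, 'a, 'i \<Rightarrow> 'm) rmod"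
  where "direct_sum J X = \<lparr>carrier = PiE J (\<lambda>i. carrier (X i)),
    mult = undefined, one = undefined,
    zero = (\<lambda>i\<in>J. \<zero>\<^bsub>X i\<^esub>),
    add = (\<lambda>x y. \<lambda>i\<in>J. x i \<oplus>\<^bsub>X i\<^esub> y i),
    smult = (\<lambda>c x. \<lambda>i\<in>J. c \<odot>\<^bsub>X i\<^esub> x i),
    ract = (\<lambda>x a. \<lambda>i\<in>J. ract (X i) (x i) a)\<rparr>"
  \<comment> \<open>only used for finite \<open>J\<close>\<close>

definition inj_summand :: "'i set \<Rightarrow> ('i \<Rightarrow> ('k, 'a, 'm) rmod) \<Rightarrow> 'i \<Rightarrow> 'm \<Rightarrow> 'i \<Rightarrow> 'm"
  where "inj_summand J X i = (\<lambda>x\<in>carrier (X i). \<lambda>j\<in>J. if j = i then x else \<zero>\<^bsub>X j\<^esub>)"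

definition proj_summand :: "'i set \<Rightarrow> ('i \<Rightarrow> ('k, 'a, 'm) rmod) \<Rightarrow> 'i \<Rightarrow> ('i \<Rightarrow> 'm) \<Rightarrow> 'm"
  where "proj_summand J X i = (\<lambda>x\<in>carrier (direct_sum J X). x i)"

definition indecomposable ::
  "('k, 'z) ring_scheme \<Rightarrow> ('k, 'a, 'y) module_scheme \<Rightarrow> ('k, 'a, 'm) rmod \<Rightarrow> bool"
  where "indecomposable K A M \<longleftrightarrow> carrier M \<noteq> {\<zero>\<^bsub>M\<^esub>} \<and>
    (\<forall>N N'. right_submodule K A M N \<and> right_submodule K A M N' \<and>
      N \<inter> N' = {\<zero>\<^bsub>M\<^esub>} \<and> N <+>\<^bsub>M\<^esub> N' = carrier M \<longrightarrow> N = {\<zero>\<^bsub>M\<^esub>} \<or> N' = {\<zero>\<^bsub>M\<^esub>})"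

text \<open>
  Quantifiers over \<open>mod A\<close> range over modules whose elements have type \<^typ>\<open>nat \<Rightarrow> 'k\<close>. For a
  finite dimensional \<open>A\<close> this is no restriction: a finitely generated module is finite
  dimensional over \<open>K\<close>, hence isomorphic to one carried by some \<^term>\<open>coord_space K n\<close>.
\<close>

definition projective ::
  "('k, 'z) ring_scheme \<Rightarrow> ('k, 'a, 'y) module_scheme \<Rightarrow> ('k, 'a, 'm) rmod \<Rightarrow> bool"
  where "projective K A P \<longleftrightarrow>
    (\<forall>(M :: ('k, 'a, nat \<Rightarrow> 'k) rmod) (N :: ('k, 'a, nat \<Rightarrow> 'k) rmod).
      fg_module K A M \<and> fg_module K A N \<longrightarrow>
      (\<forall>g\<in>Hom K A M N. \<forall>f\<in>Hom K A P N. g ` carrier M = carrier N \<longrightarrow>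
        (\<exists>h\<in>Hom K A P M. compose (carrier P) g h = f)))"

definition injective ::
  "('k, 'z) ring_scheme \<Rightarrow> ('k, 'a, 'y) module_scheme \<Rightarrow> ('k, 'a, 'm) rmod \<Rightarrow> bool"
  where "injective K A E \<longleftrightarrow>
    (\<forall>(M :: ('k, 'a, nat \<Rightarrow> 'k) rmod) (N :: ('k, 'a, nat \<Rightarrow> 'k) rmod).
      fg_module K A M \<and> fg_module K A N \<longrightarrow>
      (\<forall>g\<in>Hom K A M N. \<forall>f\<in>Hom K A M E. inj_on g (carrier M) \<longrightarrow>
        (\<exists>h\<in>Hom K A N E. compose (carrier M) h g = f)))"

text \<open>There is a projective resolution \<open>0 \<rightarrow> P\<^sub>n \<rightarrow> \<dots> \<rightarrow> P\<^sub>0 \<rightarrow> M \<rightarrow> 0\<close>, the maps being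
  \<open>f 0 : P\<^sub>0 \<rightarrow> M\<close> and \<open>f (i+1) : P\<^sub>i\<^sub>+\<^sub>1 \<rightarrow> P\<^sub>i\<close>.\<close>

definition proj_dim_le ::
  "('k, 'z) ring_scheme \<Rightarrow> ('k, 'a, 'y) module_scheme \<Rightarrow> ('k, 'a, nat \<Rightarrow> 'k) rmod \<Rightarrow> nat \<Rightarrow> bool"
  where "proj_dim_le K A M n \<longleftrightarrow>
    (\<exists>(P :: nat \<Rightarrow> ('k, 'a, nat \<Rightarrow> 'k) rmod) f.
      (\<forall>i\<le>n. fg_module K A (P i) \<and> projective K A (P i)) \<and>
      f 0 \<in> Hom K A (P 0) M \<and> (\<forall>i<n. f (Suc i) \<in> Hom K A (P (Suc i)) (P i)) \<and>
      f 0 ` carrier (P 0) = carrier M \<and>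
      (\<forall>i<n. f (Suc i) ` carrier (P (Suc i)) =
        {x \<in> carrier (P i). f i x = (if i = 0 then \<zero>\<^bsub>M\<^esub> else \<zero>\<^bsub>P (i - 1)\<^esub>)}) \<and>
      inj_on (f n) (carrier (P n)))"

definition gldim_le :: "('k, 'z) ring_scheme \<Rightarrow> ('k, 'a, 'y) module_scheme \<Rightarrow> nat \<Rightarrow> bool"
  where "gldim_le K A n \<longleftrightarrow>
    (\<forall>M :: ('k, 'a, nat \<Rightarrow> 'k) rmod. fg_module K A M \<longrightarrow> proj_dim_le K A M n)"


section \<open>Ext\<close>

text \<open>
  \<open>Ext\<close> is the cohomology of \<open>Hom\<^sub>A(B\<^sub>\<bullet>, X)\<close> for the bar resolution
  \<open>B\<^sub>n = M \<otimes>\<^sub>K A\<^bsup>\<otimes>n\<^esup> \<otimes>\<^sub>K A\<close> of \<open>M\<close>. Via \<open>Hom\<^sub>A(B\<^sub>n, X) = Hom\<^sub>K(M \<otimes>\<^sub>K A\<^bsup>\<otimes>n\<^esup>, X)\<close>,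
  an \<open>n\<close>-cochain is a \<open>K\<close>-multilinear map \<open>M \<times> A\<^sup>n \<rightarrow> X\<close>; its arguments are given as a pair
  \<open>(m, as)\<close> with \<open>as\<close> a list of length \<open>n\<close>. As the bar resolution is functorial in \<open>M\<close>, maps
  induced by morphisms in either argument are given by composition on cochains.
\<close>

definition bar_dom :: "('k, 'a, 'y) module_scheme \<Rightarrow> ('k, 'a, 'm) rmod \<Rightarrow> nat \<Rightarrow> ('m \<times> 'a list) set"
  where "bar_dom A M n = {(m, as). m \<in> carrier M \<and> set as \<subseteq> carrier A \<and> length as = n}"

definition cochains ::
  "('k, 'z) ring_scheme \<Rightarrow> ('k, 'a, 'y) module_scheme \<Rightarrow> ('k, 'a, 'm) rmod \<Rightarrow> ('k, 'a, 'x) rmod \<Rightarrow>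
    nat \<Rightarrow> ('k, 'm \<times> 'a list \<Rightarrow> 'x) module"
  where "cochains K A M X n = \<lparr>
    carrier = {f \<in> bar_dom A M n \<rightarrow>\<^sub>E carrier X. \<forall>(m, as)\<in>bar_dom A M n.
      (\<lambda>m'\<in>carrier M. f (m', as)) \<in> linear_maps K M X \<and>
      (\<forall>i<n. (\<lambda>a\<in>carrier A. f (m, as[i := a])) \<in> linear_maps K A X)},
    mult = undefined, one = undefined,
    zero = (\<lambda>z\<in>bar_dom A M n. \<zero>\<^bsub>X\<^esub>),
    add = (\<lambda>f g. \<lambda>z\<in>bar_dom A M n. f z \<oplus>\<^bsub>X\<^esub> g z),
    smult = (\<lambda>c f. \<lambda>z\<in>bar_dom A M n. c \<odot>\<^bsub>X\<^esub> f z)\<rparr>"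

definition signed :: "('k, 'x, 'y) module_scheme \<Rightarrow> nat \<Rightarrow> 'x \<Rightarrow> 'x"
  where "signed X i x = (if even i then x else \<ominus>\<^bsub>X\<^esub> x)"

definition coboundary ::
  "('k, 'a, 'y) module_scheme \<Rightarrow> ('k, 'a, 'm) rmod \<Rightarrow> ('k, 'a, 'x) rmod \<Rightarrow>
    nat \<Rightarrow> ('m \<times> 'a list \<Rightarrow> 'x) \<Rightarrow> 'm \<times> 'a list \<Rightarrow> 'x"
  where "coboundary A M X n f = (\<lambda>(m, as)\<in>bar_dom A M (Suc n).
    f (ract M m (hd as), tl as)
    \<oplus>\<^bsub>X\<^esub> (\<Oplus>\<^bsub>X\<^esub>i\<in>{..<n}. signed X (Suc i)
        (f (m, take i as @ (as ! i \<otimes>\<^bsub>A\<^esub> as ! Suc i) # drop (i + 2) as)))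
    \<oplus>\<^bsub>X\<^esub> signed X (Suc n) (ract X (f (m, butlast as)) (last as)))"

definition cocycles ::
  "('k, 'z) ring_scheme \<Rightarrow> ('k, 'a, 'y) module_scheme \<Rightarrow> ('k, 'a, 'm) rmod \<Rightarrow> ('k, 'a, 'x) rmod \<Rightarrow>
    nat \<Rightarrow> ('m \<times> 'a list \<Rightarrow> 'x) set"
  where "cocycles K A M X n = {f \<in> carrier (cochains K A M X n).
    coboundary A M X n f = \<zero>\<^bsub>cochains K A M X (Suc n)\<^esub>}"

definition coboundaries ::
  "('k, 'z) ring_scheme \<Rightarrow> ('k, 'a, 'y) module_scheme \<Rightarrow> ('k, 'a, 'm) rmod \<Rightarrow> ('k, 'a, 'x) rmod \<Rightarrow>
    nat \<Rightarrow> ('m \<times> 'a list \<Rightarrow> 'x) set"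
  where "coboundaries K A M X n = (if n = 0 then {\<zero>\<^bsub>cochains K A M X 0\<^esub>}
    else coboundary A M X (n - 1) ` carrier (cochains K A M X (n - 1)))"

definition Ext ::
  "('k, 'z) ring_scheme \<Rightarrow> ('k, 'a, 'y) module_scheme \<Rightarrow> nat \<Rightarrow> ('k, 'a, 'm) rmod \<Rightarrow>
    ('k, 'a, 'x) rmod \<Rightarrow> ('k, ('m \<times> 'a list \<Rightarrow> 'x) set) module"
  where "Ext K A n M X = (let C = cochains K A M X n; B = coboundaries K A M X n in
    \<lparr>carrier = (\<lambda>f. B +>\<^bsub>C\<^esub> f) ` cocycles K A M X n,
     mult = undefined, one = undefined,
     zero = B,
     add = set_add C,
     smult = (\<lambda>c. coset_map C B (\<lambda>f. c \<odot>\<^bsub>C\<^esub> f))\<rparr>)"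

definition Ext_zero ::
  "('k, 'z) ring_scheme \<Rightarrow> ('k, 'a, 'y) module_scheme \<Rightarrow> nat \<Rightarrow> ('k, 'a, 'm) rmod \<Rightarrow>
    ('k, 'a, 'x) rmod \<Rightarrow> bool"
  where "Ext_zero K A n M X \<longleftrightarrow> carrier (Ext K A n M X) = {\<zero>\<^bsub>Ext K A n M X\<^esub>}"


section \<open>Cluster tilting modules and \<open>d\<close>-representation-finite algebras\<close>

definition in_add ::
  "('k, 'z) ring_scheme \<Rightarrow> ('k, 'a, 'y) module_scheme \<Rightarrow> ('k, 'a, 'm) rmod \<Rightarrow> ('k, 'a, 'x) rmod \<Rightarrow> bool"
  where "in_add K A M X \<longleftrightarrow>
    (\<exists>n. \<exists>f\<in>Hom K A X (direct_sum {..<n::nat} (\<lambda>_. M)).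
         \<exists>g\<in>Hom K A (direct_sum {..<n} (\<lambda>_. M)) X. compose (carrier X) g f = id_map X)"

definition cluster_tilting ::
  "('k, 'z) ring_scheme \<Rightarrow> ('k, 'a, 'y) module_scheme \<Rightarrow> nat \<Rightarrow> ('k, 'a, 'm) rmod \<Rightarrow> bool"
  where "cluster_tilting K A d M \<longleftrightarrow> fg_module K A M \<and>
    (\<forall>X :: ('k, 'a, nat \<Rightarrow> 'k) rmod. fg_module K A X \<longrightarrow>
      (in_add K A M X \<longleftrightarrow> (\<forall>i. 1 \<le> i \<and> i < d \<longrightarrow> Ext_zero K A i M X)) \<and>
      (in_add K A M X \<longleftrightarrow> (\<forall>i. 1 \<le> i \<and> i < d \<longrightarrow> Ext_zero K A i X M)))"

definition d_representation_finite ::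
  "('k, 'z) ring_scheme \<Rightarrow> ('k, 'a, 'y) module_scheme \<Rightarrow> nat \<Rightarrow> bool"
  where "d_representation_finite K A d \<longleftrightarrow> fd_algebra K A \<and> gldim_le K A d \<and>
    (\<exists>M :: ('k, 'a, nat \<Rightarrow> 'k) rmod. cluster_tilting K A d M)"


section \<open>The inverse \<open>d\<close>-Auslander-Reiten translation\<close>

definition regular_module :: "('k, 'a, 'y) module_scheme \<Rightarrow> ('k, 'a, 'a) rmod"
  where "regular_module A = with_action A (mult A)"

definition dual_module ::
  "('k, 'z) ring_scheme \<Rightarrow> ('k, 'a, 'y) module_scheme \<Rightarrow> ('k, 'a, 'a \<Rightarrow> 'k) rmod"
  where "dual_module K A = \<lparr>carrier = linear_maps K A (base_field K),
    mult = undefined, one = undefined,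
    zero = (\<lambda>x\<in>carrier A. \<zero>\<^bsub>K\<^esub>),
    add = (\<lambda>f g. \<lambda>x\<in>carrier A. f x \<oplus>\<^bsub>K\<^esub> g x),
    smult = (\<lambda>c f. \<lambda>x\<in>carrier A. c \<otimes>\<^bsub>K\<^esub> f x),
    ract = (\<lambda>f a. \<lambda>x\<in>carrier A. f (a \<otimes>\<^bsub>A\<^esub> x))\<rparr>"

definition dual_lact :: "('k, 'a, 'y) module_scheme \<Rightarrow> 'a \<Rightarrow> ('a \<Rightarrow> 'k) \<Rightarrow> 'a \<Rightarrow> 'k"
  where "dual_lact A a f = (\<lambda>x\<in>carrier A. f (x \<otimes>\<^bsub>A\<^esub> a))"

text \<open>\<open>Ext\<^sup>d\<^sub>A(DA, X)\<close>; its right module structure comes from the left action on the bimodule \<open>DA\<close>.\<close>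

definition Ext_dual ::
  "('k, 'z) ring_scheme \<Rightarrow> ('k, 'a, 'y) module_scheme \<Rightarrow> nat \<Rightarrow> ('k, 'a, 'x) rmod \<Rightarrow>
    ('k, 'a, (('a \<Rightarrow> 'k) \<times> 'a list \<Rightarrow> 'x) set) rmod"
  where "Ext_dual K A d X = (let D = dual_module K A in
    with_action (Ext K A d D X)
      (\<lambda>S a. coset_map (cochains K A D X d) (coboundaries K A D X d)
        (\<lambda>f. \<lambda>(m, as)\<in>bar_dom A D d. f (dual_lact A a m, as)) S))"

definition Ext_dual_map ::
  "('k, 'z) ring_scheme \<Rightarrow> ('k, 'a, 'y) module_scheme \<Rightarrow> nat \<Rightarrow>
    ('k, 'a, 'x) rmod \<Rightarrow> ('k, 'a, 'w) rmod \<Rightarrow> ('x \<Rightarrow> 'w) \<Rightarrow>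
    (('a \<Rightarrow> 'k) \<times> 'a list \<Rightarrow> 'x) set \<Rightarrow> (('a \<Rightarrow> 'k) \<times> 'a list \<Rightarrow> 'w) set"
  where "Ext_dual_map K A d X Y h = (let D = dual_module K A in
    (\<lambda>S\<in>carrier (Ext_dual K A d X).
      coset_map (cochains K A D Y d) (coboundaries K A D Y d) (compose (bar_dom A D d) h) S))"

text \<open>
  The type of the elements of \<open>Ext\<^sup>d\<^sub>A(DA, X)\<close> differs from that of \<open>X\<close>, so in order to iterate
  the functor we transport its values along a chosen \<open>K\<close>-linear isomorphism onto some \<open>K\<^sup>n\<close>.
  The result is naturally isomorphic to \<open>Ext\<^sup>d\<^sub>A(DA, -)\<close> on \<open>mod A\<close>.
\<close>

definition coord :: "('k, 'z) ring_scheme \<Rightarrow> ('k, 'm, 'y) module_scheme \<Rightarrow> 'm \<Rightarrow> nat \<Rightarrow> 'k"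
  where "coord K M = (SOME \<phi>. is_coord K M \<phi>)"

definition std_module :: "('k, 'z) ring_scheme \<Rightarrow> ('k, 'a, 'm) rmod \<Rightarrow> ('k, 'a, nat \<Rightarrow> 'k) rmod"
  where "std_module K M = (let \<phi> = coord K M; \<psi> = inv_into (carrier M) \<phi> in
    \<lparr>carrier = \<phi> ` carrier M, mult = undefined, one = undefined,
     zero = \<phi> \<zero>\<^bsub>M\<^esub>,
     add = (\<lambda>x y. \<phi> (\<psi> x \<oplus>\<^bsub>M\<^esub> \<psi> y)),
     smult = (\<lambda>c x. \<phi> (c \<odot>\<^bsub>M\<^esub> \<psi> x)),
     ract = (\<lambda>x a. \<phi> (ract M (\<psi> x) a))\<rparr>)"

definition std_map ::
  "('k, 'z) ring_scheme \<Rightarrow> ('k, 'a, 'm) rmod \<Rightarrow> ('k, 'a, 'n) rmod \<Rightarrow> ('m \<Rightarrow> 'n) \<Rightarrow>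
    (nat \<Rightarrow> 'k) \<Rightarrow> nat \<Rightarrow> 'k"
  where "std_map K M N f =
    (\<lambda>x\<in>carrier (std_module K M). coord K N (f (inv_into (carrier M) (coord K M) x)))"

definition tau ::
  "('k, 'z) ring_scheme \<Rightarrow> ('k, 'a, 'y) module_scheme \<Rightarrow> nat \<Rightarrow> ('k, 'a, 'x) rmod \<Rightarrow>
    ('k, 'a, nat \<Rightarrow> 'k) rmod"
  where "tau K A d X = std_module K (Ext_dual K A d X)"

definition tau_map ::
  "('k, 'z) ring_scheme \<Rightarrow> ('k, 'a, 'y) module_scheme \<Rightarrow> nat \<Rightarrow>
    ('k, 'a, 'x) rmod \<Rightarrow> ('k, 'a, 'w) rmod \<Rightarrow> ('x \<Rightarrow> 'w) \<Rightarrow> (nat \<Rightarrow> 'k) \<Rightarrow> nat \<Rightarrow> 'k"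
  where "tau_map K A d X Y h =
    std_map K (Ext_dual K A d X) (Ext_dual K A d Y) (Ext_dual_map K A d X Y h)"

definition tau_pow ::
  "('k, 'z) ring_scheme \<Rightarrow> ('k, 'a, 'y) module_scheme \<Rightarrow> nat \<Rightarrow> nat \<Rightarrow> ('k, 'a, nat \<Rightarrow> 'k) rmod \<Rightarrow>
    ('k, 'a, nat \<Rightarrow> 'k) rmod"
  where "tau_pow K A d i X = (tau K A d ^^ i) X"

primrec tau_pow_map ::
  "('k, 'z) ring_scheme \<Rightarrow> ('k, 'a, 'y) module_scheme \<Rightarrow> nat \<Rightarrow> nat \<Rightarrow>
    ('k, 'a, nat \<Rightarrow> 'k) rmod \<Rightarrow> ('k, 'a, nat \<Rightarrow> 'k) rmod \<Rightarrow>
    ((nat \<Rightarrow> 'k) \<Rightarrow> nat \<Rightarrow> 'k) \<Rightarrow> (nat \<Rightarrow> 'k) \<Rightarrow> nat \<Rightarrow> 'k"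
  where
    "tau_pow_map K A d 0 X Y h = h"
  | "tau_pow_map K A d (Suc i) X Y h =
      tau_map K A d (tau_pow K A d i X) (tau_pow K A d i Y) (tau_pow_map K A d i X Y h)"


section \<open>Preprojective algebras\<close>

text \<open>
  The algebra \<open>\<Psi>\<^sub>A\<^sup>X = \<Oplus>\<^sub>i Hom\<^sub>A(X, \<tau>\<^sup>-\<^sup>iX)\<close>, whose elements are finitely supported families. In degree
  \<open>n\<close> the product \<open>G \<cdot> F\<close> is the sum over \<open>i \<le> n\<close> of \<open>\<tau>\<^sup>-\<^sup>i(G\<^sub>n\<^sub>-\<^sub>i) \<circ> F\<^sub>i\<close>; note that
  \<open>\<tau>\<^sup>-\<^sup>i(\<tau>\<^sup>-\<^sup>(\<^sup>n\<^sup>-\<^sup>i\<^sup>)X)\<close> and \<open>\<tau>\<^sup>-\<^sup>nX\<close> are equal on the nose.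
\<close>

definition Psi ::
  "('k, 'z) ring_scheme \<Rightarrow> ('k, 'a, 'y) module_scheme \<Rightarrow> nat \<Rightarrow> ('k, 'a, nat \<Rightarrow> 'k) rmod \<Rightarrow>
    ('k, nat \<Rightarrow> (nat \<Rightarrow> 'k) \<Rightarrow> (nat \<Rightarrow> 'k)) module"
  where "Psi K A d X = (let T = (\<lambda>i. tau_pow K A d i X) in
    \<lparr>carrier = {F. (\<forall>i. F i \<in> Hom K A X (T i)) \<and> finite {i. F i \<noteq> zero_map X (T i)}},
     mult = (\<lambda>G F n. \<lambda>x\<in>carrier X.
       \<Oplus>\<^bsub>T n\<^esub>i\<in>{..n}. tau_pow_map K A d i X (T (n - i)) (G (n - i)) (F i x)),
     one = (\<lambda>i. if i = 0 then id_map X else zero_map X (T i)),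
     zero = (\<lambda>i. zero_map X (T i)),
     add = (\<lambda>F G i. \<lambda>x\<in>carrier X. F i x \<oplus>\<^bsub>T i\<^esub> G i x),
     smult = (\<lambda>c F i. \<lambda>x\<in>carrier X. c \<odot>\<^bsub>T i\<^esub> F i x)\<rparr>)"

definition preprojective ::
  "('k, 'z) ring_scheme \<Rightarrow> ('k, 'a, 'y) module_scheme \<Rightarrow> nat \<Rightarrow>
    ('k, nat \<Rightarrow> (nat \<Rightarrow> 'k) \<Rightarrow> (nat \<Rightarrow> 'k)) module"
  where "preprojective K A d = Psi K A d (std_module K (regular_module A))"

text \<open>
  The algebra map \<open>A \<cong> End\<^sub>A(A) \<subseteq> \<Pi>\<close> onto the degree \<open>0\<close> part, sending \<open>a\<close> to left
  multiplication by \<open>a\<close>.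
\<close>

definition to_preprojective ::
  "('k, 'z) ring_scheme \<Rightarrow> ('k, 'a, 'y) module_scheme \<Rightarrow> nat \<Rightarrow> 'a \<Rightarrow>
    nat \<Rightarrow> (nat \<Rightarrow> 'k) \<Rightarrow> (nat \<Rightarrow> 'k)"
  where "to_preprojective K A d a = (let R = regular_module A; X = std_module K R in
    (\<lambda>i. if i = 0 then std_map K R R (\<lambda>x\<in>carrier A. a \<otimes>\<^bsub>A\<^esub> x)
         else zero_map X (tau_pow K A d i X)))"

definition preprojective_module ::
  "('k, 'z) ring_scheme \<Rightarrow> ('k, 'a, 'y) module_scheme \<Rightarrow> nat \<Rightarrow>
    ('k, 'a, nat \<Rightarrow> (nat \<Rightarrow> 'k) \<Rightarrow> (nat \<Rightarrow> 'k)) rmod"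
  where "preprojective_module K A d = with_action (preprojective K A d)
    (\<lambda>p a. p \<otimes>\<^bsub>preprojective K A d\<^esub> to_preprojective K A d a)"

definition total_preprojective ::
  "('k, 'z) ring_scheme \<Rightarrow> ('k, 'a, 'y) module_scheme \<Rightarrow> nat \<Rightarrow>
    ('k, nat \<Rightarrow> (nat \<Rightarrow> 'k) \<Rightarrow> (nat \<Rightarrow> 'k)) module"
  where "total_preprojective K A d = Psi K A d (std_module K (preprojective_module K A d))"


section \<open>Path algebras\<close>

text \<open>
  A path is a pair \<open>(u, p)\<close> of its first vertex and its list of arrows in the order in which they
  are traversed. Products follow the composition of maps: \<open>g \<cdot> f\<close> is the path \<open>f\<close> followed by \<open>g\<close>,
  so that \<open>(u, [a, b])\<close> is the path written \<open>ba\<close>.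
\<close>

definition paths :: "('v, 'e) pre_digraph \<Rightarrow> ('v \<times> 'e list) set"
  where "paths Q = {(u, p). \<exists>v. pre_digraph.awalk Q u p v}"

definition path_algebra ::
  "('k, 'z) ring_scheme \<Rightarrow> ('v, 'e) pre_digraph \<Rightarrow> ('k, 'v \<times> 'e list \<Rightarrow> 'k) module"
  where "path_algebra K Q = \<lparr>
    carrier = {f. (\<forall>p\<in>paths Q. f p \<in> carrier K) \<and> (\<forall>p. p \<notin> paths Q \<longrightarrow> f p = \<zero>\<^bsub>K\<^esub>) \<and>
      finite {p. f p \<noteq> \<zero>\<^bsub>K\<^esub>}},
    mult = (\<lambda>g f (u, p). \<Oplus>\<^bsub>K\<^esub>i\<in>{..length p}.
      g (pre_digraph.awlast Q u (take i p), drop i p) \<otimes>\<^bsub>K\<^esub> f (u, take i p)),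
    one = (\<lambda>(u, p). if u \<in> verts Q \<and> p = [] then \<one>\<^bsub>K\<^esub> else \<zero>\<^bsub>K\<^esub>),
    zero = (\<lambda>p. \<zero>\<^bsub>K\<^esub>),
    add = (\<lambda>f g p. f p \<oplus>\<^bsub>K\<^esub> g p),
    smult = (\<lambda>c f p. c \<otimes>\<^bsub>K\<^esub> f p)\<rparr>"

definition path_elt :: "('k, 'z) ring_scheme \<Rightarrow> 'v \<times> 'e list \<Rightarrow> 'v \<times> 'e list \<Rightarrow> 'k"
  where "path_elt K p = (\<lambda>p'. if p' = p then \<one>\<^bsub>K\<^esub> else \<zero>\<^bsub>K\<^esub>)"

definition vertex_elt :: "('k, 'z) ring_scheme \<Rightarrow> 'v \<Rightarrow> 'v \<times> 'e list \<Rightarrow> 'k"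
  where "vertex_elt K v = path_elt K (v, [])"

definition arrow_elt :: "('k, 'z) ring_scheme \<Rightarrow> ('v, 'e) pre_digraph \<Rightarrow> 'e \<Rightarrow> 'v \<times> 'e list \<Rightarrow> 'k"
  where "arrow_elt K Q a = path_elt K (tail Q a, [a])"


section \<open>Presentations of \<open>End\<^sub>\<Lambda>(\<Pi>)\<close> and the extended quiver\<close>

text \<open>
  \<open>\<Delta> : M \<cong> \<Oplus>\<^sub>v X v\<close> is a decomposition indexed by the vertices. A morphism \<open>X v \<rightarrow> X w\<close> is
  regarded as an endomorphism of \<open>M\<close> by \<open>summand_to_end\<close>, and \<open>end_to_summand\<close> extracts the
  component \<open>X v \<rightarrow> X w\<close> of an endomorphism.
\<close>

definition summand_to_end ::
  "('k, 'a, 'm) rmod \<Rightarrow> 'v set \<Rightarrow> ('v \<Rightarrow> ('k, 'a, 'n) rmod) \<Rightarrow> ('m \<Rightarrow> 'v \<Rightarrow> 'n) \<Rightarrow>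
    'v \<Rightarrow> 'v \<Rightarrow> ('n \<Rightarrow> 'n) \<Rightarrow> 'm \<Rightarrow> 'm"
  where "summand_to_end M V X \<Delta> v w f = (\<lambda>m\<in>carrier M.
    inv_into (carrier M) \<Delta> (inj_summand V X w (f (proj_summand V X v (\<Delta> m)))))"

definition end_to_summand ::
  "('k, 'a, 'm) rmod \<Rightarrow> 'v set \<Rightarrow> ('v \<Rightarrow> ('k, 'a, 'n) rmod) \<Rightarrow> ('m \<Rightarrow> 'v \<Rightarrow> 'n) \<Rightarrow>
    'v \<Rightarrow> 'v \<Rightarrow> ('m \<Rightarrow> 'm) \<Rightarrow> 'n \<Rightarrow> 'n"
  where "end_to_summand M V X \<Delta> v w g = (\<lambda>x\<in>carrier (X v).
    proj_summand V X w (\<Delta> (g (inv_into (carrier M) \<Delta> (inj_summand V X v x)))))"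

text \<open>
  Decomposition of \<open>M\<close> into pairwise non-isomorphic indecomposables, together with an isomorphism
  \<open>\<Phi> : KQ/I \<cong> End(M)\<close> sending the class of each vertex to the projection onto its summand.
\<close>

definition quiver_presentation ::
  "('k, 'z) ring_scheme \<Rightarrow> ('k, 'a, 'y) module_scheme \<Rightarrow> ('k, 'a, 'm) rmod \<Rightarrow>
    ('v, 'e) pre_digraph \<Rightarrow> ('v \<times> 'e list \<Rightarrow> 'k) set \<Rightarrow>
    ('v \<Rightarrow> ('k, 'a, nat \<Rightarrow> 'k) rmod) \<Rightarrow> ('m \<Rightarrow> 'v \<Rightarrow> nat \<Rightarrow> 'k) \<Rightarrow>
    (('v \<times> 'e list \<Rightarrow> 'k) set \<Rightarrow> 'm \<Rightarrow> 'm) \<Rightarrow> bool"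
  where "quiver_presentation K A M Q I X \<Delta> \<Phi> \<longleftrightarrow>
    fin_digraph Q \<and>
    (\<forall>v\<in>verts Q. fg_module K A (X v) \<and> indecomposable K A (X v)) \<and>
    (\<forall>v\<in>verts Q. \<forall>w\<in>verts Q. v \<noteq> w \<longrightarrow> mod_iso K A (X v) (X w) = {}) \<and>
    \<Delta> \<in> mod_iso K A M (direct_sum (verts Q) X) \<and>
    ideal I (path_algebra K Q) \<and>
    \<Phi> \<in> alg_iso K (alg_quot (path_algebra K Q) I) (End_algebra K A M) \<and>
    (\<forall>v\<in>verts Q. \<Phi> (I +>\<^bsub>path_algebra K Q\<^esub> vertex_elt K v) =
      summand_to_end M (verts Q) X \<Delta> v v (id_map (X v)))"

text \<open>
  A choice, for every non-injective \<open>X v\<close>, of the vertex \<open>t v\<close> with \<open>\<tau>\<^sup>-(X v) \<cong> X (t v)\<close> and of an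
  isomorphism \<open>\<theta> v\<close> identifying the two modules.
\<close>

definition tau_identification ::
  "('k, 'z) ring_scheme \<Rightarrow> ('k, 'a, 'y) module_scheme \<Rightarrow> nat \<Rightarrow> 'v set \<Rightarrow>
    ('v \<Rightarrow> ('k, 'a, nat \<Rightarrow> 'k) rmod) \<Rightarrow> ('v \<Rightarrow> 'v) \<Rightarrow> ('v \<Rightarrow> (nat \<Rightarrow> 'k) \<Rightarrow> nat \<Rightarrow> 'k) \<Rightarrow> bool"
  where "tau_identification K A d V X t \<theta> \<longleftrightarrow>
    (\<forall>v\<in>V. \<not> injective K A (X v) \<longrightarrow>
      t v \<in> V \<and> \<theta> v \<in> mod_iso K A (tau K A d (X v)) (X (t v)))"

text \<open>The extended quiver: \<open>Inl a\<close> is an old arrow, \<open>Inr v\<close> is the new arrow \<open>q\<^sub>v : t v \<rightarrow> v\<close>.\<close>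

definition ext_quiver ::
  "('v, 'e) pre_digraph \<Rightarrow> 'v set \<Rightarrow> ('v \<Rightarrow> 'v) \<Rightarrow> ('v, 'e + 'v) pre_digraph"
  where "ext_quiver Q N t = \<lparr>verts = verts Q, arcs = Inl ` arcs Q \<union> Inr ` N,
    tail = case_sum (tail Q) t, head = case_sum (head Q) (\<lambda>v. v)\<rparr>"

definition ext_elt ::
  "('k, 'z) ring_scheme \<Rightarrow> ('v \<times> 'e list \<Rightarrow> 'k) \<Rightarrow> 'v \<times> ('e + 'v) list \<Rightarrow> 'k"
  where "ext_elt K f = (\<lambda>(u, p). if \<forall>b\<in>set p. isl b then f (u, map projl p) else \<zero>\<^bsub>K\<^esub>)"

definition noninj_verts ::
  "('k, 'z) ring_scheme \<Rightarrow> ('k, 'a, 'y) module_scheme \<Rightarrow> ('v, 'e) pre_digraph \<Rightarrow>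
    ('v \<Rightarrow> ('k, 'a, nat \<Rightarrow> 'k) rmod) \<Rightarrow> 'v set"
  where "noninj_verts K A Q X = {v \<in> verts Q. \<not> injective K A (X v)}"

definition ext_path_algebra ::
  "('k, 'z) ring_scheme \<Rightarrow> ('k, 'a, 'y) module_scheme \<Rightarrow> ('v, 'e) pre_digraph \<Rightarrow>
    ('v \<Rightarrow> ('k, 'a, nat \<Rightarrow> 'k) rmod) \<Rightarrow> ('v \<Rightarrow> 'v) \<Rightarrow> ('k, 'v \<times> ('e + 'v) list \<Rightarrow> 'k) module"
  where "ext_path_algebra K A Q X t = path_algebra K (ext_quiver Q (noninj_verts K A Q X) t)"

definition ext_ideal ::
  "('k, 'z) ring_scheme \<Rightarrow> ('k, 'a, 'y) module_scheme \<Rightarrow> ('v, 'e) pre_digraph \<Rightarrow>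
    ('v \<times> 'e list \<Rightarrow> 'k) set \<Rightarrow> ('v \<Rightarrow> ('k, 'a, nat \<Rightarrow> 'k) rmod) \<Rightarrow> ('v \<Rightarrow> 'v) \<Rightarrow>
    ('v \<times> ('e + 'v) list \<Rightarrow> 'k) set"
  where "ext_ideal K A Q I X t = genideal (ext_path_algebra K A Q X t) (ext_elt K ` I)"

text \<open>
  \<open>\<tau>\<^sup>-(a)\<close> for an arrow \<open>a : v \<rightarrow> w\<close> between non-injective vertices: the morphism
  \<open>X v \<rightarrow> X w\<close> given by \<open>a\<close> is turned into \<open>\<theta> w \<circ> \<tau>\<^sup>-(a) \<circ> (\<theta> v)\<^sup>-\<^sup>1 : X (t v) \<rightarrow> X (t w)\<close>,
  which is regarded as an element of \<open>End(M)\<close>, then of \<open>KQ/I\<close>, and finally mapped to the quotient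
  of the path algebra of the extended quiver by the ideal generated by \<open>I\<close>.
\<close>

definition tau_arrow ::
  "('k, 'z) ring_scheme \<Rightarrow> ('k, 'a, 'y) module_scheme \<Rightarrow> nat \<Rightarrow> ('k, 'a, 'm) rmod \<Rightarrow>
    ('v, 'e) pre_digraph \<Rightarrow> ('v \<times> 'e list \<Rightarrow> 'k) set \<Rightarrow>
    ('v \<Rightarrow> ('k, 'a, nat \<Rightarrow> 'k) rmod) \<Rightarrow> ('m \<Rightarrow> 'v \<Rightarrow> nat \<Rightarrow> 'k) \<Rightarrow>
    (('v \<times> 'e list \<Rightarrow> 'k) set \<Rightarrow> 'm \<Rightarrow> 'm) \<Rightarrow>
    ('v \<Rightarrow> 'v) \<Rightarrow> ('v \<Rightarrow> (nat \<Rightarrow> 'k) \<Rightarrow> nat \<Rightarrow> 'k) \<Rightarrow> 'e \<Rightarrow> ('v \<times> ('e + 'v) list \<Rightarrow> 'k) set"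
  where "tau_arrow K A d M Q I X \<Delta> \<Phi> t \<theta> a =
   (let P = path_algebra K Q; v = tail Q a; w = head Q a;
        f = end_to_summand M (verts Q) X \<Delta> v w (\<Phi> (I +>\<^bsub>P\<^esub> arrow_elt K Q a));
        g = (\<lambda>x\<in>carrier (X (t v)).
              \<theta> w (tau_map K A d (X v) (X w) f (inv_into (carrier (tau K A d (X v))) (\<theta> v) x)));
        \<gamma> = inv_into (carrier (alg_quot P I)) \<Phi>
              (summand_to_end M (verts Q) X \<Delta> (t v) (t w) g)
    in coset_map (ext_path_algebra K A Q X t) (ext_ideal K A Q I X t) (ext_elt K) \<gamma>)"

text \<open>The relations \<open>r\<^sub>a\<close>, elements of the quotient by \<open>ext_ideal\<close> and hence cosets.\<close>

definition rel ::
  "('k, 'z) ring_scheme \<Rightarrow> ('k, 'a, 'y) module_scheme \<Rightarrow> nat \<Rightarrow> ('k, 'a, 'm) rmod \<Rightarrow>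
    ('v, 'e) pre_digraph \<Rightarrow> ('v \<times> 'e list \<Rightarrow> 'k) set \<Rightarrow>
    ('v \<Rightarrow> ('k, 'a, nat \<Rightarrow> 'k) rmod) \<Rightarrow> ('m \<Rightarrow> 'v \<Rightarrow> nat \<Rightarrow> 'k) \<Rightarrow>
    (('v \<times> 'e list \<Rightarrow> 'k) set \<Rightarrow> 'm \<Rightarrow> 'm) \<Rightarrow>
    ('v \<Rightarrow> 'v) \<Rightarrow> ('v \<Rightarrow> (nat \<Rightarrow> 'k) \<Rightarrow> nat \<Rightarrow> 'k) \<Rightarrow> 'e \<Rightarrow> ('v \<times> ('e + 'v) list \<Rightarrow> 'k) set"
  where "rel K A d M Q I X \<Delta> \<Phi> t \<theta> a =
   (let Q' = ext_quiver Q (noninj_verts K A Q X) t;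
        P' = ext_path_algebra K A Q X t;
        I' = ext_ideal K A Q I X t;
        B = alg_quot P' I';
        arr = (\<lambda>b. I' +>\<^bsub>P'\<^esub> arrow_elt K Q' b);
        v = tail Q a; w = head Q a
    in if injective K A (X v) then \<zero>\<^bsub>B\<^esub>
       else if injective K A (X w) then arr (Inl a) \<otimes>\<^bsub>B\<^esub> arr (Inr v)
       else (arr (Inl a) \<otimes>\<^bsub>B\<^esub> arr (Inr v)) \<ominus>\<^bsub>B\<^esub>
            (arr (Inr w) \<otimes>\<^bsub>B\<^esub> tau_arrow K A d M Q I X \<Delta> \<Phi> t \<theta> a))"

text \<open>
  The ideal \<open>(I, r\<^sub>a | a)\<close> of the path algebra of the extended quiver; a coset \<open>r\<^sub>a\<close> contributes
  all of its representatives.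
\<close>

definition rel_ideal ::
  "('k, 'z) ring_scheme \<Rightarrow> ('k, 'a, 'y) module_scheme \<Rightarrow> nat \<Rightarrow> ('k, 'a, 'm) rmod \<Rightarrow>
    ('v, 'e) pre_digraph \<Rightarrow> ('v \<times> 'e list \<Rightarrow> 'k) set \<Rightarrow>
    ('v \<Rightarrow> ('k, 'a, nat \<Rightarrow> 'k) rmod) \<Rightarrow> ('m \<Rightarrow> 'v \<Rightarrow> nat \<Rightarrow> 'k) \<Rightarrow>
    (('v \<times> 'e list \<Rightarrow> 'k) set \<Rightarrow> 'm \<Rightarrow> 'm) \<Rightarrow>
    ('v \<Rightarrow> 'v) \<Rightarrow> ('v \<Rightarrow> (nat \<Rightarrow> 'k) \<Rightarrow> nat \<Rightarrow> 'k) \<Rightarrow> ('v \<times> ('e + 'v) list \<Rightarrow> 'k) set"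
  where "rel_ideal K A d M Q I X \<Delta> \<Phi> t \<theta> = genideal (ext_path_algebra K A Q X t)
    (ext_elt K ` I \<union> (\<Union>a\<in>arcs Q. rel K A d M Q I X \<Delta> \<Phi> t \<theta> a))"

end

theory Submission
  imports Defs
begin

text \<open>
  Let \<open>M\<close> be the cluster tilting module with its decomposition \<open>M \<cong> \<Oplus>\<^sub>v X v\<close>, and let \<open>e\<^sub>v\<close> be the idempotents
  given by the vertices. The degree \<open>0\<close> part of \<open>\<Psi>\<close> is \<open>End(M) \<cong> KQ/I\<close>. For every non-injective \<open>X v\<close>
  there is an element of degree \<open>1\<close>, namely \<open>q\<^sub>v : M \<rightarrow> X (t v) \<cong> \<tau>\<^sup>-(X v) \<rightarrow> \<tau>\<^sup>-M\<close>. For an arrow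
  \<open>a : v \<rightarrow> w\<close> of \<open>Q\<close>, functoriality of \<open>\<tau>\<^sup>-\<close> yields \<open>a q\<^sub>v = q\<^sub>w \<tau>\<^sup>-(a)\<close> if \<open>X w\<close> is not injective and
  \<open>a q\<^sub>v = 0\<close> if it is, because \<open>\<tau>\<^sup>-\<close> annihilates injective modules. These are the relations \<open>r\<^sub>a\<close>, so the
  universal property of path algebras provides a homomorphism from the quotient of the extended
  path algebra to \<open>\<Psi>\<close>.

  It is bijective because normal forms correspond (\<open>normal_form_iso\<close>). In the quotient, the relations
  move a new arrow to the left past old ones. Hence every element can be written \<open>y + \<Sum>\<^sub>v q\<^sub>v s\<^sub>v\<close> with \<open>y\<close>
  in the image of \<open>KQ\<close> and with \<open>s\<^sub>v = e\<^sub>t\<^sub>v s\<^sub>v\<close> of the same form. In \<open>\<Psi>\<close>, such expressions exist and are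
  unique: the injective summands of \<open>M\<close> contribute nothing to \<open>\<tau>\<^sup>-M\<close>, so \<open>\<tau>\<^sup>-M\<close> is the direct sum of the
  \<open>\<tau>\<^sup>-(X v) \<cong> X (t v)\<close> over the non-injective \<open>X v\<close>, embedded by the \<open>q\<^sub>v\<close>. Applying \<open>\<tau>\<^sup>-\<^sup>n\<close>, one sees that every
  \<open>F : M \<rightarrow> \<tau>\<^sup>-\<^sup>n\<^sup>-\<^sup>1M\<close> is \<open>\<Sum>\<^sub>v q\<^sub>v x\<^sub>v\<close> for unique \<open>x\<^sub>v = e\<^sub>t\<^sub>v x\<^sub>v\<close> of degree \<open>n\<close> (\<open>normal_form_exists\<close>,
  \<open>normal_form_unique\<close>), and induction on the degree finishes the argument.

  Two facts about \<open>\<tau>\<^sup>- = Ext\<^sup>d(DA, -)\<close> enter. It is an additive functor on finite-dimensional modules,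
  which is read off from the bar construction. It annihilates an injective module \<open>X\<close> since \<open>X\<close> is a direct
  summand of the coinduced module \<open>Hom\<^sub>K(A, X)\<close>: a retraction converts the last argument of a cocycle
  into a primitive for it (\<open>injective_coboundary\<close>).
\<close>

type_synonym 'k vec = "nat => 'k"

section \<open>Linear algebra over a field\<close>

lemma finsum_additive:
  assumes G: "abelian_group G" and H: "abelian_group H"
    and h: "\<And>x. x \<in> carrier G ==> h x \<in> carrier H"
    and add: "\<And>x y. x \<in> carrier G ==> y \<in> carrier G ==> h (x \<oplus>\<^bsub>G\<^esub> y) = h x \<oplus>\<^bsub>H\<^esub> h y"
    and f: "\<And>i. i \<in> A ==> f i \<in> carrier G"
  shows "h (finsum G f A) = finsum H (\<lambda>i. h (f i)) A"
proof -
  interpret G: abelian_group G by (rule G)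
  interpret H: abelian_group H by (rule H)
  have "h \<zero>\<^bsub>G\<^esub> \<oplus>\<^bsub>H\<^esub> h \<zero>\<^bsub>G\<^esub> = h \<zero>\<^bsub>G\<^esub>"
    using add[of "\<zero>\<^bsub>G\<^esub>" "\<zero>\<^bsub>G\<^esub>"] by simp
  then have z: "h \<zero>\<^bsub>G\<^esub> = \<zero>\<^bsub>H\<^esub>"
    using h by (metis G.zero_closed H.add.l_cancel_one')
  show ?thesis
  proof (cases "finite A")
    case False
    then show ?thesis using z by (simp add: finsum_def finprod_def)
  next
    case True
    then show ?thesis using f
    proof (induction A rule: finite_induct)
      case empty
      then show ?case using z by simp
    next
      case (insert x F)
      have fF: "f \<in> F \<rightarrow> carrier G" "f x \<in> carrier G"
        "(\<lambda>i. h (f i)) \<in> F \<rightarrow> carrier H" "h (f x) \<in> carrier H"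
        using insert.prems h by auto
      then show ?case using insert by (simp add: add)
    qed
  qed
qed

lemma finsum_pointwise:
  assumes "abelian_group G" and "abelian_group H"
    and "\<And>x. x \<in> carrier G ==> x j \<in> carrier H"
    and "\<And>x y. x \<in> carrier G ==> y \<in> carrier G ==> (x \<oplus>\<^bsub>G\<^esub> y) j = x j \<oplus>\<^bsub>H\<^esub> y j"
    and "\<And>i. i \<in> A ==> f i \<in> carrier G"
  shows "finsum G f A j = finsum H (\<lambda>i. f i j) A"
  using finsum_additive[where h = "\<lambda>x. x j", OF assms(1,2)] assms(3-) by blast

lemma (in abelian_monoid) finsum_single:
  assumes "finite A" "k \<in> A" "f k \<in> carrier G" "\<And>i. i \<in> A ==> i \<noteq> k ==> f i = \<zero>"
  shows "finsum G f A = f k"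
proof -
  have "finsum G f A = finsum G (\<lambda>i. if k = i then f i else \<zero>) A"
    using assms by (intro finsum_cong') auto
  also have "\<dots> = f k"
    using assms by (subst finsum_singleton) (auto simp: Pi_def, metis assms(3) assms(4) zero_closed)
  finally show ?thesis .
qed

lemma (in abelian_monoid) finsum_all_zero:
  assumes "\<And>i. i \<in> A ==> f i = \<zero>"
  shows "finsum G f A = \<zero>"
  using assms by (metis finsum_cong' finsum_zero Pi_I zero_closed)

text \<open>
  Summing over the triangle \<open>i + j \<le> n\<close> along diagonals or along rows. This is the combinatorial
  core of associativity for every product that convolves a grading.
\<close>

lemma (in abelian_monoid) finsum_triangle:
  fixes n :: nat
  assumes "\<And>i j. i + j \<le> n ==> a i j \<in> carrier G"
  shows "(\<Oplus>k\<in>{..n}. \<Oplus>i\<in>{..k}. a i (k - i)) = (\<Oplus>i\<in>{..n}. \<Oplus>j\<in>{..n - i}. a i j)"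
  using assms
proof (induction n)
  case 0
  then show ?case by simp
next
  case (Suc n)
  have IH: "(\<Oplus>k\<in>{..n}. \<Oplus>i\<in>{..k}. a i (k - i)) = (\<Oplus>i\<in>{..n}. \<Oplus>j\<in>{..n - i}. a i j)"
    using Suc by auto
  have row: "(\<Oplus>j\<in>{..Suc n - i}. a i j) = (\<Oplus>j\<in>{..n - i}. a i j) \<oplus> a i (Suc n - i)"
    if "i \<le> n" for i
  proof -
    have e: "{..Suc n - i} = insert (Suc n - i) {..n - i}" using that by auto
    show ?thesis unfolding e using that Suc.prems
      by (subst finsum_insert) (auto intro!: a_comm finsum_closed Suc.prems)
  qed
  have c1: "(\<lambda>i. \<Oplus>j\<in>{..n - i}. a i j) \<in> {..n} \<rightarrow> carrier G"
    by (auto intro!: finsum_closed Suc.prems)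
  have c2: "(\<lambda>i. a i (Suc n - i)) \<in> {..n} \<rightarrow> carrier G" "a (Suc n) 0 \<in> carrier G"
    by (auto intro!: Suc.prems)
  have c3: "(\<Oplus>i\<in>{..n}. \<Oplus>j\<in>{..Suc n - i}. a i j)
     = (\<Oplus>i\<in>{..n}. (\<Oplus>j\<in>{..n - i}. a i j) \<oplus> a i (Suc n - i))"
    using c1 c2 by (intro finsum_cong' row) auto
  have "(\<Oplus>i\<in>{..Suc n}. \<Oplus>j\<in>{..Suc n - i}. a i j)
     = a (Suc n) 0 \<oplus> (\<Oplus>i\<in>{..n}. \<Oplus>j\<in>{..Suc n - i}. a i j)"
    using c2 by (subst atMost_Suc, subst finsum_insert) (auto intro!: finsum_closed Suc.prems)
  also have "\<dots> = a (Suc n) 0 \<oplus> (\<Oplus>i\<in>{..n}. (\<Oplus>j\<in>{..n - i}. a i j) \<oplus> a i (Suc n - i))"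
    by (simp only: c3)
  also have "\<dots> = a (Suc n) 0 \<oplus> ((\<Oplus>i\<in>{..n}. \<Oplus>j\<in>{..n - i}. a i j) \<oplus> (\<Oplus>i\<in>{..n}. a i (Suc n - i)))"
    using c1 c2 by (subst finsum_addf) auto
  also have "\<dots> = (a (Suc n) 0 \<oplus> (\<Oplus>i\<in>{..n}. a i (Suc n - i))) \<oplus> (\<Oplus>i\<in>{..n}. \<Oplus>j\<in>{..n - i}. a i j)"
    using c2 finsum_closed[OF c1] finsum_closed[OF c2(1)] by (simp add: a_ac)
  also have "a (Suc n) 0 \<oplus> (\<Oplus>i\<in>{..n}. a i (Suc n - i)) = (\<Oplus>i\<in>{..Suc n}. a i (Suc n - i))"
    using c2 by (subst atMost_Suc, subst finsum_insert) auto
  also have "\<dots> \<oplus> (\<Oplus>i\<in>{..n}. \<Oplus>j\<in>{..n - i}. a i j) = (\<Oplus>k\<in>{..Suc n}. \<Oplus>i\<in>{..k}. a i (k - i))"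
    unfolding IH[symmetric] using c2
    by (subst (2) finsum_Suc) (auto intro!: finsum_closed Suc.prems)
  finally show ?case by (rule sym)
qed

lemma (in abelian_group) minus_zero_eq:
  assumes "x \<in> carrier G" "y \<in> carrier G" "x \<ominus> y = \<zero>"
  shows "x = y"
proof -
  have "x = (x \<ominus> y) \<oplus> y" using assms(1,2) by (simp add: a_minus_def a_assoc l_neg)
  then show ?thesis using assms by simp
qed

lemma linear_mapsI:
  assumes "\<And>x. x \<in> carrier V ==> f x \<in> carrier W" "f \<in> extensional (carrier V)"
    "\<And>x y. x \<in> carrier V ==> y \<in> carrier V ==> f (x \<oplus>\<^bsub>V\<^esub> y) = f x \<oplus>\<^bsub>W\<^esub> f y"
    "\<And>c x. c \<in> carrier K ==> x \<in> carrier V ==> f (c \<odot>\<^bsub>V\<^esub> x) = c \<odot>\<^bsub>W\<^esub> f x"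
  shows "f \<in> linear_maps K V W"
  using assms unfolding linear_maps_def by (auto simp: PiE_def)

lemma linear_mapsD:
  assumes "f \<in> linear_maps K V W"
  shows "x \<in> carrier V ==> f x \<in> carrier W" "f \<in> extensional (carrier V)"
    "x \<in> carrier V ==> y \<in> carrier V ==> f (x \<oplus>\<^bsub>V\<^esub> y) = f x \<oplus>\<^bsub>W\<^esub> f y"
    "c \<in> carrier K ==> x \<in> carrier V ==> f (c \<odot>\<^bsub>V\<^esub> x) = c \<odot>\<^bsub>W\<^esub> f x"
  using assms unfolding linear_maps_def by (auto simp: PiE_def)

lemma module_abelian_group: "module K V ==> abelian_group V"
  unfolding module_def by auto

lemma linear_maps_zero:
  assumes "module K V" "module K W" "f \<in> linear_maps K V W"
  shows "f \<zero>\<^bsub>V\<^esub> = \<zero>\<^bsub>W\<^esub>"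
proof -
  interpret V: module K V by fact
  interpret W: module K W by fact
  have "f (\<zero>\<^bsub>K\<^esub> \<odot>\<^bsub>V\<^esub> \<zero>\<^bsub>V\<^esub>) = \<zero>\<^bsub>K\<^esub> \<odot>\<^bsub>W\<^esub> f \<zero>\<^bsub>V\<^esub>"
    by (rule linear_mapsD[OF assms(3)]) auto
  then show ?thesis using linear_mapsD(1)[OF assms(3), of "\<zero>\<^bsub>V\<^esub>"] by simp
qed

lemma linear_maps_minus:
  assumes "module K V" "module K W" "f \<in> linear_maps K V W" "x \<in> carrier V" "y \<in> carrier V"
  shows "f (x \<ominus>\<^bsub>V\<^esub> y) = f x \<ominus>\<^bsub>W\<^esub> f y"
proof -
  interpret V: module K V by fact
  interpret W: module K W by fact
  have "f (\<ominus>\<^bsub>V\<^esub> y) \<oplus>\<^bsub>W\<^esub> f y = f (\<ominus>\<^bsub>V\<^esub> y \<oplus>\<^bsub>V\<^esub> y)"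
    using linear_mapsD[OF assms(3)] assms(5) by simp
  also have "\<dots> = \<zero>\<^bsub>W\<^esub>"
    using linear_maps_zero[OF assms(1-3)] assms(5) by (simp add: V.M.l_neg)
  finally have "f (\<ominus>\<^bsub>V\<^esub> y) = \<ominus>\<^bsub>W\<^esub> f y"
    using linear_mapsD[OF assms(3)] assms(5) by (metis V.M.a_inv_closed W.M.minus_equality)
  then show ?thesis
    using linear_mapsD[OF assms(3)] assms(4,5) by (simp add: a_minus_def)
qed

lemma linear_maps_finsum:
  assumes "module K V" "module K W" "f \<in> linear_maps K V W" "\<And>i. i \<in> A ==> g i \<in> carrier V"
  shows "f (finsum V g A) = finsum W (\<lambda>i. f (g i)) A"
  using finsum_additive[of V W f A g] linear_mapsD[OF assms(3)] assms(4)
    module_abelian_group[OF assms(1)] module_abelian_group[OF assms(2)] by blast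

text \<open>
  A set with operations that embeds additively and homogeneously into a module is a module. All
  the function spaces below are recognised as modules through this lemma, by embedding them
  into products.
\<close>

lemma module_transfer:
  assumes V: "module K V"
    and h: "\<And>x. x \<in> carrier W ==> h x \<in> carrier V" "inj_on h (carrier W)"
    and closed: "\<zero>\<^bsub>W\<^esub> \<in> carrier W"
      "\<And>x y. x \<in> carrier W ==> y \<in> carrier W ==> x \<oplus>\<^bsub>W\<^esub> y \<in> carrier W"
      "\<And>c x. c \<in> carrier K ==> x \<in> carrier W ==> c \<odot>\<^bsub>W\<^esub> x \<in> carrier W"
    and hom: "h \<zero>\<^bsub>W\<^esub> = \<zero>\<^bsub>V\<^esub>"
      "\<And>x y. x \<in> carrier W ==> y \<in> carrier W ==> h (x \<oplus>\<^bsub>W\<^esub> y) = h x \<oplus>\<^bsub>V\<^esub> h y"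
      "\<And>c x. c \<in> carrier K ==> x \<in> carrier W ==> h (c \<odot>\<^bsub>W\<^esub> x) = c \<odot>\<^bsub>V\<^esub> h x"
  shows "module K W"
proof -
  interpret V: module K V by (rule V)
  have eq: "x = y" if "x \<in> carrier W" "y \<in> carrier W" "h x = h y" for x y
    using inj_onD[OF h(2)] that by blast
  note C = closed h(1)
  show ?thesis
  proof (rule moduleI)
    show "cring K" by (rule V.R.is_cring)
    show "abelian_group W"
    proof (rule abelian_groupI)
      fix x y z assume "x \<in> carrier W" "y \<in> carrier W" "z \<in> carrier W"
      then show "x \<oplus>\<^bsub>W\<^esub> y \<oplus>\<^bsub>W\<^esub> z = x \<oplus>\<^bsub>W\<^esub> (y \<oplus>\<^bsub>W\<^esub> z)"
        by (intro eq) (simp_all add: C hom V.M.a_assoc)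
    next
      fix x y assume "x \<in> carrier W" "y \<in> carrier W"
      then show "x \<oplus>\<^bsub>W\<^esub> y = y \<oplus>\<^bsub>W\<^esub> x"
        by (intro eq) (simp_all add: C hom V.M.a_comm)
    next
      fix x assume x: "x \<in> carrier W"
      show "\<zero>\<^bsub>W\<^esub> \<oplus>\<^bsub>W\<^esub> x = x"
        by (intro eq) (simp_all add: C hom x)
      have "(\<ominus>\<^bsub>K\<^esub> \<one>\<^bsub>K\<^esub>) \<odot>\<^bsub>W\<^esub> x \<oplus>\<^bsub>W\<^esub> x = \<zero>\<^bsub>W\<^esub>"
        by (intro eq) (simp_all add: C hom x V.smult_l_minus V.M.l_neg)
      then show "\<exists>y\<in>carrier W. y \<oplus>\<^bsub>W\<^esub> x = \<zero>\<^bsub>W\<^esub>"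
        by (rule bexI) (simp add: C x)
    qed (auto simp: C)
  next
    fix a b x assume "a \<in> carrier K" "b \<in> carrier K" "x \<in> carrier W"
    then show "(a \<oplus>\<^bsub>K\<^esub> b) \<odot>\<^bsub>W\<^esub> x = a \<odot>\<^bsub>W\<^esub> x \<oplus>\<^bsub>W\<^esub> b \<odot>\<^bsub>W\<^esub> x"
      by (intro eq) (simp_all add: C hom V.smult_l_distr)
  next
    fix a x y assume "a \<in> carrier K" "x \<in> carrier W" "y \<in> carrier W"
    then show "a \<odot>\<^bsub>W\<^esub> (x \<oplus>\<^bsub>W\<^esub> y) = a \<odot>\<^bsub>W\<^esub> x \<oplus>\<^bsub>W\<^esub> a \<odot>\<^bsub>W\<^esub> y"
      by (intro eq) (simp_all add: C hom V.smult_r_distr)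
  next
    fix a b x assume "a \<in> carrier K" "b \<in> carrier K" "x \<in> carrier W"
    then show "(a \<otimes>\<^bsub>K\<^esub> b) \<odot>\<^bsub>W\<^esub> x = a \<odot>\<^bsub>W\<^esub> (b \<odot>\<^bsub>W\<^esub> x)"
      by (intro eq) (simp_all add: C hom V.smult_assoc1)
  next
    fix x assume "x \<in> carrier W"
    then show "\<one>\<^bsub>K\<^esub> \<odot>\<^bsub>W\<^esub> x = x"
      by (intro eq) (simp_all add: C hom)
  qed (auto simp: C)
qed

definition prod_module :: "'i set => ('i => ('k, 'm, 'y) module_scheme) => ('k, 'i => 'm) module"
  where "prod_module J X = \<lparr>carrier = PiE J (\<lambda>i. carrier (X i)),
    mult = undefined, one = undefined,
    zero = (\<lambda>i\<in>J. \<zero>\<^bsub>X i\<^esub>),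
    add = (\<lambda>x y. \<lambda>i\<in>J. x i \<oplus>\<^bsub>X i\<^esub> y i),
    smult = (\<lambda>c x. \<lambda>i\<in>J. c \<odot>\<^bsub>X i\<^esub> x i)\<rparr>"

lemma prod_module_module:
  fixes X :: "'i => ('k, 'm, 'y) module_scheme" and K :: "('k, 'z) ring_scheme"
  assumes "cring K" "\<And>i. i \<in> J ==> module K (X i)"
  shows "module K (prod_module J X)"
proof -
  have ax: "abelian_group (X i)" if "i \<in> J" for i
    using module_abelian_group[OF assms(2)[OF that]] .
  have eqI: "x = y" if "x \<in> extensional J" "y \<in> extensional J" "\<And>i. i \<in> J ==> x i = y i" for x y :: "'i => 'm"
    using that by (metis extensionalityI)
  show ?thesis
  proof (rule moduleI)
    show "cring K" by fact
    show "abelian_group (prod_module J X)"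
    proof (rule abelian_groupI)
      fix x assume x: "x \<in> carrier (prod_module J X)"
      then have "(\<lambda>i\<in>J. \<ominus>\<^bsub>X i\<^esub> x i) \<in> carrier (prod_module J X)"
        by (auto simp: prod_module_def intro!: abelian_group.a_inv_closed[OF ax])
      moreover have "(\<lambda>i\<in>J. \<ominus>\<^bsub>X i\<^esub> x i) \<oplus>\<^bsub>prod_module J X\<^esub> x = \<zero>\<^bsub>prod_module J X\<^esub>"
        using x by (auto simp: prod_module_def abelian_group.l_neg[OF ax] PiE_iff intro!: restrict_ext)
      ultimately show "\<exists>y\<in>carrier (prod_module J X). y \<oplus>\<^bsub>prod_module J X\<^esub> x = \<zero>\<^bsub>prod_module J X\<^esub>"
        by blast
    qed (auto simp: prod_module_def PiE_iff intro!: eqI abelian_groupE[OF ax])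
  qed (auto simp: prod_module_def PiE_iff module.smult_one[OF assms(2)] intro!: eqI
      module.smult_closed[OF assms(2)] module.smult_l_distr[OF assms(2)]
      module.smult_r_distr[OF assms(2)] module.smult_assoc1[OF assms(2)])
qed

lemma module_subset:
  assumes "module K V" "S \<subseteq> carrier V" "\<zero>\<^bsub>V\<^esub> \<in> S"
    "\<And>x y. x \<in> S ==> y \<in> S ==> x \<oplus>\<^bsub>V\<^esub> y \<in> S"
    "\<And>c x. c \<in> carrier K ==> x \<in> S ==> c \<odot>\<^bsub>V\<^esub> x \<in> S"
  shows "module K (V\<lparr>carrier := S\<rparr>)"
  by (rule module_transfer[OF assms(1), where h = "\<lambda>x. x"]) (use assms in auto)

locale scalar_field = K?: field K for K :: "('k, 'z) ring_scheme" (structure)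
begin

lemma base_field_module: "module K (base_field K)"
  by (rule moduleI) (auto simp: base_field_def K.m_assoc K.l_distr K.r_distr
      intro!: K.is_cring abelian_groupI K.a_assoc K.a_comm intro: K.l_neg)

lemma base_field_sel [simp]:
  "carrier (base_field K) = carrier K" "\<zero>\<^bsub>base_field K\<^esub> = \<zero>" "add (base_field K) = add K"
  "smult (base_field K) = mult K"
  by (auto simp: base_field_def)

lemma coord_space_module: "module K (coord_space K n)"
proof (rule module_transfer[where V = "prod_module {..<n} (\<lambda>_. base_field K)"
      and h = "\<lambda>x. restrict x {..<n}"])
  show "module K (prod_module {..<n} (\<lambda>_. base_field K))"
    by (intro prod_module_module K.is_cring base_field_module)
  show "inj_on (\<lambda>x. restrict x {..<n}) (carrier (coord_space K n))"
  proof (rule inj_onI)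
    fix x y assume *: "x \<in> carrier (coord_space K n)" "y \<in> carrier (coord_space K n)"
      "restrict x {..<n} = restrict y {..<n}"
    show "x = y"
    proof
      fix i show "x i = y i"
        using *(1,2) fun_cong[OF *(3), of i] by (cases "i < n") (simp_all add: coord_space_def)
    qed
  qed
qed (auto simp: coord_space_def prod_module_def fun_eq_iff)

lemma kernel_module:
  assumes "module K V" "f \<in> linear_maps K V W" "module K W"
  shows "module K (V\<lparr>carrier := {x \<in> carrier V. f x = \<zero>\<^bsub>W\<^esub>}\<rparr>)"
proof -
  interpret V: module K V by fact
  interpret W: module K W by fact
  show ?thesis
    using linear_mapsD[OF assms(2)] linear_maps_zero[OF assms(1,3,2)]
    by (intro module_subset assms(1)) auto
qed

text \<open>
  Finite dimensionality is tested by linear functionals: a space is finite dimensional as soon as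
  finitely many functionals separate its points. They are not required to be extensional, so that
  evaluations at points qualify as they are.
\<close>

definition functional :: "('k, 'v, 'y) module_scheme => ('v => 'k) => bool"
  where "functional V \<phi> \<longleftrightarrow> (\<forall>x\<in>carrier V. \<phi> x \<in> carrier K) \<and>
    (\<forall>x\<in>carrier V. \<forall>y\<in>carrier V. \<phi> (x \<oplus>\<^bsub>V\<^esub> y) = \<phi> x \<oplus> \<phi> y) \<and>
    (\<forall>c\<in>carrier K. \<forall>x\<in>carrier V. \<phi> (c \<odot>\<^bsub>V\<^esub> x) = c \<otimes> \<phi> x)"

lemma functional_linear: "functional V \<phi> ==> restrict \<phi> (carrier V) \<in> linear_maps K V (base_field K)"
  if "module K V"
proof -
  interpret V: module K V by fact
  show "functional V \<phi> ==> restrict \<phi> (carrier V) \<in> linear_maps K V (base_field K)"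
    by (rule linear_mapsI) (auto simp: functional_def)
qed

lemma functional_kernel_module:
  assumes V: "module K V" and f: "functional V f"
  shows "module K (V\<lparr>carrier := {x \<in> carrier V. f x = \<zero>}\<rparr>)"
proof -
  have "{x \<in> carrier V. restrict f (carrier V) x = \<zero>} = {x \<in> carrier V. f x = \<zero>}" by auto
  then show ?thesis
    using kernel_module[OF V functional_linear[OF V f] base_field_module] by simp
qed

lemma functional_diff:
  assumes V: "module K V" and f: "functional V f" and "x \<in> carrier V" "y \<in> carrier V"
  shows "f (x \<ominus>\<^bsub>V\<^esub> y) = f x \<ominus> f y"
proof -
  interpret V: module K V by fact
  define u where "u = x \<ominus>\<^bsub>V\<^esub> y"
  have u: "u \<in> carrier V" "x = u \<oplus>\<^bsub>V\<^esub> y"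
    using assms(3,4) by (simp_all add: u_def a_minus_def V.M.a_assoc V.M.l_neg)
  then have "f x = f u \<oplus> f y" "f u \<in> carrier K" "f y \<in> carrier K"
    using assms by (auto simp: functional_def)
  then show ?thesis unfolding u_def[symmetric] by (simp add: a_minus_def K.a_assoc K.r_neg)
qed

end

context scalar_field
begin

lemma separated_fin_dim:
  assumes "finite J" "module K V" "\<And>j. j \<in> J ==> functional V (\<phi> j)"
    "\<And>x. x \<in> carrier V ==> (\<And>j. j \<in> J ==> \<phi> j x = \<zero>) ==> x = \<zero>\<^bsub>V\<^esub>"
  shows "fin_dim K V"
  using assms
proof (induction J arbitrary: V rule: finite_induct)
  case (empty V)
  interpret V: module K V by fact
  have V0: "carrier V = {\<zero>\<^bsub>V\<^esub>}" using empty.prems(3) by auto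
  have "is_coord K V (\<lambda>x\<in>carrier V. \<lambda>i. \<zero>)"
    unfolding is_coord_def V0
    by (rule exI[of _ 0]) (auto simp: V0 coord_space_def bij_betw_def intro!: linear_mapsI)
  then show ?case unfolding fin_dim_def by blast
next
  case (insert j J V)
  interpret V: module K V by fact
  have fj: "functional V (\<phi> j)" using insert.prems by auto
  note f = fj[unfolded functional_def]
  let ?V = "V\<lparr>carrier := {x \<in> carrier V. \<phi> j x = \<zero>}\<rparr>"
  have fV: "functional ?V (\<phi> i)" if "i \<in> J" for i
    using insert.prems(2)[of i] that by (simp add: functional_def)
  have sep: "x = \<zero>\<^bsub>?V\<^esub>" if "x \<in> carrier ?V" "\<And>i. i \<in> J ==> \<phi> i x = \<zero>" for x
    using that insert.prems(3)[of x] by auto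
  have "fin_dim K ?V"
    by (rule insert.IH[OF functional_kernel_module[OF insert.prems(1) fj] fV sep])
  then obtain \<psi> n where \<psi>: "\<psi> \<in> linear_maps K ?V (coord_space K n)"
    and bij: "bij_betw \<psi> (carrier ?V) (carrier (coord_space K n))"
    unfolding fin_dim_def is_coord_def by blast
  note \<psi>D = linear_mapsD[OF \<psi>]
  show ?case
  proof (cases "\<forall>x\<in>carrier V. \<phi> j x = \<zero>")
    case True
    then have "{x \<in> carrier V. \<phi> j x = \<zero>} = carrier V" by blast
    then have "?V = V" by simp
    then have "is_coord K V \<psi>" using \<psi> bij unfolding is_coord_def by auto
    then show ?thesis unfolding fin_dim_def by blast
  next
    case False
    then obtain w where w: "w \<in> carrier V" "\<phi> j w \<noteq> \<zero>" by blast
    define v where "v = inv (\<phi> j w) \<odot>\<^bsub>V\<^esub> w"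
    have wU: "\<phi> j w \<in> Units K" using w f by (auto simp: K.field_Units)
    then have v: "v \<in> carrier V" "\<phi> j v = \<one>"
      using w f unfolding v_def by (auto simp: K.Units_inv_closed K.Units_l_inv)
    define p where "p x = x \<ominus>\<^bsub>V\<^esub> \<phi> j x \<odot>\<^bsub>V\<^esub> v" for x
    have pc: "p x \<in> carrier ?V" if "x \<in> carrier V" for x
      using that v f functional_diff[OF insert.prems(1) fj, of x "\<phi> j x \<odot>\<^bsub>V\<^esub> v"]
      by (auto simp: p_def K.r_neg a_minus_def)
    have p0: "p x \<in> carrier V" if "x \<in> carrier V" for x using pc[OF that] by simp
    have padd: "p (x \<oplus>\<^bsub>V\<^esub> y) = p x \<oplus>\<^bsub>V\<^esub> p y" if "x \<in> carrier V" "y \<in> carrier V" for x y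
      using that v f by (simp add: p_def V.smult_l_distr a_minus_def V.M.minus_add V.M.a_ac)
    have psm: "p (c \<odot>\<^bsub>V\<^esub> x) = c \<odot>\<^bsub>V\<^esub> p x" if "x \<in> carrier V" "c \<in> carrier K" for x c
      using that v f by (simp add: p_def V.smult_r_distr a_minus_def V.smult_r_minus V.smult_assoc1)
    have prec: "x = p x \<oplus>\<^bsub>V\<^esub> \<phi> j x \<odot>\<^bsub>V\<^esub> v" if "x \<in> carrier V" for x
      using that v f by (simp add: p_def a_minus_def V.M.a_assoc V.M.l_neg)
    have \<psi>c: "\<psi> u \<in> carrier (coord_space K n)" if "u \<in> carrier ?V" for u
      using \<psi>D(1) that by blast
    have \<psi>z: "\<psi> u i \<in> carrier K" "n \<le> i ==> \<psi> u i = \<zero>" if "u \<in> carrier ?V" for u i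
      using \<psi>c[OF that] by (cases "i < n"; auto simp: coord_space_def)+
    define \<Psi> where "\<Psi> = (\<lambda>x\<in>carrier V. (\<psi> (p x))(n := \<phi> j x))"
    have "\<Psi> \<in> linear_maps K V (coord_space K (Suc n))"
    proof (rule linear_mapsI)
      fix x assume x: "x \<in> carrier V"
      show "\<Psi> x \<in> carrier (coord_space K (Suc n))"
        using \<psi>z[OF pc[OF x]] x f by (auto simp: \<Psi>_def coord_space_def)
    next
      fix x y assume x: "x \<in> carrier V" "y \<in> carrier V"
      have "\<psi> (p (x \<oplus>\<^bsub>V\<^esub> y)) = \<psi> (p x) \<oplus>\<^bsub>coord_space K n\<^esub> \<psi> (p y)"
        using \<psi>D(3)[OF pc[OF x(1)] pc[OF x(2)]] x by (simp add: padd)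
      then show "\<Psi> (x \<oplus>\<^bsub>V\<^esub> y) = \<Psi> x \<oplus>\<^bsub>coord_space K (Suc n)\<^esub> \<Psi> y"
        using x f by (auto simp: \<Psi>_def coord_space_def)
    next
      fix c x assume x: "c \<in> carrier K" "x \<in> carrier V"
      have "\<psi> (p (c \<odot>\<^bsub>V\<^esub> x)) = c \<odot>\<^bsub>coord_space K n\<^esub> \<psi> (p x)"
        using \<psi>D(4)[OF x(1) pc[OF x(2)]] x by (simp add: psm)
      then show "\<Psi> (c \<odot>\<^bsub>V\<^esub> x) = c \<odot>\<^bsub>coord_space K (Suc n)\<^esub> \<Psi> x"
        using x f by (auto simp: \<Psi>_def coord_space_def)
    qed (auto simp: \<Psi>_def)
    moreover have "bij_betw \<Psi> (carrier V) (carrier (coord_space K (Suc n)))"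
    proof (rule bij_betw_imageI)
      show "inj_on \<Psi> (carrier V)"
      proof (rule inj_onI)
        fix x y assume x: "x \<in> carrier V" "y \<in> carrier V" and e: "\<Psi> x = \<Psi> y"
        have e': "(\<psi> (p x))(n := \<phi> j x) = (\<psi> (p y))(n := \<phi> j y)" using e x by (simp add: \<Psi>_def)
        then have e1: "\<phi> j x = \<phi> j y" by (metis fun_upd_same)
        have "\<psi> (p x) i = \<psi> (p y) i" for i
          using fun_cong[OF e', of i] \<psi>z(2)[OF pc[OF x(1)], of n] \<psi>z(2)[OF pc[OF x(2)], of n]
          by (cases "i = n") auto
        then have "\<psi> (p x) = \<psi> (p y)" by blast
        then have "p x = p y" using bij pc x by (meson bij_betw_def inj_onD)
        then show "x = y" using prec x e1 by metis
      qed
      show "\<Psi> ` carrier V = carrier (coord_space K (Suc n))"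
      proof (rule equalityI; rule subsetI)
        fix z assume "z \<in> \<Psi> ` carrier V"
        then show "z \<in> carrier (coord_space K (Suc n))"
          using \<psi>z[OF pc] f by (auto simp: \<Psi>_def coord_space_def)
      next
        fix z assume z: "z \<in> carrier (coord_space K (Suc n))"
        then have "z(n := \<zero>) \<in> carrier (coord_space K n)" by (auto simp: coord_space_def)
        then obtain u where u: "u \<in> carrier ?V" "\<psi> u = z(n := \<zero>)"
          unfolding bij_betw_imp_surj_on[OF bij, symmetric] by fastforce
        have zn: "z n \<in> carrier K" using z by (auto simp: coord_space_def)
        define x where "x = u \<oplus>\<^bsub>V\<^esub> z n \<odot>\<^bsub>V\<^esub> v"
        have x: "x \<in> carrier V" "\<phi> j x = z n" using u v zn f by (auto simp: x_def)
        have "p x = u" using u v zn by (simp add: p_def x(2), simp add: x_def a_minus_def V.M.a_assoc V.M.r_neg)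
        then have "\<Psi> x = z" using x u by (simp add: \<Psi>_def)
        then show "z \<in> \<Psi> ` carrier V" using x by blast
      qed
    qed
    ultimately show ?thesis unfolding fin_dim_def is_coord_def by blast
  qed
qed

lemma fin_dim_linear_iso:
  assumes "module K V" "module K W" "fin_dim K V" "g \<in> linear_maps K V W"
    "bij_betw g (carrier V) (carrier W)"
  shows "fin_dim K W"
proof -
  from assms(3) obtain \<psi> n where \<psi>: "\<psi> \<in> linear_maps K V (coord_space K n)"
    and bij: "bij_betw \<psi> (carrier V) (carrier (coord_space K n))"
    unfolding fin_dim_def is_coord_def by blast
  let ?h = "inv_into (carrier V) g"
  have h: "?h y \<in> carrier V" "g (?h y) = y" if "y \<in> carrier W" for y
    using that assms(5) by (auto simp: bij_betw_def inv_into_into f_inv_into_f)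
  have hg: "?h (g x) = x" if "x \<in> carrier V" for x
    using that assms(5) by (auto simp: bij_betw_def)
  interpret V: module K V by fact
  have hadd: "?h (x \<oplus>\<^bsub>W\<^esub> y) = ?h x \<oplus>\<^bsub>V\<^esub> ?h y" if "x \<in> carrier W" "y \<in> carrier W" for x y
    using linear_mapsD(3)[OF assms(4) h(1)[OF that(1)] h(1)[OF that(2)]] that
      hg[of "?h x \<oplus>\<^bsub>V\<^esub> ?h y"] h by simp
  have hsm: "?h (c \<odot>\<^bsub>W\<^esub> x) = c \<odot>\<^bsub>V\<^esub> ?h x" if "c \<in> carrier K" "x \<in> carrier W" for c x
    using linear_mapsD(4)[OF assms(4) that(1) h(1)[OF that(2)]] that
      hg[of "c \<odot>\<^bsub>V\<^esub> ?h x"] h by simp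
  interpret W: module K W by fact
  have "(\<lambda>y\<in>carrier W. \<psi> (?h y)) \<in> linear_maps K W (coord_space K n)"
    by (rule linear_mapsI) (auto simp: h hadd hsm linear_mapsD[OF \<psi>])
  moreover have "bij_betw (\<lambda>y\<in>carrier W. \<psi> (?h y)) (carrier W) (carrier (coord_space K n))"
    using bij_betw_trans[OF bij_betw_inv_into[OF assms(5)] bij]
    by (subst bij_betw_cong[of _ _ "\<psi> \<circ> ?h"]) auto
  ultimately show ?thesis unfolding fin_dim_def is_coord_def by blast
qed

text \<open>
  Induction on the number of separating functionals: a nonzero vector \<open>u\<close> in the kernel of the
  surjection lets one replace the source by the kernel of a functional that does not vanish at \<open>u\<close>.
\<close>

lemma separated_image_fin_dim:
  assumes "finite J" "module K V" "\<And>j. j \<in> J ==> functional V (\<phi> j)"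
    "\<And>x. x \<in> carrier V ==> (\<And>j. j \<in> J ==> \<phi> j x = \<zero>) ==> x = \<zero>\<^bsub>V\<^esub>"
    "module K W" "g \<in> linear_maps K V W" "g ` carrier V = carrier W"
  shows "fin_dim K W"
  using assms
proof (induction "card J" arbitrary: J V g rule: less_induct)
  case less
  interpret V: module K V by fact
  interpret W: module K W by fact
  note gD = linear_mapsD[OF less.prems(6)]
  have nz: "\<ominus>\<^bsub>W\<^esub> \<zero>\<^bsub>W\<^esub> = \<zero>\<^bsub>W\<^esub>"
    using W.M.r_neg W.M.l_zero W.M.a_inv_closed W.M.zero_closed by metis
  show ?case
  proof (cases "\<forall>u\<in>carrier V. g u = \<zero>\<^bsub>W\<^esub> \<longrightarrow> u = \<zero>\<^bsub>V\<^esub>")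
    case True
    have "inj_on g (carrier V)"
    proof (rule inj_onI)
      fix x y assume x: "x \<in> carrier V" "y \<in> carrier V" "g x = g y"
      then have "g (x \<ominus>\<^bsub>V\<^esub> y) = \<zero>\<^bsub>W\<^esub>"
        using linear_maps_minus[OF less.prems(2,5,6) x(1,2)] gD(1)[OF x(2)]
        by (simp add: W.M.r_neg a_minus_def)
      then have "x \<ominus>\<^bsub>V\<^esub> y = \<zero>\<^bsub>V\<^esub>" using bspec[OF True V.M.minus_closed[OF x(1,2)]] by simp
      then show "x = y" by (rule V.M.minus_zero_eq[OF x(1,2)])
    qed
    then show ?thesis
      using fin_dim_linear_iso[OF less.prems(2,5) separated_fin_dim[OF less.prems(1-4)] less.prems(6)]
        less.prems(7) by (auto simp: bij_betw_def)
  next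
    case False
    then obtain u where u: "u \<in> carrier V" "g u = \<zero>\<^bsub>W\<^esub>" "u \<noteq> \<zero>\<^bsub>V\<^esub>" by blast
    then obtain j where j: "j \<in> J" "\<phi> j u \<noteq> \<zero>" using less.prems(4) by blast
    have fj: "functional V (\<phi> j)" using less.prems j by auto
    note f = fj[unfolded functional_def]
    let ?V = "V\<lparr>carrier := {x \<in> carrier V. \<phi> j x = \<zero>}\<rparr>"
    have U: "\<phi> j u \<in> Units K" using u j f by (auto simp: K.field_Units)
    have surj: "\<exists>x\<in>carrier ?V. g x = y" if "y \<in> carrier W" for y
    proof -
      have "y \<in> g ` carrier V" using that by (simp only: less.prems(7))
      then obtain x where x: "x \<in> carrier V" "g x = y" by (elim imageE) simp
      let ?c = "\<phi> j x \<otimes> inv (\<phi> j u)"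
      have c: "?c \<in> carrier K" "\<phi> j x \<in> carrier K" "\<phi> j u \<in> carrier K" using x u f U by auto
      have "\<phi> j (x \<ominus>\<^bsub>V\<^esub> ?c \<odot>\<^bsub>V\<^esub> u) = \<zero>"
        using functional_diff[OF less.prems(2) fj x(1), of "?c \<odot>\<^bsub>V\<^esub> u"] c u f U
        by (simp add: K.m_assoc K.Units_l_inv a_minus_def K.r_neg)
      moreover have "g (x \<ominus>\<^bsub>V\<^esub> ?c \<odot>\<^bsub>V\<^esub> u) = y"
        using linear_maps_minus[OF less.prems(2,5,6) x(1), of "?c \<odot>\<^bsub>V\<^esub> u"] c u gD x that
        by (simp add: a_minus_def nz)
      ultimately show ?thesis using x(1) u(1) c by (intro bexI[of _ "x \<ominus>\<^bsub>V\<^esub> ?c \<odot>\<^bsub>V\<^esub> u"]) auto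
    qed
    have lin: "restrict g (carrier ?V) \<in> linear_maps K ?V W"
      using gD f functional_kernel_module[OF less.prems(2) fj] by (intro linear_mapsI) auto
    have im: "restrict g (carrier ?V) ` carrier ?V = carrier W"
      using surj gD(1) by (auto simp: image_iff)
    have fV: "functional ?V (\<phi> i)" if "i \<in> J - {j}" for i
      using less.prems(3)[of i] that by (auto simp: functional_def)
    have sep: "x = \<zero>\<^bsub>?V\<^esub>" if "x \<in> carrier ?V" "\<And>i. i \<in> J - {j} ==> \<phi> i x = \<zero>" for x
    proof -
      have "\<phi> i x = \<zero>" if "i \<in> J" for i
        using \<open>x \<in> carrier ?V\<close> \<open>\<And>i. i \<in> J - {j} ==> \<phi> i x = \<zero>\<close>[of i] that by (cases "i = j") auto
      then show ?thesis using less.prems(4)[of x] \<open>x \<in> carrier ?V\<close> by simp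
    qed
    have cd: "card (J - {j}) < card J" "finite (J - {j})"
      using card_Diff1_less[OF less.prems(1) j(1)] less.prems(1) by auto
    show ?thesis
      by (rule less.hyps[OF cd functional_kernel_module[OF less.prems(2) fj] fV sep less.prems(5) lin im])
  qed
qed

text \<open>
  Coordinates are turned into a basis together with its dual functionals, the form in which finite
  dimensionality enters all later arguments with sums.
\<close>

lemma fin_dim_basis:
  assumes "module K V" "fin_dim K V"
  shows "\<exists>(n :: nat) b \<phi>. (\<forall>j<n. b j \<in> carrier V) \<and> (\<forall>j<n. functional V (\<phi> j)) \<and>
    (\<forall>x\<in>carrier V. x = (\<Oplus>\<^bsub>V\<^esub>j\<in>{..<n}. \<phi> j x \<odot>\<^bsub>V\<^esub> b j))"
proof -
  from assms(2) obtain \<sigma> n where \<sigma>: "\<sigma> \<in> linear_maps K V (coord_space K n)"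
    and bij: "bij_betw \<sigma> (carrier V) (carrier (coord_space K n))"
    unfolding fin_dim_def is_coord_def by blast
  interpret V: module K V by fact
  interpret C: module K "coord_space K n" by (rule coord_space_module)
  define e where "e j = (\<lambda>i. if i = j then \<one> else \<zero>)" for j :: nat
  have e: "e j \<in> carrier (coord_space K n)" if "j < n" for j
    using that by (auto simp: e_def coord_space_def)
  define b where "b j = inv_into (carrier V) \<sigma> (e j)" for j
  have b: "b j \<in> carrier V" "\<sigma> (b j) = e j" if "j < n" for j
    using e[OF that] bij unfolding b_def by (auto simp: bij_betw_def inv_into_into f_inv_into_f)
  have \<sigma>c: "\<sigma> x \<in> carrier (coord_space K n)" if "x \<in> carrier V" for x
    using linear_mapsD(1)[OF \<sigma> that] .
  have \<sigma>z: "\<sigma> x j \<in> carrier K" "j \<ge> n ==> \<sigma> x j = \<zero>" if "x \<in> carrier V" for x j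
    using \<sigma>c[OF that] by (cases "j < n"; auto simp: coord_space_def)+
  have fun\<sigma>: "functional V (\<lambda>x. \<sigma> x j)" for j
    unfolding functional_def using \<sigma>z linear_mapsD(3,4)[OF \<sigma>] by (auto simp: coord_space_def)
  have rep: "x = (\<Oplus>\<^bsub>V\<^esub>j\<in>{..<n}. \<sigma> x j \<odot>\<^bsub>V\<^esub> b j)" if x: "x \<in> carrier V" for x
  proof -
    have "\<sigma> (\<Oplus>\<^bsub>V\<^esub>j\<in>{..<n}. \<sigma> x j \<odot>\<^bsub>V\<^esub> b j) = (\<Oplus>\<^bsub>coord_space K n\<^esub>j\<in>{..<n}. \<sigma> (\<sigma> x j \<odot>\<^bsub>V\<^esub> b j))"
      by (rule linear_maps_finsum[OF assms(1) coord_space_module \<sigma>]) (use b \<sigma>z x in auto)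
    also have "\<dots> = (\<Oplus>\<^bsub>coord_space K n\<^esub>j\<in>{..<n}. \<sigma> x j \<odot>\<^bsub>coord_space K n\<^esub> e j)"
      using b e \<sigma>z[OF x] linear_mapsD(4)[OF \<sigma>] by (intro C.M.finsum_cong') auto
    also have "\<dots> = \<sigma> x"
    proof
      fix i
      have "(\<Oplus>\<^bsub>coord_space K n\<^esub>j\<in>{..<n}. \<sigma> x j \<odot>\<^bsub>coord_space K n\<^esub> e j) i
          = (\<Oplus>j\<in>{..<n}. (\<sigma> x j \<odot>\<^bsub>coord_space K n\<^esub> e j) i)"
        by (rule finsum_pointwise[OF C.M.abelian_group_axioms K.abelian_group_axioms])
          (use e \<sigma>z[OF x] in \<open>auto simp: coord_space_def\<close>, metis K.zero_closed not_le)
      also have "\<dots> = \<sigma> x i"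
      proof (cases "i < n")
        case True
        then show ?thesis
          by (subst K.finsum_single[of _ i]) (auto simp: coord_space_def e_def \<sigma>z[OF x])
      next
        case False
        then show ?thesis
          by (subst K.finsum_all_zero) (auto simp: coord_space_def e_def \<sigma>z[OF x])
      qed
      finally show "(\<Oplus>\<^bsub>coord_space K n\<^esub>j\<in>{..<n}. \<sigma> x j \<odot>\<^bsub>coord_space K n\<^esub> e j) i = \<sigma> x i" .
    qed
    finally show ?thesis
      using bij x b \<sigma>z[OF x] V.M.finsum_closed[of "\<lambda>j. \<sigma> x j \<odot>\<^bsub>V\<^esub> b j" "{..<n}"]
      by (auto simp: bij_betw_def Pi_def dest!: inj_onD)
  qed
  show ?thesis
    by (intro exI[of _ n] exI[of _ b] exI[of _ "\<lambda>j x. \<sigma> x j"] conjI allI impI ballI b(1) fun\<sigma> rep)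
qed

lemma fin_dim_surj:
  assumes V: "module K V" "fin_dim K V" and W: "module K W" and "g \<in> linear_maps K V W"
    "g ` carrier V = carrier W"
  shows "fin_dim K W"
proof -
  obtain n b \<phi> where b: "\<And>j. j < n ==> b j \<in> carrier V" and \<phi>: "\<And>j. j < n ==> functional V (\<phi> j)"
    and rep: "\<And>x. x \<in> carrier V ==> x = (\<Oplus>\<^bsub>V\<^esub>j\<in>{..<n::nat}. \<phi> j x \<odot>\<^bsub>V\<^esub> b j)"
    using fin_dim_basis[OF V] by blast
  interpret V: module K V by fact
  have "x = \<zero>\<^bsub>V\<^esub>" if "x \<in> carrier V" "\<And>j. j \<in> {..<n} ==> \<phi> j x = \<zero>" for x
    using that b by (subst rep) (auto intro!: V.M.finsum_all_zero)
  then show ?thesis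
    using separated_image_fin_dim[OF _ V(1) _ _ W assms(4,5), of "{..<n}" \<phi>] \<phi> by auto
qed

lemma fin_dim_separated:
  assumes V: "module K V" "fin_dim K V"
  shows "\<exists>(n :: nat) \<phi>. (\<forall>j<n. functional V (\<phi> j)) \<and>
    (\<forall>x\<in>carrier V. (\<forall>j<n. \<phi> j x = \<zero>) \<longrightarrow> x = \<zero>\<^bsub>V\<^esub>)"
proof -
  obtain n b \<phi> where b: "\<And>j. j < n ==> b j \<in> carrier V" and \<phi>: "\<And>j. j < n ==> functional V (\<phi> j)"
    and rep: "\<And>x. x \<in> carrier V ==> x = (\<Oplus>\<^bsub>V\<^esub>j\<in>{..<n::nat}. \<phi> j x \<odot>\<^bsub>V\<^esub> b j)"
    using fin_dim_basis[OF V] by blast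
  interpret V: module K V by fact
  have zero: "x = \<zero>\<^bsub>V\<^esub>" if "x \<in> carrier V" "\<And>j. j < n ==> \<phi> j x = \<zero>" for x
    using that b by (subst rep) (auto intro!: V.M.finsum_all_zero)
  show ?thesis using \<phi> zero by blast
qed

lemma fin_dim_prod_module:
  assumes "finite J" "\<And>i. i \<in> J ==> module K (X i)" "\<And>i. i \<in> J ==> fin_dim K (X i)"
  shows "fin_dim K (prod_module J X)"
proof -
  define P where "P i n \<phi> \<longleftrightarrow> (\<forall>j<n::nat. functional (X i) (\<phi> j)) \<and>
      (\<forall>x\<in>carrier (X i). (\<forall>j<n. \<phi> j x = \<zero>) \<longrightarrow> x = \<zero>\<^bsub>X i\<^esub>)" for i n \<phi>
  have "\<exists>n \<phi>. P i n \<phi>" if "i \<in> J" for i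
    unfolding P_def by (rule fin_dim_separated[OF assms(2,3)[OF that]])
  then obtain n \<phi> where "\<And>i. i \<in> J ==> P i (n i) (\<phi> i)" by metis
  then have n: "\<And>i j. i \<in> J ==> j < n i ==> functional (X i) (\<phi> i j)"
    and s: "\<And>i x. i \<in> J ==> x \<in> carrier (X i) ==> (\<forall>j<n i. \<phi> i j x = \<zero>) ==> x = \<zero>\<^bsub>X i\<^esub>"
    unfolding P_def by blast+
  show ?thesis
  proof (rule separated_fin_dim[where J = "SIGMA i:J. {..<n i}" and \<phi> = "\<lambda>(i, j) x. \<phi> i j (x i)"])
    fix p assume "p \<in> (SIGMA i:J. {..<n i})"
    then show "functional (prod_module J X) ((\<lambda>(i, j) x. \<phi> i j (x i)) p)"
      using n by (fastforce simp: functional_def prod_module_def PiE_iff)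
  next
    fix x assume x: "x \<in> carrier (prod_module J X)"
      and z: "\<And>p. p \<in> (SIGMA i:J. {..<n i}) ==> (\<lambda>(i, j) x. \<phi> i j (x i)) p x = \<zero>"
    show "x = \<zero>\<^bsub>prod_module J X\<^esub>"
    proof
      fix i show "x i = \<zero>\<^bsub>prod_module J X\<^esub> i"
        using x s[of i "x i"] z[of "(i, _)"] by (cases "i \<in> J") (auto simp: prod_module_def PiE_iff extensional_def)
    qed
  qed (use assms in \<open>auto intro!: prod_module_module K.is_cring\<close>)
qed

lemma fin_dim_injective:
  assumes V: "module K V" "fin_dim K V" and W: "module K W"
    and h: "\<And>x. x \<in> carrier W ==> h x \<in> carrier V" "inj_on h (carrier W)"
    "\<And>x y. x \<in> carrier W ==> y \<in> carrier W ==> h (x \<oplus>\<^bsub>W\<^esub> y) = h x \<oplus>\<^bsub>V\<^esub> h y"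
    "\<And>c x. c \<in> carrier K ==> x \<in> carrier W ==> h (c \<odot>\<^bsub>W\<^esub> x) = c \<odot>\<^bsub>V\<^esub> h x"
  shows "fin_dim K W"
proof -
  obtain n \<phi> where \<phi>: "\<And>j. j < n ==> functional V (\<phi> j)"
    and s: "\<And>x. x \<in> carrier V ==> (\<forall>j<(n::nat). \<phi> j x = \<zero>) ==> x = \<zero>\<^bsub>V\<^esub>"
    using fin_dim_separated[OF V] by blast
  interpret V: module K V by fact
  interpret W: module K W by fact
  have "restrict h (carrier W) \<in> linear_maps K W V" by (rule linear_mapsI) (auto simp: h)
  from linear_maps_zero[OF W V(1) this] have h0: "h \<zero>\<^bsub>W\<^esub> = \<zero>\<^bsub>V\<^esub>" by simp
  show ?thesis
  proof (rule separated_fin_dim[where J = "{..<n}" and \<phi> = "\<lambda>j x. \<phi> j (h x)"])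
    fix j assume "j \<in> {..<n}"
    then show "functional W (\<lambda>x. \<phi> j (h x))" using \<phi>[of j] h by (auto simp: functional_def)
  next
    fix x assume x: "x \<in> carrier W" "\<And>j. j \<in> {..<n} ==> \<phi> j (h x) = \<zero>"
    then have "h x = h \<zero>\<^bsub>W\<^esub>" using s[of "h x"] h h0 by auto
    then show "x = \<zero>\<^bsub>W\<^esub>" using h(2) x(1) by (auto dest: inj_onD)
  qed (use W in auto)
qed

end

section \<open>Right modules and their morphisms\<close>

lemma right_moduleD:
  assumes "right_module K A M"
  shows "module K M"
    "m \<in> carrier M ==> a \<in> carrier A ==> ract M m a \<in> carrier M"
    "m \<in> carrier M ==> n \<in> carrier M ==> a \<in> carrier A ==>
      ract M (m \<oplus>\<^bsub>M\<^esub> n) a = ract M m a \<oplus>\<^bsub>M\<^esub> ract M n a"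
    "c \<in> carrier K ==> m \<in> carrier M ==> a \<in> carrier A ==>
      ract M (c \<odot>\<^bsub>M\<^esub> m) a = c \<odot>\<^bsub>M\<^esub> ract M m a"
    "m \<in> carrier M ==> ract M m \<one>\<^bsub>A\<^esub> = m"
    "m \<in> carrier M ==> a \<in> carrier A ==> b \<in> carrier A ==>
      ract M (ract M m a) b = ract M m (a \<otimes>\<^bsub>A\<^esub> b)"
proof -
  note R = assms[unfolded right_module_def]
  interpret M: module K M using R by auto
  show "module K M" by (rule M.module_axioms)
  show "m \<in> carrier M ==> a \<in> carrier A ==> ract M m a \<in> carrier M" using R by auto
  have l: "(\<lambda>m\<in>carrier M. ract M m a) \<in> linear_maps K M M" if "a \<in> carrier A" using R that by auto
  show "m \<in> carrier M ==> n \<in> carrier M ==> a \<in> carrier A ==>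
      ract M (m \<oplus>\<^bsub>M\<^esub> n) a = ract M m a \<oplus>\<^bsub>M\<^esub> ract M n a"
    using linear_mapsD(3)[OF l, of m n] by simp
  show "c \<in> carrier K ==> m \<in> carrier M ==> a \<in> carrier A ==>
      ract M (c \<odot>\<^bsub>M\<^esub> m) a = c \<odot>\<^bsub>M\<^esub> ract M m a"
    using linear_mapsD(4)[OF l, of c m] by simp
  show "m \<in> carrier M ==> ract M m \<one>\<^bsub>A\<^esub> = m"
    "m \<in> carrier M ==> a \<in> carrier A ==> b \<in> carrier A ==>
      ract M (ract M m a) b = ract M m (a \<otimes>\<^bsub>A\<^esub> b)"
    using R by auto
qed

lemma right_moduleD_scalar:
  assumes "right_module K A M" "module K A"
  shows "m \<in> carrier M ==> a \<in> carrier A ==> b \<in> carrier A ==>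
      ract M m (a \<oplus>\<^bsub>A\<^esub> b) = ract M m a \<oplus>\<^bsub>M\<^esub> ract M m b"
    "c \<in> carrier K ==> m \<in> carrier M ==> a \<in> carrier A ==>
      ract M m (c \<odot>\<^bsub>A\<^esub> a) = c \<odot>\<^bsub>M\<^esub> ract M m a"
proof -
  interpret A: module K A by fact
  have l: "(\<lambda>a\<in>carrier A. ract M m a) \<in> linear_maps K A M" if "m \<in> carrier M"
    using assms(1) that unfolding right_module_def by auto
  show "m \<in> carrier M ==> a \<in> carrier A ==> b \<in> carrier A ==>
      ract M m (a \<oplus>\<^bsub>A\<^esub> b) = ract M m a \<oplus>\<^bsub>M\<^esub> ract M m b"
    using linear_mapsD(3)[OF l, of a b] by simp
  show "c \<in> carrier K ==> m \<in> carrier M ==> a \<in> carrier A ==>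
      ract M m (c \<odot>\<^bsub>A\<^esub> a) = c \<odot>\<^bsub>M\<^esub> ract M m a"
    using linear_mapsD(4)[OF l, of c a] by simp
qed

lemma right_moduleI:
  assumes M: "module K M" and A: "module K A"
    and act: "\<And>m a. m \<in> carrier M ==> a \<in> carrier A ==> ract M m a \<in> carrier M"
    "\<And>m n a. m \<in> carrier M ==> n \<in> carrier M ==> a \<in> carrier A ==>
      ract M (m \<oplus>\<^bsub>M\<^esub> n) a = ract M m a \<oplus>\<^bsub>M\<^esub> ract M n a"
    "\<And>c m a. c \<in> carrier K ==> m \<in> carrier M ==> a \<in> carrier A ==>
      ract M (c \<odot>\<^bsub>M\<^esub> m) a = c \<odot>\<^bsub>M\<^esub> ract M m a"
    "\<And>m. m \<in> carrier M ==> ract M m \<one>\<^bsub>A\<^esub> = m"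
    "\<And>m a b. m \<in> carrier M ==> a \<in> carrier A ==> b \<in> carrier A ==>
      ract M (ract M m a) b = ract M m (a \<otimes>\<^bsub>A\<^esub> b)"
    "\<And>m a b. m \<in> carrier M ==> a \<in> carrier A ==> b \<in> carrier A ==>
      ract M m (a \<oplus>\<^bsub>A\<^esub> b) = ract M m a \<oplus>\<^bsub>M\<^esub> ract M m b"
    "\<And>c m a. c \<in> carrier K ==> m \<in> carrier M ==> a \<in> carrier A ==>
      ract M m (c \<odot>\<^bsub>A\<^esub> a) = c \<odot>\<^bsub>M\<^esub> ract M m a"
  shows "right_module K A M"
proof -
  interpret M: module K M by fact
  interpret A: module K A by fact
  show ?thesis unfolding right_module_def
    using act by (auto intro!: M.module_axioms linear_mapsI)
qed

lemma HomI:
  assumes "\<And>x. x \<in> carrier M ==> f x \<in> carrier N" "f \<in> extensional (carrier M)"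
    "\<And>x y. x \<in> carrier M ==> y \<in> carrier M ==> f (x \<oplus>\<^bsub>M\<^esub> y) = f x \<oplus>\<^bsub>N\<^esub> f y"
    "\<And>c x. c \<in> carrier K ==> x \<in> carrier M ==> f (c \<odot>\<^bsub>M\<^esub> x) = c \<odot>\<^bsub>N\<^esub> f x"
    "\<And>x a. x \<in> carrier M ==> a \<in> carrier A ==> f (ract M x a) = ract N (f x) a"
  shows "f \<in> Hom K A M N"
  using assms unfolding Hom_def by (auto intro: linear_mapsI)

lemma HomD:
  assumes "f \<in> Hom K A M N"
  shows "x \<in> carrier M ==> f x \<in> carrier N" "f \<in> extensional (carrier M)"
    "x \<in> carrier M ==> y \<in> carrier M ==> f (x \<oplus>\<^bsub>M\<^esub> y) = f x \<oplus>\<^bsub>N\<^esub> f y"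
    "c \<in> carrier K ==> x \<in> carrier M ==> f (c \<odot>\<^bsub>M\<^esub> x) = c \<odot>\<^bsub>N\<^esub> f x"
    "x \<in> carrier M ==> a \<in> carrier A ==> f (ract M x a) = ract N (f x) a"
  using assms unfolding Hom_def by (auto dest: linear_mapsD)

lemma Hom_linear: "f \<in> Hom K A M N ==> f \<in> linear_maps K M N"
  unfolding Hom_def by auto

lemma Hom_eqI:
  assumes "f \<in> Hom K A M N" "g \<in> Hom K A M N" "\<And>x. x \<in> carrier M ==> f x = g x"
  shows "f = g"
  using assms by (auto intro: extensionalityI[OF HomD(2) HomD(2)])

lemma compose_Hom:
  assumes "right_module K A X" "f \<in> Hom K A X Y" "g \<in> Hom K A Y Z"
  shows "compose (carrier X) g f \<in> Hom K A X Z"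
proof -
  note X = right_moduleD[OF assms(1)]
  interpret X: module K X by (rule X)
  show ?thesis
    by (rule HomI) (auto simp: HomD[OF assms(2)] HomD[OF assms(3)] compose_def X)
qed

lemma id_Hom:
  assumes "right_module K A X"
  shows "id_map X \<in> Hom K A X X"
proof -
  note X = right_moduleD[OF assms]
  interpret X: module K X by (rule X)
  show ?thesis by (rule HomI) (auto simp: id_map_def X)
qed

lemma compose_id_map:
  assumes "f \<in> Hom K A X Y"
  shows "compose (carrier X) f (id_map X) = f" "compose (carrier X) (id_map Y) f = f"
  using HomD(1,2)[OF assms] by (auto simp: compose_def id_map_def extensional_def fun_eq_iff)

lemma compose_Hom_assoc:
  assumes "f \<in> Hom K A X Y"
  shows "compose (carrier X) h (compose (carrier X) g f) = compose (carrier X) (compose (carrier Y) h g) f"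
  using HomD(1)[OF assms] by (auto simp: compose_def fun_eq_iff)

lemma mod_isoD:
  assumes "f \<in> mod_iso K A M N" and "right_module K A M" "right_module K A N"
  defines "g \<equiv> restrict (inv_into (carrier M) f) (carrier N)"
  shows "f \<in> Hom K A M N" "g \<in> Hom K A N M" "compose (carrier M) g f = id_map M"
    "compose (carrier N) f g = id_map N"
proof -
  show f: "f \<in> Hom K A M N" using assms by (auto simp: mod_iso_def)
  have bij: "bij_betw f (carrier M) (carrier N)" using assms by (auto simp: mod_iso_def)
  note M = right_moduleD[OF assms(2)] note N = right_moduleD[OF assms(3)]
  interpret M: module K M by (rule M)
  interpret N: module K N by (rule N)
  note fD = HomD[OF f]
  have g: "g y \<in> carrier M" "f (g y) = y" if "y \<in> carrier N" for y
    using that bij unfolding g_def by (auto simp: bij_betw_def inv_into_into f_inv_into_f)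
  have gf: "g (f x) = x" if "x \<in> carrier M" for x
    using that bij fD(1) unfolding g_def by (auto simp: bij_betw_def)
  have inj: "x = y" if "x \<in> carrier M" "y \<in> carrier M" "f x = f y" for x y
    using bij that by (auto simp: bij_betw_def dest: inj_onD)
  show "g \<in> Hom K A N M"
    by (rule HomI) (auto simp: g_def[symmetric] g fD M N intro!: inj, auto simp: g_def)
  show "compose (carrier M) g f = id_map M" "compose (carrier N) f g = id_map N"
    by (auto simp: compose_def id_map_def gf g)
qed

definition hom_space ::
  "('k, 'z) ring_scheme => ('k, 'a, 'y) module_scheme => ('k, 'a, 'm) rmod => ('k, 'a, 'n) rmod =>
    ('k, 'm => 'n) module"
  where "hom_space K A X Y = \<lparr>carrier = Hom K A X Y, mult = undefined, one = undefined,
    zero = zero_map X Y, add = (\<lambda>f g. \<lambda>x\<in>carrier X. f x \<oplus>\<^bsub>Y\<^esub> g x),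
    smult = (\<lambda>c f. \<lambda>x\<in>carrier X. c \<odot>\<^bsub>Y\<^esub> f x)\<rparr>"

lemma hom_space_sel [simp]:
  "carrier (hom_space K A X Y) = Hom K A X Y" "\<zero>\<^bsub>hom_space K A X Y\<^esub> = zero_map X Y"
  "x \<in> carrier X ==> (f \<oplus>\<^bsub>hom_space K A X Y\<^esub> g) x = f x \<oplus>\<^bsub>Y\<^esub> g x"
  "x \<in> carrier X ==> (c \<odot>\<^bsub>hom_space K A X Y\<^esub> f) x = c \<odot>\<^bsub>Y\<^esub> f x"
  by (auto simp: hom_space_def)

lemma zero_map_apply [simp]: "x \<in> carrier X ==> zero_map X Y x = \<zero>\<^bsub>Y\<^esub>"
  by (simp add: zero_map_def)

lemma id_map_apply [simp]: "x \<in> carrier X ==> id_map X x = x"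
  by (simp add: id_map_def)

lemma right_module_zero_act:
  assumes "right_module K A Y" "a \<in> carrier A"
  shows "ract Y \<zero>\<^bsub>Y\<^esub> a = \<zero>\<^bsub>Y\<^esub>"
proof -
  note Y = right_moduleD[OF assms(1)]
  interpret Y: module K Y by (rule Y)
  have "ract Y (\<zero>\<^bsub>K\<^esub> \<odot>\<^bsub>Y\<^esub> \<zero>\<^bsub>Y\<^esub>) a = \<zero>\<^bsub>K\<^esub> \<odot>\<^bsub>Y\<^esub> ract Y \<zero>\<^bsub>Y\<^esub> a"
    using assms(2) by (intro Y) auto
  then show ?thesis using Y(2)[OF Y.M.zero_closed assms(2)] by simp
qed

lemma hom_space_module:
  assumes "right_module K A X" "right_module K A Y"
  shows "module K (hom_space K A X Y)"
proof -
  note X = right_moduleD[OF assms(1)] note Y = right_moduleD[OF assms(2)]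
  interpret X: module K X by (rule X)
  interpret Y: module K Y by (rule Y)
  have z: "zero_map X Y \<in> Hom K A X Y"
    by (rule HomI) (auto simp: X right_module_zero_act[OF assms(2)], auto simp: zero_map_def)
  have a: "(\<lambda>x\<in>carrier X. f x \<oplus>\<^bsub>Y\<^esub> g x) \<in> Hom K A X Y" if "f \<in> Hom K A X Y" "g \<in> Hom K A X Y" for f g
    using HomD[OF that(1)] HomD[OF that(2)]
    by (intro HomI) (auto simp: X Y Y.smult_r_distr Y.M.a_ac)
  have s: "(\<lambda>x\<in>carrier X. c \<odot>\<^bsub>Y\<^esub> f x) \<in> Hom K A X Y" if "f \<in> Hom K A X Y" "c \<in> carrier K" for f c
    using HomD[OF that(1)] that(2)
    by (intro HomI) (auto simp: X Y Y.smult_r_distr Y.smult_assoc1[symmetric] X.R.m_comm)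
  show ?thesis
  proof (rule module_transfer[where V = "prod_module (carrier X) (\<lambda>_. Y)" and h = "\<lambda>f. f"])
    show "module K (prod_module (carrier X) (\<lambda>_. Y))"
      by (intro prod_module_module X.R.is_cring Y.module_axioms)
  qed (use z a s in \<open>auto simp: prod_module_def hom_space_def zero_map_def dest: HomD(1) intro: extensional_arb[OF HomD(2)]\<close>)
qed

lemma compose_bilinear:
  assumes XY: "f \<in> Hom K A X Y" "f' \<in> Hom K A X Y" and YZ: "g \<in> Hom K A Y Z" "g' \<in> Hom K A Y Z"
    and "right_module K A X" "right_module K A Y" "right_module K A Z" and c: "c \<in> carrier K"
  shows "compose (carrier X) g (f \<oplus>\<^bsub>hom_space K A X Y\<^esub> f') =
      compose (carrier X) g f \<oplus>\<^bsub>hom_space K A X Z\<^esub> compose (carrier X) g f'"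
    "compose (carrier X) (g \<oplus>\<^bsub>hom_space K A Y Z\<^esub> g') f =
      compose (carrier X) g f \<oplus>\<^bsub>hom_space K A X Z\<^esub> compose (carrier X) g' f"
    "compose (carrier X) g (c \<odot>\<^bsub>hom_space K A X Y\<^esub> f) = c \<odot>\<^bsub>hom_space K A X Z\<^esub> compose (carrier X) g f"
    "compose (carrier X) (c \<odot>\<^bsub>hom_space K A Y Z\<^esub> g) f = c \<odot>\<^bsub>hom_space K A X Z\<^esub> compose (carrier X) g f"
    "compose (carrier X) g (zero_map X Y) = zero_map X Z"
    "compose (carrier X) (zero_map Y Z) f = zero_map X Z"
  using HomD[OF XY(1)] HomD[OF XY(2)] HomD[OF YZ(1)] HomD[OF YZ(2)] c
    linear_maps_zero[OF right_moduleD(1)[OF assms(6)] right_moduleD(1)[OF assms(7)] Hom_linear[OF YZ(1)]]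
  by (auto simp: hom_space_def compose_def zero_map_def fun_eq_iff)

lemma compose_finsum:
  assumes "right_module K A X" "right_module K A Y" "right_module K A Z"
    and "\<And>i. i \<in> I ==> f i \<in> Hom K A X Y" "g \<in> Hom K A Y Z"
  shows "compose (carrier X) g (finsum (hom_space K A X Y) f I) =
    finsum (hom_space K A X Z) (\<lambda>i. compose (carrier X) g (f i)) I"
proof -
  interpret K: cring K using right_moduleD(1)[OF assms(1)] unfolding module_def by auto
  note mods = module_abelian_group[OF hom_space_module]
  show ?thesis
    by (rule finsum_additive[where h = "compose (carrier X) g"])
      (auto simp: assms mods compose_Hom[OF assms(1) _ assms(5)]
        compose_bilinear(1)[OF _ _ assms(5,5) assms(1-3) K.one_closed])
qed

lemma finsum_compose:
  assumes "right_module K A X" "right_module K A Y" "right_module K A Z"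
    and "\<And>i. i \<in> I ==> g i \<in> Hom K A Y Z" "f \<in> Hom K A X Y"
  shows "compose (carrier X) (finsum (hom_space K A Y Z) g I) f =
    finsum (hom_space K A X Z) (\<lambda>i. compose (carrier X) (g i) f) I"
proof -
  interpret K: cring K using right_moduleD(1)[OF assms(1)] unfolding module_def by auto
  note mods = module_abelian_group[OF hom_space_module]
  show ?thesis
    by (rule finsum_additive[where h = "\<lambda>g. compose (carrier X) g f"])
      (auto simp: assms mods compose_Hom[OF assms(1) assms(5)]
        compose_bilinear(2)[OF assms(5,5) _ _ assms(1-3) K.one_closed])
qed

lemma finsum_hom_apply:
  assumes "right_module K A X" "right_module K A Y" "\<And>i. i \<in> I ==> f i \<in> Hom K A X Y" "x \<in> carrier X"
  shows "finsum (hom_space K A X Y) f I x = (\<Oplus>\<^bsub>Y\<^esub>i\<in>I. f i x)"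
  by (rule finsum_pointwise[OF module_abelian_group[OF hom_space_module[OF assms(1,2)]]
        module_abelian_group[OF right_moduleD(1)[OF assms(2)]]])
    (use assms in \<open>auto dest: HomD(1) intro: extensional_arb[OF HomD(2)]\<close>)

text \<open>
  The analogue of \<open>module_transfer\<close> for right modules: all axioms are equations and may be tested
  after applying an injective map.
\<close>

lemma right_module_transfer:
  assumes V: "right_module K A V" and A: "module K A"
    and h: "\<And>x. x \<in> carrier W ==> h x \<in> carrier V" "inj_on h (carrier W)"
    and closed: "\<zero>\<^bsub>W\<^esub> \<in> carrier W"
      "\<And>x y. x \<in> carrier W ==> y \<in> carrier W ==> x \<oplus>\<^bsub>W\<^esub> y \<in> carrier W"
      "\<And>c x. c \<in> carrier K ==> x \<in> carrier W ==> c \<odot>\<^bsub>W\<^esub> x \<in> carrier W"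
      "\<And>x a. x \<in> carrier W ==> a \<in> carrier A ==> ract W x a \<in> carrier W"
    and hom: "h \<zero>\<^bsub>W\<^esub> = \<zero>\<^bsub>V\<^esub>"
      "\<And>x y. x \<in> carrier W ==> y \<in> carrier W ==> h (x \<oplus>\<^bsub>W\<^esub> y) = h x \<oplus>\<^bsub>V\<^esub> h y"
      "\<And>c x. c \<in> carrier K ==> x \<in> carrier W ==> h (c \<odot>\<^bsub>W\<^esub> x) = c \<odot>\<^bsub>V\<^esub> h x"
      "\<And>x a. x \<in> carrier W ==> a \<in> carrier A ==> h (ract W x a) = ract V (h x) a"
    and ring: "ring A"
  shows "right_module K A W"
proof -
  note V' = right_moduleD[OF V] right_moduleD_scalar[OF V A]
  interpret A: module K A by fact
  interpret A: ring A by fact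
  have eq: "x = y" if "x \<in> carrier W" "y \<in> carrier W" "h x = h y" for x y
    using inj_onD[OF h(2)] that by blast
  show ?thesis
  proof (rule right_moduleI[OF _ A])
    show "module K W" by (rule module_transfer[OF V'(1) h closed(1-3) hom(1-3)])
  qed (auto intro!: eq simp: closed hom h V')
qed

section \<open>Finite-dimensional modules\<close>

lemma (in abelian_monoid) finsum_in_subset:
  assumes "N \<subseteq> carrier G" "\<zero> \<in> N" "\<And>x y. x \<in> N ==> y \<in> N ==> x \<oplus> y \<in> N"
    "\<And>i. i \<in> I ==> f i \<in> N"
  shows "finsum G f I \<in> N"
  using assms(4)
proof (induction I rule: infinite_finite_induct)
  case (insert i I)
  have "f \<in> I \<rightarrow> carrier G" "f i \<in> carrier G" using insert.prems assms(1) by auto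
  then show ?case using insert assms(3) by simp
qed (simp_all add: assms(2))

locale fd_alg = scalar_field K for K :: "('k, 'z) ring_scheme" (structure) +
  fixes A :: "('k, 'a, 'y) module_scheme"
  assumes alg: "k_algebra K A" and fdA: "fin_dim K A"
begin

lemma A_module: "module K A" and A_ring: "ring A"
  using alg unfolding k_algebra_def by auto

text \<open>
  For modules over a finite-dimensional algebra this is the same as being finitely generated, by
  \<open>fdmod_fg\<close> and \<open>fg_fdmod\<close>. Finite dimensionality is what \<open>std_module\<close> depends on.
\<close>

definition fdmod :: "('k, 'a, 'm) rmod => bool"
  where "fdmod M \<longleftrightarrow> right_module K A M \<and> fin_dim K M"

lemma fdmodD:
  assumes "fdmod M"
  shows "right_module K A M" "fin_dim K M" "module K M"
  using assms right_moduleD(1) unfolding fdmod_def by auto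

lemma fdmod_coord:
  assumes M: "fdmod M"
  shows "fdmod (std_module K M)" "coord K M \<in> mod_iso K A M (std_module K M)"
proof -
  note M' = fdmodD[OF M]
  note MD = right_moduleD[OF M'(1)]
  interpret M: module K M by (rule M')
  define \<sigma> where "\<sigma> = coord K M"
  define \<psi> where "\<psi> = inv_into (carrier M) \<sigma>"
  have "is_coord K M \<sigma>"
    using M'(2) unfolding \<sigma>_def coord_def fin_dim_def by (rule someI_ex)
  then obtain n where \<sigma>: "\<sigma> \<in> linear_maps K M (coord_space K n)"
    and bij: "bij_betw \<sigma> (carrier M) (carrier (coord_space K n))"
    unfolding is_coord_def by blast
  have inj: "inj_on \<sigma> (carrier M)" using bij by (auto simp: bij_betw_def)
  let ?S = "std_module K M"
  have sel: "carrier ?S = \<sigma> ` carrier M" "\<zero>\<^bsub>?S\<^esub> = \<sigma> \<zero>\<^bsub>M\<^esub>"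
    "\<And>x y. x \<oplus>\<^bsub>?S\<^esub> y = \<sigma> (\<psi> x \<oplus>\<^bsub>M\<^esub> \<psi> y)" "\<And>c x. c \<odot>\<^bsub>?S\<^esub> x = \<sigma> (c \<odot>\<^bsub>M\<^esub> \<psi> x)"
    "\<And>x a. ract ?S x a = \<sigma> (ract M (\<psi> x) a)"
    by (simp_all add: std_module_def \<sigma>_def \<psi>_def Let_def)
  have \<psi>\<sigma>: "\<psi> (\<sigma> x) = x" if "x \<in> carrier M" for x
    using that inj by (simp add: \<psi>_def)
  have \<psi>c: "\<psi> y \<in> carrier M" if "y \<in> carrier ?S" for y
    using that \<psi>\<sigma> by (auto simp: sel)
  have rm: "right_module K A ?S"
    by (rule right_module_transfer[OF M'(1) A_module, where h = \<psi>])
      (auto simp: A_ring sel \<psi>\<sigma> MD intro!: inj_onI)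
  show iso: "coord K M \<in> mod_iso K A M ?S"
    unfolding \<sigma>_def[symmetric] mod_iso_def
    using linear_mapsD(2)[OF \<sigma>] inj
    by (auto simp: sel \<psi>\<sigma> bij_betw_def MD intro!: HomI)
  have "fin_dim K ?S"
    using fin_dim_linear_iso[OF M'(3) right_moduleD(1)[OF rm] M'(2)] iso
    by (auto simp: mod_iso_def Hom_def)
  then show "fdmod ?S" using rm by (simp add: fdmod_def)
qed

definition unstd :: "('k, 'a, 'm) rmod => 'k vec => 'm"
  where "unstd M = restrict (inv_into (carrier M) (coord K M)) (carrier (std_module K M))"

lemma coord_unstd:
  assumes M: "fdmod M"
  shows "coord K M \<in> Hom K A M (std_module K M)" "unstd M \<in> Hom K A (std_module K M) M"
    "compose (carrier M) (unstd M) (coord K M) = id_map M"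
    "compose (carrier (std_module K M)) (coord K M) (unstd M) = id_map (std_module K M)"
  using mod_isoD[OF fdmod_coord(2)[OF M] fdmodD(1)[OF M] fdmodD(1)[OF fdmod_coord(1)[OF M]]]
  unfolding unstd_def by auto

lemma unstd_coord:
  assumes "fdmod M"
  shows "x \<in> carrier M ==> unstd M (coord K M x) = x"
    "y \<in> carrier (std_module K M) ==> coord K M (unstd M y) = y"
  using fun_cong[OF coord_unstd(3)[OF assms], of x] fun_cong[OF coord_unstd(4)[OF assms], of y]
  by (auto simp: compose_def id_map_def)

lemma std_map_apply:
  "x \<in> carrier (std_module K M) ==> std_map K M N f x = coord K N (f (unstd M x))"
  by (simp add: std_map_def unstd_def)

lemma std_map_Hom:
  assumes M: "fdmod M" and N: "fdmod N" and f: "f \<in> Hom K A M N"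
  shows "std_map K M N f \<in> Hom K A (std_module K M) (std_module K N)"
proof -
  note S = right_moduleD[OF fdmodD(1)[OF fdmod_coord(1)[OF M]]]
  interpret S: module K "std_module K M" by (rule S)
  note D = HomD[OF coord_unstd(1)[OF N]] HomD[OF coord_unstd(2)[OF M]] HomD[OF f]
  show ?thesis
    by (rule HomI) (auto simp: std_map_apply D S, auto simp: std_map_def)
qed

lemma std_map_compose:
  assumes M: "fdmod M" and N: "fdmod N" and P: "fdmod P" and f: "f \<in> Hom K A M N" and g: "g \<in> Hom K A N P"
  shows "std_map K M P (compose (carrier M) g f) =
    compose (carrier (std_module K M)) (std_map K N P g) (std_map K M N f)"
proof -
  note D = HomD(1)[OF coord_unstd(1)[OF N]] HomD(1)[OF coord_unstd(2)[OF M]] HomD(1)[OF f]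
  show ?thesis
  proof
    fix x show "std_map K M P (compose (carrier M) g f) x =
      compose (carrier (std_module K M)) (std_map K N P g) (std_map K M N f) x"
      by (cases "x \<in> carrier (std_module K M)")
        (auto simp: std_map_apply compose_def D unstd_coord[OF N], auto simp: std_map_def)
  qed
qed

lemma std_map_id:
  assumes M: "fdmod M"
  shows "std_map K M M (id_map M) = id_map (std_module K M)"
proof
  fix x show "std_map K M M (id_map M) x = id_map (std_module K M) x"
    using HomD(1)[OF coord_unstd(2)[OF M]]
    by (cases "x \<in> carrier (std_module K M)")
      (auto simp: std_map_apply unstd_coord[OF M], auto simp: std_map_def id_map_def)
qed

lemma std_map_linear:
  assumes M: "fdmod M" and N: "fdmod N" and f: "f \<in> Hom K A M N" "g \<in> Hom K A M N" and c: "c \<in> carrier K"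
  shows "std_map K M N (f \<oplus>\<^bsub>hom_space K A M N\<^esub> g) =
      std_map K M N f \<oplus>\<^bsub>hom_space K A (std_module K M) (std_module K N)\<^esub> std_map K M N g"
    "std_map K M N (c \<odot>\<^bsub>hom_space K A M N\<^esub> f) =
      c \<odot>\<^bsub>hom_space K A (std_module K M) (std_module K N)\<^esub> std_map K M N f"
proof -
  note D = HomD[OF coord_unstd(1)[OF N]] HomD(1)[OF coord_unstd(2)[OF M]] HomD(1)[OF f(1)] HomD(1)[OF f(2)]
  show "std_map K M N (f \<oplus>\<^bsub>hom_space K A M N\<^esub> g) =
      std_map K M N f \<oplus>\<^bsub>hom_space K A (std_module K M) (std_module K N)\<^esub> std_map K M N g"
  proof
    fix x show "std_map K M N (f \<oplus>\<^bsub>hom_space K A M N\<^esub> g) x =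
      (std_map K M N f \<oplus>\<^bsub>hom_space K A (std_module K M) (std_module K N)\<^esub> std_map K M N g) x"
      by (cases "x \<in> carrier (std_module K M)")
        (auto simp: std_map_apply D, auto simp: std_map_def hom_space_def)
  qed
  show "std_map K M N (c \<odot>\<^bsub>hom_space K A M N\<^esub> f) =
      c \<odot>\<^bsub>hom_space K A (std_module K M) (std_module K N)\<^esub> std_map K M N f"
  proof
    fix x show "std_map K M N (c \<odot>\<^bsub>hom_space K A M N\<^esub> f) x =
      (c \<odot>\<^bsub>hom_space K A (std_module K M) (std_module K N)\<^esub> std_map K M N f) x"
      by (cases "x \<in> carrier (std_module K M)")
        (auto simp: std_map_apply D c, auto simp: std_map_def hom_space_def)
  qed
qed

lemma fdmod_fg:
  assumes M: "fdmod M"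
  shows "fg_module K A M"
proof -
  interpret M: module K M by (rule fdmodD(3)[OF M])
  obtain n b \<phi> where b: "\<And>j. j < n ==> b j \<in> carrier M" and \<phi>: "\<And>j. j < n ==> functional M (\<phi> j)"
    and rep: "\<And>x. x \<in> carrier M ==> x = (\<Oplus>\<^bsub>M\<^esub>j\<in>{..<n::nat}. \<phi> j x \<odot>\<^bsub>M\<^esub> b j)"
    using fin_dim_basis[OF fdmodD(3,2)[OF M]] by blast
  have "N = carrier M" if N: "right_submodule K A M N" "b ` {..<n} \<subseteq> N" for N
  proof -
    have sg: "subgroup N (add_monoid M)" and sm: "\<And>c x. c \<in> carrier K ==> x \<in> N ==> c \<odot>\<^bsub>M\<^esub> x \<in> N"
      using N(1) unfolding right_submodule_def submodule_def submodule_axioms_def by auto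
    have NM: "N \<subseteq> carrier M" and N0: "\<zero>\<^bsub>M\<^esub> \<in> N" and Na: "\<And>x y. x \<in> N ==> y \<in> N ==> x \<oplus>\<^bsub>M\<^esub> y \<in> N"
      using subgroup.subset[OF sg] subgroup.one_closed[OF sg] subgroup.m_closed[OF sg] by auto
    have "x \<in> N" if x: "x \<in> carrier M" for x
    proof -
      have "(\<Oplus>\<^bsub>M\<^esub>j\<in>{..<n}. \<phi> j x \<odot>\<^bsub>M\<^esub> b j) \<in> N"
        using N(2) \<phi> x by (intro M.M.finsum_in_subset NM N0 Na sm) (auto simp: functional_def)
      then show ?thesis using rep[OF x] by simp
    qed
    then show ?thesis using NM by blast
  qed
  then show ?thesis
    unfolding fg_module_def using fdmodD(1)[OF M] b
    by (auto intro!: exI[of _ "b ` {..<n}"])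
qed

text \<open>
  A module generated by a finite set \<open>S\<close> is a quotient of the finite-dimensional space \<open>A\<^sup>S\<close>.
\<close>

lemma fg_fdmod:
  assumes "fg_module K A M"
  shows "fdmod M"
proof -
  have rm: "right_module K A M" using assms by (auto simp: fg_module_def)
  obtain S where S: "S \<subseteq> carrier M" "finite S"
    and gen: "\<And>N. right_submodule K A M N ==> S \<subseteq> N ==> N = carrier M"
    using assms unfolding fg_module_def by blast
  note MD = right_moduleD[OF rm] right_moduleD_scalar[OF rm A_module]
  interpret M: module K M by (rule MD)
  interpret A: k_algebra K A by (rule alg)
  interpret A: ring A by (rule A_ring)
  let ?V = "prod_module S (\<lambda>_. A)"
  have V: "module K ?V" "fin_dim K ?V"
    by (intro prod_module_module fin_dim_prod_module K.is_cring S A_module fdA)+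
  interpret V: module K ?V by (rule V)
  define g where "g = (\<lambda>c\<in>carrier ?V. \<Oplus>\<^bsub>M\<^esub>s\<in>S. ract M s (c s))"
  have Sc: "s \<in> carrier M" if "s \<in> S" for s using that S by auto
  have cc: "c s \<in> carrier A" if "c \<in> carrier ?V" "s \<in> S" for c s
    using that by (auto simp: prod_module_def)
  have tc: "(\<lambda>s. ract M s (c s)) \<in> S \<rightarrow> carrier M" if "c \<in> carrier ?V" for c
    using that cc Sc MD by auto
  have g: "g \<in> linear_maps K ?V M"
  proof (rule linear_mapsI)
    fix c assume "c \<in> carrier ?V"
    then show "g c \<in> carrier M" using tc by (auto simp: g_def intro!: M.finsum_closed)
  next
    fix c d assume c: "c \<in> carrier ?V" "d \<in> carrier ?V"
    have "g (c \<oplus>\<^bsub>?V\<^esub> d) = (\<Oplus>\<^bsub>M\<^esub>s\<in>S. ract M s ((c \<oplus>\<^bsub>?V\<^esub> d) s))"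
      using c by (simp add: g_def)
    also have "\<dots> = (\<Oplus>\<^bsub>M\<^esub>s\<in>S. ract M s (c s) \<oplus>\<^bsub>M\<^esub> ract M s (d s))"
      using c cc Sc tc MD by (intro M.finsum_cong') (auto simp: prod_module_def)
    also have "\<dots> = g c \<oplus>\<^bsub>M\<^esub> g d"
      using c tc by (simp add: g_def M.finsum_addf)
    finally show "g (c \<oplus>\<^bsub>?V\<^esub> d) = g c \<oplus>\<^bsub>M\<^esub> g d" .
  next
    fix k c assume k: "k \<in> carrier K" and c: "c \<in> carrier ?V"
    have "k \<odot>\<^bsub>M\<^esub> g c = (\<Oplus>\<^bsub>M\<^esub>s\<in>S. k \<odot>\<^bsub>M\<^esub> ract M s (c s))"
      using k c tc by (simp add: g_def, intro finsum_additive[where h = "\<lambda>x. k \<odot>\<^bsub>M\<^esub> x", OF M.M.abelian_group_axioms M.M.abelian_group_axioms])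
        (auto simp: M.smult_r_distr)
    also have "\<dots> = (\<Oplus>\<^bsub>M\<^esub>s\<in>S. ract M s ((k \<odot>\<^bsub>?V\<^esub> c) s))"
      using k c cc Sc tc MD by (intro M.finsum_cong') (auto simp: prod_module_def)
    also have "\<dots> = g (k \<odot>\<^bsub>?V\<^esub> c)"
      using k c by (simp add: g_def)
    finally show "g (k \<odot>\<^bsub>?V\<^esub> c) = k \<odot>\<^bsub>M\<^esub> g c" by simp
  qed (auto simp: g_def)
  note gD = linear_mapsD[OF g]
  have sub: "right_submodule K A M (g ` carrier ?V)"
    unfolding right_submodule_def
  proof
    show "submodule (g ` carrier ?V) K M"
    proof (rule M.submoduleI)
      show "g ` carrier ?V \<subseteq> carrier M" using gD by auto
      show "\<zero>\<^bsub>M\<^esub> \<in> g ` carrier ?V"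
        using linear_maps_zero[OF V(1) MD(1) g] V.M.zero_closed by (metis image_eqI)
      fix x assume "x \<in> g ` carrier ?V"
      then obtain c where c: "c \<in> carrier ?V" "x = g c" by blast
      have "g (\<zero>\<^bsub>?V\<^esub> \<ominus>\<^bsub>?V\<^esub> c) = \<ominus>\<^bsub>M\<^esub> x"
        using linear_maps_minus[OF V(1) MD(1) g V.M.zero_closed c(1)] linear_maps_zero[OF V(1) MD(1) g] gD(1)[OF c(1)] c
        by (simp add: a_minus_def)
      then show "\<ominus>\<^bsub>M\<^esub> x \<in> g ` carrier ?V" using c V.M.minus_closed[OF V.M.zero_closed c(1)] by (metis image_eqI)
    next
      fix x y assume "x \<in> g ` carrier ?V" "y \<in> g ` carrier ?V"
      then obtain c d where c: "c \<in> carrier ?V" "x = g c" "d \<in> carrier ?V" "y = g d" by blast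
      show "x \<oplus>\<^bsub>M\<^esub> y \<in> g ` carrier ?V"
        using gD(3)[OF c(1,3)] c V.M.add.m_closed by (metis image_eqI)
    next
      fix k x assume k: "k \<in> carrier K" "x \<in> g ` carrier ?V"
      then obtain c where c: "c \<in> carrier ?V" "x = g c" by blast
      show "k \<odot>\<^bsub>M\<^esub> x \<in> g ` carrier ?V"
        using gD(4)[OF k(1) c(1)] c k V.smult_closed by (metis image_eqI)
    qed
    show "\<forall>m\<in>g ` carrier ?V. \<forall>a\<in>carrier A. ract M m a \<in> g ` carrier ?V"
    proof (intro ballI)
      fix m a assume m: "m \<in> g ` carrier ?V" and a: "a \<in> carrier A"
      then obtain c where c: "c \<in> carrier ?V" "m = g c" by blast
      define c' where "c' = (\<lambda>s\<in>S. c s \<otimes>\<^bsub>A\<^esub> a)"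
      have c': "c' \<in> carrier ?V" using c a cc by (auto simp: c'_def prod_module_def)
      have "ract M m a = (\<Oplus>\<^bsub>M\<^esub>s\<in>S. ract M (ract M s (c s)) a)"
        using c tc a MD(2,3) by (simp add: g_def, intro finsum_additive[where h = "\<lambda>x. ract M x a", OF M.M.abelian_group_axioms M.M.abelian_group_axioms])
          auto
      also have "\<dots> = (\<Oplus>\<^bsub>M\<^esub>s\<in>S. ract M s (c' s))"
        using c a cc Sc tc[OF c'] MD(6) by (intro M.finsum_cong') (auto simp: c'_def)
      also have "\<dots> = g c'" using c' by (simp add: g_def)
      finally show "ract M m a \<in> g ` carrier ?V" using c' by blast
    qed
  qed
  have "S \<subseteq> g ` carrier ?V"
  proof
    fix s assume s: "s \<in> S"
    define c where "c = (\<lambda>s'\<in>S. if s' = s then \<one>\<^bsub>A\<^esub> else \<zero>\<^bsub>A\<^esub>)"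
    have c: "c \<in> carrier ?V" by (auto simp: c_def prod_module_def)
    have z: "ract M s' \<zero>\<^bsub>A\<^esub> = \<zero>\<^bsub>M\<^esub>" if "s' \<in> S" for s'
      using MD(8)[of "\<zero>" s' "\<zero>\<^bsub>A\<^esub>"] Sc[OF that] MD(2) A.smult_l_null by simp
    have "g c = (\<Oplus>\<^bsub>M\<^esub>s'\<in>S. ract M s' (c s'))" using c by (simp add: g_def)
    also have "\<dots> = ract M s (c s)"
      using s S Sc z MD(2) by (intro M.M.finsum_single) (auto simp: c_def)
    also have "\<dots> = s" using s Sc MD(5) by (simp add: c_def)
    finally show "s \<in> g ` carrier ?V" using c by (metis image_eqI)
  qed
  from gen[OF sub this] have "fin_dim K M"
    by (intro fin_dim_surj[OF V MD(1) g]) simp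
  then show ?thesis using rm by (simp add: fdmod_def)
qed

end

section \<open>Subquotients of vector spaces\<close>

text \<open>
  The image of \<open>Z\<close> in \<open>F/B\<close>, which is \<open>Z/B\<close> when \<open>B \<subseteq> Z\<close>; for cocycles and coboundaries this is \<open>Ext\<close>.
\<close>

definition quot_space :: "('k, 'f, 'y) module_scheme => 'f set => 'f set => ('k, 'f set) module"
  where "quot_space F Z B = \<lparr>carrier = (\<lambda>f. B +>\<^bsub>F\<^esub> f) ` Z, mult = undefined, one = undefined,
     zero = B, add = set_add F, smult = (\<lambda>c. coset_map F B (\<lambda>f. c \<odot>\<^bsub>F\<^esub> f))\<rparr>"

definition subspace :: "('k, 'z) ring_scheme => ('k, 'f, 'y) module_scheme => 'f set => bool"
  where "subspace K F B \<longleftrightarrow> B \<subseteq> carrier F \<and> \<zero>\<^bsub>F\<^esub> \<in> B \<and> (\<forall>x\<in>B. \<forall>y\<in>B. x \<oplus>\<^bsub>F\<^esub> y \<in> B) \<and>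
    (\<forall>c\<in>carrier K. \<forall>x\<in>B. c \<odot>\<^bsub>F\<^esub> x \<in> B)"

lemma subspaceD:
  assumes "subspace K F B"
  shows "B \<subseteq> carrier F" "x \<in> B ==> x \<in> carrier F" "\<zero>\<^bsub>F\<^esub> \<in> B" "x \<in> B ==> y \<in> B ==> x \<oplus>\<^bsub>F\<^esub> y \<in> B"
    "c \<in> carrier K ==> x \<in> B ==> c \<odot>\<^bsub>F\<^esub> x \<in> B"
  using assms unfolding subspace_def by auto

lemma subspace_uminus:
  assumes F: "module K F" and B: "subspace K F B" and x: "x \<in> B"
  shows "\<ominus>\<^bsub>F\<^esub> x \<in> B"
proof -
  interpret F: module K F by (rule F)
  have "(\<ominus>\<^bsub>K\<^esub> \<one>\<^bsub>K\<^esub>) \<odot>\<^bsub>F\<^esub> x \<in> B" using x by (intro subspaceD(5)[OF B]) auto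
  then show ?thesis using x subspaceD(2)[OF B x] by (simp add: F.smult_l_minus)
qed

lemma subspace_abelian_subgroup:
  assumes F: "module K F" and B: "subspace K F B"
  shows "abelian_subgroup B F"
proof -
  interpret F: module K F by (rule F)
  show ?thesis
  proof (rule abelian_subgroupI3)
    show "additive_subgroup B F"
      by (rule additive_subgroup.intro, rule F.M.add.subgroupI)
        (use subspaceD[OF B] subspace_uminus[OF F B] in \<open>auto simp: a_inv_def\<close>)
  qed (rule F.M.abelian_group_axioms)
qed

context
  fixes K :: "('k, 'z) ring_scheme" and F :: "('k, 'f, 'y) module_scheme" and B :: "'f set"
  assumes F: "module K F" and B: "subspace K F B"
begin

lemma coset_eqI:
  assumes "f \<in> carrier F" "g \<in> carrier F" "b \<in> B" "f = b \<oplus>\<^bsub>F\<^esub> g"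
  shows "B +>\<^bsub>F\<^esub> f = B +>\<^bsub>F\<^esub> g"
proof -
  interpret S: abelian_subgroup B F by (rule subspace_abelian_subgroup[OF F B])
  have "f \<in> B +>\<^bsub>F\<^esub> g" using assms by (auto simp: a_r_coset_def')
  then show ?thesis using S.a_repr_independence[OF _ assms(2) S.a_subgroup] by simp
qed

lemma coset_zero: "B +>\<^bsub>F\<^esub> \<zero>\<^bsub>F\<^esub> = B"
proof -
  interpret F: module K F by (rule F)
  show ?thesis using subspaceD(2)[OF B] by (force simp: a_r_coset_def')
qed

lemma coset_eqD:
  assumes "f \<in> carrier F" "B +>\<^bsub>F\<^esub> f = B"
  shows "f \<in> B"
proof -
  interpret F: module K F by (rule F)
  have "\<zero>\<^bsub>F\<^esub> \<oplus>\<^bsub>F\<^esub> f \<in> B +>\<^bsub>F\<^esub> f" using subspaceD(3)[OF B] unfolding a_r_coset_def' by blast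
  then show ?thesis using assms by simp
qed

lemma coset_map_coset:
  assumes F': "module K F'" and B': "subspace K F' B'"
    and g: "\<And>x. x \<in> carrier F ==> g x \<in> carrier F'"
    "\<And>x y. x \<in> carrier F ==> y \<in> carrier F ==> g (x \<oplus>\<^bsub>F\<^esub> y) = g x \<oplus>\<^bsub>F'\<^esub> g y"
    "\<And>x. x \<in> B ==> g x \<in> B'"
    and f: "f \<in> carrier F"
  shows "coset_map F' B' g (B +>\<^bsub>F\<^esub> f) = B' +>\<^bsub>F'\<^esub> g f"
proof -
  interpret F: module K F by (rule F)
  interpret F': module K F' by (rule F')
  interpret S': abelian_subgroup B' F' by (rule subspace_abelian_subgroup[OF F' B'])
  have eq: "B' +>\<^bsub>F'\<^esub> g s = B' +>\<^bsub>F'\<^esub> g f" if s: "s \<in> B +>\<^bsub>F\<^esub> f" for s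
  proof -
    obtain b where b: "b \<in> B" "s = b \<oplus>\<^bsub>F\<^esub> f" using s by (auto simp: a_r_coset_def')
    have "g s = g b \<oplus>\<^bsub>F'\<^esub> g f" using b f subspaceD(2)[OF B] g by simp
    then have "g s \<in> B' +>\<^bsub>F'\<^esub> g f" using g(3)[OF b(1)] by (auto simp: a_r_coset_def')
    then show ?thesis using F'.M.a_repr_independence[OF _ g(1)[OF f] S'.a_subgroup] by simp
  qed
  have "\<zero>\<^bsub>F\<^esub> \<oplus>\<^bsub>F\<^esub> f \<in> B +>\<^bsub>F\<^esub> f" using subspaceD(3)[OF B] unfolding a_r_coset_def' by blast
  then have ne: "B +>\<^bsub>F\<^esub> f \<noteq> {}" by blast
  have "coset_map F' B' g (B +>\<^bsub>F\<^esub> f) = (\<Union>s\<in>B +>\<^bsub>F\<^esub> f. B' +>\<^bsub>F'\<^esub> g f)"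
    unfolding coset_map_def using eq by (intro SUP_cong) simp_all
  then show ?thesis using ne by simp
qed

lemma coset_add:
  assumes "f \<in> carrier F" "g \<in> carrier F"
  shows "(B +>\<^bsub>F\<^esub> f) <+>\<^bsub>F\<^esub> (B +>\<^bsub>F\<^esub> g) = B +>\<^bsub>F\<^esub> (f \<oplus>\<^bsub>F\<^esub> g)"
  using abelian_subgroup.a_rcos_sum[OF subspace_abelian_subgroup[OF F B] assms] .

lemma coset_smult:
  assumes "c \<in> carrier K" "f \<in> carrier F"
  shows "coset_map F B (\<lambda>f. c \<odot>\<^bsub>F\<^esub> f) (B +>\<^bsub>F\<^esub> f) = B +>\<^bsub>F\<^esub> (c \<odot>\<^bsub>F\<^esub> f)"
proof -
  interpret F: module K F by (rule F)
  show ?thesis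
    by (rule coset_map_coset[OF F B]) (use assms subspaceD(5)[OF B] in \<open>auto simp: F.smult_r_distr\<close>)
qed

lemma quot_space_sel:
  "carrier (quot_space F Z B) = (\<lambda>f. B +>\<^bsub>F\<^esub> f) ` Z" "\<zero>\<^bsub>quot_space F Z B\<^esub> = B"
  "f \<in> carrier F ==> g \<in> carrier F ==>
    (B +>\<^bsub>F\<^esub> f) \<oplus>\<^bsub>quot_space F Z B\<^esub> (B +>\<^bsub>F\<^esub> g) = B +>\<^bsub>F\<^esub> (f \<oplus>\<^bsub>F\<^esub> g)"
  "c \<in> carrier K ==> f \<in> carrier F ==>
    c \<odot>\<^bsub>quot_space F Z B\<^esub> (B +>\<^bsub>F\<^esub> f) = B +>\<^bsub>F\<^esub> (c \<odot>\<^bsub>F\<^esub> f)"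
  by (simp_all add: quot_space_def coset_add coset_smult)

lemma quot_space_module:
  assumes Z: "subspace K F Z"
  shows "module K (quot_space F Z B)"
    "(\<lambda>f\<in>Z. B +>\<^bsub>F\<^esub> f) \<in> linear_maps K (F\<lparr>carrier := Z\<rparr>) (quot_space F Z B)"
    "module K (F\<lparr>carrier := Z\<rparr>)"
proof -
  interpret F: module K F by (rule F)
  let ?Q = "quot_space F Z B" and ?c = "\<lambda>f. B +>\<^bsub>F\<^esub> f"
  note ZD = subspaceD(2)[OF Z]
  have c0: "?c \<zero>\<^bsub>F\<^esub> = \<zero>\<^bsub>?Q\<^esub>" by (simp add: coset_zero quot_space_sel)
  have car: "S \<in> carrier ?Q \<longleftrightarrow> (\<exists>f\<in>Z. S = ?c f)" for S
    by (auto simp: quot_space_sel)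
  have cl: "?c f \<in> carrier ?Q" if "f \<in> Z" for f using that by (auto simp: quot_space_sel)
  note S = quot_space_sel(3,4)
  note Zc = subspaceD(3,4,5)[OF Z]
  show "module K ?Q"
  proof (rule moduleI)
    show "cring K" by (rule F.R.is_cring)
    show "abelian_group ?Q"
    proof (rule abelian_groupI)
      show "\<zero>\<^bsub>?Q\<^esub> \<in> carrier ?Q" using cl[OF Zc(1)] c0 by simp
      fix x assume "x \<in> carrier ?Q"
      then obtain f where f: "f \<in> Z" "x = ?c f" by (auto simp: car)
      have "?c \<zero>\<^bsub>F\<^esub> \<oplus>\<^bsub>?Q\<^esub> x = x" using f by (simp add: S ZD)
      then show "\<zero>\<^bsub>?Q\<^esub> \<oplus>\<^bsub>?Q\<^esub> x = x" by (simp add: c0)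
      have n: "(\<ominus>\<^bsub>K\<^esub> \<one>\<^bsub>K\<^esub>) \<odot>\<^bsub>F\<^esub> f \<in> Z" using f Zc(3) by simp
      have "?c ((\<ominus>\<^bsub>K\<^esub> \<one>\<^bsub>K\<^esub>) \<odot>\<^bsub>F\<^esub> f) \<oplus>\<^bsub>?Q\<^esub> x = ?c \<zero>\<^bsub>F\<^esub>"
        using f ZD by (simp add: S F.smult_l_minus F.M.l_neg)
      then show "\<exists>y\<in>carrier ?Q. y \<oplus>\<^bsub>?Q\<^esub> x = \<zero>\<^bsub>?Q\<^esub>" using cl[OF n] unfolding c0 by blast
    next
      fix x y z assume "x \<in> carrier ?Q" "y \<in> carrier ?Q" "z \<in> carrier ?Q"
      then obtain f g h where "f \<in> Z" "x = ?c f" "g \<in> Z" "y = ?c g" "h \<in> Z" "z = ?c h"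
        unfolding car by blast
      then show "x \<oplus>\<^bsub>?Q\<^esub> y \<oplus>\<^bsub>?Q\<^esub> z = x \<oplus>\<^bsub>?Q\<^esub> (y \<oplus>\<^bsub>?Q\<^esub> z)"
        by (simp add: S ZD F.M.a_assoc)
    next
      fix x y assume "x \<in> carrier ?Q" "y \<in> carrier ?Q"
      then obtain f g where fg: "f \<in> Z" "x = ?c f" "g \<in> Z" "y = ?c g" unfolding car by blast
      then show "x \<oplus>\<^bsub>?Q\<^esub> y = y \<oplus>\<^bsub>?Q\<^esub> x" by (simp add: S ZD F.M.a_comm)
      show "x \<oplus>\<^bsub>?Q\<^esub> y \<in> carrier ?Q" using fg Zc(2) by (auto simp: S ZD intro!: cl)
    qed
  next
    fix c x assume c: "c \<in> carrier K" and "x \<in> carrier ?Q"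
    then obtain f where f: "f \<in> Z" "x = ?c f" unfolding car by blast
    then show "c \<odot>\<^bsub>?Q\<^esub> x \<in> carrier ?Q" using c Zc(3) by (auto simp: S ZD intro!: cl)
  next
    fix a b x assume "a \<in> carrier K" "b \<in> carrier K" "x \<in> carrier ?Q"
    then obtain f where "f \<in> Z" "x = ?c f" "a \<in> carrier K" "b \<in> carrier K" unfolding car by blast
    then show "(a \<oplus>\<^bsub>K\<^esub> b) \<odot>\<^bsub>?Q\<^esub> x = a \<odot>\<^bsub>?Q\<^esub> x \<oplus>\<^bsub>?Q\<^esub> b \<odot>\<^bsub>?Q\<^esub> x"
      "(a \<otimes>\<^bsub>K\<^esub> b) \<odot>\<^bsub>?Q\<^esub> x = a \<odot>\<^bsub>?Q\<^esub> (b \<odot>\<^bsub>?Q\<^esub> x)"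
      by (simp_all add: S ZD F.smult_l_distr F.smult_assoc1)
  next
    fix a x y assume "a \<in> carrier K" "x \<in> carrier ?Q" "y \<in> carrier ?Q"
    then obtain f g where "f \<in> Z" "x = ?c f" "g \<in> Z" "y = ?c g" "a \<in> carrier K" unfolding car by blast
    then show "a \<odot>\<^bsub>?Q\<^esub> (x \<oplus>\<^bsub>?Q\<^esub> y) = a \<odot>\<^bsub>?Q\<^esub> x \<oplus>\<^bsub>?Q\<^esub> a \<odot>\<^bsub>?Q\<^esub> y"
      by (simp add: S ZD F.smult_r_distr)
  next
    fix x assume "x \<in> carrier ?Q"
    then show "\<one>\<^bsub>K\<^esub> \<odot>\<^bsub>?Q\<^esub> x = x" unfolding car by (auto simp: S ZD)
  qed
  show "(\<lambda>f\<in>Z. B +>\<^bsub>F\<^esub> f) \<in> linear_maps K (F\<lparr>carrier := Z\<rparr>) ?Q"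
    by (rule linear_mapsI) (auto simp: S ZD Zc cl)
  show "module K (F\<lparr>carrier := Z\<rparr>)"
    using Zc subspaceD(1)[OF Z] by (intro module_subset F) auto
qed

end

section \<open>Cochains and the functor \<open>Ext\<^sup>d\<^sub>A(DA, -)\<close>\<close>

text \<open>
  Cosets of coboundaries only involve pointwise addition, so \<open>Ext\<close> may be computed inside the space
  of all functions on the domain of the bar construction.
\<close>

definition fun_space :: "('k, 'a, 'y) module_scheme => ('k, 'a, 'm) rmod => ('k, 'a, 'x) rmod =>
    nat => ('k, 'm \<times> 'a list => 'x) module"
  where "fun_space A M X n = prod_module (bar_dom A M n) (\<lambda>_. X)"

lemma fun_space_sel:
  "carrier (fun_space A M X n) = bar_dom A M n \<rightarrow>\<^sub>E carrier X"
  "\<zero>\<^bsub>fun_space A M X n\<^esub> = (\<lambda>z\<in>bar_dom A M n. \<zero>\<^bsub>X\<^esub>)"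
  "f \<oplus>\<^bsub>fun_space A M X n\<^esub> g = (\<lambda>z\<in>bar_dom A M n. f z \<oplus>\<^bsub>X\<^esub> g z)"
  "c \<odot>\<^bsub>fun_space A M X n\<^esub> f = (\<lambda>z\<in>bar_dom A M n. c \<odot>\<^bsub>X\<^esub> f z)"
  by (simp_all add: fun_space_def prod_module_def)

lemma a_r_coset_cochains: "a_r_coset (cochains K A M X n) = a_r_coset (fun_space A M X n)"
  by (intro ext) (simp add: a_r_coset_def r_coset_def cochains_def fun_space_def prod_module_def)

lemma set_add_cochains: "set_add (cochains K A M X n) = set_add (fun_space A M X n)"
  by (intro ext) (simp add: set_add_def set_mult_def cochains_def fun_space_def prod_module_def)

lemma coset_map_cochains: "coset_map (cochains K A M X n) = coset_map (fun_space A M X n)"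
  by (intro ext) (simp add: coset_map_def a_r_coset_cochains)

lemma Ext_quot_space:
  "Ext K A n M X = quot_space (fun_space A M X n) (cocycles K A M X n) (coboundaries K A M X n)"
proof -
  have "smult (cochains K A M X n) = smult (fun_space A M X n)"
    by (simp add: cochains_def fun_space_def prod_module_def)
  then show ?thesis
    by (simp add: Ext_def quot_space_def a_r_coset_cochains set_add_cochains coset_map_cochains Let_def)
qed

lemma bar_domI: "m \<in> carrier M ==> set as \<subseteq> carrier A ==> length as = n ==> (m, as) \<in> bar_dom A M n"
  by (auto simp: bar_dom_def)

lemma bar_domD:
  assumes "(m, as) \<in> bar_dom A M n"
  shows "m \<in> carrier M" "set as \<subseteq> carrier A" "length as = n" "i < n ==> as ! i \<in> carrier A"
  using assms by (auto simp: bar_dom_def)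

lemma bar_dom_faces:
  assumes "(m, as) \<in> bar_dom A M (Suc n)" and "monoid A"
    and M: "right_module K A M"
  shows "(ract M m (hd as), tl as) \<in> bar_dom A M n"
    "i < n ==> (m, take i as @ (as ! i \<otimes>\<^bsub>A\<^esub> as ! Suc i) # drop (i + 2) as) \<in> bar_dom A M n"
    "(m, butlast as) \<in> bar_dom A M n" "last as \<in> carrier A"
proof -
  interpret A: monoid A by fact
  note act = right_moduleD(2)[OF M]
  note D = bar_domD[OF assms(1)]
  have ne: "as \<noteq> []" using D(3) by auto
  have hd: "hd as \<in> carrier A" using ne D(2) by (meson list.set_sel(1) subsetD)
  show "(ract M m (hd as), tl as) \<in> bar_dom A M n"
    using ne D act hd by (auto intro!: bar_domI dest: list.set_sel(2))
  show "(m, butlast as) \<in> bar_dom A M n" "last as \<in> carrier A"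
    using ne D by (auto intro!: bar_domI dest: in_set_butlastD)
  show "i < n ==> (m, take i as @ (as ! i \<otimes>\<^bsub>A\<^esub> as ! Suc i) # drop (i + 2) as) \<in> bar_dom A M n"
  proof (rule bar_domI)
    assume i: "i < n"
    show "set (take i as @ (as ! i \<otimes>\<^bsub>A\<^esub> as ! Suc i) # drop (i + 2) as) \<subseteq> carrier A"
      using D i set_take_subset[of i as] set_drop_subset[of "i + 2" as] by (auto intro!: D(4))
  qed (use D in auto)
qed

lemma signed_additive:
  assumes "abelian_group X" "abelian_group Y"
    and h: "\<And>x. x \<in> carrier X ==> h x \<in> carrier Y"
    "\<And>x y. x \<in> carrier X ==> y \<in> carrier X ==> h (x \<oplus>\<^bsub>X\<^esub> y) = h x \<oplus>\<^bsub>Y\<^esub> h y"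
    and x: "x \<in> carrier X"
  shows "h (signed X i x) = signed Y i (h x)"
proof -
  interpret X: abelian_group X by fact
  interpret Y: abelian_group Y by fact
  have "h \<zero>\<^bsub>X\<^esub> \<oplus>\<^bsub>Y\<^esub> h \<zero>\<^bsub>X\<^esub> = h \<zero>\<^bsub>X\<^esub>" using h(2)[of "\<zero>\<^bsub>X\<^esub>" "\<zero>\<^bsub>X\<^esub>"] by simp
  then have z: "h \<zero>\<^bsub>X\<^esub> = \<zero>\<^bsub>Y\<^esub>" using h by (metis X.zero_closed Y.add.l_cancel_one')
  have "h (\<ominus>\<^bsub>X\<^esub> x) \<oplus>\<^bsub>Y\<^esub> h x = \<zero>\<^bsub>Y\<^esub>" using h(2)[of "\<ominus>\<^bsub>X\<^esub> x" x] x z by (simp add: X.l_neg)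
  then have "h (\<ominus>\<^bsub>X\<^esub> x) = \<ominus>\<^bsub>Y\<^esub> h x" using x h(1) by (metis X.a_inv_closed Y.minus_equality)
  then show ?thesis by (simp add: signed_def)
qed

lemma signed_closed: "abelian_group X ==> x \<in> carrier X ==> signed X i x \<in> carrier X"
  by (simp add: signed_def abelian_group.a_inv_closed)

lemma signed_add:
  assumes "abelian_group X" "x \<in> carrier X" "y \<in> carrier X"
  shows "signed X i (x \<oplus>\<^bsub>X\<^esub> y) = signed X i x \<oplus>\<^bsub>X\<^esub> signed X i y"
  using assms by (simp add: signed_def abelian_group.minus_add)

context fd_alg
begin

lemma A_monoid: "monoid A"
  using A_ring by (simp add: ring_def)

lemma coboundary_closed:
  assumes "right_module K A M" "right_module K A X"
    and f: "f \<in> bar_dom A M n \<rightarrow> carrier X" and z: "z \<in> bar_dom A M (Suc n)"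
  shows "coboundary A M X n f z \<in> carrier X"
proof -
  obtain m as where mas: "z = (m, as)" by fastforce
  note fc = bar_dom_faces[OF z[unfolded mas] A_monoid assms(1)]
  note XD = right_moduleD[OF assms(2)]
  interpret X: module K X by (rule XD)
  have ab: "abelian_group X" by (rule X.M.abelian_group_axioms)
  show ?thesis
    using z fc f XD(2) unfolding mas coboundary_def
    by (auto intro!: X.M.a_closed X.M.finsum_closed signed_closed[OF ab])
qed

text \<open>
  The coboundary is natural: in the coefficients for additive maps that respect the action, and in
  the first argument for maps that respect the action.
\<close>

lemma coboundary_push:
  assumes "right_module K A M" "right_module K A X" "right_module K A Y"
    and h: "\<And>x. x \<in> carrier X ==> h x \<in> carrier Y"
    "\<And>x y. x \<in> carrier X ==> y \<in> carrier X ==> h (x \<oplus>\<^bsub>X\<^esub> y) = h x \<oplus>\<^bsub>Y\<^esub> h y"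
    "\<And>x a. x \<in> carrier X ==> a \<in> carrier A ==> h (ract X x a) = ract Y (h x) a"
    and f: "f \<in> bar_dom A M n \<rightarrow> carrier X" and z: "z \<in> bar_dom A M (Suc n)"
    and g: "\<And>y. y \<in> bar_dom A M n ==> g y = h (f y)"
  shows "coboundary A M Y n g z = h (coboundary A M X n f z)"
proof -
  obtain m as where mas: "z = (m, as)" by fastforce
  note fc = bar_dom_faces[OF z[unfolded mas] A_monoid assms(1)]
  note XD = right_moduleD[OF assms(2)]
  interpret X: module K X by (rule XD)
  interpret Y: module K Y by (rule right_moduleD[OF assms(3)])
  have ab: "abelian_group X" "abelian_group Y" by (rule X.M.abelian_group_axioms Y.M.abelian_group_axioms)+
  note sc = signed_closed[OF ab(1)]
  have sg: "h (signed X i x) = signed Y i (h x)" if "x \<in> carrier X" for i x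
    by (rule signed_additive[OF ab]) (use h that in auto)
  define s where "s i = signed X (Suc i) (f (m, take i as @ (as ! i \<otimes>\<^bsub>A\<^esub> as ! Suc i) # drop (i + 2) as))" for i
  have sC: "s i \<in> carrier X" if "i < n" for i
    using fc(2)[OF that] f by (auto simp: s_def intro!: sc)
  have fin: "h (\<Oplus>\<^bsub>X\<^esub>i\<in>{..<n}. s i) =
    (\<Oplus>\<^bsub>Y\<^esub>i\<in>{..<n}. signed Y (Suc i) (g (m, take i as @ (as ! i \<otimes>\<^bsub>A\<^esub> as ! Suc i) # drop (i + 2) as)))"
  proof -
    have "h (\<Oplus>\<^bsub>X\<^esub>i\<in>{..<n}. s i) = (\<Oplus>\<^bsub>Y\<^esub>i\<in>{..<n}. h (s i))"
      by (rule finsum_additive[OF ab h(1,2)]) (use sC in auto)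
    also have "\<dots> = (\<Oplus>\<^bsub>Y\<^esub>i\<in>{..<n}. signed Y (Suc i) (g (m, take i as @ (as ! i \<otimes>\<^bsub>A\<^esub> as ! Suc i) # drop (i + 2) as)))"
    proof (rule Y.M.finsum_cong')
      fix i assume "i \<in> {..<n}"
      then have i: "i < n" by simp
      show "h (s i) = signed Y (Suc i) (g (m, take i as @ (as ! i \<otimes>\<^bsub>A\<^esub> as ! Suc i) # drop (i + 2) as))"
        unfolding s_def g[OF fc(2)[OF i]] using fc(2)[OF i] f by (intro sg) auto
    next
      show "(\<lambda>i. signed Y (Suc i) (g (m, take i as @ (as ! i \<otimes>\<^bsub>A\<^esub> as ! Suc i) # drop (i + 2) as))) \<in> {..<n} \<rightarrow> carrier Y"
      proof
        fix i assume "i \<in> {..<n}"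
        then have i: "i < n" by simp
        show "signed Y (Suc i) (g (m, take i as @ (as ! i \<otimes>\<^bsub>A\<^esub> as ! Suc i) # drop (i + 2) as)) \<in> carrier Y"
          unfolding g[OF fc(2)[OF i]] using fc(2)[OF i] f h(1) by (intro signed_closed ab) auto
      qed
    qed simp
    finally show ?thesis .
  qed
  have S: "(\<Oplus>\<^bsub>X\<^esub>i\<in>{..<n}. s i) \<in> carrier X" using sC by (intro X.M.finsum_closed) auto
  have f0: "f (ract M m (hd as), tl as) \<in> carrier X" using fc f by auto
  have f1: "ract X (f (m, butlast as)) (last as) \<in> carrier X" "f (m, butlast as) \<in> carrier X"
    using fc f XD(2) by auto
  have "coboundary A M X n f z = f (ract M m (hd as), tl as) \<oplus>\<^bsub>X\<^esub> (\<Oplus>\<^bsub>X\<^esub>i\<in>{..<n}. s i)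
    \<oplus>\<^bsub>X\<^esub> signed X (Suc n) (ract X (f (m, butlast as)) (last as))"
    using z unfolding mas coboundary_def s_def by simp
  then have "h (coboundary A M X n f z) = h (f (ract M m (hd as), tl as)) \<oplus>\<^bsub>Y\<^esub> h (\<Oplus>\<^bsub>X\<^esub>i\<in>{..<n}. s i)
    \<oplus>\<^bsub>Y\<^esub> signed Y (Suc n) (ract Y (h (f (m, butlast as))) (last as))"
    using S f0 f1 sc by (simp add: h(2) sg[OF f1(1)] h(3)[OF f1(2) fc(4)])
  then show ?thesis
    using z g[OF fc(1)] g[OF fc(3)] unfolding mas coboundary_def fin by simp
qed

lemma coboundary_add:
  fixes M :: "('k, 'a, 'm) rmod" and X :: "('k, 'a, 'x) rmod"
  assumes "right_module K A M" "right_module K A X"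
    and f: "f \<in> bar_dom A M n \<rightarrow> carrier X" "g \<in> bar_dom A M n \<rightarrow> carrier X"
    and z: "z \<in> bar_dom A M (Suc n)"
  shows "coboundary A M X n (\<lambda>z\<in>bar_dom A M n. f z \<oplus>\<^bsub>X\<^esub> g z) z =
    coboundary A M X n f z \<oplus>\<^bsub>X\<^esub> coboundary A M X n g z"
proof -
  obtain m as where mas: "z = (m, as)" by fastforce
  note fc = bar_dom_faces[OF z[unfolded mas] A_monoid assms(1)]
  note XD = right_moduleD[OF assms(2)]
  interpret X: module K X by (rule XD)
  have ab: "abelian_group X" by (rule X.M.abelian_group_axioms)
  define s where "s f i = signed X (Suc i) (f (m, take i as @ (as ! i \<otimes>\<^bsub>A\<^esub> as ! Suc i) # drop (i + 2) as))"
    for f :: "'m \<times> 'a list => 'x" and i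
  let ?h = "\<lambda>z\<in>bar_dom A M n. f z \<oplus>\<^bsub>X\<^esub> g z"
  have sC: "s f \<in> {..<n} \<rightarrow> carrier X" if "f \<in> bar_dom A M n \<rightarrow> carrier X" for f
    using fc(2) that by (auto simp: s_def intro!: signed_closed[OF ab])
  have "(\<Oplus>\<^bsub>X\<^esub>i\<in>{..<n}. s ?h i) = (\<Oplus>\<^bsub>X\<^esub>i\<in>{..<n}. s f i \<oplus>\<^bsub>X\<^esub> s g i)"
  proof (rule X.M.finsum_cong')
    show "(\<lambda>i. s f i \<oplus>\<^bsub>X\<^esub> s g i) \<in> {..<n} \<rightarrow> carrier X"
      using sC[OF f(1)] sC[OF f(2)] by auto
    fix i assume "i \<in> {..<n}"
    then show "s ?h i = s f i \<oplus>\<^bsub>X\<^esub> s g i"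
      using fc(2)[of i] f by (auto simp: s_def intro!: signed_add[OF ab])
  qed simp
  then have sum: "(\<Oplus>\<^bsub>X\<^esub>i\<in>{..<n}. s ?h i) = (\<Oplus>\<^bsub>X\<^esub>i\<in>{..<n}. s f i) \<oplus>\<^bsub>X\<^esub> (\<Oplus>\<^bsub>X\<^esub>i\<in>{..<n}. s g i)"
    using sC[OF f(1)] sC[OF f(2)] by (simp add: X.M.finsum_addf)
  have S: "(\<Oplus>\<^bsub>X\<^esub>i\<in>{..<n}. s f i) \<in> carrier X" "(\<Oplus>\<^bsub>X\<^esub>i\<in>{..<n}. s g i) \<in> carrier X"
    using sC[OF f(1)] sC[OF f(2)] by (auto intro!: X.M.finsum_closed)
  have cb: "coboundary A M X n f z = f (ract M m (hd as), tl as) \<oplus>\<^bsub>X\<^esub> (\<Oplus>\<^bsub>X\<^esub>i\<in>{..<n}. s f i)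
    \<oplus>\<^bsub>X\<^esub> signed X (Suc n) (ract X (f (m, butlast as)) (last as))" for f
    using z unfolding mas coboundary_def s_def by simp
  have c: "f (ract M m (hd as), tl as) \<in> carrier X" "g (ract M m (hd as), tl as) \<in> carrier X"
    "f (m, butlast as) \<in> carrier X" "g (m, butlast as) \<in> carrier X"
    using fc f by auto
  have sc: "signed X (Suc n) (ract X (f (m, butlast as)) (last as)) \<in> carrier X"
    "signed X (Suc n) (ract X (g (m, butlast as)) (last as)) \<in> carrier X"
    using c fc(4) XD(2) by (auto intro!: signed_closed[OF ab])
  show ?thesis
    unfolding cb sum using fc S c sc XD(2,3)
    by (simp add: signed_add[OF ab] X.M.a_ac)
qed

text \<open>
  Precomposition in the module argument. For left multiplications on \<open>DA\<close> it induces the right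
  action on \<open>Ext\<^sup>d\<^sub>A(DA, X)\<close>.
\<close>

definition pull :: "('k, 'a, 'm) rmod => nat => ('m => 'm) => ('m \<times> 'a list => 'x) => 'm \<times> 'a list => 'x"
  where "pull M n u f = (\<lambda>(m, as)\<in>bar_dom A M n. f (u m, as))"

lemma pull_apply: "(m, as) \<in> bar_dom A M n ==> pull M n u f (m, as) = f (u m, as)"
  by (simp add: pull_def)

lemma coboundary_pull:
  assumes "right_module K A M"
    and u: "\<And>m. m \<in> carrier M ==> u m \<in> carrier M"
    "\<And>m a. m \<in> carrier M ==> a \<in> carrier A ==> u (ract M m a) = ract M (u m) a"
    and X: "right_module K A X" and f: "f \<in> bar_dom A M n \<rightarrow> carrier X"
  shows "coboundary A M X n (pull M n u f) = pull M (Suc n) u (coboundary A M X n f)"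
proof
  fix z
  show "coboundary A M X n (pull M n u f) z = pull M (Suc n) u (coboundary A M X n f) z"
  proof (cases "z \<in> bar_dom A M (Suc n)")
    case False
    then show ?thesis unfolding pull_def coboundary_def by (simp only: restrict_def if_False)
  next
    case True
    obtain m as where mas: "z = (m, as)" by fastforce
    note z = True[unfolded mas]
    interpret X: module K X by (rule right_moduleD[OF X])
    have ab: "abelian_group X" by (rule X.M.abelian_group_axioms)
    note fc = bar_dom_faces[OF z A_monoid assms(1)]
    have uz: "(u m, as) \<in> bar_dom A M (Suc n)" using z u by (auto simp: bar_dom_def)
    note fu = bar_dom_faces[OF uz A_monoid assms(1)]
    have hd: "hd as \<in> carrier A" using bar_domD(2,3)[OF z] by (cases as) auto
    have "(\<Oplus>\<^bsub>X\<^esub>i\<in>{..<n}. signed X (Suc i) (pull M n u f (m, take i as @ (as ! i \<otimes>\<^bsub>A\<^esub> as ! Suc i) # drop (i + 2) as)))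
      = (\<Oplus>\<^bsub>X\<^esub>i\<in>{..<n}. signed X (Suc i) (f (u m, take i as @ (as ! i \<otimes>\<^bsub>A\<^esub> as ! Suc i) # drop (i + 2) as)))"
    proof (rule X.M.finsum_cong')
      fix i assume "i \<in> {..<n}"
      then show "signed X (Suc i) (pull M n u f (m, take i as @ (as ! i \<otimes>\<^bsub>A\<^esub> as ! Suc i) # drop (i + 2) as)) =
        signed X (Suc i) (f (u m, take i as @ (as ! i \<otimes>\<^bsub>A\<^esub> as ! Suc i) # drop (i + 2) as))"
        using fc(2)[of i] by (simp add: pull_apply)
    next
      show "(\<lambda>i. signed X (Suc i) (f (u m, take i as @ (as ! i \<otimes>\<^bsub>A\<^esub> as ! Suc i) # drop (i + 2) as))) \<in> {..<n} \<rightarrow> carrier X"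
        using fu(2) f by (auto intro!: signed_closed[OF ab])
    qed simp
    then show ?thesis
      using z fc uz unfolding mas pull_apply[OF z] unfolding coboundary_def
      by (simp add: pull_apply u(2)[OF bar_domD(1)[OF z] hd])
  qed
qed

lemma cochainsI:
  assumes "\<And>m as. (m, as) \<in> bar_dom A M n ==> f (m, as) \<in> carrier X" "f \<in> extensional (bar_dom A M n)"
    "\<And>m as. (m, as) \<in> bar_dom A M n ==> (\<lambda>m'\<in>carrier M. f (m', as)) \<in> linear_maps K M X"
    "\<And>m as i. (m, as) \<in> bar_dom A M n ==> i < n ==> (\<lambda>a\<in>carrier A. f (m, as[i := a])) \<in> linear_maps K A X"
  shows "f \<in> carrier (cochains K A M X n)"
  using assms by (auto simp: cochains_def PiE_def)

lemma cochainsD: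
  assumes "f \<in> carrier (cochains K A M X n)"
  shows "f \<in> bar_dom A M n \<rightarrow>\<^sub>E carrier X" "f \<in> bar_dom A M n \<rightarrow> carrier X" "f \<in> extensional (bar_dom A M n)"
    "z \<in> bar_dom A M n ==> f z \<in> carrier X"
    "(m, as) \<in> bar_dom A M n ==> (\<lambda>m'\<in>carrier M. f (m', as)) \<in> linear_maps K M X"
    "(m, as) \<in> bar_dom A M n ==> i < n ==> (\<lambda>a\<in>carrier A. f (m, as[i := a])) \<in> linear_maps K A X"
  using assms by (auto simp: cochains_def PiE_def)

lemma bar_dom_change:
  assumes "(m, as) \<in> bar_dom A M n"
  shows "m' \<in> carrier M ==> (m', as) \<in> bar_dom A M n"
    "a \<in> carrier A ==> (m, as[i := a]) \<in> bar_dom A M n"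
  using assms set_update_subset_insert[of as i a] by (auto simp: bar_dom_def)

text \<open>Applying a linear operation to linear maps pointwise yields a linear map.\<close>

lemma linear_maps_post:
  assumes "f \<in> linear_maps K V X" "module K V"
    and h: "\<And>x. x \<in> carrier X ==> h x \<in> carrier Y"
    "\<And>x y. x \<in> carrier X ==> y \<in> carrier X ==> h (x \<oplus>\<^bsub>X\<^esub> y) = h x \<oplus>\<^bsub>Y\<^esub> h y"
    "\<And>c x. c \<in> carrier K ==> x \<in> carrier X ==> h (c \<odot>\<^bsub>X\<^esub> x) = c \<odot>\<^bsub>Y\<^esub> h x"
    and g: "g \<in> extensional (carrier V)" "\<And>v. v \<in> carrier V ==> g v = h (f v)"
  shows "g \<in> linear_maps K V Y"
proof -
  interpret V: module K V by fact
  show ?thesis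
    by (rule linear_mapsI) (auto simp: g linear_mapsD[OF assms(1)] h)
qed

lemma cochains_push:
  assumes M: "module K M" and f: "f \<in> carrier (cochains K A M X n)"
    and h: "\<And>x. x \<in> carrier X ==> h x \<in> carrier Y"
    "\<And>x y. x \<in> carrier X ==> y \<in> carrier X ==> h (x \<oplus>\<^bsub>X\<^esub> y) = h x \<oplus>\<^bsub>Y\<^esub> h y"
    "\<And>c x. c \<in> carrier K ==> x \<in> carrier X ==> h (c \<odot>\<^bsub>X\<^esub> x) = c \<odot>\<^bsub>Y\<^esub> h x"
  shows "(\<lambda>z\<in>bar_dom A M n. h (f z)) \<in> carrier (cochains K A M Y n)"
proof (rule cochainsI)
  fix m as assume z: "(m, as) \<in> bar_dom A M n"
  show "(\<lambda>z\<in>bar_dom A M n. h (f z)) (m, as) \<in> carrier Y"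
    using z cochainsD(4)[OF f] h(1) by simp
  show "(\<lambda>m'\<in>carrier M. (\<lambda>z\<in>bar_dom A M n. h (f z)) (m', as)) \<in> linear_maps K M Y"
    by (rule linear_maps_post[OF cochainsD(5)[OF f z] M h]) (use bar_dom_change[OF z] in auto)
  fix i assume "i < n"
  then show "(\<lambda>a\<in>carrier A. (\<lambda>z\<in>bar_dom A M n. h (f z)) (m, as[i := a])) \<in> linear_maps K A Y"
    by (intro linear_maps_post[OF cochainsD(6)[OF f z] A_module h]) (use bar_dom_change[OF z] in auto)
qed auto

lemma cochains_pull:
  assumes f: "f \<in> carrier (cochains K A M X n)" and M: "module K M"
    and u: "\<And>m. m \<in> carrier M ==> u m \<in> carrier M"
    "\<And>m m'. m \<in> carrier M ==> m' \<in> carrier M ==> u (m \<oplus>\<^bsub>M\<^esub> m') = u m \<oplus>\<^bsub>M\<^esub> u m'"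
    "\<And>c m. c \<in> carrier K ==> m \<in> carrier M ==> u (c \<odot>\<^bsub>M\<^esub> m) = c \<odot>\<^bsub>M\<^esub> u m"
  shows "pull M n u f \<in> carrier (cochains K A M X n)"
proof (rule cochainsI)
  interpret M: module K M by (rule M)
  fix m as assume z: "(m, as) \<in> bar_dom A M n"
  have uz: "(u m', as) \<in> bar_dom A M n" if "m' \<in> carrier M" for m'
    using z u that by (auto simp: bar_dom_def)
  show "pull M n u f (m, as) \<in> carrier X"
    using z uz bar_domD(1)[OF z] cochainsD(4)[OF f] by (simp add: pull_apply)
  show "(\<lambda>m'\<in>carrier M. pull M n u f (m', as)) \<in> linear_maps K M X"
    using linear_mapsD[OF cochainsD(5)[OF f z]] bar_dom_change(1)[OF z] u
    by (intro linear_mapsI) (auto simp: pull_apply)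
  fix i assume i: "i < n"
  have "(\<lambda>a\<in>carrier A. f (u m, as[i := a])) \<in> linear_maps K A X"
    by (rule cochainsD(6)[OF f uz[OF bar_domD(1)[OF z]] i])
  moreover have "(\<lambda>a\<in>carrier A. pull M n u f (m, as[i := a])) = (\<lambda>a\<in>carrier A. f (u m, as[i := a]))"
    using bar_dom_change(2)[OF z] by (auto simp: pull_apply)
  ultimately show "(\<lambda>a\<in>carrier A. pull M n u f (m, as[i := a])) \<in> linear_maps K A X" by simp
qed (auto simp: pull_def)

lemma linear_maps_add:
  assumes "f \<in> linear_maps K V X" "g \<in> linear_maps K V X" "module K V" "module K X"
    and e: "e \<in> extensional (carrier V)" "\<And>v. v \<in> carrier V ==> e v = f v \<oplus>\<^bsub>X\<^esub> g v"
  shows "e \<in> linear_maps K V X"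
proof -
  interpret V: module K V by fact
  interpret X: module K X by fact
  show ?thesis
    by (rule linear_mapsI)
      (auto simp: e linear_mapsD[OF assms(1)] linear_mapsD[OF assms(2)] X.M.a_ac X.smult_r_distr)
qed

lemma zero_map_linear:
  assumes "module K V" "module K W"
  shows "zero_map V W \<in> linear_maps K V W"
proof -
  interpret V: module K V by fact
  interpret W: module K W by fact
  show ?thesis by (rule linear_mapsI) (auto, simp add: zero_map_def)
qed

lemma fun_space_module: "right_module K A X ==> module K (fun_space A M X n)"
  unfolding fun_space_def by (intro prod_module_module K.is_cring right_moduleD(1))

lemma cochains_subspace:
  assumes M: "module K M" and X: "right_module K A X"
  shows "subspace K (fun_space A M X n) (carrier (cochains K A M X n))"
proof -
  interpret X: module K X by (rule right_moduleD[OF X])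
  interpret M: module K M by (rule M)
  interpret A: module K A by (rule A_module)
  have z: "(\<lambda>z\<in>bar_dom A M n. \<zero>\<^bsub>X\<^esub>) \<in> carrier (cochains K A M X n)"
  proof (rule cochainsI)
    fix m as assume z: "(m, as) \<in> bar_dom A M n"
    have "(\<lambda>m'\<in>carrier M. (\<lambda>z\<in>bar_dom A M n. \<zero>\<^bsub>X\<^esub>) (m', as)) = zero_map M X"
      using bar_dom_change(1)[OF z] by (auto simp: zero_map_def)
    then show "(\<lambda>m'\<in>carrier M. (\<lambda>z\<in>bar_dom A M n. \<zero>\<^bsub>X\<^esub>) (m', as)) \<in> linear_maps K M X"
      by (simp add: zero_map_linear M X.module_axioms)
    fix i
    have "(\<lambda>a\<in>carrier A. (\<lambda>z\<in>bar_dom A M n. \<zero>\<^bsub>X\<^esub>) (m, as[i := a])) = zero_map A X"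
      using bar_dom_change(2)[OF z] by (auto simp: zero_map_def)
    then show "(\<lambda>a\<in>carrier A. (\<lambda>z\<in>bar_dom A M n. \<zero>\<^bsub>X\<^esub>) (m, as[i := a])) \<in> linear_maps K A X"
      by (simp add: zero_map_linear A_module X.module_axioms)
  qed auto
  have a: "(\<lambda>z\<in>bar_dom A M n. f z \<oplus>\<^bsub>X\<^esub> g z) \<in> carrier (cochains K A M X n)"
    if f: "f \<in> carrier (cochains K A M X n)" and g: "g \<in> carrier (cochains K A M X n)" for f g
  proof (rule cochainsI)
    fix m as assume z: "(m, as) \<in> bar_dom A M n"
    show "(\<lambda>z\<in>bar_dom A M n. f z \<oplus>\<^bsub>X\<^esub> g z) (m, as) \<in> carrier X"
      using z cochainsD(4)[OF f] cochainsD(4)[OF g] by simp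
    show "(\<lambda>m'\<in>carrier M. (\<lambda>z\<in>bar_dom A M n. f z \<oplus>\<^bsub>X\<^esub> g z) (m', as)) \<in> linear_maps K M X"
      by (rule linear_maps_add[OF cochainsD(5)[OF f z] cochainsD(5)[OF g z] M X.module_axioms])
        (use bar_dom_change[OF z] in auto)
    fix i assume i: "i < n"
    show "(\<lambda>a\<in>carrier A. (\<lambda>z\<in>bar_dom A M n. f z \<oplus>\<^bsub>X\<^esub> g z) (m, as[i := a])) \<in> linear_maps K A X"
      by (rule linear_maps_add[OF cochainsD(6)[OF f z i] cochainsD(6)[OF g z i] A_module X.module_axioms])
        (use bar_dom_change[OF z] in auto)
  qed auto
  have s: "(\<lambda>z\<in>bar_dom A M n. c \<odot>\<^bsub>X\<^esub> f z) \<in> carrier (cochains K A M X n)"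
    if c: "c \<in> carrier K" and f: "f \<in> carrier (cochains K A M X n)" for c f
    by (rule cochains_push[OF M f]) (use c in \<open>auto simp: X.smult_r_distr X.smult_assoc1[symmetric] K.m_comm\<close>)
  have sub: "carrier (cochains K A M X n) \<subseteq> bar_dom A M n \<rightarrow>\<^sub>E carrier X"
    using cochainsD(1) by blast
  show ?thesis
    unfolding subspace_def fun_space_sel by (intro conjI ballI sub z a s)
qed

lemma cocycles_subspace:
  assumes M: "right_module K A M" and X: "right_module K A X"
  shows "subspace K (fun_space A M X n) (cocycles K A M X n)"
proof -
  interpret X: module K X by (rule right_moduleD[OF X])
  let ?z = "\<lambda>n. \<lambda>z\<in>bar_dom A M n. \<zero>\<^bsub>X\<^esub>"
  note C = cochains_subspace[OF right_moduleD(1)[OF M] X, of n, unfolded subspace_def fun_space_sel]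
  have coc: "f \<in> cocycles K A M X n \<longleftrightarrow> f \<in> carrier (cochains K A M X n) \<and>
      (\<forall>z\<in>bar_dom A M (Suc n). coboundary A M X n f z = \<zero>\<^bsub>X\<^esub>)" for f
  proof -
    have "coboundary A M X n f = (\<lambda>z\<in>bar_dom A M (Suc n). \<zero>\<^bsub>X\<^esub>) \<longleftrightarrow>
      (\<forall>z\<in>bar_dom A M (Suc n). coboundary A M X n f z = \<zero>\<^bsub>X\<^esub>)"
      unfolding coboundary_def by (auto simp: fun_eq_iff)
    then show ?thesis by (auto simp: cocycles_def cochains_def)
  qed
  have s: "(\<lambda>z\<in>bar_dom A M n. c \<odot>\<^bsub>X\<^esub> f z) \<in> cocycles K A M X n"
    if c: "c \<in> carrier K" and f: "f \<in> cocycles K A M X n" for c f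
  proof -
    have fC: "f \<in> carrier (cochains K A M X n)" using f by (simp add: coc)
    have "coboundary A M X n (\<lambda>z\<in>bar_dom A M n. c \<odot>\<^bsub>X\<^esub> f z) z = c \<odot>\<^bsub>X\<^esub> coboundary A M X n f z"
      if "z \<in> bar_dom A M (Suc n)" for z
      by (rule coboundary_push[OF M X X _ _ _ cochainsD(2)[OF fC] that])
        (use c in \<open>auto simp: X.smult_r_distr right_moduleD(4)[OF X]\<close>)
    then show ?thesis using f c C by (simp add: coc)
  qed
  have zc: "?z n \<in> cocycles K A M X n"
    using s[of "\<zero>"] C unfolding coc
  proof -
    have fC: "?z n \<in> carrier (cochains K A M X n)" using C by blast
    have "coboundary A M X n (?z n) z = \<zero> \<odot>\<^bsub>X\<^esub> coboundary A M X n (?z n) z"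
      if "z \<in> bar_dom A M (Suc n)" for z
      by (rule coboundary_push[OF M X X _ _ _ cochainsD(2)[OF fC] that])
        (auto simp: X.smult_r_distr right_module_zero_act[OF X] right_moduleD(2)[OF X])
    then show "?z n \<in> carrier (cochains K A M X n) \<and> (\<forall>z\<in>bar_dom A M (Suc n). coboundary A M X n (?z n) z = \<zero>\<^bsub>X\<^esub>)"
      using fC coboundary_closed[OF M X cochainsD(2)[OF fC]] by auto
  qed
  have a: "(\<lambda>z\<in>bar_dom A M n. f z \<oplus>\<^bsub>X\<^esub> g z) \<in> cocycles K A M X n"
    if f: "f \<in> cocycles K A M X n" and g: "g \<in> cocycles K A M X n" for f g
  proof -
    have fC: "f \<in> carrier (cochains K A M X n)" "g \<in> carrier (cochains K A M X n)"
      using f g by (auto simp: coc)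
    show ?thesis
      using f g C coboundary_add[OF M X cochainsD(2)[OF fC(1)] cochainsD(2)[OF fC(2)]] by (simp add: coc)
  qed
  show ?thesis
    unfolding subspace_def fun_space_sel using s zc a C by (auto simp: coc)
qed

lemma coboundaries_subspace:
  assumes M: "right_module K A M" and X: "right_module K A X"
  shows "subspace K (fun_space A M X n) (coboundaries K A M X n)"
proof -
  interpret X: module K X by (rule right_moduleD[OF X])
  interpret F: module K "fun_space A M X n" by (rule fun_space_module[OF X])
  show ?thesis
  proof (cases n)
    case 0
    have "coboundaries K A M X n = {\<zero>\<^bsub>fun_space A M X n\<^esub>}"
      unfolding 0 by (simp add: coboundaries_def cochains_def fun_space_sel)
    then show ?thesis by (auto simp: subspace_def)
  next
    case (Suc n')
    note C = cochains_subspace[OF right_moduleD(1)[OF M] X, of n', unfolded subspace_def fun_space_sel]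
    have B: "coboundaries K A M X n = coboundary A M X n' ` carrier (cochains K A M X n')"
      by (simp add: coboundaries_def Suc)
    have ext: "coboundary A M X n' f \<in> extensional (bar_dom A M n)" for f
      by (simp add: coboundary_def Suc)
    have dC: "coboundary A M X n' f \<in> carrier (fun_space A M X n)" if "f \<in> carrier (cochains K A M X n')" for f
      using coboundary_closed[OF M X cochainsD(2)[OF that]] ext by (auto simp: fun_space_sel PiE_def Suc)
    have a: "coboundary A M X n' f \<oplus>\<^bsub>fun_space A M X n\<^esub> coboundary A M X n' g =
      coboundary A M X n' (\<lambda>z\<in>bar_dom A M n'. f z \<oplus>\<^bsub>X\<^esub> g z)"
      if "f \<in> carrier (cochains K A M X n')" "g \<in> carrier (cochains K A M X n')" for f g
      unfolding fun_space_sel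
      by (rule extensionalityI[OF restrict_extensional ext])
        (simp add: coboundary_add[OF M X cochainsD(2)[OF that(1)] cochainsD(2)[OF that(2)]] Suc)
    have s: "c \<odot>\<^bsub>fun_space A M X n\<^esub> coboundary A M X n' f =
      coboundary A M X n' (\<lambda>z\<in>bar_dom A M n'. c \<odot>\<^bsub>X\<^esub> f z)"
      if f: "f \<in> carrier (cochains K A M X n')" and c: "c \<in> carrier K" for f c
    proof -
      have "coboundary A M X n' (\<lambda>z\<in>bar_dom A M n'. c \<odot>\<^bsub>X\<^esub> f z) z = c \<odot>\<^bsub>X\<^esub> coboundary A M X n' f z"
        if "z \<in> bar_dom A M (Suc n')" for z
        by (rule coboundary_push[OF M X X _ _ _ cochainsD(2)[OF f] that])
          (use c in \<open>auto simp: X.smult_r_distr right_moduleD(4)[OF X]\<close>)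
      then show ?thesis unfolding fun_space_sel
        by (intro extensionalityI[OF restrict_extensional ext]) (simp add: Suc)
    qed
    have z: "\<zero>\<^bsub>fun_space A M X n\<^esub> \<in> coboundaries K A M X n"
    proof -
      have zC: "(\<lambda>z\<in>bar_dom A M n'. \<zero>\<^bsub>X\<^esub>) \<in> carrier (cochains K A M X n')" using C by blast
      have "\<zero> \<odot>\<^bsub>fun_space A M X n\<^esub> coboundary A M X n' (\<lambda>z\<in>bar_dom A M n'. \<zero>\<^bsub>X\<^esub>) \<in> coboundaries K A M X n"
        unfolding B s[OF zC K.zero_closed]
      proof (rule imageI)
        show "(\<lambda>z\<in>bar_dom A M n'. \<zero> \<odot>\<^bsub>X\<^esub> (\<lambda>z\<in>bar_dom A M n'. \<zero>\<^bsub>X\<^esub>) z) \<in> carrier (cochains K A M X n')"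
          using C zC K.zero_closed by blast
      qed
      then show ?thesis using dC[OF zC] by simp
    qed
    show ?thesis
      unfolding subspace_def using z dC a s C by (auto simp: B)
  qed
qed

end

context fd_alg
begin

text \<open>A multilinear map is determined by its values on basis vectors, so cochains between
  finite-dimensional modules form a finite-dimensional space.\<close>

lemma linear_map_zero_on_basis:
  assumes "f \<in> linear_maps K V W" "module K V" "module K W"
    and b: "\<And>j. j < n ==> b j \<in> carrier V" "\<And>j. j < n ==> functional V (\<phi> j)"
    and rep: "x = (\<Oplus>\<^bsub>V\<^esub>j\<in>{..<n::nat}. \<phi> j x \<odot>\<^bsub>V\<^esub> b j)" and x: "x \<in> carrier V"
    and z: "\<And>j. j < n ==> f (b j) = \<zero>\<^bsub>W\<^esub>"
  shows "f x = \<zero>\<^bsub>W\<^esub>"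
proof -
  interpret V: module K V by fact
  interpret W: module K W by fact
  have \<phi>: "\<phi> j x \<in> carrier K" if "j < n" for j using b(2)[OF that] x by (simp add: functional_def)
  have "f x = f (\<Oplus>\<^bsub>V\<^esub>j\<in>{..<n}. \<phi> j x \<odot>\<^bsub>V\<^esub> b j)" using rep by simp
  also have "\<dots> = (\<Oplus>\<^bsub>W\<^esub>j\<in>{..<n}. f (\<phi> j x \<odot>\<^bsub>V\<^esub> b j))"
    by (rule linear_maps_finsum[OF assms(2,3,1)]) (use \<phi> b in auto)
  also have "\<dots> = \<zero>\<^bsub>W\<^esub>"
    by (rule W.M.finsum_all_zero) (use \<phi> b z linear_mapsD(4)[OF assms(1)] in auto)
  finally show ?thesis .
qed

lemma cochains_fin_dim:
  assumes M: "module K M" "fin_dim K M" and X: "right_module K A X" "fin_dim K X"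
    and Z: "subspace K (fun_space A M X n) Z" "Z \<subseteq> carrier (cochains K A M X n)"
  shows "fin_dim K ((fun_space A M X n)\<lparr>carrier := Z\<rparr>)"
proof -
  interpret X: module K X by (rule right_moduleD[OF X(1)])
  interpret A: module K A by (rule A_module)
  obtain nM b \<phi> where b: "\<And>j. j < nM ==> b j \<in> carrier M" "\<And>j. j < nM ==> functional M (\<phi> j)"
    and brep: "\<And>x. x \<in> carrier M ==> x = (\<Oplus>\<^bsub>M\<^esub>j\<in>{..<nM::nat}. \<phi> j x \<odot>\<^bsub>M\<^esub> b j)"
    using fin_dim_basis[OF M] by blast
  obtain nA \<beta> \<psi> where \<beta>: "\<And>j. j < nA ==> \<beta> j \<in> carrier A" "\<And>j. j < nA ==> functional A (\<psi> j)"
    and \<beta>rep: "\<And>x. x \<in> carrier A ==> x = (\<Oplus>\<^bsub>A\<^esub>j\<in>{..<nA::nat}. \<psi> j x \<odot>\<^bsub>A\<^esub> \<beta> j)"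
    using fin_dim_basis[OF A_module fdA] by blast
  obtain nX \<chi> where \<chi>: "\<And>j. j < nX ==> functional X (\<chi> j)"
    and sep: "\<And>x. x \<in> carrier X ==> (\<forall>j<(nX::nat). \<chi> j x = \<zero>) ==> x = \<zero>\<^bsub>X\<^esub>"
    using fin_dim_separated[OF right_moduleD(1)[OF X(1)] X(2)] by blast
  define J where "J = {..<nM} \<times> {ks. set ks \<subseteq> {..<nA} \<and> length ks = n} \<times> {..<nX}"
  define ev where "ev = (\<lambda>(j, ks, l) f. \<chi> l (f (b j, map \<beta> ks)))"
  have dom: "(b j, map \<beta> ks) \<in> bar_dom A M n" if "j < nM" "set ks \<subseteq> {..<nA}" "length ks = n" for j ks
    using that b \<beta> by (auto simp: bar_dom_def)
  show ?thesis
  proof (rule separated_fin_dim[where J = J and \<phi> = ev])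
    show "finite J" unfolding J_def by (intro finite_cartesian_product finite_lists_length_eq) auto
    show "module K ((fun_space A M X n)\<lparr>carrier := Z\<rparr>)"
      using subspaceD[OF Z(1)] by (intro module_subset fun_space_module X(1)) auto
  next
    fix p assume "p \<in> J"
    then obtain j ks l where p: "p = (j, ks, l)" "j < nM" "set ks \<subseteq> {..<nA}" "length ks = n" "l < nX"
      by (auto simp: J_def)
    have "f (b j, map \<beta> ks) \<in> carrier X" if "f \<in> Z" for f
      using cochainsD(4)[OF _ dom[OF p(2-4)]] that Z(2) by blast
    then show "functional ((fun_space A M X n)\<lparr>carrier := Z\<rparr>) (ev p)"
      using \<chi>[OF p(5)] dom[OF p(2-4)] by (simp add: p(1) ev_def functional_def fun_space_sel)
  next
    fix f assume f: "f \<in> carrier ((fun_space A M X n)\<lparr>carrier := Z\<rparr>)" and z: "\<And>p. p \<in> J ==> ev p f = \<zero>"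
    have fC: "f \<in> carrier (cochains K A M X n)" using f Z(2) by auto
    have base: "f (b j, map \<beta> ks) = \<zero>\<^bsub>X\<^esub>" if "j < nM" "set ks \<subseteq> {..<nA}" "length ks = n" for j ks
    proof (rule sep)
      show "f (b j, map \<beta> ks) \<in> carrier X" by (rule cochainsD(4)[OF fC dom[OF that]])
      show "\<forall>l<nX. \<chi> l (f (b j, map \<beta> ks)) = \<zero>"
        using z[of "(j, ks, _)"] that by (auto simp: ev_def J_def)
    qed
    have claim: "f (m, as) = \<zero>\<^bsub>X\<^esub>"
      if "(m, as) \<in> bar_dom A M n" "k \<le> n" "\<And>i. k \<le> i ==> i < n ==> as ! i \<in> \<beta> ` {..<nA}" for k m as
      using that
    proof (induction k arbitrary: as)
      case 0
      have "\<exists>ks. set ks \<subseteq> {..<nA} \<and> length ks = n \<and> as = map \<beta> ks"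
      proof -
        have "\<forall>i<n. \<exists>k<nA. as ! i = \<beta> k" using 0(3) by auto
        then obtain g where g: "\<And>i. i < n ==> g i < nA \<and> as ! i = \<beta> (g i)" by metis
        then show ?thesis
          using bar_domD(3)[OF 0(1)] by (intro exI[of _ "map g [0..<n]"]) (auto intro!: nth_equalityI)
      qed
      then obtain ks where ks: "set ks \<subseteq> {..<nA}" "length ks = n" "as = map \<beta> ks" by blast
      note m = bar_domD(1)[OF 0(1)]
      have "(\<lambda>m'\<in>carrier M. f (m', as)) m = \<zero>\<^bsub>X\<^esub>"
        by (rule linear_map_zero_on_basis[OF cochainsD(5)[OF fC 0(1)] M(1) X.module_axioms b brep[OF m] m])
          (use b base ks in auto)
      then show ?case using m by simp
    next
      case (Suc k)
      have k: "k < n" using Suc.prems by simp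
      note a = bar_domD(4)[OF Suc.prems(1) k]
      have len: "length as = n" by (rule bar_domD(3)[OF Suc.prems(1)])
      have "(\<lambda>a\<in>carrier A. f (m, as[k := a])) (as ! k) = \<zero>\<^bsub>X\<^esub>"
      proof (rule linear_map_zero_on_basis[OF cochainsD(6)[OF fC Suc.prems(1) k] A_module X.module_axioms \<beta> \<beta>rep[OF a] a])
        fix j assume j: "j < nA"
        have "f (m, as[k := \<beta> j]) = \<zero>\<^bsub>X\<^esub>"
        proof (rule Suc.IH)
          show "(m, as[k := \<beta> j]) \<in> bar_dom A M n" using bar_dom_change(2)[OF Suc.prems(1)] \<beta> j by auto
          fix i assume "k \<le> i" "i < n"
          then show "as[k := \<beta> j] ! i \<in> \<beta> ` {..<nA}"
            using Suc.prems(3)[of i] j len by (cases "i = k") auto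
        qed (use k in auto)
        then show "(\<lambda>a\<in>carrier A. f (m, as[k := a])) (\<beta> j) = \<zero>\<^bsub>X\<^esub>" using \<beta> j by simp
      qed
      then show ?case using a by simp
    qed
    have "f z = \<zero>\<^bsub>X\<^esub>" if "z \<in> bar_dom A M n" for z
      using claim[of "fst z" "snd z" n] that by simp
    then show "f = \<zero>\<^bsub>(fun_space A M X n)\<lparr>carrier := Z\<rparr>\<^esub>"
      using cochainsD(3)[OF fC] by (auto simp: fun_space_sel extensional_def fun_eq_iff)
  qed
qed

text \<open>
  The coinduced module \<open>Hom\<^sub>K(A, V)\<close>; for \<open>V = K\<close> it is the dual \<open>DA\<close>, and for a module \<open>V\<close> it
  receives an embedding of \<open>V\<close> by \<open>v \<mapsto> (a \<mapsto> va)\<close>.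
\<close>

definition coind :: "('k, 'v, 'x) module_scheme => ('k, 'a, 'a => 'v) rmod"
  where "coind V = \<lparr>carrier = linear_maps K A V, mult = undefined, one = undefined,
    zero = (\<lambda>x\<in>carrier A. \<zero>\<^bsub>V\<^esub>), add = (\<lambda>f g. \<lambda>x\<in>carrier A. f x \<oplus>\<^bsub>V\<^esub> g x),
    smult = (\<lambda>c f. \<lambda>x\<in>carrier A. c \<odot>\<^bsub>V\<^esub> f x), ract = (\<lambda>f a. \<lambda>x\<in>carrier A. f (a \<otimes>\<^bsub>A\<^esub> x))\<rparr>"

lemma coind_sel:
  "carrier (coind V) = linear_maps K A V" "\<zero>\<^bsub>coind V\<^esub> = (\<lambda>x\<in>carrier A. \<zero>\<^bsub>V\<^esub>)"
  "f \<oplus>\<^bsub>coind V\<^esub> g = (\<lambda>x\<in>carrier A. f x \<oplus>\<^bsub>V\<^esub> g x)" "c \<odot>\<^bsub>coind V\<^esub> f = (\<lambda>x\<in>carrier A. c \<odot>\<^bsub>V\<^esub> f x)"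
  "ract (coind V) f a = (\<lambda>x\<in>carrier A. f (a \<otimes>\<^bsub>A\<^esub> x))"
  by (simp_all add: coind_def)

lemma coind_fdmod:
  assumes V: "module K V" "fin_dim K V"
  shows "right_module K A (coind V)" "fin_dim K (coind V)"
proof -
  interpret A: k_algebra K A by (rule alg)
  interpret A: ring A by (rule A_ring)
  interpret V: module K V by (rule V)
  have D: "f x \<in> carrier V" "f (x \<oplus>\<^bsub>A\<^esub> y) = f x \<oplus>\<^bsub>V\<^esub> f y" "c \<in> carrier K ==> f (c \<odot>\<^bsub>A\<^esub> x) = c \<odot>\<^bsub>V\<^esub> f x"
    if "f \<in> carrier (coind V)" "x \<in> carrier A" "y \<in> carrier A" for f x y c
    using that linear_mapsD[of f K A V] by (auto simp: coind_sel)
  have E: "f \<in> extensional (carrier A)" if "f \<in> carrier (coind V)" for f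
    using that linear_mapsD(2)[of f] by (auto simp: coind_sel)
  have I: "f \<in> carrier (coind V)" if "\<And>x. x \<in> carrier A ==> f x \<in> carrier V" "f \<in> extensional (carrier A)"
    "\<And>x y. x \<in> carrier A ==> y \<in> carrier A ==> f (x \<oplus>\<^bsub>A\<^esub> y) = f x \<oplus>\<^bsub>V\<^esub> f y"
    "\<And>c x. c \<in> carrier K ==> x \<in> carrier A ==> f (c \<odot>\<^bsub>A\<^esub> x) = c \<odot>\<^bsub>V\<^esub> f x" for f
    unfolding coind_sel by (rule linear_mapsI) (use that in auto)
  have cl: "\<zero>\<^bsub>coind V\<^esub> \<in> carrier (coind V)"
    "\<And>f g. f \<in> carrier (coind V) ==> g \<in> carrier (coind V) ==> f \<oplus>\<^bsub>coind V\<^esub> g \<in> carrier (coind V)"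
    "\<And>c f. c \<in> carrier K ==> f \<in> carrier (coind V) ==> c \<odot>\<^bsub>coind V\<^esub> f \<in> carrier (coind V)"
    by (rule I; auto simp: coind_sel(2-4) D V.smult_r_distr V.M.a_ac V.smult_assoc1[symmetric] K.m_comm)+
  have ra: "ract (coind V) f a \<in> carrier (coind V)" if "f \<in> carrier (coind V)" "a \<in> carrier A" for f a
    by (rule I) (use that in \<open>auto simp: coind_sel(5) D A.r_distr A.smult_mult_right\<close>)
  have mod: "module K (coind V)"
  proof (rule module_transfer[where V = "prod_module (carrier A) (\<lambda>_. V)" and h = "\<lambda>f. f"])
    show "module K (prod_module (carrier A) (\<lambda>_. V))"
      by (intro prod_module_module V K.is_cring)
    fix f assume f: "f \<in> carrier (coind V)"
    then show "f \<in> carrier (prod_module (carrier A) (\<lambda>_. V))"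
      using E[OF f] D(1)[OF f] by (auto simp: prod_module_def PiE_def)
  qed (use cl in \<open>auto simp: prod_module_def coind_sel(2-4)\<close>)
  show "right_module K A (coind V)"
  proof (rule right_moduleI[OF mod A_module ra])
    fix f a b assume f: "f \<in> carrier (coind V)" "a \<in> carrier A" "b \<in> carrier A"
    show "ract (coind V) (ract (coind V) f a) b = ract (coind V) f (a \<otimes>\<^bsub>A\<^esub> b)"
      using f by (auto simp: coind_sel(5) A.m_assoc)
    show "ract (coind V) f (a \<oplus>\<^bsub>A\<^esub> b) = ract (coind V) f a \<oplus>\<^bsub>coind V\<^esub> ract (coind V) f b"
      using f by (auto simp: coind_sel(3,5) A.l_distr D)
  next
    fix f assume f: "f \<in> carrier (coind V)"
    show "ract (coind V) f \<one>\<^bsub>A\<^esub> = f"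
      by (rule extensionalityI[OF _ E[OF f]]) (auto simp: coind_sel(5))
  qed (auto simp: coind_sel(3-5) D A.smult_mult_left)
  obtain n \<beta> \<psi> where \<beta>: "\<And>j. j < n ==> \<beta> j \<in> carrier A" "\<And>j. j < n ==> functional A (\<psi> j)"
    and \<beta>rep: "\<And>x. x \<in> carrier A ==> x = (\<Oplus>\<^bsub>A\<^esub>j\<in>{..<n::nat}. \<psi> j x \<odot>\<^bsub>A\<^esub> \<beta> j)"
    using fin_dim_basis[OF A_module fdA] by blast
  obtain nV \<chi> where \<chi>: "\<And>j. j < nV ==> functional V (\<chi> j)"
    and sep: "\<And>x. x \<in> carrier V ==> (\<forall>j<(nV::nat). \<chi> j x = \<zero>) ==> x = \<zero>\<^bsub>V\<^esub>"
    using fin_dim_separated[OF V] by blast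
  show "fin_dim K (coind V)"
  proof (rule separated_fin_dim[where J = "{..<n} \<times> {..<nV}" and \<phi> = "\<lambda>(j, l) f. \<chi> l (f (\<beta> j))", OF _ mod])
    fix p assume "p \<in> {..<n} \<times> {..<nV}"
    then obtain j l where p: "p = (j, l)" "j < n" "l < nV" by auto
    show "functional (coind V) ((\<lambda>(j, l) f. \<chi> l (f (\<beta> j))) p)"
      using \<beta>(1)[OF p(2)] \<chi>[OF p(3)] D(1)[of _ "\<beta> j" "\<beta> j"]
      by (auto simp: p(1) functional_def coind_sel(3,4))
  next
    fix f assume f: "f \<in> carrier (coind V)"
      and z: "\<And>p. p \<in> {..<n} \<times> {..<nV} ==> (\<lambda>(j, l) f. \<chi> l (f (\<beta> j))) p f = \<zero>"
    have fb: "f (\<beta> j) = \<zero>\<^bsub>V\<^esub>" if "j < n" for j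
      by (rule sep) (use z[of "(j, _)"] that D(1)[OF f \<beta>(1)[OF that] \<beta>(1)[OF that]] in auto)
    have "f x = \<zero>\<^bsub>V\<^esub>" if "x \<in> carrier A" for x
      by (rule linear_map_zero_on_basis[OF _ A_module V(1) \<beta> \<beta>rep[OF that] that])
        (use f fb in \<open>auto simp: coind_sel(1)\<close>)
    then show "f = \<zero>\<^bsub>coind V\<^esub>" using E[OF f] by (auto simp: coind_sel(2) extensional_def fun_eq_iff)
  qed auto
qed

abbreviation DA :: "('k, 'a, 'a => 'k) rmod" where "DA \<equiv> dual_module K A"

lemma DA_coind: "DA = coind (base_field K)"
  by (simp add: dual_module_def coind_def)

lemmas DA_sel = coind_sel[of "base_field K", folded DA_coind, unfolded base_field_sel]

lemma DA_fdmod: "right_module K A DA" "fin_dim K DA" "module K DA"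
proof -
  have "fin_dim K (base_field K)"
    by (rule separated_fin_dim[where J = "{()}" and \<phi> = "\<lambda>_ x. x", OF _ base_field_module])
      (auto simp: functional_def)
  from coind_fdmod[OF base_field_module this] show "right_module K A DA" "fin_dim K DA"
    unfolding DA_coind by auto
  then show "module K DA" using right_moduleD(1) by blast
qed

lemma dual_lact_props:
  assumes a: "a \<in> carrier A"
  shows "f \<in> carrier DA ==> dual_lact A a f \<in> carrier DA"
    "f \<in> carrier DA ==> g \<in> carrier DA ==> dual_lact A a (f \<oplus>\<^bsub>DA\<^esub> g) = dual_lact A a f \<oplus>\<^bsub>DA\<^esub> dual_lact A a g"
    "c \<in> carrier K ==> f \<in> carrier DA ==> dual_lact A a (c \<odot>\<^bsub>DA\<^esub> f) = c \<odot>\<^bsub>DA\<^esub> dual_lact A a f"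
    "f \<in> carrier DA ==> b \<in> carrier A ==> dual_lact A a (ract DA f b) = ract DA (dual_lact A a f) b"
    "f \<in> carrier DA ==> b \<in> carrier A ==> dual_lact A a (dual_lact A b f) = dual_lact A (a \<otimes>\<^bsub>A\<^esub> b) f"
    "f \<in> carrier DA ==> b \<in> carrier A ==> dual_lact A (a \<oplus>\<^bsub>A\<^esub> b) f = dual_lact A a f \<oplus>\<^bsub>DA\<^esub> dual_lact A b f"
    "f \<in> carrier DA ==> c \<in> carrier K ==> dual_lact A (c \<odot>\<^bsub>A\<^esub> a) f = c \<odot>\<^bsub>DA\<^esub> dual_lact A a f"
    "f \<in> carrier DA ==> dual_lact A \<one>\<^bsub>A\<^esub> f = f"
proof -
  interpret A: k_algebra K A by (rule alg)
  interpret A: ring A by (rule A_ring)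
  note D = linear_mapsD[of _ K A "base_field K", simplified]
  show "f \<in> carrier DA ==> dual_lact A a f \<in> carrier DA"
    unfolding DA_sel(1) using a
    by (intro linear_mapsI) (auto simp: dual_lact_def D A.l_distr A.smult_mult_left)
  show "f \<in> carrier DA ==> dual_lact A \<one>\<^bsub>A\<^esub> f = f"
    using D(2)[of f] by (auto simp: dual_lact_def DA_sel(1) extensional_def fun_eq_iff)
qed (use a linear_mapsD[of _ K A "base_field K"] A_ring alg in
    \<open>auto simp: dual_lact_def DA_sel ring.ring_simprules k_algebra.smult_mult_right[OF alg] module.smult_closed[OF A_module]\<close>)

end

locale ext_functor = fd_alg K A for K :: "('k, 'z) ring_scheme" (structure) and A :: "('k, 'a, 'y) module_scheme" +
  fixes d :: nat
  assumes d_pos: "d \<ge> 1"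
begin

abbreviation Fun :: "('k, 'a, 'x) rmod => ('k, ('a => 'k) \<times> 'a list => 'x) module"
  where "Fun X \<equiv> fun_space A DA X d"
abbreviation Cyc :: "('k, 'a, 'x) rmod => (('a => 'k) \<times> 'a list => 'x) set"
  where "Cyc X \<equiv> cocycles K A DA X d"
abbreviation Bnd :: "('k, 'a, 'x) rmod => (('a => 'k) \<times> 'a list => 'x) set"
  where "Bnd X \<equiv> coboundaries K A DA X d"
abbreviation cls :: "('k, 'a, 'x) rmod => (('a => 'k) \<times> 'a list => 'x) => (('a => 'k) \<times> 'a list => 'x) set"
  where "cls X f \<equiv> Bnd X +>\<^bsub>Fun X\<^esub> f"
abbreviation E :: "('k, 'a, 'x) rmod => ('k, 'a, (('a => 'k) \<times> 'a list => 'x) set) rmod"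
  where "E X \<equiv> Ext_dual K A d X"

lemma cocycles_iff:
  "f \<in> cocycles K A M X n \<longleftrightarrow> f \<in> carrier (cochains K A M X n) \<and>
      (\<forall>z\<in>bar_dom A M (Suc n). coboundary A M X n f z = \<zero>\<^bsub>X\<^esub>)"
proof -
  have "coboundary A M X n f = (\<lambda>z\<in>bar_dom A M (Suc n). \<zero>\<^bsub>X\<^esub>) \<longleftrightarrow>
    (\<forall>z\<in>bar_dom A M (Suc n). coboundary A M X n f z = \<zero>\<^bsub>X\<^esub>)"
    unfolding coboundary_def by (auto simp: fun_eq_iff)
  then show ?thesis by (auto simp: cocycles_def cochains_def)
qed

lemma coboundaries_iff:
  "g \<in> Bnd X \<longleftrightarrow> (\<exists>h\<in>carrier (cochains K A DA X (d - 1)). g = coboundary A DA X (d - 1) h)"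
  using d_pos by (auto simp: coboundaries_def)

lemma d_Suc: "Suc (d - 1) = d"
  using d_pos by simp

context
  fixes X :: "('k, 'a, 'x) rmod"
  assumes X: "right_module K A X"
begin

lemma Fun_module: "module K (Fun X)"
  by (rule fun_space_module[OF X])

lemma Cyc_sub: "subspace K (Fun X) (Cyc X)"
  by (rule cocycles_subspace[OF DA_fdmod(1) X])

lemma Bnd_sub: "subspace K (Fun X) (Bnd X)"
  by (rule coboundaries_subspace[OF DA_fdmod(1) X])

lemma pull_Fun: "f \<in> carrier (Fun X) ==> a \<in> carrier A ==> pull DA d (dual_lact A a) f \<in> carrier (Fun X)"
  using dual_lact_props(1) by (auto simp: fun_space_sel pull_def bar_dom_def PiE_iff)

lemma pull_Cyc:
  assumes f: "f \<in> Cyc X" and a: "a \<in> carrier A"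
  shows "pull DA d (dual_lact A a) f \<in> Cyc X"
proof -
  have fC: "f \<in> carrier (cochains K A DA X d)" using f by (simp add: cocycles_iff)
  note u = dual_lact_props[OF a]
  have "coboundary A DA X d (pull DA d (dual_lact A a) f) = pull DA (Suc d) (dual_lact A a) (coboundary A DA X d f)"
    by (rule coboundary_pull[OF DA_fdmod(1) u(1,4) X cochainsD(2)[OF fC]])
  moreover have "pull DA (Suc d) (dual_lact A a) (coboundary A DA X d f) z = \<zero>\<^bsub>X\<^esub>"
    if "z \<in> bar_dom A DA (Suc d)" for z
    using f that u(1) by (auto simp: cocycles_iff pull_def bar_dom_def)
  ultimately show ?thesis
    using cochains_pull[OF fC DA_fdmod(3) u(1-3)] by (simp add: cocycles_iff)
qed

lemma pull_Bnd:
  assumes g: "g \<in> Bnd X" and a: "a \<in> carrier A"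
  shows "pull DA d (dual_lact A a) g \<in> Bnd X"
proof -
  obtain h where h: "h \<in> carrier (cochains K A DA X (d - 1))" "g = coboundary A DA X (d - 1) h"
    using g coboundaries_iff by blast
  note u = dual_lact_props[OF a]
  have "coboundary A DA X (d - 1) (pull DA (d - 1) (dual_lact A a) h) = pull DA d (dual_lact A a) g"
    using coboundary_pull[OF DA_fdmod(1) u(1,4) X cochainsD(2)[OF h(1)]] h(2) d_Suc by simp
  then show ?thesis
    unfolding coboundaries_iff using cochains_pull[OF h(1) DA_fdmod(3) u(1-3)] by metis
qed

lemma Ext_dual_sel:
  shows "carrier (E X) = cls X ` Cyc X" "\<zero>\<^bsub>E X\<^esub> = Bnd X"
    "f \<in> carrier (Fun X) ==> g \<in> carrier (Fun X) ==> cls X f \<oplus>\<^bsub>E X\<^esub> cls X g = cls X (f \<oplus>\<^bsub>Fun X\<^esub> g)"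
    "c \<in> carrier K ==> f \<in> carrier (Fun X) ==> c \<odot>\<^bsub>E X\<^esub> cls X f = cls X (c \<odot>\<^bsub>Fun X\<^esub> f)"
    "f \<in> carrier (Fun X) ==> a \<in> carrier A ==> ract (E X) (cls X f) a = cls X (pull DA d (dual_lact A a) f)"
proof -
  have E: "E X = with_action (quot_space (Fun X) (Cyc X) (Bnd X))
    (\<lambda>S a. coset_map (Fun X) (Bnd X) (pull DA d (dual_lact A a)) S)"
    by (simp add: Ext_dual_def Ext_quot_space coset_map_cochains Let_def pull_def[abs_def])
  note Q = quot_space_sel[OF Fun_module Bnd_sub]
  show "carrier (E X) = cls X ` Cyc X" "\<zero>\<^bsub>E X\<^esub> = Bnd X"
    by (simp_all add: E with_action_def Q)
  show "f \<in> carrier (Fun X) ==> g \<in> carrier (Fun X) ==> cls X f \<oplus>\<^bsub>E X\<^esub> cls X g = cls X (f \<oplus>\<^bsub>Fun X\<^esub> g)"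
    "c \<in> carrier K ==> f \<in> carrier (Fun X) ==> c \<odot>\<^bsub>E X\<^esub> cls X f = cls X (c \<odot>\<^bsub>Fun X\<^esub> f)"
    by (simp_all add: E with_action_def Q)
  assume f: "f \<in> carrier (Fun X)" and a: "a \<in> carrier A"
  have "coset_map (Fun X) (Bnd X) (pull DA d (dual_lact A a)) (cls X f) = cls X (pull DA d (dual_lact A a) f)"
  proof (rule coset_map_coset[OF Fun_module Bnd_sub Fun_module Bnd_sub])
    fix g h assume "g \<in> carrier (Fun X)" "h \<in> carrier (Fun X)"
    show "pull DA d (dual_lact A a) (g \<oplus>\<^bsub>Fun X\<^esub> h) =
      pull DA d (dual_lact A a) g \<oplus>\<^bsub>Fun X\<^esub> pull DA d (dual_lact A a) h"
      using dual_lact_props(1)[OF a] by (auto simp: fun_space_sel pull_def bar_dom_def fun_eq_iff)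
  qed (use f a pull_Fun pull_Bnd in auto)
  then show "ract (E X) (cls X f) a = cls X (pull DA d (dual_lact A a) f)"
    by (simp add: E with_action_def)
qed

lemma Cyc_Fun: "f \<in> Cyc X ==> f \<in> carrier (Fun X)"
  using subspaceD(2)[OF Cyc_sub] .

text \<open>
  Since \<open>DA\<close> is a bimodule, left multiplication by \<open>a\<close> is an endomorphism of the right module \<open>DA\<close>, so
  precomposing with it preserves cocycles and coboundaries. The axioms are inherited from
  the identities in \<open>dual_lact_props\<close>, evaluated on representatives.
\<close>

lemma Ext_dual_right_module: "right_module K A (E X)"
proof -
  have eq: "carrier (E X) = carrier (quot_space (Fun X) (Cyc X) (Bnd X))"
    by (simp add: Ext_dual_sel(1) quot_space_def)
  have sim: "module K (E X)"
    using quot_space_module(1)[OF Fun_module Bnd_sub Cyc_sub]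
    by (rule module_transfer[where h = "\<lambda>x. x"])
      (auto simp: Ext_dual_def Ext_quot_space with_action_def Let_def
        intro!: module.smult_closed[OF quot_space_module(1)[OF Fun_module Bnd_sub Cyc_sub]]
          abelian_groupE(1,2)[OF module_abelian_group[OF quot_space_module(1)[OF Fun_module Bnd_sub Cyc_sub]]])
  interpret XX: module K X by (rule right_moduleD[OF X])
  interpret A: ring A by (rule A_ring)
  interpret A: module K A by (rule A_module)
  note S = Ext_dual_sel(3-5) and C = Cyc_Fun pull_Fun
  have car: "x \<in> carrier (E X) \<longleftrightarrow> (\<exists>f\<in>Cyc X. x = cls X f)" for x
    by (auto simp: Ext_dual_sel(1))
  have lin: "f (dual_lact A a m \<oplus>\<^bsub>DA\<^esub> dual_lact A b m, as) = f (dual_lact A a m, as) \<oplus>\<^bsub>X\<^esub> f (dual_lact A b m, as)"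
    "c \<in> carrier K ==> f (c \<odot>\<^bsub>DA\<^esub> dual_lact A a m, as) = c \<odot>\<^bsub>X\<^esub> f (dual_lact A a m, as)"
    if f: "f \<in> Cyc X" and a: "a \<in> carrier A" "b \<in> carrier A" and z: "(m, as) \<in> bar_dom A DA d" for f a b m as c
  proof -
    interpret D: module K DA by (rule DA_fdmod)
    have "f \<in> carrier (cochains K A DA X d)" using f by (simp add: cocycles_iff)
    note L = linear_mapsD(3,4)[OF cochainsD(5)[OF this z]]
    have m: "dual_lact A a m \<in> carrier DA" "dual_lact A b m \<in> carrier DA"
      using a bar_domD(1)[OF z] by (auto intro: dual_lact_props)
    show "f (dual_lact A a m \<oplus>\<^bsub>DA\<^esub> dual_lact A b m, as) = f (dual_lact A a m, as) \<oplus>\<^bsub>X\<^esub> f (dual_lact A b m, as)"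
      using L(1)[OF m] m by simp
    show "c \<in> carrier K ==> f (c \<odot>\<^bsub>DA\<^esub> dual_lact A a m, as) = c \<odot>\<^bsub>X\<^esub> f (dual_lact A a m, as)"
      using L(2)[OF _ m(1)] m by simp
  qed
  have feq: "f = g" if "f \<in> extensional (bar_dom A DA d)" "g \<in> extensional (bar_dom A DA d)"
    "\<And>m as. (m, as) \<in> bar_dom A DA d ==> f (m, as) = g (m, as)" for f g :: "_ => 'x"
    by (rule extensionalityI[OF that(1,2)]) (use that(3) in auto)
  have pext: "pull DA d u f \<in> extensional (bar_dom A DA d)" for u and f :: "_ => 'x" by (simp add: pull_def)
  have pz: "(dual_lact A a m, as) \<in> bar_dom A DA d" if "(m, as) \<in> bar_dom A DA d" "a \<in> carrier A" for a m as
    using that dual_lact_props(1) by (auto simp: bar_dom_def)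
  show ?thesis
  proof (rule right_moduleI[OF sim A_module])
    fix x a assume "x \<in> carrier (E X)" and a: "a \<in> carrier A"
    then obtain f where f: "f \<in> Cyc X" "x = cls X f" unfolding car by blast
    then show "ract (E X) x a \<in> carrier (E X)" using a pull_Cyc by (auto simp: car S C)
  next
    fix x y a assume "x \<in> carrier (E X)" "y \<in> carrier (E X)" and a: "a \<in> carrier A"
    then obtain f g where f: "f \<in> Cyc X" "x = cls X f" "g \<in> Cyc X" "y = cls X g" unfolding car by blast
    have "pull DA d (dual_lact A a) (f \<oplus>\<^bsub>Fun X\<^esub> g) = pull DA d (dual_lact A a) f \<oplus>\<^bsub>Fun X\<^esub> pull DA d (dual_lact A a) g"
      by (rule feq) (use a pz in \<open>auto simp: fun_space_sel pull_apply pext[unfolded pull_def] pull_def\<close>)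
    then show "ract (E X) (x \<oplus>\<^bsub>E X\<^esub> y) a = ract (E X) x a \<oplus>\<^bsub>E X\<^esub> ract (E X) y a"
      using f a module.axioms(2)[OF Fun_module] by (simp add: S C abelian_groupE(1)[OF module_abelian_group[OF Fun_module]])
  next
    fix c x a assume c: "c \<in> carrier K" and "x \<in> carrier (E X)" and a: "a \<in> carrier A"
    then obtain f where f: "f \<in> Cyc X" "x = cls X f" unfolding car by blast
    have "pull DA d (dual_lact A a) (c \<odot>\<^bsub>Fun X\<^esub> f) = c \<odot>\<^bsub>Fun X\<^esub> pull DA d (dual_lact A a) f"
      by (rule feq) (use a pz in \<open>auto simp: fun_space_sel pull_def\<close>)
    then show "ract (E X) (c \<odot>\<^bsub>E X\<^esub> x) a = c \<odot>\<^bsub>E X\<^esub> ract (E X) x a"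
      using f a c by (simp add: S C module.smult_closed[OF Fun_module])
    have "pull DA d (dual_lact A (c \<odot>\<^bsub>A\<^esub> a)) f = c \<odot>\<^bsub>Fun X\<^esub> pull DA d (dual_lact A a) f"
    proof (rule feq[OF pext])
      fix m as assume z: "(m, as) \<in> bar_dom A DA d"
      show "pull DA d (dual_lact A (c \<odot>\<^bsub>A\<^esub> a)) f (m, as) = (c \<odot>\<^bsub>Fun X\<^esub> pull DA d (dual_lact A a) f) (m, as)"
        using z by (simp add: fun_space_sel pull_apply dual_lact_props(7)[OF a bar_domD(1)[OF z] c] lin(2)[OF f(1) a a z c])
    qed (simp add: fun_space_sel)
    then show "ract (E X) x (c \<odot>\<^bsub>A\<^esub> a) = c \<odot>\<^bsub>E X\<^esub> ract (E X) x a"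
      using f a c by (simp add: S C)
  next
    fix x assume "x \<in> carrier (E X)"
    then obtain f where f: "f \<in> Cyc X" "x = cls X f" unfolding car by blast
    have "pull DA d (dual_lact A \<one>\<^bsub>A\<^esub>) f = f"
      by (rule feq) (use Cyc_Fun[OF f(1)] in \<open>auto simp: fun_space_sel pull_def PiE_iff dual_lact_props(8)[OF A.one_closed] dest: bar_domD(1)\<close>)
    then show "ract (E X) x \<one>\<^bsub>A\<^esub> = x" using f by (simp add: S C)
  next
    fix x a b assume "x \<in> carrier (E X)" and a: "a \<in> carrier A" "b \<in> carrier A"
    then obtain f where f: "f \<in> Cyc X" "x = cls X f" unfolding car by blast
    have "pull DA d (dual_lact A b) (pull DA d (dual_lact A a) f) = pull DA d (dual_lact A (a \<otimes>\<^bsub>A\<^esub> b)) f"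
      by (rule feq) (use a pz in \<open>auto simp: pull_def dual_lact_props(5) dest: bar_domD(1)\<close>)
    then show "ract (E X) (ract (E X) x a) b = ract (E X) x (a \<otimes>\<^bsub>A\<^esub> b)"
      using f a by (simp add: S C)
    have "pull DA d (dual_lact A (a \<oplus>\<^bsub>A\<^esub> b)) f = pull DA d (dual_lact A a) f \<oplus>\<^bsub>Fun X\<^esub> pull DA d (dual_lact A b) f"
    proof (rule feq[OF pext])
      fix m as assume z: "(m, as) \<in> bar_dom A DA d"
      show "pull DA d (dual_lact A (a \<oplus>\<^bsub>A\<^esub> b)) f (m, as) =
        (pull DA d (dual_lact A a) f \<oplus>\<^bsub>Fun X\<^esub> pull DA d (dual_lact A b) f) (m, as)"
        using z by (simp add: fun_space_sel pull_apply dual_lact_props(6)[OF a(1) bar_domD(1)[OF z] a(2)] lin(1)[OF f(1) a z])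
    qed (simp add: fun_space_sel)
    then show "ract (E X) x (a \<oplus>\<^bsub>A\<^esub> b) = ract (E X) x a \<oplus>\<^bsub>E X\<^esub> ract (E X) x b"
      using f a by (simp add: S C)
  qed
qed

lemma Ext_dual_fin_dim: "fin_dim K X ==> fin_dim K (E X)"
proof -
  assume fdX: "fin_dim K X"
  note Q = quot_space_module[OF Fun_module Bnd_sub Cyc_sub]
  have fdZ: "fin_dim K ((Fun X)\<lparr>carrier := Cyc X\<rparr>)"
    by (rule cochains_fin_dim[OF DA_fdmod(3,2) X fdX Cyc_sub]) (auto simp: cocycles_iff)
  have sel: "carrier (quot_space (Fun X) (Cyc X) (Bnd X)) = carrier (E X)"
    "add (quot_space (Fun X) (Cyc X) (Bnd X)) = add (E X)"
    "smult (quot_space (Fun X) (Cyc X) (Bnd X)) = smult (E X)"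
    by (simp_all add: Ext_dual_def Ext_quot_space with_action_def Let_def)
  have "(\<lambda>f\<in>Cyc X. cls X f) \<in> linear_maps K ((Fun X)\<lparr>carrier := Cyc X\<rparr>) (E X)"
    using Q(2) by (simp add: linear_maps_def sel)
  then show ?thesis
    by (rule fin_dim_surj[OF Q(3) fdZ right_moduleD(1)[OF Ext_dual_right_module]])
      (auto simp: Ext_dual_sel(1))
qed

end

lemma Ext_dual_fdmod: "fdmod X ==> fdmod (E X)"
  by (auto simp: fdmod_def intro: Ext_dual_right_module Ext_dual_fin_dim)

end

section \<open>The functor \<open>\<tau>\<^sup>-\<close> and its powers\<close>

context ext_functor
begin

text \<open>Postcomposition with a morphism, the cochain map that induces \<open>Ext\<^sup>d\<^sub>A(DA, h)\<close>.\<close>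

abbreviation push :: "('x => 'w) => (('a => 'k) \<times> 'a list => 'x) => ('a => 'k) \<times> 'a list => 'w"
  where "push h \<equiv> compose (bar_dom A DA d) h"

context
  fixes X :: "('k, 'a, 'x) rmod" and Y :: "('k, 'a, 'w) rmod"
  assumes X: "right_module K A X" and Y: "right_module K A Y"
begin

lemma push_Fun: "h \<in> Hom K A X Y ==> f \<in> carrier (Fun X) ==> push h f \<in> carrier (Fun Y)"
  using HomD(1)[of h K A X Y] by (auto simp: fun_space_sel compose_def)

lemma push_Cyc:
  assumes h: "h \<in> Hom K A X Y" and f: "f \<in> Cyc X"
  shows "push h f \<in> Cyc Y"
proof -
  have fC: "f \<in> carrier (cochains K A DA X d)" using f by (simp add: cocycles_iff)
  note hD = HomD[OF h]
  have "coboundary A DA Y d (push h f) z = h (coboundary A DA X d f z)" if "z \<in> bar_dom A DA (Suc d)" for z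
    by (rule coboundary_push[OF DA_fdmod(1) X Y hD(1,3,5) cochainsD(2)[OF fC] that]) (auto simp: compose_def)
  then show ?thesis
    using f cochains_push[OF DA_fdmod(3) fC hD(1,3,4)]
      linear_maps_zero[OF right_moduleD(1)[OF X] right_moduleD(1)[OF Y] Hom_linear[OF h]]
    by (simp add: cocycles_iff compose_def)
qed

lemma push_Bnd:
  assumes h: "h \<in> Hom K A X Y" and g: "g \<in> Bnd X"
  shows "push h g \<in> Bnd Y"
proof -
  obtain f where f: "f \<in> carrier (cochains K A DA X (d - 1))" "g = coboundary A DA X (d - 1) f"
    using g coboundaries_iff by blast
  note hD = HomD[OF h]
  let ?f = "\<lambda>z\<in>bar_dom A DA (d - 1). h (f z)"
  have "coboundary A DA Y (d - 1) ?f z = h (g z)" if "z \<in> bar_dom A DA (Suc (d - 1))" for z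
    unfolding f(2)
    by (rule coboundary_push[OF DA_fdmod(1) X Y hD(1,3,5) cochainsD(2)[OF f(1)] that]) auto
  then have val: "coboundary A DA Y (d - 1) ?f z = push h g z" if "z \<in> bar_dom A DA d" for z
    using that unfolding d_Suc by (simp add: compose_def)
  have ext: "coboundary A DA Y (d - 1) ?f \<in> extensional (bar_dom A DA d)"
    unfolding coboundary_def d_Suc by (rule restrict_extensional)
  have "push h g = coboundary A DA Y (d - 1) ?f"
    by (rule extensionalityI[OF compose_extensional ext]) (simp only: val)
  then show ?thesis
    unfolding coboundaries_iff using cochains_push[OF DA_fdmod(3) f(1) hD(1,3,4)] by blast
qed

lemma Ext_dual_map_cls:
  assumes h: "h \<in> Hom K A X Y" and f: "f \<in> Cyc X"
  shows "Ext_dual_map K A d X Y h (cls X f) = cls Y (push h f)"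
proof -
  have "coset_map (Fun Y) (Bnd Y) (push h) (cls X f) = cls Y (push h f)"
  proof (rule coset_map_coset[OF Fun_module[OF X] Bnd_sub[OF X] Fun_module[OF Y] Bnd_sub[OF Y]])
    show "push h (g \<oplus>\<^bsub>Fun X\<^esub> g') = push h g \<oplus>\<^bsub>Fun Y\<^esub> push h g'"
      if "g \<in> carrier (Fun X)" "g' \<in> carrier (Fun X)" for g g'
      using HomD(3)[OF h] that by (auto simp: fun_space_sel compose_def fun_eq_iff PiE_iff)
  qed (use h push_Fun push_Bnd Cyc_Fun[OF X f] in auto)
  then show ?thesis
    using f by (simp add: Ext_dual_map_def Let_def coset_map_cochains Ext_dual_sel(1)[OF X])
qed

lemma Ext_dual_map_ext: "Ext_dual_map K A d X Y h \<in> extensional (carrier (E X))"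
  by (simp add: Ext_dual_map_def Let_def)

lemma Ext_dual_map_Hom:
  assumes h: "h \<in> Hom K A X Y"
  shows "Ext_dual_map K A d X Y h \<in> Hom K A (E X) (E Y)"
proof -
  note S = Ext_dual_sel
  have car: "x \<in> carrier (E X) \<longleftrightarrow> (\<exists>f\<in>Cyc X. x = cls X f)" for x
    by (auto simp: S[OF X])
  note hD = HomD[OF h]
  note mX = subspaceD(4,5)[OF Cyc_sub[OF X]]
  note C = Cyc_Fun[OF X] Cyc_Fun[OF Y] push_Cyc[OF h] push_Fun[OF h]
  show ?thesis
  proof (rule HomI)
    fix x assume "x \<in> carrier (E X)"
    then show "Ext_dual_map K A d X Y h x \<in> carrier (E Y)"
      using push_Cyc[OF h] by (auto simp: car Ext_dual_map_cls[OF h] S(1)[OF Y])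
  next
    fix x y assume "x \<in> carrier (E X)" "y \<in> carrier (E X)"
    then obtain f g where f: "f \<in> Cyc X" "x = cls X f" "g \<in> Cyc X" "y = cls X g" unfolding car by blast
    have "push h (f \<oplus>\<^bsub>Fun X\<^esub> g) = push h f \<oplus>\<^bsub>Fun Y\<^esub> push h g"
      using hD(3) C(1)[OF f(1)] C(1)[OF f(3)] by (auto simp: fun_space_sel compose_def fun_eq_iff PiE_iff)
    then show "Ext_dual_map K A d X Y h (x \<oplus>\<^bsub>E X\<^esub> y) = Ext_dual_map K A d X Y h x \<oplus>\<^bsub>E Y\<^esub> Ext_dual_map K A d X Y h y"
      using f mX(1)[OF f(1,3)] by (simp add: S(3)[OF X] S(3)[OF Y] C Ext_dual_map_cls[OF h])
  next
    fix c x assume c: "c \<in> carrier K" and "x \<in> carrier (E X)"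
    then obtain f where f: "f \<in> Cyc X" "x = cls X f" unfolding car by blast
    have "push h (c \<odot>\<^bsub>Fun X\<^esub> f) = c \<odot>\<^bsub>Fun Y\<^esub> push h f"
      using hD(4)[OF c] C(1)[OF f(1)] by (auto simp: fun_space_sel compose_def fun_eq_iff PiE_iff)
    then show "Ext_dual_map K A d X Y h (c \<odot>\<^bsub>E X\<^esub> x) = c \<odot>\<^bsub>E Y\<^esub> Ext_dual_map K A d X Y h x"
      using f c mX(2)[OF c f(1)] by (simp add: S(4)[OF X] S(4)[OF Y] C Ext_dual_map_cls[OF h])
  next
    fix x a assume "x \<in> carrier (E X)" and a: "a \<in> carrier A"
    then obtain f where f: "f \<in> Cyc X" "x = cls X f" unfolding car by blast
    have "push h (pull DA d (dual_lact A a) f) = pull DA d (dual_lact A a) (push h f)"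
      using dual_lact_props(1)[OF a] by (auto simp: pull_def compose_def fun_eq_iff bar_dom_def)
    then show "Ext_dual_map K A d X Y h (ract (E X) x a) = ract (E Y) (Ext_dual_map K A d X Y h x) a"
      using f a by (simp add: S(5)[OF X] S(5)[OF Y] C Ext_dual_map_cls[OF h] pull_Cyc[OF X])
  qed (rule Ext_dual_map_ext)
qed

lemma Ext_dual_map_linear:
  assumes h: "h \<in> Hom K A X Y" "h' \<in> Hom K A X Y" and c: "c \<in> carrier K"
  shows "Ext_dual_map K A d X Y (h \<oplus>\<^bsub>hom_space K A X Y\<^esub> h') =
      Ext_dual_map K A d X Y h \<oplus>\<^bsub>hom_space K A (E X) (E Y)\<^esub> Ext_dual_map K A d X Y h'"
    "Ext_dual_map K A d X Y (c \<odot>\<^bsub>hom_space K A X Y\<^esub> h) =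
      c \<odot>\<^bsub>hom_space K A (E X) (E Y)\<^esub> Ext_dual_map K A d X Y h"
proof -
  interpret H: module K "hom_space K A X Y" by (rule hom_space_module[OF X Y])
  interpret H': module K "hom_space K A (E X) (E Y)"
    by (rule hom_space_module[OF Ext_dual_right_module[OF X] Ext_dual_right_module[OF Y]])
  have hh: "h \<oplus>\<^bsub>hom_space K A X Y\<^esub> h' \<in> Hom K A X Y" "c \<odot>\<^bsub>hom_space K A X Y\<^esub> h \<in> Hom K A X Y"
    using H.M.a_closed[of h h'] H.smult_closed[OF c, of h] h by simp_all
  note EH = Ext_dual_map_Hom
  have EE: "Ext_dual_map K A d X Y h \<oplus>\<^bsub>hom_space K A (E X) (E Y)\<^esub> Ext_dual_map K A d X Y h' \<in> Hom K A (E X) (E Y)"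
    "c \<odot>\<^bsub>hom_space K A (E X) (E Y)\<^esub> Ext_dual_map K A d X Y h \<in> Hom K A (E X) (E Y)"
    using H'.M.a_closed[of "Ext_dual_map K A d X Y h" "Ext_dual_map K A d X Y h'"]
      H'.smult_closed[OF c, of "Ext_dual_map K A d X Y h"] EH h by simp_all
  note F = Cyc_Fun[OF X] push_Fun
  show "Ext_dual_map K A d X Y (h \<oplus>\<^bsub>hom_space K A X Y\<^esub> h') =
      Ext_dual_map K A d X Y h \<oplus>\<^bsub>hom_space K A (E X) (E Y)\<^esub> Ext_dual_map K A d X Y h'"
  proof (rule Hom_eqI[OF EH[OF hh(1)] EE(1)])
    fix x assume x: "x \<in> carrier (E X)"
    then obtain f where f: "f \<in> Cyc X" "x = cls X f" by (auto simp: Ext_dual_sel(1)[OF X])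
    have "push (h \<oplus>\<^bsub>hom_space K A X Y\<^esub> h') f = push h f \<oplus>\<^bsub>Fun Y\<^esub> push h' f"
      using F(1)[OF f(1)] by (auto simp: fun_space_sel compose_def fun_eq_iff PiE_iff)
    then show "Ext_dual_map K A d X Y (h \<oplus>\<^bsub>hom_space K A X Y\<^esub> h') x =
      (Ext_dual_map K A d X Y h \<oplus>\<^bsub>hom_space K A (E X) (E Y)\<^esub> Ext_dual_map K A d X Y h') x"
      using f x h hh F Ext_dual_map_cls by (simp add: Ext_dual_sel(3)[OF Y])
  qed
  show "Ext_dual_map K A d X Y (c \<odot>\<^bsub>hom_space K A X Y\<^esub> h) =
      c \<odot>\<^bsub>hom_space K A (E X) (E Y)\<^esub> Ext_dual_map K A d X Y h"
  proof (rule Hom_eqI[OF EH[OF hh(2)] EE(2)])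
    fix x assume x: "x \<in> carrier (E X)"
    then obtain f where f: "f \<in> Cyc X" "x = cls X f" by (auto simp: Ext_dual_sel(1)[OF X])
    have "push (c \<odot>\<^bsub>hom_space K A X Y\<^esub> h) f = c \<odot>\<^bsub>Fun Y\<^esub> push h f"
      using F(1)[OF f(1)] by (auto simp: fun_space_sel compose_def fun_eq_iff PiE_iff)
    then show "Ext_dual_map K A d X Y (c \<odot>\<^bsub>hom_space K A X Y\<^esub> h) x =
      (c \<odot>\<^bsub>hom_space K A (E X) (E Y)\<^esub> Ext_dual_map K A d X Y h) x"
      using f x h hh c F Ext_dual_map_cls by (simp add: Ext_dual_sel(4)[OF Y])
  qed
qed

end

lemma Ext_dual_map_compose:
  assumes X: "right_module K A X" and Y: "right_module K A Y" and Z: "right_module K A Z"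
    and g: "g \<in> Hom K A X Y" and h: "h \<in> Hom K A Y Z"
  shows "Ext_dual_map K A d X Z (compose (carrier X) h g) =
    compose (carrier (E X)) (Ext_dual_map K A d Y Z h) (Ext_dual_map K A d X Y g)"
proof (rule Hom_eqI)
  note hg = compose_Hom[OF X g h]
  show "Ext_dual_map K A d X Z (compose (carrier X) h g) \<in> Hom K A (E X) (E Z)"
    by (rule Ext_dual_map_Hom[OF X Z hg])
  show "compose (carrier (E X)) (Ext_dual_map K A d Y Z h) (Ext_dual_map K A d X Y g) \<in> Hom K A (E X) (E Z)"
    by (rule compose_Hom[OF Ext_dual_right_module[OF X] Ext_dual_map_Hom[OF X Y g] Ext_dual_map_Hom[OF Y Z h]])
  fix x assume x: "x \<in> carrier (E X)"
  then obtain f where f: "f \<in> Cyc X" "x = cls X f" by (auto simp: Ext_dual_sel(1)[OF X])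
  have "push (compose (carrier X) h g) f = push h (push g f)"
    using Cyc_Fun[OF X f(1)] by (auto simp: fun_space_sel compose_def fun_eq_iff PiE_iff)
  then show "Ext_dual_map K A d X Z (compose (carrier X) h g) x =
      compose (carrier (E X)) (Ext_dual_map K A d Y Z h) (Ext_dual_map K A d X Y g) x"
    using x f by (simp add: compose_eq Ext_dual_map_cls[OF X Z hg] Ext_dual_map_cls[OF X Y g]
      Ext_dual_map_cls[OF Y Z h] push_Cyc[OF X Y g])
qed

lemma Ext_dual_map_id:
  assumes X: "right_module K A X"
  shows "Ext_dual_map K A d X X (id_map X) = id_map (E X)"
proof (rule Hom_eqI[OF Ext_dual_map_Hom[OF X X id_Hom[OF X]] id_Hom[OF Ext_dual_right_module[OF X]]])
  fix x assume x: "x \<in> carrier (E X)"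
  then obtain f where f: "f \<in> Cyc X" "x = cls X f" by (auto simp: Ext_dual_sel(1)[OF X])
  have "push (id_map X) f = f"
    using Cyc_Fun[OF X f(1)] by (auto simp: fun_space_sel compose_def fun_eq_iff PiE_iff extensional_def)
  then show "Ext_dual_map K A d X X (id_map X) x = id_map (E X) x"
    using x f by (simp add: Ext_dual_map_cls[OF X X id_Hom[OF X]])
qed

abbreviation \<tau> :: "('k, 'a, 'x) rmod => ('k, 'a, 'k vec) rmod" where "\<tau> X \<equiv> tau K A d X"
abbreviation \<tau>map :: "('k, 'a, 'x) rmod => ('k, 'a, 'w) rmod => ('x => 'w) => 'k vec => 'k vec"
  where "\<tau>map X Y h \<equiv> tau_map K A d X Y h"

lemma tau_fdmod: "fdmod X ==> fdmod (\<tau> X)"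
  unfolding tau_def by (intro fdmod_coord(1) Ext_dual_fdmod)

lemma tau_map_Hom:
  assumes "fdmod X" "fdmod Y" "h \<in> Hom K A X Y"
  shows "\<tau>map X Y h \<in> Hom K A (\<tau> X) (\<tau> Y)"
  unfolding tau_def tau_map_def
  by (intro std_map_Hom Ext_dual_fdmod Ext_dual_map_Hom fdmodD(1) assms)

lemma tau_map_compose:
  assumes "fdmod X" "fdmod Y" "fdmod Z" "g \<in> Hom K A X Y" "h \<in> Hom K A Y Z"
  shows "\<tau>map X Z (compose (carrier X) h g) = compose (carrier (\<tau> X)) (\<tau>map Y Z h) (\<tau>map X Y g)"
  unfolding tau_def tau_map_def Ext_dual_map_compose[OF assms(1-3)[THEN fdmodD(1)] assms(4,5)]
  by (intro std_map_compose Ext_dual_fdmod Ext_dual_map_Hom fdmodD(1) assms)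

lemma tau_map_id: "fdmod X ==> \<tau>map X X (id_map X) = id_map (\<tau> X)"
  by (simp add: tau_def tau_map_def Ext_dual_map_id fdmodD(1) std_map_id Ext_dual_fdmod)

lemma tau_map_linear:
  assumes "fdmod X" "fdmod Y" "h \<in> Hom K A X Y" "h' \<in> Hom K A X Y" "c \<in> carrier K"
  shows "\<tau>map X Y (h \<oplus>\<^bsub>hom_space K A X Y\<^esub> h') = \<tau>map X Y h \<oplus>\<^bsub>hom_space K A (\<tau> X) (\<tau> Y)\<^esub> \<tau>map X Y h'"
    "\<tau>map X Y (c \<odot>\<^bsub>hom_space K A X Y\<^esub> h) = c \<odot>\<^bsub>hom_space K A (\<tau> X) (\<tau> Y)\<^esub> \<tau>map X Y h"
proof -
  note e = Ext_dual_map_Hom[OF assms(1,2)[THEN fdmodD(1)]]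
  show "\<tau>map X Y (h \<oplus>\<^bsub>hom_space K A X Y\<^esub> h') = \<tau>map X Y h \<oplus>\<^bsub>hom_space K A (\<tau> X) (\<tau> Y)\<^esub> \<tau>map X Y h'"
    unfolding tau_def tau_map_def Ext_dual_map_linear(1)[OF assms(1,2)[THEN fdmodD(1)] assms(3-5)]
    by (rule std_map_linear(1)[OF assms(1,2)[THEN Ext_dual_fdmod] e[OF assms(3)] e[OF assms(4)] assms(5)])
  show "\<tau>map X Y (c \<odot>\<^bsub>hom_space K A X Y\<^esub> h) = c \<odot>\<^bsub>hom_space K A (\<tau> X) (\<tau> Y)\<^esub> \<tau>map X Y h"
    unfolding tau_def tau_map_def Ext_dual_map_linear(2)[OF assms(1,2)[THEN fdmodD(1)] assms(3-5)]
    by (rule std_map_linear(2)[OF assms(1,2)[THEN Ext_dual_fdmod] e[OF assms(3)] e[OF assms(4)] assms(5)])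
qed

abbreviation T :: "nat => ('k, 'a, 'k vec) rmod => ('k, 'a, 'k vec) rmod"
  where "T i X \<equiv> tau_pow K A d i X"
abbreviation Tm :: "nat => ('k, 'a, 'k vec) rmod => ('k, 'a, 'k vec) rmod =>
    ('k vec => 'k vec) => 'k vec => 'k vec"
  where "Tm i X Y h \<equiv> tau_pow_map K A d i X Y h"

lemma T_0 [simp]: "T 0 X = X" and T_Suc: "T (Suc i) X = \<tau> (T i X)"
  by (simp_all add: tau_pow_def)

lemma T_add: "T i (T j X) = T (i + j) X"
  by (simp add: tau_pow_def funpow_add)

lemma T_fdmod: "fdmod X ==> fdmod (T i X)"
  by (induction i) (simp_all add: T_Suc tau_fdmod)

lemma Tm_Hom: "fdmod X ==> fdmod Y ==> h \<in> Hom K A X Y ==> Tm i X Y h \<in> Hom K A (T i X) (T i Y)"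
  by (induction i) (simp_all add: T_Suc tau_map_Hom T_fdmod)

lemma Tm_compose:
  assumes "fdmod X" "fdmod Y" "fdmod Z" "g \<in> Hom K A X Y" "h \<in> Hom K A Y Z"
  shows "Tm i X Z (compose (carrier X) h g) = compose (carrier (T i X)) (Tm i Y Z h) (Tm i X Y g)"
  by (induction i) (simp_all add: T_Suc assms T_fdmod Tm_Hom tau_map_compose)

lemma Tm_id: "fdmod X ==> Tm i X X (id_map X) = id_map (T i X)"
  by (induction i) (simp_all add: T_Suc tau_map_id T_fdmod)

lemma Tm_linear:
  assumes "fdmod X" "fdmod Y" "h \<in> Hom K A X Y" "h' \<in> Hom K A X Y" "c \<in> carrier K"
  shows "Tm i X Y (h \<oplus>\<^bsub>hom_space K A X Y\<^esub> h') = Tm i X Y h \<oplus>\<^bsub>hom_space K A (T i X) (T i Y)\<^esub> Tm i X Y h'"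
    "Tm i X Y (c \<odot>\<^bsub>hom_space K A X Y\<^esub> h) = c \<odot>\<^bsub>hom_space K A (T i X) (T i Y)\<^esub> Tm i X Y h"
  by (induction i)
    (simp_all add: T_Suc assms tau_map_linear[OF T_fdmod[OF assms(1)] T_fdmod[OF assms(2)]
      Tm_Hom[OF assms(1,2,3)] Tm_Hom[OF assms(1,2,4)] assms(5)])

lemma hom_space_zero_smult:
  assumes "right_module K A X" "right_module K A Y" "h \<in> Hom K A X Y"
  shows "\<zero> \<odot>\<^bsub>hom_space K A X Y\<^esub> h = zero_map X Y"
  using module.smult_l_null[OF hom_space_module[OF assms(1,2)], of h] assms(3) by simp

lemma zero_map_Hom: "right_module K A X ==> right_module K A Y ==> zero_map X Y \<in> Hom K A X Y"
  using abelian_groupE(2)[OF module_abelian_group[OF hom_space_module]] by simp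

lemma Tm_zero:
  assumes "fdmod X" "fdmod Y"
  shows "Tm i X Y (zero_map X Y) = zero_map (T i X) (T i Y)"
proof -
  note z = zero_map_Hom[OF assms[THEN fdmodD(1)]]
  show ?thesis
    using Tm_linear(2)[OF assms z z K.zero_closed, of i]
      hom_space_zero_smult[OF assms[THEN fdmodD(1)] z]
      hom_space_zero_smult[OF fdmodD(1)[OF T_fdmod] fdmodD(1)[OF T_fdmod] Tm_Hom[OF assms z], OF assms]
    by simp
qed

lemma Tm_add: "Tm i (T j X) (T j Y) (Tm j X Y h) = Tm (i + j) X Y h"
  by (induction i) (simp_all add: T_add)

lemma Tm_finsum:
  assumes "fdmod X" "fdmod Y" "\<And>j. j \<in> J ==> f j \<in> Hom K A X Y"
  shows "Tm i X Y (finsum (hom_space K A X Y) f J) = finsum (hom_space K A (T i X) (T i Y)) (\<lambda>j. Tm i X Y (f j)) J"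
  by (rule finsum_additive[where h = "Tm i X Y"])
    (use assms Tm_Hom Tm_linear(1)[OF assms(1,2) _ _ K.one_closed] in
      \<open>auto intro!: module_abelian_group hom_space_module fdmodD(1) T_fdmod\<close>)

end

section \<open>Injective modules are annihilated by \<open>\<tau>\<^sup>-\<close>\<close>

context fd_alg
begin

text \<open>
  The embedding of an injective module \<open>X\<close> into the coinduced module \<open>Hom\<^sub>K(A, X)\<close> splits. The
  retraction takes the place of a contracting homotopy of the bar construction.
\<close>

lemma injective_retraction:
  fixes X :: "('k, 'a, 'k vec) rmod"
  assumes X: "fdmod X" and inj: "injective K A X"
  shows "\<exists>r\<in>Hom K A (coind X) X. \<forall>x\<in>carrier X. r (\<lambda>a\<in>carrier A. ract X x a) = x"
proof -
  note rX = fdmodD(1)[OF X]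
  note XD = right_moduleD[OF rX] right_moduleD_scalar[OF rX A_module]
  interpret X: module K X by (rule XD)
  interpret A: ring A by (rule A_ring)
  have C: "fdmod (coind X)" unfolding fdmod_def using coind_fdmod[OF fdmodD(3,2)[OF X]] by simp
  define \<eta> where "\<eta> = (\<lambda>x\<in>carrier X. \<lambda>a\<in>carrier A. ract X x a)"
  have \<eta>c: "\<eta> x \<in> carrier (coind X)" if "x \<in> carrier X" for x
    unfolding coind_sel using that XD by (intro linear_mapsI) (auto simp: \<eta>_def A.a_closed module.smult_closed[OF A_module])
  have \<eta>: "\<eta> \<in> Hom K A X (coind X)"
    by (rule HomI) (use \<eta>c in \<open>auto simp: \<eta>_def coind_sel(3-5) XD\<close>)
  let ?N = "std_module K (coind X)"
  note co = coord_unstd[OF C]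
  define g where "g = compose (carrier X) (coord K (coind X)) \<eta>"
  have g: "g \<in> Hom K A X ?N" unfolding g_def by (rule compose_Hom[OF rX \<eta> co(1)])
  have "inj_on g (carrier X)"
  proof (rule inj_onI)
    fix x y assume x: "x \<in> carrier X" "y \<in> carrier X" "g x = g y"
    then have "coord K (coind X) (\<eta> x) = coord K (coind X) (\<eta> y)" by (simp add: g_def compose_eq)
    then have "\<eta> x = \<eta> y" using unstd_coord(1)[OF C] \<eta>c x by metis
    then have "\<eta> x \<one>\<^bsub>A\<^esub> = \<eta> y \<one>\<^bsub>A\<^esub>" by simp
    then show "x = y" using x by (simp add: \<eta>_def XD)
  qed
  then obtain r0 where r0: "r0 \<in> Hom K A ?N X" "compose (carrier X) r0 g = id_map X"
    using inj[unfolded injective_def, rule_format, of X ?N g "id_map X"]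
      fdmod_fg[OF X] fdmod_fg[OF fdmod_coord(1)[OF C]] g id_Hom[OF rX] by blast
  let ?r = "compose (carrier (coind X)) r0 (coord K (coind X))"
  show ?thesis
  proof (intro bexI[of _ ?r] ballI)
    show "?r \<in> Hom K A (coind X) X" by (rule compose_Hom[OF fdmodD(1)[OF C] co(1) r0(1)])
    fix x assume x: "x \<in> carrier X"
    have "?r (\<eta> x) = r0 (g x)" using x \<eta>c[OF x] by (simp add: g_def compose_eq)
    also have "\<dots> = x" using fun_cong[OF r0(2), of x] x by (simp add: compose_eq)
    finally show "?r (\<lambda>a\<in>carrier A. ract X x a) = x" using x by (simp add: \<eta>_def)
  qed
qed

lemma cochain_curry:
  assumes M: "module K M" and X: "right_module K A X" and f: "f \<in> carrier (cochains K A M X (Suc e))"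
  shows "(\<lambda>(m, as)\<in>bar_dom A M e. \<lambda>a\<in>carrier A. f (m, as @ [a])) \<in> carrier (cochains K A M (coind X) e)"
    (is "?\<phi> \<in> _")
proof -
  interpret M: module K M by (rule M)
  interpret X: module K X by (rule right_moduleD[OF X])
  interpret A: module K A by (rule A_module)
  have ext: "(m, as @ [a]) \<in> bar_dom A M (Suc e)" if "(m, as) \<in> bar_dom A M e" "a \<in> carrier A" for m as a
    using that by (auto simp: bar_dom_def)
  show ?thesis
  proof (rule cochainsI)
    fix m as assume z: "(m, as) \<in> bar_dom A M e"
    have "(\<lambda>a\<in>carrier A. f (m, (as @ [\<zero>\<^bsub>A\<^esub>])[e := a])) \<in> linear_maps K A X"
      by (rule cochainsD(6)[OF f ext[OF z]]) auto
    moreover have "(as @ [\<zero>\<^bsub>A\<^esub>])[e := a] = as @ [a]" for a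
      using bar_domD(3)[OF z] by (metis list_update_length)
    ultimately show "?\<phi> (m, as) \<in> carrier (coind X)" using z by (simp add: coind_sel)
    show "(\<lambda>m'\<in>carrier M. ?\<phi> (m', as)) \<in> linear_maps K M (coind X)"
    proof (rule linear_mapsI)
      fix m' assume m': "m' \<in> carrier M"
      note z' = bar_dom_change(1)[OF z m']
      have "(\<lambda>a\<in>carrier A. f (m', (as @ [\<zero>\<^bsub>A\<^esub>])[e := a])) \<in> linear_maps K A X"
        by (rule cochainsD(6)[OF f ext[OF z']]) auto
      moreover have "(as @ [\<zero>\<^bsub>A\<^esub>])[e := a] = as @ [a]" for a
        using bar_domD(3)[OF z] by (metis list_update_length)
      ultimately show "(\<lambda>m'\<in>carrier M. ?\<phi> (m', as)) m' \<in> carrier (coind X)"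
        using z' m' by (simp add: coind_sel)
    next
      fix x y assume xy: "x \<in> carrier M" "y \<in> carrier M"
      have "f (x \<oplus>\<^bsub>M\<^esub> y, as @ [a]) = f (x, as @ [a]) \<oplus>\<^bsub>X\<^esub> f (y, as @ [a])" if "a \<in> carrier A" for a
        using linear_mapsD(3)[OF cochainsD(5)[OF f ext[OF z that]] xy] xy by simp
      then show "(\<lambda>m'\<in>carrier M. ?\<phi> (m', as)) (x \<oplus>\<^bsub>M\<^esub> y) =
        (\<lambda>m'\<in>carrier M. ?\<phi> (m', as)) x \<oplus>\<^bsub>coind X\<^esub> (\<lambda>m'\<in>carrier M. ?\<phi> (m', as)) y"
        using xy bar_dom_change(1)[OF z] by (simp add: coind_sel) (auto intro!: restrict_ext)
    next
      fix c x assume c: "c \<in> carrier K" and x: "x \<in> carrier M"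
      have "f (c \<odot>\<^bsub>M\<^esub> x, as @ [a]) = c \<odot>\<^bsub>X\<^esub> f (x, as @ [a])" if "a \<in> carrier A" for a
        using linear_mapsD(4)[OF cochainsD(5)[OF f ext[OF z that]] c x] c x by simp
      then show "(\<lambda>m'\<in>carrier M. ?\<phi> (m', as)) (c \<odot>\<^bsub>M\<^esub> x) = c \<odot>\<^bsub>coind X\<^esub> (\<lambda>m'\<in>carrier M. ?\<phi> (m', as)) x"
        using c x bar_dom_change(1)[OF z] by (simp add: coind_sel) (auto intro!: restrict_ext)
    qed auto
    fix i assume i: "i < e"
    have up: "as[i := b] @ [a] = (as @ [a])[i := b]" for a b
      using i bar_domD(3)[OF z] by (simp add: list_update_append)
    show "(\<lambda>b\<in>carrier A. ?\<phi> (m, as[i := b])) \<in> linear_maps K A (coind X)"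
    proof (rule linear_mapsI)
      fix b assume b: "b \<in> carrier A"
      note z' = bar_dom_change(2)[OF z b, of i]
      have "(\<lambda>a\<in>carrier A. f (m, (as[i := b] @ [\<zero>\<^bsub>A\<^esub>])[e := a])) \<in> linear_maps K A X"
        by (rule cochainsD(6)[OF f ext[OF z']]) auto
      moreover have "(as[i := b] @ [\<zero>\<^bsub>A\<^esub>])[e := a] = as[i := b] @ [a]" for a
        using bar_domD(3)[OF z'] by (metis list_update_length)
      ultimately show "(\<lambda>b\<in>carrier A. ?\<phi> (m, as[i := b])) b \<in> carrier (coind X)"
        using z' b by (simp add: coind_sel)
    next
      fix x y assume xy: "x \<in> carrier A" "y \<in> carrier A"
      have "f (m, as[i := x \<oplus>\<^bsub>A\<^esub> y] @ [a]) = f (m, as[i := x] @ [a]) \<oplus>\<^bsub>X\<^esub> f (m, as[i := y] @ [a])"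
        if "a \<in> carrier A" for a
        using linear_mapsD(3)[OF cochainsD(6)[OF f ext[OF z that], of i] xy] xy i unfolding up by simp
      then show "(\<lambda>b\<in>carrier A. ?\<phi> (m, as[i := b])) (x \<oplus>\<^bsub>A\<^esub> y) =
        (\<lambda>b\<in>carrier A. ?\<phi> (m, as[i := b])) x \<oplus>\<^bsub>coind X\<^esub> (\<lambda>b\<in>carrier A. ?\<phi> (m, as[i := b])) y"
        using xy bar_dom_change(2)[OF z] by (simp add: coind_sel) (auto intro!: restrict_ext)
    next
      fix c x assume c: "c \<in> carrier K" and x: "x \<in> carrier A"
      have "f (m, as[i := c \<odot>\<^bsub>A\<^esub> x] @ [a]) = c \<odot>\<^bsub>X\<^esub> f (m, as[i := x] @ [a])" if "a \<in> carrier A" for a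
        using linear_mapsD(4)[OF cochainsD(6)[OF f ext[OF z that], of i] c x] c x i unfolding up by simp
      then show "(\<lambda>b\<in>carrier A. ?\<phi> (m, as[i := b])) (c \<odot>\<^bsub>A\<^esub> x) =
        c \<odot>\<^bsub>coind X\<^esub> (\<lambda>b\<in>carrier A. ?\<phi> (m, as[i := b])) x"
        using c x bar_dom_change(2)[OF z] by (simp add: coind_sel) (auto intro!: restrict_ext)
    qed auto
  qed auto
qed

text \<open>
  Regarding the last argument of a cocycle \<open>f\<close> as a parameter gives a cochain \<open>\<phi>\<close> with values in the
  coinduced module, and the cocycle condition for \<open>f\<close> says that the coboundary of \<open>\<phi>\<close> is \<open>f\<close>,
  embedded into the coinduced module, up to sign.
\<close>

lemma coboundary_curry:
  fixes M :: "('k, 'a, 'm) rmod" and X :: "('k, 'a, 'x) rmod"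
  assumes M: "right_module K A M" and X: "right_module K A X" "fin_dim K X"
    and fC: "f \<in> carrier (cochains K A M X (Suc e))"
    and cocycle: "\<And>z. z \<in> bar_dom A M (Suc (Suc e)) ==> coboundary A M X (Suc e) f z = \<zero>\<^bsub>X\<^esub>"
    and z: "z \<in> bar_dom A M (Suc e)"
  defines "\<phi> \<equiv> (\<lambda>(m, as)\<in>bar_dom A M e. \<lambda>a\<in>carrier A. f (m, as @ [a]))"
  shows "coboundary A M (coind X) e \<phi> z = (\<lambda>a\<in>carrier A. ract X (signed X (Suc e) (f z)) a)"
proof -
  let ?C = "coind X"
  note XD = right_moduleD[OF X(1)]
  interpret X: module K X by (rule XD)
  interpret A: ring A by (rule A_ring)
  have rC: "right_module K A ?C" using coind_fdmod[OF XD(1) X(2)] by simp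
  interpret C: module K ?C by (rule right_moduleD[OF rC])
  note ab = C.M.abelian_group_axioms X.M.abelian_group_axioms
  have \<phi>: "\<phi> \<in> carrier (cochains K A M ?C e)"
    unfolding \<phi>_def by (rule cochain_curry[OF right_moduleD(1)[OF M] X(1) fC])
  obtain m as where mas: "z = (m, as)" by fastforce
  note zz = z[unfolded mas]
  note fc = bar_dom_faces[OF zz A_monoid M]
  have len: "length as = Suc e" and ne: "as \<noteq> []" using bar_domD(3)[OF zz] by auto
  define s where "s i = signed ?C (Suc i) (\<phi> (m, take i as @ (as ! i \<otimes>\<^bsub>A\<^esub> as ! Suc i) # drop (i + 2) as))" for i
  have sC: "s i \<in> carrier ?C" if "i < e" for i
    using cochainsD(4)[OF \<phi> fc(2)[OF that]] by (auto simp: s_def intro!: signed_closed ab)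
  have \<phi>0: "\<phi> (ract M m (hd as), tl as) \<in> carrier ?C" and \<phi>1: "\<phi> (m, butlast as) \<in> carrier ?C"
    using cochainsD(4)[OF \<phi>] fc by auto
  have \<phi>1': "ract ?C (\<phi> (m, butlast as)) (last as) \<in> carrier ?C"
    by (rule right_moduleD(2)[OF rC \<phi>1 fc(4)])
  have cb: "coboundary A M ?C e \<phi> z = \<phi> (ract M m (hd as), tl as) \<oplus>\<^bsub>?C\<^esub> (\<Oplus>\<^bsub>?C\<^esub>i\<in>{..<e}. s i)
    \<oplus>\<^bsub>?C\<^esub> signed ?C (Suc e) (ract ?C (\<phi> (m, butlast as)) (last as))"
    using zz unfolding mas coboundary_def s_def by simp
  have cbC: "coboundary A M ?C e \<phi> z \<in> carrier ?C"
    by (rule coboundary_closed[OF M rC cochainsD(2)[OF \<phi>] z])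
  have main: "coboundary A M ?C e \<phi> z a = ract X (signed X (Suc e) (f z)) a" if a: "a \<in> carrier A" for a
  proof -
    have ev: "u a \<in> carrier X" "(u \<oplus>\<^bsub>?C\<^esub> v) a = u a \<oplus>\<^bsub>X\<^esub> v a" if "u \<in> carrier ?C" "v \<in> carrier ?C" for u v
      using that a linear_mapsD(1)[of u K A X] by (auto simp: coind_sel)
    have evs: "signed ?C i u a = signed X i (u a)" if "u \<in> carrier ?C" for i u
      by (rule signed_additive[OF ab, where h = "\<lambda>u. u a"]) (use ev that in auto)
    have za: "(m, as @ [a]) \<in> bar_dom A M (Suc (Suc e))" using zz a by (auto simp: bar_dom_def)
    note fa = bar_dom_faces[OF za A_monoid M]
    define t where "t i = signed X (Suc i) (f (m, take i (as @ [a]) @ ((as @ [a]) ! i \<otimes>\<^bsub>A\<^esub> (as @ [a]) ! Suc i) # drop (i + 2) (as @ [a])))" for i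
    have tC: "t i \<in> carrier X" if "i < Suc e" for i
      using cochainsD(4)[OF fC fa(2)[OF that]] by (auto simp: t_def intro!: signed_closed ab)
    have st: "s i a = t i" if i: "i < e" for i
    proof -
      have "take i as @ (as ! i \<otimes>\<^bsub>A\<^esub> as ! Suc i) # drop (i + 2) as @ [a] =
        take i (as @ [a]) @ ((as @ [a]) ! i \<otimes>\<^bsub>A\<^esub> (as @ [a]) ! Suc i) # drop (i + 2) (as @ [a])"
        using i len by (simp add: nth_append)
      moreover have "s i a = signed X (Suc i) (\<phi> (m, take i as @ (as ! i \<otimes>\<^bsub>A\<^esub> as ! Suc i) # drop (i + 2) as) a)"
        unfolding s_def by (rule evs[OF cochainsD(4)[OF \<phi> fc(2)[OF i]]])
      ultimately show ?thesis using fc(2)[OF i] a by (simp add: \<phi>_def t_def)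
    qed
    have te: "t e = signed X (Suc e) (ract ?C (\<phi> (m, butlast as)) (last as) a)"
    proof -
      have "take e (as @ [a]) @ ((as @ [a]) ! e \<otimes>\<^bsub>A\<^esub> (as @ [a]) ! Suc e) # drop (e + 2) (as @ [a]) =
        butlast as @ [last as \<otimes>\<^bsub>A\<^esub> a]"
        using len ne by (simp add: nth_append butlast_conv_take last_conv_nth)
      then show ?thesis using fc(3,4) a by (simp add: t_def coind_sel(5) \<phi>_def)
    qed
    have hdtl: "\<phi> (ract M m (hd as), tl as) a = f (ract M m (hd (as @ [a])), tl (as @ [a]))"
      using fc(1) a ne by (simp add: \<phi>_def)
    have fin: "(\<Oplus>\<^bsub>?C\<^esub>i\<in>{..<e}. s i) a = (\<Oplus>\<^bsub>X\<^esub>i\<in>{..<e}. t i)"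
    proof -
      have "(\<Oplus>\<^bsub>?C\<^esub>i\<in>{..<e}. s i) a = (\<Oplus>\<^bsub>X\<^esub>i\<in>{..<e}. s i a)"
        by (rule finsum_pointwise[OF ab]) (use ev sC in auto)
      also have "\<dots> = (\<Oplus>\<^bsub>X\<^esub>i\<in>{..<e}. t i)" using st tC by (intro X.M.finsum_cong') auto
      finally show ?thesis .
    qed
    have S: "(\<Oplus>\<^bsub>?C\<^esub>i\<in>{..<e}. s i) \<in> carrier ?C" using sC by (intro C.M.finsum_closed) auto
    define u v w x where "u = f (ract M m (hd (as @ [a])), tl (as @ [a]))" and "v = (\<Oplus>\<^bsub>X\<^esub>i\<in>{..<e}. t i)"
      and "w = t e" and "x = signed X (Suc (Suc e)) (ract X (f z) a)"
    have uvwx: "u \<in> carrier X" "v \<in> carrier X" "w \<in> carrier X" "x \<in> carrier X"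
      using cochainsD(4)[OF fC fa(1)] tC cochainsD(4)[OF fC z] a XD(2)
      by (auto simp: u_def v_def w_def x_def intro!: X.M.finsum_closed signed_closed ab)
    have lhs: "coboundary A M ?C e \<phi> z a = u \<oplus>\<^bsub>X\<^esub> v \<oplus>\<^bsub>X\<^esub> w"
      unfolding cb using S \<phi>0 signed_closed[OF ab(1) \<phi>1', of "Suc e"]
      by (simp add: ev evs[OF \<phi>1'] fin hdtl te u_def v_def w_def)
    have vw: "(\<Oplus>\<^bsub>X\<^esub>i\<in>{..<Suc e}. t i) = w \<oplus>\<^bsub>X\<^esub> v"
      unfolding lessThan_Suc v_def w_def using tC by (subst X.M.finsum_insert) auto
    have "coboundary A M X (Suc e) f (m, as @ [a]) = u \<oplus>\<^bsub>X\<^esub> (\<Oplus>\<^bsub>X\<^esub>i\<in>{..<Suc e}. t i) \<oplus>\<^bsub>X\<^esub> x"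
      using za unfolding coboundary_def t_def u_def x_def mas by simp
    then have "(u \<oplus>\<^bsub>X\<^esub> v \<oplus>\<^bsub>X\<^esub> w) \<oplus>\<^bsub>X\<^esub> x = \<zero>\<^bsub>X\<^esub>"
      using cocycle[OF za] uvwx unfolding vw by (simp add: X.M.a_ac)
    then have e1: "u \<oplus>\<^bsub>X\<^esub> v \<oplus>\<^bsub>X\<^esub> w = \<ominus>\<^bsub>X\<^esub> x"
      using uvwx by (intro X.M.minus_equality[symmetric]) auto
    have fz: "f z \<in> carrier X" by (rule cochainsD(4)[OF fC z])
    have "signed X (Suc e) (ract X (f z) a) = ract X (signed X (Suc e) (f z)) a"
      by (rule signed_additive[OF ab(2,2), where h = "\<lambda>x. ract X x a", symmetric]) (use a fz XD(2,3) in auto)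
    moreover have "\<ominus>\<^bsub>X\<^esub> x = signed X (Suc e) (ract X (f z) a)"
      using XD(2)[OF fz a] by (simp add: x_def signed_def)
    ultimately show ?thesis using lhs e1 by simp
  qed
  show ?thesis
    by (rule extensionalityI[where A = "carrier A"])
      (use main linear_mapsD(2)[of "coboundary A M ?C e \<phi> z" K A X] cbC in \<open>auto simp: coind_sel(1)\<close>)
qed

lemma injective_coboundary:
  fixes X :: "('k, 'a, 'k vec) rmod" and M :: "('k, 'a, 'm) rmod"
  assumes M: "right_module K A M" and X: "fdmod X" and inj: "injective K A X"
    and fC: "f \<in> carrier (cochains K A M X (Suc e))"
    and cocycle: "\<And>z. z \<in> bar_dom A M (Suc (Suc e)) ==> coboundary A M X (Suc e) f z = \<zero>\<^bsub>X\<^esub>"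
  shows "\<exists>h\<in>carrier (cochains K A M X e). \<forall>z\<in>bar_dom A M (Suc e). coboundary A M X e h z = signed X (Suc e) (f z)"
proof -
  note rX = fdmodD(1)[OF X]
  obtain r where r: "r \<in> Hom K A (coind X) X" "\<And>x. x \<in> carrier X ==> r (\<lambda>a\<in>carrier A. ract X x a) = x"
    using injective_retraction[OF X inj] by blast
  note rD = HomD[OF r(1)]
  have rC: "right_module K A (coind X)" using coind_fdmod[OF fdmodD(3,2)[OF X]] by simp
  let ?\<phi> = "\<lambda>(m, as)\<in>bar_dom A M e. \<lambda>a\<in>carrier A. f (m, as @ [a])"
  have \<phi>: "?\<phi> \<in> carrier (cochains K A M (coind X) e)"
    by (rule cochain_curry[OF right_moduleD(1)[OF M] rX fC])
  define h where "h = (\<lambda>z\<in>bar_dom A M e. r (?\<phi> z))"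
  have h: "h \<in> carrier (cochains K A M X e)"
    unfolding h_def by (rule cochains_push[where h = r and X = "coind X" and Y = X, OF right_moduleD(1)[OF M] \<phi> rD(1) rD(3) rD(4)])
  have hr: "h y = r (?\<phi> y)" if "y \<in> bar_dom A M e" for y
    unfolding h_def by (rule restrict_apply'[OF that])
  have "coboundary A M X e h z = signed X (Suc e) (f z)" if z: "z \<in> bar_dom A M (Suc e)" for z
  proof -
    have "coboundary A M X e h z = r (coboundary A M (coind X) e ?\<phi> z)"
      by (rule coboundary_push[where h = r and X = "coind X" and Y = X, OF M rC rX rD(1) rD(3) rD(5) cochainsD(2)[OF \<phi>] z hr])
    also have "\<dots> = r (\<lambda>a\<in>carrier A. ract X (signed X (Suc e) (f z)) a)"
      by (subst coboundary_curry[OF M rX fdmodD(2)[OF X] fC cocycle z]) auto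
    also have "\<dots> = signed X (Suc e) (f z)"
      using cochainsD(4)[OF fC z] module_abelian_group[OF fdmodD(3)[OF X]] by (intro r signed_closed)
    finally show ?thesis .
  qed
  then show ?thesis using h by blast
qed

end

context ext_functor
begin

lemma tau_injective:
  fixes X :: "('k, 'a, 'k vec) rmod"
  assumes X: "fdmod X" and inj: "injective K A X"
  shows "carrier (\<tau> X) = {\<zero>\<^bsub>\<tau> X\<^esub>}"
proof -
  note rX = fdmodD(1)[OF X]
  interpret X: module K X by (rule fdmodD[OF X])
  interpret F: module K "Fun X" by (rule Fun_module[OF rX])
  note B = subspaceD[OF Bnd_sub[OF rX]]
  have "f \<in> Bnd X" if f: "f \<in> Cyc X" for f
  proof -
    have fC: "f \<in> carrier (cochains K A DA X (Suc (d - 1)))"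
      and co: "\<And>z. z \<in> bar_dom A DA (Suc (Suc (d - 1))) ==> coboundary A DA X (Suc (d - 1)) f z = \<zero>\<^bsub>X\<^esub>"
      using f unfolding d_Suc by (auto simp: cocycles_iff)
    obtain h where h: "h \<in> carrier (cochains K A DA X (d - 1))"
      and e: "\<And>z. z \<in> bar_dom A DA d ==> coboundary A DA X (d - 1) h z = signed X d (f z)"
      using injective_coboundary[OF DA_fdmod(1) X inj fC co] unfolding d_Suc by blast
    define g where "g = coboundary A DA X (d - 1) h"
    have g: "g \<in> Bnd X" unfolding coboundaries_iff g_def using h by blast
    have gext: "g \<in> extensional (bar_dom A DA d)"
      unfolding g_def coboundary_def d_Suc by (rule restrict_extensional)
    note fF = Cyc_Fun[OF rX f, unfolded fun_space_sel]
    define c where "c = (if even d then \<one> else \<ominus> \<one>)"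
    have c: "c \<in> carrier K" by (simp add: c_def)
    have "f = c \<odot>\<^bsub>Fun X\<^esub> g"
    proof (rule extensionalityI[where A = "bar_dom A DA d"])
      fix z assume z: "z \<in> bar_dom A DA d"
      have "f z \<in> carrier X" using fF z by auto
      then show "f z = (c \<odot>\<^bsub>Fun X\<^esub> g) z"
        using z e[OF z] unfolding g_def[symmetric]
        by (auto simp: fun_space_sel c_def signed_def X.smult_l_minus)
    qed (use fF in \<open>auto simp: fun_space_sel PiE_def\<close>)
    then show ?thesis using B(5)[OF c g] by simp
  qed
  then have "cls X f = Bnd X" if "f \<in> Cyc X" for f
    using coset_eqI[OF Fun_module[OF rX] Bnd_sub[OF rX], of f "\<zero>\<^bsub>Fun X\<^esub>" f] that
      Cyc_Fun[OF rX that] coset_zero[OF Fun_module[OF rX] Bnd_sub[OF rX]] by simp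
  moreover have "\<zero>\<^bsub>Fun X\<^esub> \<in> Cyc X" using subspaceD(3)[OF Cyc_sub[OF rX]] .
  ultimately have "carrier (E X) = {\<zero>\<^bsub>E X\<^esub>}"
    unfolding Ext_dual_sel(1,2)[OF rX] by blast
  then show ?thesis by (simp add: tau_def std_module_def Let_def)
qed

end

section \<open>The graded algebra \<open>\<Psi>\<^sup>X\<close>\<close>

context ext_functor
begin

context
  fixes X :: "('k, 'a, 'k vec) rmod"
  assumes X: "fdmod X"
begin

abbreviation H :: "nat => ('k, 'k vec => 'k vec) module"
  where "H n \<equiv> hom_space K A X (T n X)"
abbreviation \<Psi> :: "('k, nat => 'k vec => 'k vec) module"
  where "\<Psi> \<equiv> Psi K A d X"
abbreviation star :: "nat => nat => ('k vec => 'k vec) => ('k vec => 'k vec) => 'k vec => 'k vec"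
  where "star i j g f \<equiv> compose (carrier X) (Tm i X (T j X) g) f"
abbreviation times_Psi :: "(nat => 'k vec => 'k vec) => (nat => 'k vec => 'k vec) => nat => 'k vec => 'k vec"
    (infixl "\<cdot>" 70)
  where "G \<cdot> F \<equiv> G \<otimes>\<^bsub>\<Psi>\<^esub> F"

lemma rX: "right_module K A X"
  by (rule fdmodD[OF X])

lemma TX: "fdmod (T n X)" "right_module K A (T n X)"
  using T_fdmod[OF X] fdmodD(1) by auto

lemma H_module: "module K (H n)"
  by (rule hom_space_module[OF rX TX(2)])

lemma H_ab: "abelian_group (H n)" "abelian_monoid (H n)"
  using module_abelian_group[OF H_module] unfolding abelian_group_def by auto

lemma H_closed:
  "zero_map X (T n X) \<in> Hom K A X (T n X)"
  "f \<in> Hom K A X (T n X) ==> g \<in> Hom K A X (T n X) ==> f \<oplus>\<^bsub>H n\<^esub> g \<in> Hom K A X (T n X)"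
  "c \<in> carrier K ==> f \<in> Hom K A X (T n X) ==> c \<odot>\<^bsub>H n\<^esub> f \<in> Hom K A X (T n X)"
  "(\<And>i. i \<in> I ==> u i \<in> Hom K A X (T n X)) ==> finsum (H n) u I \<in> Hom K A X (T n X)"
  using abelian_groupE(1,2)[OF H_ab(1)] module.smult_closed[OF H_module]
    abelian_monoid.finsum_closed[OF H_ab(2), of u I n] by auto

lemma star_Hom:
  assumes "g \<in> Hom K A X (T j X)" "f \<in> Hom K A X (T i X)"
  shows "star i j g f \<in> Hom K A X (T (i + j) X)"
  using compose_Hom[OF rX assms(2) Tm_Hom[OF X TX(1) assms(1)]] by (simp add: T_add)

lemma star_Hom': "i \<le> n ==> g \<in> Hom K A X (T (n - i) X) ==> f \<in> Hom K A X (T i X) ==>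
    star i (n - i) g f \<in> Hom K A X (T n X)"
  using star_Hom[of g "n - i" f i] by simp

lemma star_bilinear:
  assumes "g \<in> Hom K A X (T j X)" "g' \<in> Hom K A X (T j X)" "f \<in> Hom K A X (T i X)" "f' \<in> Hom K A X (T i X)"
    and c: "c \<in> carrier K"
  shows "star i j (g \<oplus>\<^bsub>H j\<^esub> g') f = star i j g f \<oplus>\<^bsub>H (i + j)\<^esub> star i j g' f"
    "star i j g (f \<oplus>\<^bsub>H i\<^esub> f') = star i j g f \<oplus>\<^bsub>H (i + j)\<^esub> star i j g f'"
    "star i j (c \<odot>\<^bsub>H j\<^esub> g) f = c \<odot>\<^bsub>H (i + j)\<^esub> star i j g f"
    "star i j g (c \<odot>\<^bsub>H i\<^esub> f) = c \<odot>\<^bsub>H (i + j)\<^esub> star i j g f"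
    "star i j (zero_map X (T j X)) f = zero_map X (T (i + j) X)"
    "star i j g (zero_map X (T i X)) = zero_map X (T (i + j) X)"
proof -
  note tg = Tm_Hom[OF X TX(1) assms(1), of i] Tm_Hom[OF X TX(1) assms(2), of i]
  note B = compose_bilinear[OF assms(3,4) tg rX TX(2) fdmodD(1)[OF T_fdmod[OF TX(1)]] c]
  note L = Tm_linear[OF X TX(1) assms(1,2) c]
  show "star i j (g \<oplus>\<^bsub>H j\<^esub> g') f = star i j g f \<oplus>\<^bsub>H (i + j)\<^esub> star i j g' f"
    unfolding L B by (simp only: T_add)
  show "star i j g (f \<oplus>\<^bsub>H i\<^esub> f') = star i j g f \<oplus>\<^bsub>H (i + j)\<^esub> star i j g f'"
    unfolding B by (simp only: T_add)
  show "star i j (c \<odot>\<^bsub>H j\<^esub> g) f = c \<odot>\<^bsub>H (i + j)\<^esub> star i j g f"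
    unfolding L B by (simp only: T_add)
  show "star i j g (c \<odot>\<^bsub>H i\<^esub> f) = c \<odot>\<^bsub>H (i + j)\<^esub> star i j g f"
    unfolding B by (simp only: T_add)
  show "star i j (zero_map X (T j X)) f = zero_map X (T (i + j) X)"
    unfolding Tm_zero[OF X TX(1)] B by (simp only: T_add)
  show "star i j g (zero_map X (T i X)) = zero_map X (T (i + j) X)"
    unfolding B by (simp only: T_add)
qed

lemma star_bilinear':
  assumes "i \<le> n" "g \<in> Hom K A X (T (n - i) X)" "g' \<in> Hom K A X (T (n - i) X)"
    "f \<in> Hom K A X (T i X)" "f' \<in> Hom K A X (T i X)" "c \<in> carrier K"
  shows "star i (n - i) (g \<oplus>\<^bsub>H (n - i)\<^esub> g') f = star i (n - i) g f \<oplus>\<^bsub>H n\<^esub> star i (n - i) g' f"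
    "star i (n - i) g (f \<oplus>\<^bsub>H i\<^esub> f') = star i (n - i) g f \<oplus>\<^bsub>H n\<^esub> star i (n - i) g f'"
    "star i (n - i) (c \<odot>\<^bsub>H (n - i)\<^esub> g) f = c \<odot>\<^bsub>H n\<^esub> star i (n - i) g f"
    "star i (n - i) g (c \<odot>\<^bsub>H i\<^esub> f) = c \<odot>\<^bsub>H n\<^esub> star i (n - i) g f"
  using star_bilinear(1-4)[OF assms(2-6)] assms(1) by simp_all

text \<open>
  Associativity for homogeneous elements is functoriality of \<open>\<tau>\<^sup>-\<^sup>i\<close>, combined with
  \<open>\<tau>\<^sup>-\<^sup>i \<tau>\<^sup>-\<^sup>j = \<tau>\<^sup>-\<^sup>(\<^sup>i\<^sup>+\<^sup>j\<^sup>)\<close>.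
\<close>

lemma star_assoc:
  assumes "h \<in> Hom K A X (T k X)" "g \<in> Hom K A X (T j X)" "f \<in> Hom K A X (T i X)"
  shows "star i (j + k) (star j k h g) f = star (i + j) k h (star i j g f)"
proof -
  note th = Tm_Hom[OF X TX(1) assms(1), of j]
  have "Tm i X (T (j + k) X) (star j k h g) =
    compose (carrier (T i X)) (Tm (i + j) X (T k X) h) (Tm i X (T j X) g)"
    using Tm_compose[OF X TX(1) T_fdmod[OF TX(1)] assms(2) th, of i] Tm_add[of i j X "T k X" h]
    by (simp add: T_add)
  then show ?thesis by (simp add: compose_Hom_assoc[OF assms(3)])
qed

lemma star_finsum_left:
  assumes "\<And>l. l \<in> L ==> g l \<in> Hom K A X (T j X)" "f \<in> Hom K A X (T i X)"
  shows "star i j (finsum (H j) g L) f = finsum (H (i + j)) (\<lambda>l. star i j (g l) f) L"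
  by (rule finsum_additive[OF H_ab(1) H_ab(1), where h = "\<lambda>g. star i j g f"])
    (use assms star_Hom star_bilinear(1)[OF _ _ _ _ K.one_closed] in auto)

lemma star_finsum_right:
  assumes "\<And>l. l \<in> L ==> f l \<in> Hom K A X (T i X)" "g \<in> Hom K A X (T j X)"
  shows "star i j g (finsum (H i) f L) = finsum (H (i + j)) (\<lambda>l. star i j g (f l)) L"
  by (rule finsum_additive[OF H_ab(1) H_ab(1), where h = "star i j g"])
    (use assms star_Hom star_bilinear(2)[OF _ _ _ _ K.one_closed] in auto)

lemma Psi_sel:
  "carrier \<Psi> = {F. (\<forall>i. F i \<in> Hom K A X (T i X)) \<and> finite {i. F i \<noteq> zero_map X (T i X)}}"
  "\<one>\<^bsub>\<Psi>\<^esub> = (\<lambda>i. if i = 0 then id_map X else zero_map X (T i X))"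
  "\<zero>\<^bsub>\<Psi>\<^esub> = (\<lambda>i. zero_map X (T i X))"
  "(F \<oplus>\<^bsub>\<Psi>\<^esub> G) i = F i \<oplus>\<^bsub>H i\<^esub> G i" "(c \<odot>\<^bsub>\<Psi>\<^esub> F) i = c \<odot>\<^bsub>H i\<^esub> F i"
  by (simp_all add: Psi_def Let_def hom_space_def)

lemma PsiD:
  assumes "F \<in> carrier \<Psi>"
  shows "F i \<in> Hom K A X (T i X)" "finite {i. F i \<noteq> zero_map X (T i X)}"
  using assms by (auto simp: Psi_sel)

lemma Psi_mult:
  assumes "\<And>i. G i \<in> Hom K A X (T i X)" "\<And>i. F i \<in> Hom K A X (T i X)"
  shows "(G \<cdot> F) n = (\<Oplus>\<^bsub>H n\<^esub>i\<in>{..n}. star i (n - i) (G (n - i)) (F i))"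
proof
  have st: "star i (n - i) (G (n - i)) (F i) \<in> Hom K A X (T n X)" if "i \<in> {..n}" for i
    using that assms by (intro star_Hom') auto
  have L: "(G \<cdot> F) n = (\<lambda>x\<in>carrier X. \<Oplus>\<^bsub>T n X\<^esub>i\<in>{..n}. Tm i X (T (n - i) X) (G (n - i)) (F i x))"
    by (simp add: Psi_def Let_def)
  have R: "(\<Oplus>\<^bsub>H n\<^esub>i\<in>{..n}. star i (n - i) (G (n - i)) (F i)) \<in> Hom K A X (T n X)"
    by (rule H_closed(4)[OF st])
  fix x
  show "(G \<cdot> F) n x = (\<Oplus>\<^bsub>H n\<^esub>i\<in>{..n}. star i (n - i) (G (n - i)) (F i)) x"
  proof (cases "x \<in> carrier X")
    case True
    have "(\<Oplus>\<^bsub>H n\<^esub>i\<in>{..n}. star i (n - i) (G (n - i)) (F i)) x = (\<Oplus>\<^bsub>T n X\<^esub>i\<in>{..n}. star i (n - i) (G (n - i)) (F i) x)"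
      by (rule finsum_hom_apply[OF rX TX(2) st True])
    also have "\<dots> = (G \<cdot> F) n x" using True by (simp add: L compose_eq)
    finally show ?thesis by simp
  next
    case False
    then show ?thesis using HomD(2)[OF R] by (simp add: L extensional_def)
  qed
qed

lemma Psi_module: "module K \<Psi>"
proof (rule module_transfer[where V = "prod_module UNIV H" and h = "\<lambda>F. F"])
  show "module K (prod_module UNIV H)"
    by (intro prod_module_module K.is_cring H_module)
  show "\<zero>\<^bsub>\<Psi>\<^esub> \<in> carrier \<Psi>" using H_closed(1) by (simp add: Psi_sel)
  fix F G assume F: "F \<in> carrier \<Psi>" and G: "G \<in> carrier \<Psi>"
  have "{i. (F \<oplus>\<^bsub>\<Psi>\<^esub> G) i \<noteq> zero_map X (T i X)} \<subseteq> {i. F i \<noteq> zero_map X (T i X)} \<union> {i. G i \<noteq> zero_map X (T i X)}"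
  proof -
    have "zero_map X (T i X) \<oplus>\<^bsub>H i\<^esub> zero_map X (T i X) = zero_map X (T i X)" for i
      using abelian_monoid.l_zero[OF H_ab(2)[of i], of "zero_map X (T i X)"] H_closed(1)[of i] by simp
    then show ?thesis by (auto simp: Psi_sel)
  qed
  then have "finite {i. (F \<oplus>\<^bsub>\<Psi>\<^esub> G) i \<noteq> zero_map X (T i X)}"
    by (rule finite_subset) (use PsiD(2)[OF F] PsiD(2)[OF G] in simp)
  then show "F \<oplus>\<^bsub>\<Psi>\<^esub> G \<in> carrier \<Psi>"
    using H_closed(2)[OF PsiD(1)[OF F] PsiD(1)[OF G]] by (simp add: Psi_sel)
next
  fix c F assume c: "c \<in> carrier K" and F: "F \<in> carrier \<Psi>"
  have "{i. (c \<odot>\<^bsub>\<Psi>\<^esub> F) i \<noteq> zero_map X (T i X)} \<subseteq> {i. F i \<noteq> zero_map X (T i X)}"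
    using module.smult_r_null[OF H_module c] by (auto simp: Psi_sel)
  then have "finite {i. (c \<odot>\<^bsub>\<Psi>\<^esub> F) i \<noteq> zero_map X (T i X)}"
    by (rule finite_subset) (rule PsiD(2)[OF F])
  then show "c \<odot>\<^bsub>\<Psi>\<^esub> F \<in> carrier \<Psi>"
    using H_closed(3)[OF c PsiD(1)[OF F]] by (simp add: Psi_sel)
qed (auto simp: prod_module_def Psi_sel fun_eq_iff)

lemma Psi_mult_closed:
  assumes G: "G \<in> carrier \<Psi>" and F: "F \<in> carrier \<Psi>"
  shows "G \<cdot> F \<in> carrier \<Psi>"
proof -
  note D = PsiD(1)[OF G] PsiD(1)[OF F]
  have st: "star i (n - i) (G (n - i)) (F i) \<in> Hom K A X (T n X)" if "i \<in> {..n}" for i n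
    using that D by (intro star_Hom') auto
  let ?S = "{i. F i \<noteq> zero_map X (T i X)}" and ?S' = "{i. G i \<noteq> zero_map X (T i X)}"
  have "(G \<cdot> F) n = zero_map X (T n X)" if n: "n \<notin> (\<lambda>(i, j). i + j) ` (?S \<times> ?S')" for n
  proof -
    have "star i (n - i) (G (n - i)) (F i) = \<zero>\<^bsub>H n\<^esub>" if i: "i \<in> {..n}" for i
    proof -
      have "F i = zero_map X (T i X) \<or> G (n - i) = zero_map X (T (n - i) X)"
      proof (rule ccontr)
        assume "\<not> ?thesis"
        then have "(\<lambda>(i, j). i + j) (i, n - i) \<in> (\<lambda>(i, j). i + j) ` (?S \<times> ?S')" by (intro imageI) auto
        then show False using n i by simp
      qed
      then show ?thesis
        using star_bilinear(5,6)[OF D(1) D(1) D(2) D(2) K.one_closed, of i "n - i"] i by auto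
    qed
    then show ?thesis unfolding Psi_mult[OF D] by (subst abelian_monoid.finsum_all_zero[OF H_ab(2)]) auto
  qed
  then have "{n. (G \<cdot> F) n \<noteq> zero_map X (T n X)} \<subseteq> (\<lambda>(i, j). i + j) ` (?S \<times> ?S')" by blast
  moreover have "finite ((\<lambda>(i, j). i + j) ` (?S \<times> ?S'))"
    using PsiD(2)[OF F] PsiD(2)[OF G] by blast
  ultimately have "finite {n. (G \<cdot> F) n \<noteq> zero_map X (T n X)}" by (rule finite_subset)
  moreover have "(G \<cdot> F) n \<in> Hom K A X (T n X)" for n
    unfolding Psi_mult[OF D] by (rule H_closed(4)[OF st])
  ultimately show ?thesis by (simp add: Psi_sel(1))
qed

lemma Psi_one_closed: "\<one>\<^bsub>\<Psi>\<^esub> \<in> carrier \<Psi>"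
  using id_Hom[OF rX] H_closed(1) finite_subset[of "{i. (if i = 0 then id_map X else zero_map X (T i X)) \<noteq> zero_map X (T i X)}" "{0}"]
  by (auto simp: Psi_sel)

text \<open>
  Products with a homogeneous element have one summand in each degree.
\<close>

lemma Psi_single:
  assumes D: "\<And>i. G i \<in> Hom K A X (T i X)" "\<And>i. F i \<in> Hom K A X (T i X)"
    and k: "k \<le> n" and z: "\<And>i. i \<le> n ==> i \<noteq> k ==> G (n - i) = zero_map X (T (n - i) X) \<or> F i = zero_map X (T i X)"
  shows "(G \<cdot> F) n = star k (n - k) (G (n - k)) (F k)"
  unfolding Psi_mult[OF D]
proof (rule abelian_monoid.finsum_single[OF H_ab(2)])
  fix i assume i: "i \<in> {..n}" "i \<noteq> k"
  then show "star i (n - i) (G (n - i)) (F i) = \<zero>\<^bsub>H n\<^esub>"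
    using z[of i] star_bilinear(5,6)[OF D(1) D(1) D(2) D(2) K.one_closed, of i "n - i"] by auto
qed (use k D star_Hom' in auto)

text \<open>
  In degree \<open>n\<close> both sides add up the triple products with degrees \<open>i + j + k = n\<close>, along rows and along
  diagonals of the triangle \<open>i + j \<le> n\<close>.
\<close>

lemma Psi_assoc:
  assumes F': "F' \<in> carrier \<Psi>" and G: "G \<in> carrier \<Psi>" and F: "F \<in> carrier \<Psi>"
  shows "(F' \<cdot> G) \<cdot> F = F' \<cdot> (G \<cdot> F)"
proof
  fix n
  note D = PsiD(1)[OF F'] PsiD(1)[OF G] PsiD(1)[OF F]
  note EG = PsiD(1)[OF Psi_mult_closed[OF F' G]] and GF = PsiD(1)[OF Psi_mult_closed[OF G F]]
  interpret Hn: abelian_group "H n" by (rule H_ab)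
  define a where "a i j = star (i + j) (n - i - j) (F' (n - i - j)) (star i j (G j) (F i))" for i j
  have aH: "a i j \<in> Hom K A X (T n X)" if "i + j \<le> n" for i j
  proof -
    have "star i j (G j) (F i) \<in> Hom K A X (T (i + j) X)" by (rule star_Hom[OF D(2) D(3)])
    from star_Hom[OF D(1)[of "n - i - j"] this] show ?thesis using that by (simp add: a_def)
  qed
  have L: "star i (n - i) ((F' \<cdot> G) (n - i)) (F i) = (\<Oplus>\<^bsub>H n\<^esub>j\<in>{..n - i}. a i j)" if i: "i \<le> n" for i
  proof -
    have "star i (n - i) ((F' \<cdot> G) (n - i)) (F i) =
      (\<Oplus>\<^bsub>H (i + (n - i))\<^esub>j\<in>{..n - i}. star i (n - i) (star j (n - i - j) (F' (n - i - j)) (G j)) (F i))"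
      unfolding Psi_mult[OF D(1,2)] using D by (intro star_finsum_left star_Hom') auto
    also have "\<dots> = (\<Oplus>\<^bsub>H n\<^esub>j\<in>{..n - i}. a i j)"
      using i aH star_assoc[OF D(1) D(2) D(3)]
    proof (simp only: le_add_diff_inverse, intro Hn.finsum_cong')
      fix j assume j: "j \<in> {..n - i}"
      then have e: "j + (n - (i + j)) = n - i" by simp
      show "star i (n - i) (star j (n - i - j) (F' (n - i - j)) (G j)) (F i) = a i j"
        using star_assoc[OF D(1) D(2) D(3), of i j "n - i - j"] by (simp add: a_def e)
    qed auto
    finally show ?thesis .
  qed
  have R: "star k (n - k) (F' (n - k)) ((G \<cdot> F) k) = (\<Oplus>\<^bsub>H n\<^esub>i\<in>{..k}. a i (k - i))" if k: "k \<le> n" for k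
  proof -
    have "star k (n - k) (F' (n - k)) ((G \<cdot> F) k) =
      (\<Oplus>\<^bsub>H (k + (n - k))\<^esub>i\<in>{..k}. star k (n - k) (F' (n - k)) (star i (k - i) (G (k - i)) (F i)))"
      unfolding Psi_mult[OF D(2,3)] using D by (intro star_finsum_right star_Hom') auto
    also have "\<dots> = (\<Oplus>\<^bsub>H n\<^esub>i\<in>{..k}. a i (k - i))"
    proof (simp only: le_add_diff_inverse[OF k], rule Hn.finsum_cong'[OF refl])
      show "(\<lambda>i. a i (k - i)) \<in> {..k} \<rightarrow> carrier (H n)" using aH k by auto
      fix i assume "i \<in> {..k}"
      then show "star k (n - k) (F' (n - k)) (star i (k - i) (G (k - i)) (F i)) = a i (k - i)"
        by (simp add: a_def)
    qed
    finally show ?thesis .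
  qed
  have "((F' \<cdot> G) \<cdot> F) n = (\<Oplus>\<^bsub>H n\<^esub>i\<in>{..n}. \<Oplus>\<^bsub>H n\<^esub>j\<in>{..n - i}. a i j)"
    unfolding Psi_mult[OF EG D(3)] using L aH by (intro Hn.finsum_cong') (auto intro!: H_closed(4))
  also have "\<dots> = (\<Oplus>\<^bsub>H n\<^esub>k\<in>{..n}. \<Oplus>\<^bsub>H n\<^esub>i\<in>{..k}. a i (k - i))"
    by (rule Hn.finsum_triangle[symmetric]) (use aH in auto)
  also have "\<dots> = (F' \<cdot> (G \<cdot> F)) n"
    unfolding Psi_mult[OF D(1) GF] using R D GF by (intro Hn.finsum_cong') (auto intro!: star_Hom')
  finally show "((F' \<cdot> G) \<cdot> F) n = (F' \<cdot> (G \<cdot> F)) n" .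
qed

lemma Psi_k_algebra: "k_algebra K \<Psi>"
proof -
  interpret P: module K \<Psi> by (rule Psi_module)
  have Hs: "finsum (H n) (\<lambda>i. u i \<oplus>\<^bsub>H n\<^esub> v i) {..n} = finsum (H n) u {..n} \<oplus>\<^bsub>H n\<^esub> finsum (H n) v {..n}"
    if "\<And>i. i \<le> n ==> u i \<in> Hom K A X (T n X)" "\<And>i. i \<le> n ==> v i \<in> Hom K A X (T n X)" for u v and n :: nat
    by (rule abelian_monoid.finsum_addf[OF H_ab(2)]) (use that in auto)
  have Hc: "finsum (H n) (\<lambda>i. c \<odot>\<^bsub>H n\<^esub> u i) {..n} = c \<odot>\<^bsub>H n\<^esub> finsum (H n) u {..n}"
    if "\<And>i. i \<le> n ==> u i \<in> Hom K A X (T n X)" "c \<in> carrier K" for u c and n :: nat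
    by (rule finsum_additive[OF H_ab(1) H_ab(1), where h = "\<lambda>f. c \<odot>\<^bsub>H n\<^esub> f", symmetric])
      (use that H_closed module.smult_r_distr[OF H_module] in auto)
  have cong: "finsum (H n) u {..n} = finsum (H n) v {..n}"
    if "\<And>i. i \<le> n ==> u i = v i" "\<And>i. i \<le> n ==> v i \<in> Hom K A X (T n X)" for u v and n :: nat
    by (rule abelian_monoid.finsum_cong'[OF H_ab(2)]) (use that in auto)
  note D = PsiD(1) and st = star_Hom'
  show ?thesis
  proof (intro k_algebra.intro k_algebra_axioms.intro Psi_module ringI P.M.abelian_group_axioms)
    show "monoid \<Psi>"
    proof (rule monoidI)
      fix F assume F: "F \<in> carrier \<Psi>"
      show "\<one>\<^bsub>\<Psi>\<^esub> \<cdot> F = F"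
      proof
        fix n show "(\<one>\<^bsub>\<Psi>\<^esub> \<cdot> F) n = F n"
          using compose_id_map(2)[OF D[OF F, of n]] Tm_id[OF X, of n]
          by (subst Psi_single[OF D[OF Psi_one_closed] D[OF F], of n]) (auto simp: Psi_sel(2))
      qed
      show "F \<cdot> \<one>\<^bsub>\<Psi>\<^esub> = F"
      proof
        fix n show "(F \<cdot> \<one>\<^bsub>\<Psi>\<^esub>) n = F n"
          using compose_id_map(1)[OF D[OF F, of n]]
          by (subst Psi_single[OF D[OF F] D[OF Psi_one_closed], of 0]) (auto simp: Psi_sel(2))
      qed
    qed (auto intro: Psi_mult_closed Psi_one_closed Psi_assoc)
  next
    fix F' G F assume F': "F' \<in> carrier \<Psi>" and G: "G \<in> carrier \<Psi>" and F: "F \<in> carrier \<Psi>"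
    note C = P.M.a_closed[OF F' G]
    show "(F' \<oplus>\<^bsub>\<Psi>\<^esub> G) \<cdot> F = F' \<cdot> F \<oplus>\<^bsub>\<Psi>\<^esub> G \<cdot> F"
    proof
      fix n
      have "((F' \<oplus>\<^bsub>\<Psi>\<^esub> G) \<cdot> F) n =
        (\<Oplus>\<^bsub>H n\<^esub>i\<in>{..n}. star i (n - i) (F' (n - i)) (F i) \<oplus>\<^bsub>H n\<^esub> star i (n - i) (G (n - i)) (F i))"
        unfolding Psi_mult[OF D[OF C] D[OF F]]
        by (rule cong, unfold Psi_sel(4), rule star_bilinear'(1)[OF _ D[OF F'] D[OF G] D[OF F] D[OF F] K.one_closed], assumption) (auto intro!: H_closed(2) st D[OF F'] D[OF F] D[OF G])
      then show "((F' \<oplus>\<^bsub>\<Psi>\<^esub> G) \<cdot> F) n = (F' \<cdot> F \<oplus>\<^bsub>\<Psi>\<^esub> G \<cdot> F) n"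
        by (simp add: Psi_sel(4) Psi_mult[OF D[OF F'] D[OF F]] Psi_mult[OF D[OF G] D[OF F]] Hs st D F' F G)
    qed
    show "F \<cdot> (F' \<oplus>\<^bsub>\<Psi>\<^esub> G) = F \<cdot> F' \<oplus>\<^bsub>\<Psi>\<^esub> F \<cdot> G"
    proof
      fix n
      have "(F \<cdot> (F' \<oplus>\<^bsub>\<Psi>\<^esub> G)) n =
        (\<Oplus>\<^bsub>H n\<^esub>i\<in>{..n}. star i (n - i) (F (n - i)) (F' i) \<oplus>\<^bsub>H n\<^esub> star i (n - i) (F (n - i)) (G i))"
        unfolding Psi_mult[OF D[OF F] D[OF C]]
        by (rule cong, unfold Psi_sel(4), rule star_bilinear'(2)[OF _ D[OF F] D[OF F] D[OF F'] D[OF G] K.one_closed], assumption) (auto intro!: H_closed(2) st D[OF F'] D[OF F] D[OF G])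
      then show "(F \<cdot> (F' \<oplus>\<^bsub>\<Psi>\<^esub> G)) n = (F \<cdot> F' \<oplus>\<^bsub>\<Psi>\<^esub> F \<cdot> G) n"
        by (simp add: Psi_sel(4) Psi_mult[OF D[OF F] D[OF F']] Psi_mult[OF D[OF F] D[OF G]] Hs st D F' F G)
    qed
  next
    fix c G F assume c: "c \<in> carrier K" and G: "G \<in> carrier \<Psi>" and F: "F \<in> carrier \<Psi>"
    show "(c \<odot>\<^bsub>\<Psi>\<^esub> G) \<cdot> F = c \<odot>\<^bsub>\<Psi>\<^esub> (G \<cdot> F)"
    proof
      fix n
      have "((c \<odot>\<^bsub>\<Psi>\<^esub> G) \<cdot> F) n = (\<Oplus>\<^bsub>H n\<^esub>i\<in>{..n}. c \<odot>\<^bsub>H n\<^esub> star i (n - i) (G (n - i)) (F i))"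
        unfolding Psi_mult[OF D[OF P.smult_closed[OF c G]] D[OF F]]
        by (rule cong, unfold Psi_sel(5), rule star_bilinear'(3)[OF _ D[OF G] D[OF G] D[OF F] D[OF F] c], assumption) (auto intro!: H_closed(3) st D[OF F] D[OF G] c)
      then show "((c \<odot>\<^bsub>\<Psi>\<^esub> G) \<cdot> F) n = (c \<odot>\<^bsub>\<Psi>\<^esub> (G \<cdot> F)) n"
        by (simp add: Psi_sel(5) Psi_mult[OF D[OF G] D[OF F]] Hc st D F G c)
    qed
    show "G \<cdot> (c \<odot>\<^bsub>\<Psi>\<^esub> F) = c \<odot>\<^bsub>\<Psi>\<^esub> (G \<cdot> F)"
    proof
      fix n
      have "(G \<cdot> (c \<odot>\<^bsub>\<Psi>\<^esub> F)) n = (\<Oplus>\<^bsub>H n\<^esub>i\<in>{..n}. c \<odot>\<^bsub>H n\<^esub> star i (n - i) (G (n - i)) (F i))"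
        unfolding Psi_mult[OF D[OF G] D[OF P.smult_closed[OF c F]]]
        by (rule cong, unfold Psi_sel(5), rule star_bilinear'(4)[OF _ D[OF G] D[OF G] D[OF F] D[OF F] c], assumption) (auto intro!: H_closed(3) st D[OF F] D[OF G] c)
      then show "(G \<cdot> (c \<odot>\<^bsub>\<Psi>\<^esub> F)) n = (c \<odot>\<^bsub>\<Psi>\<^esub> (G \<cdot> F)) n"
        by (simp add: Psi_sel(5) Psi_mult[OF D[OF G] D[OF F]] Hc st D F G c)
    qed
  qed
qed

end

end

section \<open>Path algebras and their universal property\<close>

locale quiver_alg = scalar_field K + fin_digraph Q
  for K :: "('k, 'z) ring_scheme" (structure) and Q :: "('v, 'e) pre_digraph"
begin

abbreviation P :: "('k, 'v \<times> 'e list => 'k) module" where "P \<equiv> path_algebra K Q"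
abbreviation times_P :: "('v \<times> 'e list => 'k) => ('v \<times> 'e list => 'k) => 'v \<times> 'e list => 'k"
    (infixl "\<bullet>" 70)
  where "g \<bullet> f \<equiv> g \<otimes>\<^bsub>P\<^esub> f"

lemma awlast_simps [simp]: "awlast u [] = u" "awlast u (e # p) = awlast (head Q e) p"
  by (cases p, auto)

lemma awlast_append: "awlast u (p @ q) = awlast (awlast u p) q"
  by (induction p arbitrary: u) auto

lemma paths_iff: "(u, p) \<in> paths Q \<longleftrightarrow> awalk u p (awlast u p)"
  using awlast_if_cas by (auto simp: paths_def awalk_def)

lemma paths_append: "(u, p @ q) \<in> paths Q \<longleftrightarrow> (u, p) \<in> paths Q \<and> (awlast u p, q) \<in> paths Q"
  unfolding paths_iff awalk_append_iff awlast_append by blast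

lemma paths_Nil: "(u, []) \<in> paths Q \<longleftrightarrow> u \<in> verts Q"
  by (auto simp: paths_iff awalk_Nil_iff)

lemma paths_Cons: "(u, e # p) \<in> paths Q \<longleftrightarrow> e \<in> arcs Q \<and> tail Q e = u \<and> (head Q e, p) \<in> paths Q"
  by (auto simp: paths_iff awalk_Cons_iff)

lemma paths_verts: "(u, p) \<in> paths Q ==> u \<in> verts Q \<and> awlast u p \<in> verts Q"
  using awlast_in_verts awalk_hd_in_verts by (auto simp: paths_iff)

lemma paths_take_drop:
  "(u, p) \<in> paths Q \<longleftrightarrow> (u, take i p) \<in> paths Q \<and> (awlast u (take i p), drop i p) \<in> paths Q"
  using paths_append[of u "take i p" "drop i p"] by simp

lemma P_sel:
  "carrier P = {f. (\<forall>p\<in>paths Q. f p \<in> carrier K) \<and> (\<forall>p. p \<notin> paths Q \<longrightarrow> f p = \<zero>) \<and> finite {p. f p \<noteq> \<zero>}}"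
  "(g \<bullet> f) (u, p) = (\<Oplus>i\<in>{..length p}. g (awlast u (take i p), drop i p) \<otimes> f (u, take i p))"
  "\<one>\<^bsub>P\<^esub> (u, p) = (if u \<in> verts Q \<and> p = [] then \<one> else \<zero>)"
  "\<zero>\<^bsub>P\<^esub> = (\<lambda>p. \<zero>)" "(f \<oplus>\<^bsub>P\<^esub> g) x = f x \<oplus> g x" "(c \<odot>\<^bsub>P\<^esub> f) x = c \<otimes> f x"
  by (simp_all add: path_algebra_def)

lemma PD:
  assumes "f \<in> carrier P"
  shows "f p \<in> carrier K" "p \<notin> paths Q ==> f p = \<zero>" "finite {p. f p \<noteq> \<zero>}"
proof -
  have "\<forall>p\<in>paths Q. f p \<in> carrier K" "\<forall>p. p \<notin> paths Q \<longrightarrow> f p = \<zero>" "finite {p. f p \<noteq> \<zero>}"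
    using assms unfolding P_sel(1) by blast+
  note F = this
  show "p \<notin> paths Q ==> f p = \<zero>" using F(2) by blast
  then show "f p \<in> carrier K" using F(1) K.zero_closed by metis
  show "finite {p. f p \<noteq> \<zero>}" by (rule F(3))
qed

lemma PI:
  assumes "\<And>p. f p \<in> carrier K" "\<And>p. p \<notin> paths Q ==> f p = \<zero>" "finite S" "\<And>p. p \<notin> S ==> f p = \<zero>"
  shows "f \<in> carrier P"
proof -
  have "finite {p. f p \<noteq> \<zero>}" using assms(3) by (rule finite_subset[rotated]) (use assms(4) in blast)
  then show ?thesis unfolding P_sel(1) using assms(1,2) by blast
qed

lemma P_module: "module K P"
proof (rule module_transfer[where V = "prod_module UNIV (\<lambda>_. base_field K)" and h = "\<lambda>f. f"])
  show "module K (prod_module UNIV (\<lambda>_. base_field K))"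
    by (intro prod_module_module K.is_cring base_field_module)
  show "\<zero>\<^bsub>P\<^esub> \<in> carrier P" by (rule PI[of _ "{}"]) (auto simp: P_sel)
  fix f g assume f: "f \<in> carrier P" and g: "g \<in> carrier P"
  show "f \<in> carrier (prod_module UNIV (\<lambda>_. base_field K))"
    using PD(1)[OF f] by (auto simp: prod_module_def)
  show "f \<oplus>\<^bsub>P\<^esub> g \<in> carrier P"
    by (rule PI[of _ "{p. f p \<noteq> \<zero>} \<union> {p. g p \<noteq> \<zero>}"]) (use PD[OF f] PD[OF g] in \<open>auto simp: P_sel\<close>)
next
  fix c f assume c: "c \<in> carrier K" and f: "f \<in> carrier P"
  show "c \<odot>\<^bsub>P\<^esub> f \<in> carrier P"
    by (rule PI[of _ "{p. f p \<noteq> \<zero>}"]) (use PD[OF f] c in \<open>auto simp: P_sel\<close>)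
qed (auto simp: prod_module_def P_sel(4-6) fun_eq_iff)

lemma P_mult_terms:
  assumes "f \<in> carrier P" "g \<in> carrier P"
  shows "g (awlast u (take i p), drop i p) \<otimes> f (u, take i p) \<in> carrier K"
  using PD(1)[OF assms(1)] PD(1)[OF assms(2)] by simp

lemma P_mult_closed:
  assumes f: "f \<in> carrier P" and g: "g \<in> carrier P"
  shows "g \<bullet> f \<in> carrier P"
proof -
  let ?S = "(\<lambda>((v, q), (u, p)). (u, p @ q)) ` ({p. g p \<noteq> \<zero>} \<times> {p. f p \<noteq> \<zero>})"
  have val: "(g \<bullet> f) p \<in> carrier K" for p
    using P_mult_terms[OF f g] by (cases p) (auto simp: P_sel(2) intro!: K.finsum_closed)
  have off: "(g \<bullet> f) p = \<zero>" if "p \<notin> paths Q" for p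
  proof -
    obtain u p' where p: "p = (u, p')" by fastforce
    have "g (awlast u (take i p'), drop i p') \<otimes> f (u, take i p') = \<zero>" for i
    proof (cases "(u, take i p') \<in> paths Q")
      case True
      then have "(awlast u (take i p'), drop i p') \<notin> paths Q" using that p paths_take_drop by blast
      then show ?thesis using PD[OF f] PD(2)[OF g] by simp
    next
      case False
      then show ?thesis using PD(2)[OF f] PD(1)[OF g] by simp
    qed
    then show ?thesis by (simp add: p P_sel(2) K.finsum_all_zero)
  qed
  have supp: "(g \<bullet> f) p = \<zero>" if "p \<notin> ?S" for p
  proof -
    obtain u p' where p: "p = (u, p')" by fastforce
    have "g (awlast u (take i p'), drop i p') \<otimes> f (u, take i p') = \<zero>" for i
    proof -
      have "g (awlast u (take i p'), drop i p') = \<zero> \<or> f (u, take i p') = \<zero>"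
      proof (rule ccontr)
        assume "\<not> ?thesis"
        then have "(\<lambda>((v, q), (u, p)). (u, p @ q)) ((awlast u (take i p'), drop i p'), (u, take i p')) \<in> ?S"
          by (intro imageI) auto
        then show False using that p by simp
      qed
      then show ?thesis using PD(1)[OF f] PD(1)[OF g] by auto
    qed
    then show ?thesis by (simp add: p P_sel(2) K.finsum_all_zero)
  qed
  have fin: "finite ?S" using PD(3)[OF f] PD(3)[OF g] by blast
  show ?thesis by (rule PI[OF val off fin supp])
qed

lemma P_one_closed: "\<one>\<^bsub>P\<^esub> \<in> carrier P"
proof (rule PI)
  show "finite ((\<lambda>v. (v, [])) ` verts Q)" by simp
  fix p :: "'v \<times> 'e list"
  obtain u p' where p: "p = (u, p')" by fastforce
  show "\<one>\<^bsub>P\<^esub> p \<in> carrier K" by (simp add: p P_sel(3))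
  show "p \<notin> paths Q ==> \<one>\<^bsub>P\<^esub> p = \<zero>" using paths_Nil by (auto simp: p P_sel(3))
  show "p \<notin> (\<lambda>v. (v, [])) ` verts Q ==> \<one>\<^bsub>P\<^esub> p = \<zero>" by (auto simp: p P_sel(3))
qed

text \<open>
  Both sides run over the ways of cutting a path into three pieces.
\<close>

lemma P_assoc:
  assumes f: "f \<in> carrier P" and g: "g \<in> carrier P" and h: "h \<in> carrier P"
  shows "(h \<bullet> g) \<bullet> f = h \<bullet> (g \<bullet> f)"
proof
  fix x :: "'v \<times> 'e list"
  obtain u p where x: "x = (u, p)" by fastforce
  let ?n = "length p"
  note D = PD(1)[OF f] PD(1)[OF g] PD(1)[OF h]
  define a where "a i j = h (awlast u (take (i + j) p), drop (i + j) p) \<otimes>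
    g (awlast u (take i p), take j (drop i p)) \<otimes> f (u, take i p)" for i j
  have aK: "a i j \<in> carrier K" for i j using D by (simp add: a_def)
  have "((h \<bullet> g) \<bullet> f) x = (\<Oplus>i\<in>{..?n}. \<Oplus>j\<in>{..?n - i}. a i j)"
    unfolding x P_sel(2)[of "h \<bullet> g" f]
  proof (rule K.finsum_cong')
    fix i assume i: "i \<in> {..?n}"
    have t: "awlast (awlast u (take i p)) (take j (drop i p)) = awlast u (take (i + j) p)" for j
      by (simp add: take_add awlast_append)
    show "(h \<bullet> g) (awlast u (take i p), drop i p) \<otimes> f (u, take i p) = (\<Oplus>j\<in>{..?n - i}. a i j)"
      unfolding P_sel(2) using i D
      by (subst K.finsum_ldistr) (auto simp: a_def t add.commute intro!: K.finsum_cong')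
  qed (use aK in \<open>auto intro!: K.finsum_closed\<close>)
  also have "\<dots> = (\<Oplus>k\<in>{..?n}. \<Oplus>i\<in>{..k}. a i (k - i))"
    by (rule K.finsum_triangle[symmetric]) (use aK in auto)
  also have "\<dots> = (h \<bullet> (g \<bullet> f)) x"
    unfolding x P_sel(2)[of h "g \<bullet> f"]
  proof (rule K.finsum_cong'[OF refl])
    show "(\<lambda>k. h (awlast u (take k p), drop k p) \<otimes> (g \<bullet> f) (u, take k p)) \<in> {..?n} \<rightarrow> carrier K"
      using D PD(1)[OF P_mult_closed[OF f g]] by auto
    fix k assume k: "k \<in> {..?n}"
    have "(\<Oplus>i\<in>{..k}. a i (k - i)) = (\<Oplus>i\<in>{..k}. h (awlast u (take k p), drop k p) \<otimes>
      (g (awlast u (take i (take k p)), drop i (take k p)) \<otimes> f (u, take i (take k p))))"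
      using D by (intro K.finsum_cong') (auto simp: a_def K.m_assoc drop_take min_def)
    then show "(\<Oplus>i\<in>{..k}. a i (k - i)) = h (awlast u (take k p), drop k p) \<otimes> (g \<bullet> f) (u, take k p)"
      unfolding P_sel(2) using k D by (subst K.finsum_rdistr) (auto simp: min_def)
  qed
  finally show "((h \<bullet> g) \<bullet> f) x = (h \<bullet> (g \<bullet> f)) x" .
qed

lemma P_k_algebra: "k_algebra K P"
proof -
  interpret PP: module K P by (rule P_module)
  have eqI: "f = g" if "\<And>u p. f (u, p) = g (u, p)" for f g :: "'v \<times> 'e list => 'k"
    using that by auto
  show ?thesis
  proof (intro k_algebra.intro k_algebra_axioms.intro P_module ringI PP.M.abelian_group_axioms)
    show "monoid P"
    proof (rule monoidI)
      fix f assume f: "f \<in> carrier P"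
      show "\<one>\<^bsub>P\<^esub> \<bullet> f = f"
      proof (rule eqI)
        fix u p
        have v: "f (u, p) = \<zero> \<or> awlast u p \<in> verts Q" using PD(2)[OF f, of "(u, p)"] paths_verts[of u p] by blast
        show "(\<one>\<^bsub>P\<^esub> \<bullet> f) (u, p) = f (u, p)"
          unfolding P_sel(2) using PD(1)[OF f] v
          by (subst K.finsum_single[of _ "length p"]) (auto simp: P_sel(3))
      qed
      show "f \<bullet> \<one>\<^bsub>P\<^esub> = f"
      proof (rule eqI)
        fix u p
        have v: "f (u, p) = \<zero> \<or> u \<in> verts Q" using PD(2)[OF f, of "(u, p)"] paths_verts[of u p] by blast
        show "(f \<bullet> \<one>\<^bsub>P\<^esub>) (u, p) = f (u, p)"
          unfolding P_sel(2) using PD(1)[OF f] v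
          by (subst K.finsum_single[of _ 0]) (auto simp: P_sel(3))
      qed
    qed (auto intro: P_mult_closed P_one_closed simp: P_assoc)
  next
    fix f g h assume f: "f \<in> carrier P" and g: "g \<in> carrier P" and h: "h \<in> carrier P"
    note D = PD(1)[OF f] PD(1)[OF g] PD(1)[OF h]
    show "(f \<oplus>\<^bsub>P\<^esub> g) \<bullet> h = f \<bullet> h \<oplus>\<^bsub>P\<^esub> g \<bullet> h"
      by (rule eqI) (simp add: P_sel(2,5) D K.l_distr K.finsum_addf Pi_def)
    show "h \<bullet> (f \<oplus>\<^bsub>P\<^esub> g) = h \<bullet> f \<oplus>\<^bsub>P\<^esub> h \<bullet> g"
      by (rule eqI) (simp add: P_sel(2,5) D K.r_distr K.finsum_addf Pi_def)
  next
    fix c f g assume c: "c \<in> carrier K" and f: "f \<in> carrier P" and g: "g \<in> carrier P"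
    note D = PD(1)[OF f] PD(1)[OF g]
    show "(c \<odot>\<^bsub>P\<^esub> f) \<bullet> g = c \<odot>\<^bsub>P\<^esub> (f \<bullet> g)"
      by (rule eqI) (simp add: P_sel(2,6) D c K.finsum_rdistr Pi_def K.m_assoc)
    show "f \<bullet> (c \<odot>\<^bsub>P\<^esub> g) = c \<odot>\<^bsub>P\<^esub> (f \<bullet> g)"
      by (rule eqI) (simp add: P_sel(2,6) D c K.finsum_rdistr Pi_def K.m_lcomm)
  qed
qed

lemma path_elt_closed: "p \<in> paths Q ==> path_elt K p \<in> carrier P"
  by (rule PI[of _ "{p}"]) (auto simp: path_elt_def)

lemma path_elt_mult:
  assumes p: "(u, p) \<in> paths Q" and q: "(v, q) \<in> paths Q"
  shows "path_elt K (v, q) \<bullet> path_elt K (u, p) =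
    (if awlast u p = v then path_elt K (u, p @ q) else \<zero>\<^bsub>P\<^esub>)"
proof
  fix x :: "'v \<times> 'e list"
  obtain w r where x: "x = (w, r)" by fastforce
  let ?t = "\<lambda>i. path_elt K (v, q) (awlast w (take i r), drop i r) \<otimes> path_elt K (u, p) (w, take i r)"
  have t: "?t i = (if awlast u p = v \<and> w = u \<and> take i r = p \<and> drop i r = q then \<one> else \<zero>)" for i
    by (auto simp: path_elt_def)
  show "(path_elt K (v, q) \<bullet> path_elt K (u, p)) x =
    (if awlast u p = v then path_elt K (u, p @ q) else \<zero>\<^bsub>P\<^esub>) x"
  proof (cases "awlast u p = v \<and> w = u \<and> r = p @ q")
    case True
    have "(\<Oplus>i\<in>{..length r}. ?t i) = ?t (length p)"
    proof (rule K.finsum_single)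
      fix i assume i: "i \<in> {..length r}" "i \<noteq> length p"
      then have "take i r \<noteq> p" using True by (metis atMost_iff length_take min.absorb2)
      then show "?t i = \<zero>" unfolding t by simp
    next
      show "?t (length p) \<in> carrier K" unfolding t by simp
    qed (use True in auto)
    also have "\<dots> = \<one>" unfolding t using True by simp
    finally show ?thesis using True by (simp add: x P_sel(2) path_elt_def)
  next
    case False
    have "?t i = \<zero>" for i unfolding t using False by (metis append_take_drop_id)
    then have "(\<Oplus>i\<in>{..length r}. ?t i) = \<zero>" by (intro K.finsum_all_zero) auto
    then show ?thesis using False by (auto simp: x P_sel(2,4)) (auto simp: path_elt_def)
  qed
qed

lemma P_linear_induct [consumes 1, case_names zero add smult path]:
  assumes x: "x \<in> carrier P"
    and zero: "S \<zero>\<^bsub>P\<^esub>"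
    and add: "\<And>x y. x \<in> carrier P ==> y \<in> carrier P ==> S x ==> S y ==> S (x \<oplus>\<^bsub>P\<^esub> y)"
    and smult: "\<And>c x. c \<in> carrier K ==> x \<in> carrier P ==> S x ==> S (c \<odot>\<^bsub>P\<^esub> x)"
    and path: "\<And>p. p \<in> paths Q ==> S (path_elt K p)"
  shows "S x"
proof -
  interpret PP: module K P by (rule P_module)
  have "S x" if "finite B" "x \<in> carrier P" "{p. x p \<noteq> \<zero>} \<subseteq> B" for B x
    using that
  proof (induction B arbitrary: x rule: finite_induct)
    case empty
    then have "x = \<zero>\<^bsub>P\<^esub>" by (auto simp: P_sel(4))
    then show ?case using zero by simp
  next
    case (insert p B)
    show ?case
    proof (cases "p \<in> paths Q")
      case False
      then have "x p = \<zero>" by (rule PD(2)[OF insert.prems(1)])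
      then have "{p. x p \<noteq> \<zero>} \<subseteq> B" using insert.prems(2) by blast
      then show ?thesis using insert.IH insert.prems(1) by blast
    next
      case True
      define y where "y = x \<ominus>\<^bsub>P\<^esub> x p \<odot>\<^bsub>P\<^esub> path_elt K p"
      have xp: "x p \<in> carrier K" by (rule PD(1)[OF insert.prems(1)])
      have e: "path_elt K p \<in> carrier P" by (rule path_elt_closed[OF True])
      have y: "y \<in> carrier P" using insert.prems(1) xp e unfolding y_def by (intro PP.M.minus_closed PP.smult_closed)
      have xy: "x = y \<oplus>\<^bsub>P\<^esub> x p \<odot>\<^bsub>P\<^esub> path_elt K p"
        using insert.prems(1) xp e by (simp add: y_def a_minus_def PP.M.a_assoc PP.M.l_neg)
      have val: "y q \<oplus> x p \<otimes> path_elt K p q = x q" for q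
        using fun_cong[OF xy, of q] by (simp add: P_sel(5,6))
      have "{q. y q \<noteq> \<zero>} \<subseteq> B"
      proof
        fix q assume q: "q \<in> {q. y q \<noteq> \<zero>}"
        have "q \<noteq> p"
        proof
          assume "q = p"
          then have "y p \<oplus> x p = x p" using val[of p] xp by (simp add: path_elt_def)
          then have "(y p \<oplus> x p) \<oplus> (\<ominus> x p) = x p \<oplus> (\<ominus> x p)" by simp
          then have "y p = \<zero>" using PD(1)[OF y] xp by (simp only: K.a_assoc K.r_neg K.a_inv_closed K.r_zero)
          then show False using q \<open>q = p\<close> by simp
        qed
        then have "y q = x q" using val[of q] PD(1)[OF y] xp by (simp add: path_elt_def)
        then have "x q \<noteq> \<zero>" using q by simp
        then show "q \<in> B" using insert.prems(2) \<open>q \<noteq> p\<close> by blast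
      qed
      then have "S y" by (rule insert.IH[OF y])
      then show ?thesis using add[OF y PP.smult_closed[OF xp e]] smult[OF xp e path[OF True]] xy by simp
    qed
  qed
  then show ?thesis using PD(3)[OF x] x by blast
qed

lemma vertex_closed: "v \<in> verts Q ==> vertex_elt K v \<in> carrier P"
  unfolding vertex_elt_def using path_elt_closed paths_Nil by simp

lemma arrow_path: "a \<in> arcs Q ==> (tail Q a, [a]) \<in> paths Q"
  by (simp add: paths_Cons paths_Nil)

lemma arrow_closed: "a \<in> arcs Q ==> arrow_elt K Q a \<in> carrier P"
  unfolding arrow_elt_def using path_elt_closed arrow_path by simp

lemma path_elt_Cons:
  assumes "(u, e # p) \<in> paths Q"
  shows "path_elt K (u, e # p) = path_elt K (head Q e, p) \<bullet> arrow_elt K Q e"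
  using assms path_elt_mult[of "tail Q e" "[e]" "head Q e" p] arrow_path[of e]
  unfolding paths_Cons arrow_elt_def by auto

text \<open>The path algebra is generated as an algebra by vertices and arrows.\<close>

lemma P_generated [consumes 1, case_names zero add smult mult vertex arrow]:
  assumes x: "x \<in> carrier P"
    and zero: "S \<zero>\<^bsub>P\<^esub>"
    and add: "\<And>x y. x \<in> carrier P ==> y \<in> carrier P ==> S x ==> S y ==> S (x \<oplus>\<^bsub>P\<^esub> y)"
    and smult: "\<And>c x. c \<in> carrier K ==> x \<in> carrier P ==> S x ==> S (c \<odot>\<^bsub>P\<^esub> x)"
    and mult: "\<And>x y. x \<in> carrier P ==> y \<in> carrier P ==> S x ==> S y ==> S (x \<bullet> y)"
    and vertex: "\<And>v. v \<in> verts Q ==> S (vertex_elt K v)"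
    and arrow: "\<And>a. a \<in> arcs Q ==> S (arrow_elt K Q a)"
  shows "S x"
  using x
proof (induction rule: P_linear_induct)
  case (path p)
  have "S (path_elt K (u, es))" if "(u, es) \<in> paths Q" for u es
    using that
  proof (induction es arbitrary: u)
    case Nil
    then show ?case using vertex[of u] by (simp add: paths_Nil vertex_elt_def)
  next
    case (Cons e es)
    then have "e \<in> arcs Q" "(head Q e, es) \<in> paths Q" by (auto simp: paths_Cons)
    then show ?case unfolding path_elt_Cons[OF Cons.prems]
      using Cons.IH arrow by (intro mult arrow_closed path_elt_closed) auto
  qed
  then show ?case using path by (cases p) auto
qed (use zero add smult in auto)

lemma vertex_mult:
  assumes "v \<in> verts Q" "w \<in> verts Q"
  shows "vertex_elt K v \<bullet> vertex_elt K w = (if v = w then vertex_elt K v else \<zero>\<^bsub>P\<^esub>)"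
  using path_elt_mult[of w "[]" v "[]"] assms by (simp add: vertex_elt_def paths_Nil)

lemma arrow_mult_vertex:
  assumes "a \<in> arcs Q" "v \<in> verts Q"
  shows "arrow_elt K Q a \<bullet> vertex_elt K v = (if v = tail Q a then arrow_elt K Q a else \<zero>\<^bsub>P\<^esub>)"
    "vertex_elt K v \<bullet> arrow_elt K Q a = (if v = head Q a then arrow_elt K Q a else \<zero>\<^bsub>P\<^esub>)"
  using path_elt_mult[of v "[]" "tail Q a" "[a]"] path_elt_mult[of "tail Q a" "[a]" v "[]"] assms arrow_path
  by (auto simp: vertex_elt_def arrow_elt_def paths_Nil)

lemma one_eq: "\<one>\<^bsub>P\<^esub> = (\<Oplus>\<^bsub>P\<^esub>v\<in>verts Q. vertex_elt K v)"
proof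
  interpret PP: module K P by (rule P_module)
  fix x :: "'v \<times> 'e list"
  obtain u p where x: "x = (u, p)" by fastforce
  have "(\<Oplus>\<^bsub>P\<^esub>v\<in>verts Q. vertex_elt K v) x = (\<Oplus>v\<in>verts Q. vertex_elt K v x)"
    by (rule finsum_pointwise[OF PP.M.abelian_group_axioms K.abelian_group_axioms])
      (auto simp: PD P_sel(5) vertex_closed)
  also have "\<dots> = \<one>\<^bsub>P\<^esub> x"
  proof (cases "u \<in> verts Q \<and> p = []")
    case True
    then show ?thesis
      by (subst K.finsum_single[of _ u]) (auto simp: x P_sel(3) vertex_elt_def path_elt_def)
  next
    case False
    then show ?thesis
      by (subst K.finsum_all_zero) (auto simp: x P_sel(3) vertex_elt_def path_elt_def)
  qed
  finally show "\<one>\<^bsub>P\<^esub> x = (\<Oplus>\<^bsub>P\<^esub>v\<in>verts Q. vertex_elt K v) x" by simp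
qed

end

context quiver_alg
begin

primrec pval :: "('k, 'b, 'y) module_scheme => ('v => 'b) => ('e => 'b) => 'v => 'e list => 'b" where
  "pval B E R u [] = E u"
| "pval B E R u (e # p) = pval B E R (head Q e) p \<otimes>\<^bsub>B\<^esub> R e"

definition path_hom :: "('k, 'b, 'y) module_scheme => ('v => 'b) => ('e => 'b) => ('v \<times> 'e list => 'k) => 'b"
  where "path_hom B E R f = (\<Oplus>\<^bsub>B\<^esub>p\<in>{p. f p \<noteq> \<zero>}. f p \<odot>\<^bsub>B\<^esub> pval B E R (fst p) (snd p))"

lemma P_mod_alg: "k_algebra K P" "ring P" "module K P"
  using P_k_algebra P_module by (auto simp: k_algebra_def)

text \<open>
  A representation of the quiver inside \<open>B\<close>: the \<open>E v\<close> are orthogonal idempotents with sum \<open>1\<close>, and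
  \<open>R a\<close> runs from the tail to the head of \<open>a\<close>.
\<close>

definition quiver_rep :: "('k, 'b, 'y) module_scheme => ('v => 'b) => ('e => 'b) => bool"
  where "quiver_rep B E R \<longleftrightarrow> k_algebra K B \<and> (\<forall>v\<in>verts Q. E v \<in> carrier B) \<and> (\<forall>a\<in>arcs Q. R a \<in> carrier B) \<and>
    (\<forall>v\<in>verts Q. \<forall>w\<in>verts Q. E v \<otimes>\<^bsub>B\<^esub> E w = (if v = w then E v else \<zero>\<^bsub>B\<^esub>)) \<and>
    (\<Oplus>\<^bsub>B\<^esub>v\<in>verts Q. E v) = \<one>\<^bsub>B\<^esub> \<and>
    (\<forall>a\<in>arcs Q. E (head Q a) \<otimes>\<^bsub>B\<^esub> R a = R a \<and> R a \<otimes>\<^bsub>B\<^esub> E (tail Q a) = R a)"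

context
  fixes B :: "('k, 'b, 'y) module_scheme" and E R
  assumes rep: "quiver_rep B E R"
begin

lemma repD:
  "k_algebra K B" "v \<in> verts Q ==> E v \<in> carrier B" "a \<in> arcs Q ==> R a \<in> carrier B"
  "v \<in> verts Q ==> w \<in> verts Q ==> E v \<otimes>\<^bsub>B\<^esub> E w = (if v = w then E v else \<zero>\<^bsub>B\<^esub>)"
  "(\<Oplus>\<^bsub>B\<^esub>v\<in>verts Q. E v) = \<one>\<^bsub>B\<^esub>"
  "a \<in> arcs Q ==> E (head Q a) \<otimes>\<^bsub>B\<^esub> R a = R a" "a \<in> arcs Q ==> R a \<otimes>\<^bsub>B\<^esub> E (tail Q a) = R a"
  using rep unfolding quiver_rep_def by auto

abbreviation times_B :: "'b => 'b => 'b" (infixl "\<cdot>" 70) where "x \<cdot> y \<equiv> x \<otimes>\<^bsub>B\<^esub> y"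
abbreviation pv :: "'v \<times> 'e list => 'b" where "pv p \<equiv> pval B E R (fst p) (snd p)"
abbreviation \<rho> :: "('v \<times> 'e list => 'k) => 'b" where "\<rho> \<equiv> path_hom B E R"

lemma B_alg: "module K B" "ring B" "monoid B"
  using repD(1) unfolding k_algebra_def ring_def by auto

lemma pval_closed: "(u, p) \<in> paths Q ==> pval B E R u p \<in> carrier B"
proof (induction p arbitrary: u)
  case Nil
  then show ?case using repD(2) by (simp add: paths_Nil)
next
  case (Cons e p)
  then have "pval B E R (head Q e) p \<in> carrier B" "e \<in> arcs Q" by (auto simp: paths_Cons)
  then show ?case using repD(3) monoid.m_closed[OF B_alg(3)] by simp
qed

lemma pv_closed: "p \<in> paths Q ==> pv p \<in> carrier B"
  using pval_closed by (cases p) auto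

lemma pval_append:
  "(u, p @ q) \<in> paths Q ==> pval B E R u (p @ q) = pval B E R (awlast u p) q \<cdot> pval B E R u p"
proof (induction p arbitrary: u)
  case Nil
  interpret Bm: monoid B by (rule B_alg)
  show ?case
  proof (cases q)
    case Nil
    then show ?thesis using Nil.prems repD(4)[of u u] by (simp add: paths_Nil)
  next
    case (Cons e r)
    then have e: "e \<in> arcs Q" "tail Q e = u" "(head Q e, r) \<in> paths Q" using Nil.prems by (auto simp: paths_Cons)
    have "pval B E R (head Q e) r \<cdot> R e \<cdot> E u = pval B E R (head Q e) r \<cdot> R e"
      using e repD(7)[OF e(1)] pval_closed[OF e(3)] repD(3)[OF e(1)] repD(2) paths_verts[OF Nil.prems]
      by (simp add: Bm.m_assoc)
    then show ?thesis using Cons by simp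
  qed
next
  case (Cons e p)
  interpret Bm: monoid B by (rule B_alg)
  have e: "e \<in> arcs Q" "(head Q e, p @ q) \<in> paths Q" using Cons.prems by (auto simp: paths_Cons)
  then have "(head Q e, p) \<in> paths Q" "(awlast (head Q e) p, q) \<in> paths Q" by (auto simp: paths_append)
  then show ?case using Cons.IH[OF e(2)] pval_closed repD(3)[OF e(1)] by (simp add: Bm.m_assoc)
qed

lemma pval_ends:
  assumes "(u, p) \<in> paths Q"
  shows "pval B E R u p \<cdot> E u = pval B E R u p" "E (awlast u p) \<cdot> pval B E R u p = pval B E R u p"
  using pval_append[of u "[]" p] pval_append[of u p "[]"] assms by simp_all

lemma pval_mult:
  assumes p: "(u, p) \<in> paths Q" and q: "(v, q) \<in> paths Q"
  shows "pval B E R v q \<cdot> pval B E R u p = (if awlast u p = v then pval B E R u (p @ q) else \<zero>\<^bsub>B\<^esub>)"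
proof (cases "awlast u p = v")
  case True
  then show ?thesis using pval_append[of u p q] p q by (simp add: paths_append)
next
  case False
  interpret Br: ring B by (rule B_alg)
  have c: "E v \<in> carrier B" "E (awlast u p) \<in> carrier B" "pval B E R v q \<in> carrier B" "pval B E R u p \<in> carrier B"
    using paths_verts[OF p] paths_verts[OF q] repD(2) pval_closed p q by auto
  have "pval B E R v q \<cdot> pval B E R u p =
    (pval B E R v q \<cdot> E v) \<cdot> (E (awlast u p) \<cdot> pval B E R u p)"
    using pval_ends[OF p] pval_ends[OF q] by simp
  also have "\<dots> = pval B E R v q \<cdot> ((E v \<cdot> E (awlast u p)) \<cdot> pval B E R u p)"
    using c by (simp add: Br.m_assoc)
  also have "\<dots> = \<zero>\<^bsub>B\<^esub>"
    using False repD(4)[of v "awlast u p"] paths_verts[OF p] paths_verts[OF q] c by auto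
  finally show ?thesis using False by simp
qed

lemma path_hom_superset:
  assumes f: "f \<in> carrier P" and S: "finite S" "{p. f p \<noteq> \<zero>} \<subseteq> S" "S \<subseteq> paths Q"
  shows "\<rho> f = (\<Oplus>\<^bsub>B\<^esub>p\<in>S. f p \<odot>\<^bsub>B\<^esub> pv p)"
proof -
  interpret Bm: module K B by (rule B_alg)
  have c: "f p \<odot>\<^bsub>B\<^esub> pv p \<in> carrier B" if "p \<in> S" for p
    using Bm.smult_closed[OF PD(1)[OF f] pv_closed, of p p] that S(3) by blast
  show ?thesis unfolding path_hom_def
    by (rule Bm.M.add.finprod_mono_neutral_cong_left) (use S c pv_closed in auto)
qed

lemma supp_paths: "f \<in> carrier P ==> {p. f p \<noteq> \<zero>} \<subseteq> paths Q"
  using PD(2) by blast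

lemma path_hom_closed: "f \<in> carrier P ==> \<rho> f \<in> carrier B"
proof -
  interpret Bm: module K B by (rule B_alg)
  assume f: "f \<in> carrier P"
  show ?thesis unfolding path_hom_def
    using Bm.smult_closed[OF PD(1)[OF f] pv_closed] supp_paths[OF f] by (intro Bm.M.finsum_closed) blast
qed

lemma path_hom_add:
  assumes f: "f \<in> carrier P" and g: "g \<in> carrier P"
  shows "\<rho> (f \<oplus>\<^bsub>P\<^esub> g) = \<rho> f \<oplus>\<^bsub>B\<^esub> \<rho> g"
proof -
  interpret Bm: module K B by (rule B_alg)
  interpret PP: module K P by (rule P_module)
  let ?S = "{p. f p \<noteq> \<zero>} \<union> {p. g p \<noteq> \<zero>}"
  have S: "finite ?S" "?S \<subseteq> paths Q" using PD(3)[OF f] PD(3)[OF g] supp_paths[OF f] supp_paths[OF g] by auto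
  have c: "pv p \<in> carrier B" if "p \<in> ?S" for p using that S(2) pv_closed by blast
  have "\<rho> (f \<oplus>\<^bsub>P\<^esub> g) = (\<Oplus>\<^bsub>B\<^esub>p\<in>?S. (f \<oplus>\<^bsub>P\<^esub> g) p \<odot>\<^bsub>B\<^esub> pv p)"
    by (rule path_hom_superset[OF PP.M.a_closed[OF f g] S(1) _ S(2)]) (auto simp: P_sel(5))
  also have "\<dots> = (\<Oplus>\<^bsub>B\<^esub>p\<in>?S. f p \<odot>\<^bsub>B\<^esub> pv p \<oplus>\<^bsub>B\<^esub> g p \<odot>\<^bsub>B\<^esub> pv p)"
    using c PD(1)[OF f] PD(1)[OF g] by (intro Bm.M.finsum_cong') (auto simp: P_sel(5) Bm.smult_l_distr)
  also have "\<dots> = (\<Oplus>\<^bsub>B\<^esub>p\<in>?S. f p \<odot>\<^bsub>B\<^esub> pv p) \<oplus>\<^bsub>B\<^esub> (\<Oplus>\<^bsub>B\<^esub>p\<in>?S. g p \<odot>\<^bsub>B\<^esub> pv p)"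
    using c PD(1)[OF f] PD(1)[OF g] by (intro Bm.M.finsum_addf) auto
  also have "\<dots> = \<rho> f \<oplus>\<^bsub>B\<^esub> \<rho> g"
    using path_hom_superset[OF f S(1) _ S(2)] path_hom_superset[OF g S(1) _ S(2)] by simp
  finally show ?thesis .
qed

lemma path_hom_smult:
  assumes c: "c \<in> carrier K" and f: "f \<in> carrier P"
  shows "\<rho> (c \<odot>\<^bsub>P\<^esub> f) = c \<odot>\<^bsub>B\<^esub> \<rho> f"
proof -
  interpret Bm: module K B by (rule B_alg)
  interpret PP: module K P by (rule P_module)
  let ?S = "{p. f p \<noteq> \<zero>}"
  have t: "f p \<odot>\<^bsub>B\<^esub> pv p \<in> carrier B" "pv p \<in> carrier B" if "p \<in> ?S" for p
    using Bm.smult_closed[OF PD(1)[OF f] pv_closed, of p p] pv_closed[of p] that supp_paths[OF f] by blast+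
  have "\<rho> (c \<odot>\<^bsub>P\<^esub> f) = (\<Oplus>\<^bsub>B\<^esub>p\<in>?S. (c \<odot>\<^bsub>P\<^esub> f) p \<odot>\<^bsub>B\<^esub> pv p)"
    by (rule path_hom_superset[OF PP.smult_closed[OF c f] PD(3)[OF f] _ supp_paths[OF f]]) (use c in \<open>auto simp: P_sel(6)\<close>)
  also have "\<dots> = (\<Oplus>\<^bsub>B\<^esub>p\<in>?S. c \<odot>\<^bsub>B\<^esub> (f p \<odot>\<^bsub>B\<^esub> pv p))"
    using t c PD(1)[OF f] by (intro Bm.M.finsum_cong') (auto simp: P_sel(6) Bm.smult_assoc1)
  also have "\<dots> = c \<odot>\<^bsub>B\<^esub> \<rho> f" unfolding path_hom_def
    by (rule finsum_additive[OF Bm.M.abelian_group_axioms Bm.M.abelian_group_axioms, where h = "\<lambda>x. c \<odot>\<^bsub>B\<^esub> x", symmetric])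
      (use t c in \<open>auto simp: Bm.smult_r_distr\<close>)
  finally show ?thesis .
qed

lemma path_hom_path:
  assumes p: "p \<in> paths Q"
  shows "\<rho> (path_elt K p) = pv p"
proof -
  interpret Bm: module K B by (rule B_alg)
  have "\<rho> (path_elt K p) = (\<Oplus>\<^bsub>B\<^esub>q\<in>{p}. path_elt K p q \<odot>\<^bsub>B\<^esub> pv q)"
    by (rule path_hom_superset[OF path_elt_closed[OF p]]) (use p in \<open>auto simp: path_elt_def\<close>)
  then show ?thesis using pv_closed[OF p] by (simp add: path_elt_def)
qed

lemma path_hom_zero: "\<rho> \<zero>\<^bsub>P\<^esub> = \<zero>\<^bsub>B\<^esub>"
proof -
  interpret Bm: module K B by (rule B_alg)
  show ?thesis by (simp add: path_hom_def P_sel(4))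
qed

lemma path_hom_mult:
  assumes g: "g \<in> carrier P" and f: "f \<in> carrier P"
  shows "\<rho> (g \<bullet> f) = \<rho> g \<cdot> \<rho> f"
proof -
  interpret Br: ring B by (rule B_alg)
  interpret B: k_algebra K B by (rule repD)
  interpret Pr: ring P by (rule P_mod_alg)
  interpret PP: k_algebra K P by (rule P_k_algebra)
  have base: "\<rho> (path_elt K q \<bullet> path_elt K p) = \<rho> (path_elt K q) \<cdot> \<rho> (path_elt K p)"
    if "p \<in> paths Q" "q \<in> paths Q" for p q
    using that path_elt_mult[of "fst p" "snd p" "fst q" "snd q"] pval_mult[of "fst p" "snd p" "fst q" "snd q"]
      path_hom_path[of "(fst p, snd p @ snd q)"] paths_append[of "fst p" "snd p" "snd q"]
    by (auto simp: path_hom_path path_hom_zero)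
  have step: "\<rho> (path_elt K q \<bullet> f) = \<rho> (path_elt K q) \<cdot> \<rho> f" if q: "q \<in> paths Q" for q
    using f
  proof (induction rule: P_linear_induct)
    case zero
    then show ?case using path_elt_closed[OF q] path_hom_closed by (simp add: path_hom_zero)
  next
    case (add x y)
    then show ?case using path_elt_closed[OF q]
      by (simp add: Pr.r_distr path_hom_add path_hom_closed Br.r_distr)
  next
    case (smult c x)
    then show ?case using path_elt_closed[OF q]
      by (simp add: PP.smult_mult_right path_hom_smult path_hom_closed B.smult_mult_right)
  next
    case (path p)
    then show ?case by (rule base[OF _ q])
  qed
  show ?thesis using g
  proof (induction rule: P_linear_induct)
    case zero
    then show ?case using f path_hom_closed by (simp add: path_hom_zero)
  next
    case (add x y)
    then show ?case using f by (simp add: Pr.l_distr path_hom_add path_hom_closed Br.l_distr)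
  next
    case (smult c x)
    then show ?case using f by (simp add: PP.smult_mult_left path_hom_smult path_hom_closed B.smult_mult_left)
  next
    case (path q)
    then show ?case by (rule step)
  qed
qed

lemma path_hom_vertex: "v \<in> verts Q ==> \<rho> (vertex_elt K v) = E v"
  using path_hom_path[of "(v, [])"] by (simp add: vertex_elt_def paths_Nil)

lemma path_hom_arrow: "a \<in> arcs Q ==> \<rho> (arrow_elt K Q a) = R a"
  using path_hom_path[OF arrow_path, of a] repD(6)[of a] by (simp add: arrow_elt_def)

lemma path_hom_one: "\<rho> \<one>\<^bsub>P\<^esub> = \<one>\<^bsub>B\<^esub>"
proof -
  interpret Bm: module K B by (rule B_alg)
  interpret PP: module K P by (rule P_module)
  have "\<rho> \<one>\<^bsub>P\<^esub> = (\<Oplus>\<^bsub>B\<^esub>v\<in>verts Q. \<rho> (vertex_elt K v))" unfolding one_eq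
    by (rule finsum_additive[OF PP.M.abelian_group_axioms Bm.M.abelian_group_axioms])
      (auto simp: path_hom_add path_hom_closed vertex_closed)
  also have "\<dots> = (\<Oplus>\<^bsub>B\<^esub>v\<in>verts Q. E v)"
    by (rule Bm.M.finsum_cong') (auto simp: path_hom_vertex repD(2))
  finally show ?thesis by (simp add: repD(5))
qed

end

definition alg_hom :: "('k, 'b, 'y) module_scheme => ('k, 'c, 'x) module_scheme => ('b => 'c) => bool"
  where "alg_hom B C h \<longleftrightarrow> k_algebra K B \<and> k_algebra K C \<and> h \<in> ring_hom B C \<and>
    (\<forall>c\<in>carrier K. \<forall>x\<in>carrier B. h (c \<odot>\<^bsub>B\<^esub> x) = c \<odot>\<^bsub>C\<^esub> h x)"

lemma alg_homD:
  assumes "alg_hom B C h"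
  shows "x \<in> carrier B ==> h x \<in> carrier C"
    "x \<in> carrier B ==> y \<in> carrier B ==> h (x \<oplus>\<^bsub>B\<^esub> y) = h x \<oplus>\<^bsub>C\<^esub> h y"
    "x \<in> carrier B ==> y \<in> carrier B ==> h (x \<otimes>\<^bsub>B\<^esub> y) = h x \<otimes>\<^bsub>C\<^esub> h y"
    "h \<one>\<^bsub>B\<^esub> = \<one>\<^bsub>C\<^esub>"
    "c \<in> carrier K ==> x \<in> carrier B ==> h (c \<odot>\<^bsub>B\<^esub> x) = c \<odot>\<^bsub>C\<^esub> h x"
    "k_algebra K B" "k_algebra K C" "h \<zero>\<^bsub>B\<^esub> = \<zero>\<^bsub>C\<^esub>"
proof -
  have h: "h \<in> ring_hom B C" "k_algebra K B" "k_algebra K C"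
    "\<And>c x. c \<in> carrier K ==> x \<in> carrier B ==> h (c \<odot>\<^bsub>B\<^esub> x) = c \<odot>\<^bsub>C\<^esub> h x"
    using assms unfolding alg_hom_def by auto
  note H = ring_hom_closed[OF h(1)] ring_hom_add[OF h(1)] ring_hom_mult[OF h(1)] ring_hom_one[OF h(1)]
  show "x \<in> carrier B ==> h x \<in> carrier C"
    "x \<in> carrier B ==> y \<in> carrier B ==> h (x \<oplus>\<^bsub>B\<^esub> y) = h x \<oplus>\<^bsub>C\<^esub> h y"
    "x \<in> carrier B ==> y \<in> carrier B ==> h (x \<otimes>\<^bsub>B\<^esub> y) = h x \<otimes>\<^bsub>C\<^esub> h y"
    "h \<one>\<^bsub>B\<^esub> = \<one>\<^bsub>C\<^esub>"
    "c \<in> carrier K ==> x \<in> carrier B ==> h (c \<odot>\<^bsub>B\<^esub> x) = c \<odot>\<^bsub>C\<^esub> h x"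
    "k_algebra K B" "k_algebra K C"
    using H h by auto
  interpret B: ring B using h(2) by (simp add: k_algebra_def)
  interpret C: ring C using h(3) by (simp add: k_algebra_def)
  have "h \<zero>\<^bsub>B\<^esub> \<oplus>\<^bsub>C\<^esub> h \<zero>\<^bsub>B\<^esub> = h \<zero>\<^bsub>B\<^esub>" using H(2)[of "\<zero>\<^bsub>B\<^esub>" "\<zero>\<^bsub>B\<^esub>"] by simp
  then show "h \<zero>\<^bsub>B\<^esub> = \<zero>\<^bsub>C\<^esub>" using H(1)[of "\<zero>\<^bsub>B\<^esub>"] by simp
qed

text \<open>
  The universal property: orthogonal idempotents with sum \<open>1\<close> and elements \<open>R a\<close> between them
  extend to an algebra homomorphism, which is unique by \<open>P_hom_unique\<close>.
\<close>

lemma path_hom_alg_hom: "quiver_rep B E R ==> alg_hom P B (path_hom B E R)"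
  unfolding alg_hom_def ring_hom_def
  using repD(1) P_k_algebra path_hom_closed path_hom_add path_hom_mult path_hom_one path_hom_smult by auto

lemma P_hom_unique:
  assumes g: "alg_hom P B g" and h: "alg_hom P B h"
    and v: "\<And>v. v \<in> verts Q ==> g (vertex_elt K v) = h (vertex_elt K v)"
    and a: "\<And>a. a \<in> arcs Q ==> g (arrow_elt K Q a) = h (arrow_elt K Q a)"
    and x: "x \<in> carrier P"
  shows "g x = h x"
  using x by (induction rule: P_generated) (simp_all add: alg_homD[OF g] alg_homD[OF h] v a)

lemma alg_hom_rep:
  assumes h: "alg_hom P B h"
  shows "quiver_rep B (\<lambda>v. h (vertex_elt K v)) (\<lambda>a. h (arrow_elt K Q a))"
proof -
  note H = alg_homD[OF h]
  interpret PP: module K P by (rule P_module)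
  have B: "module K B" using H(7) by (simp add: k_algebra_def)
  have "(\<Oplus>\<^bsub>B\<^esub>v\<in>verts Q. h (vertex_elt K v)) = h \<one>\<^bsub>P\<^esub>" unfolding one_eq
    by (rule finsum_additive[OF PP.M.abelian_group_axioms module_abelian_group[OF B], symmetric])
      (auto simp: H vertex_closed)
  moreover have "h (vertex_elt K v) \<otimes>\<^bsub>B\<^esub> h (vertex_elt K w) = (if v = w then h (vertex_elt K v) else \<zero>\<^bsub>B\<^esub>)"
    if "v \<in> verts Q" "w \<in> verts Q" for v w
    using that vertex_mult[of v w] H(8) by (simp add: H(3)[symmetric] vertex_closed)
  moreover have "h (vertex_elt K (head Q a)) \<otimes>\<^bsub>B\<^esub> h (arrow_elt K Q a) = h (arrow_elt K Q a)"
    "h (arrow_elt K Q a) \<otimes>\<^bsub>B\<^esub> h (vertex_elt K (tail Q a)) = h (arrow_elt K Q a)" if "a \<in> arcs Q" for a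
    using that arrow_mult_vertex[of a] by (simp_all add: H(3)[symmetric] vertex_closed arrow_closed)
  ultimately show ?thesis
    unfolding quiver_rep_def by (auto simp: H vertex_closed arrow_closed)
qed

end

section \<open>Recognising an algebra by normal forms\<close>

lemma (in abelian_monoid) finsum_swap:
  assumes "finite I" "finite J" "\<And>i j. i \<in> I ==> j \<in> J ==> f i j \<in> carrier G"
  shows "(\<Oplus>i\<in>I. \<Oplus>j\<in>J. f i j) = (\<Oplus>j\<in>J. \<Oplus>i\<in>I. f i j)"
  using assms(1,3)
proof (induction I rule: finite_induct)
  case empty
  then show ?case by (simp add: finsum_all_zero)
next
  case (insert i I)
  have c: "f i j \<in> carrier G" "(\<Oplus>i\<in>I. f i j) \<in> carrier G" if "j \<in> J" for j
    using insert.prems that by (auto intro!: finsum_closed)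
  have "(\<Oplus>j\<in>J. \<Oplus>i\<in>insert i I. f i j) = (\<Oplus>j\<in>J. f i j \<oplus> (\<Oplus>i\<in>I. f i j))"
    using insert c by (intro finsum_cong' finsum_insert) auto
  also have "\<dots> = (\<Oplus>j\<in>J. f i j) \<oplus> (\<Oplus>j\<in>J. \<Oplus>i\<in>I. f i j)"
    using c by (intro finsum_addf) auto
  also have "(\<Oplus>j\<in>J. \<Oplus>i\<in>I. f i j) = (\<Oplus>i\<in>I. \<Oplus>j\<in>J. f i j)"
    using insert by simp
  also have "(\<Oplus>j\<in>J. f i j) \<oplus> (\<Oplus>i\<in>I. \<Oplus>j\<in>J. f i j) = (\<Oplus>i\<in>insert i I. \<Oplus>j\<in>J. f i j)"
    using insert by (intro finsum_insert[symmetric]) (auto intro!: finsum_closed)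
  finally show ?case by (rule sym)
qed

context quiver_alg
begin

text \<open>
  Let \<open>C\<close> be generated by the image of a path algebra under \<open>\<psi>\<close> and by elements \<open>q v\<close> that run
  from \<open>t v\<close> to \<open>v\<close>. If the relations allow one to move every \<open>q v\<close> to the left past arrows, then
  each element of \<open>C\<close> has a normal form \<open>\<psi> y + \<Sum>\<^sub>v q\<^sub>v s\<^sub>v\<close> with \<open>s\<^sub>v\<close> again in normal form and
  \<open>s\<^sub>v = e\<^sub>t\<^sub>v s\<^sub>v\<close>. The set of normal forms is defined inductively; the recursion replaces the
  degree in the new arrows.
\<close>

inductive_set normal_forms ::
  "('k, 'c, 'x) module_scheme => (('v \<times> 'e list => 'k) => 'c) => 'v set => ('v => 'v) => ('v => 'c) => 'c set"
  for C \<psi> N t q where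
  zero: "\<zero>\<^bsub>C\<^esub> \<in> normal_forms C \<psi> N t q"
| step: "y \<in> carrier P ==> (\<And>v. v \<in> N ==> s v \<in> normal_forms C \<psi> N t q) ==>
    (\<And>v. v \<in> N ==> s v \<in> carrier C) ==>
    (\<And>v. v \<in> N ==> \<psi> (vertex_elt K (t v)) \<otimes>\<^bsub>C\<^esub> s v = s v) ==>
    \<psi> y \<oplus>\<^bsub>C\<^esub> (\<Oplus>\<^bsub>C\<^esub>v\<in>N. q v \<otimes>\<^bsub>C\<^esub> s v) \<in> normal_forms C \<psi> N t q"

context
  fixes C :: "('k, 'c, 'x) module_scheme" and \<psi> N t q
  assumes \<psi>: "alg_hom P C \<psi>" and N: "finite N" "N \<subseteq> verts Q" and t: "\<And>v. v \<in> N ==> t v \<in> verts Q"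
    and q: "\<And>v. v \<in> N ==> q v \<in> carrier C"
    and q_left: "\<And>v. v \<in> N ==> \<psi> (vertex_elt K v) \<otimes>\<^bsub>C\<^esub> q v = q v"
    and q_right: "\<And>v. v \<in> N ==> q v \<otimes>\<^bsub>C\<^esub> \<psi> (vertex_elt K (t v)) = q v"
    and rel: "\<And>a. a \<in> arcs Q ==> tail Q a \<in> N ==> head Q a \<in> N ==>
      \<exists>z\<in>carrier P. \<psi> (arrow_elt K Q a) \<otimes>\<^bsub>C\<^esub> q (tail Q a) = q (head Q a) \<otimes>\<^bsub>C\<^esub> \<psi> z"
    and rel0: "\<And>a. a \<in> arcs Q ==> tail Q a \<in> N ==> head Q a \<notin> N ==>
      \<psi> (arrow_elt K Q a) \<otimes>\<^bsub>C\<^esub> q (tail Q a) = \<zero>\<^bsub>C\<^esub>"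
begin

abbreviation times_C :: "'c => 'c => 'c" (infixl "\<cdot>" 70) where "x \<cdot> y \<equiv> x \<otimes>\<^bsub>C\<^esub> y"
abbreviation q_sum :: "('v => 'c) => 'c" where "q_sum s \<equiv> \<Oplus>\<^bsub>C\<^esub>v\<in>N. q v \<cdot> s v"
abbreviation NF :: "'c set" where "NF \<equiv> normal_forms C \<psi> N t q"

lemma C_alg: "k_algebra K C" "ring C" "module K C"
  using alg_homD(7)[OF \<psi>] by (auto simp: k_algebra_def)

lemma vt: "v \<in> N ==> vertex_elt K (t v) \<in> carrier P" "v \<in> N ==> vertex_elt K v \<in> carrier P"
  using vertex_closed t N(2) by auto

lemma sum_closed:
  assumes "\<And>v. v \<in> N ==> s v \<in> carrier C"
  shows "q_sum s \<in> carrier C"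
proof -
  interpret C: ring C by (rule C_alg)
  show ?thesis using assms q by (intro C.finsum_closed) auto
qed

lemma sum_add:
  assumes "\<And>v. v \<in> N ==> s v \<in> carrier C" "\<And>v. v \<in> N ==> s' v \<in> carrier C"
  shows "q_sum (\<lambda>v. (s v \<oplus>\<^bsub>C\<^esub> s' v)) =
    (q_sum s) \<oplus>\<^bsub>C\<^esub> q_sum s'"
proof -
  interpret C: ring C by (rule C_alg)
  have "q_sum (\<lambda>v. (s v \<oplus>\<^bsub>C\<^esub> s' v)) = (\<Oplus>\<^bsub>C\<^esub>v\<in>N. q v \<cdot> s v \<oplus>\<^bsub>C\<^esub> q v \<cdot> s' v)"
    using assms q by (intro C.finsum_cong') (auto simp: C.r_distr)
  then show ?thesis using assms q by (simp add: C.finsum_addf Pi_def)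
qed

lemma NF_closed: "x \<in> NF ==> x \<in> carrier C"
proof (induction rule: normal_forms.induct)
  interpret C: ring C by (rule C_alg)
  case zero
  then show ?case by simp
next
  interpret C: ring C by (rule C_alg)
  case (step y s)
  then show ?case using sum_closed[of s] alg_homD(1)[OF \<psi>] by auto
qed

lemma NF_add: "x \<in> NF ==> x' \<in> NF ==> x \<oplus>\<^bsub>C\<^esub> x' \<in> NF"
proof (induction arbitrary: x' rule: normal_forms.induct)
  interpret C: ring C by (rule C_alg)
  case zero
  then show ?case using NF_closed by simp
next
  interpret C: ring C by (rule C_alg)
  interpret PP: module K P by (rule P_module)
  note h = alg_homD[OF \<psi>]
  case (step y s)
  from step.prems show ?case
  proof (cases rule: normal_forms.cases)
    case zero
    have "\<psi> y \<oplus>\<^bsub>C\<^esub> q_sum s \<in> NF"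
      by (rule normal_forms.step) (use step in auto)
    then show ?thesis using zero NF_closed by simp
  next
    case s': (step y' s')
    let ?u = "\<Oplus>\<^bsub>C\<^esub>v\<in>N. q v \<cdot> s v" and ?u' = "\<Oplus>\<^bsub>C\<^esub>v\<in>N. q v \<cdot> s' v"
    have c: "?u \<in> carrier C" "?u' \<in> carrier C" "\<psi> y \<in> carrier C" "\<psi> y' \<in> carrier C"
      using sum_closed step.hyps(3) s'(4) h(1) step.hyps(1) s'(2) by auto
    have "\<psi> (y \<oplus>\<^bsub>P\<^esub> y') \<oplus>\<^bsub>C\<^esub> q_sum (\<lambda>v. (s v \<oplus>\<^bsub>C\<^esub> s' v)) \<in> NF"
    proof (rule normal_forms.step)
      fix v assume v: "v \<in> N"
      show "s v \<oplus>\<^bsub>C\<^esub> s' v \<in> NF" by (rule step.IH[OF v s'(3)[OF v]])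
      show "s v \<oplus>\<^bsub>C\<^esub> s' v \<in> carrier C" using step.hyps(3) s'(4) v by simp
      show "\<psi> (vertex_elt K (t v)) \<cdot> (s v \<oplus>\<^bsub>C\<^esub> s' v) = s v \<oplus>\<^bsub>C\<^esub> s' v"
        using step.hyps(3,4) s'(4,5) v h(1)[OF vt(1)[OF v]] by (simp add: C.r_distr)
    qed (use step.hyps(1) s'(2) in auto)
    also have "\<psi> (y \<oplus>\<^bsub>P\<^esub> y') \<oplus>\<^bsub>C\<^esub> q_sum (\<lambda>v. (s v \<oplus>\<^bsub>C\<^esub> s' v)) = (\<psi> y \<oplus>\<^bsub>C\<^esub> ?u) \<oplus>\<^bsub>C\<^esub> (\<psi> y' \<oplus>\<^bsub>C\<^esub> ?u')"
      using step.hyps(1,3) s'(2,4) c by (simp add: h(2) sum_add C.a_ac)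
    finally show ?thesis using s'(1) by simp
  qed
qed

lemma NF_sum: "finite L ==> (\<And>l. l \<in> L ==> f l \<in> NF) ==> finsum C f L \<in> NF"
proof -
  interpret C: ring C by (rule C_alg)
  assume "\<And>l. l \<in> L ==> f l \<in> NF"
  then show ?thesis
    by (intro C.finsum_in_subset) (auto intro: NF_add normal_forms.zero NF_closed)
qed

text \<open>Moving the new generators to the left of the image of the path algebra.\<close>

abbreviation movable :: "'c => bool"
  where "movable x \<equiv> \<exists>z'. (\<forall>w\<in>N. z' w \<in> carrier P) \<and> x = q_sum (\<lambda>w. \<psi> (z' w))"

lemma move_left:
  assumes "z \<in> carrier P"
  shows "\<forall>v\<in>N. movable (\<psi> z \<cdot> q v)"
proof -
  interpret C: k_algebra K C by (rule C_alg)
  interpret C: ring C by (rule C_alg)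
  interpret PP: k_algebra K P by (rule P_k_algebra)
  interpret PP: ring P by (rule P_mod_alg)
  note h = alg_homD[OF \<psi>]
  have single: "movable x"
    if "w \<in> N" "z \<in> carrier P" "x = q w \<cdot> \<psi> z" for w z x
  proof -
    have "q_sum (\<lambda>u. \<psi> (if u = w then z else \<zero>\<^bsub>P\<^esub>)) = q w \<cdot> \<psi> z"
      by (subst C.finsum_single[of _ w]) (use that N(1) q h in auto)
    then show ?thesis using that by (intro exI[of _ "\<lambda>u. if u = w then z else \<zero>\<^bsub>P\<^esub>"]) auto
  qed
  have none: "movable \<zero>\<^bsub>C\<^esub>"
    using q h(8) by (intro exI[of _ "\<lambda>_. \<zero>\<^bsub>P\<^esub>"]) (auto simp: C.finsum_all_zero)
  have comb: "q_sum (\<lambda>w. \<psi> (z' w)) \<in> carrier C" if "\<forall>w\<in>N. z' w \<in> carrier P" for z'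
    using that h(1) by (intro sum_closed) auto
  show ?thesis using assms
  proof (induction rule: P_generated)
    case zero
    then show ?case using none q by (auto simp: h(8))
  next
    case (add x y)
    show ?case
    proof
      fix v assume v: "v \<in> N"
      obtain x' where x': "\<forall>w\<in>N. x' w \<in> carrier P" "\<psi> x \<cdot> q v = q_sum (\<lambda>w. \<psi> (x' w))"
        using bspec[OF add.IH(1) v] by blast
      obtain y' where y': "\<forall>w\<in>N. y' w \<in> carrier P" "\<psi> y \<cdot> q v = q_sum (\<lambda>w. \<psi> (y' w))"
        using bspec[OF add.IH(2) v] by blast
      have "\<psi> (x \<oplus>\<^bsub>P\<^esub> y) \<cdot> q v = q_sum (\<lambda>w. (\<psi> (x' w) \<oplus>\<^bsub>C\<^esub> \<psi> (y' w)))"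
        using sum_add[of "\<lambda>w. \<psi> (x' w)" "\<lambda>w. \<psi> (y' w)"] x' y' add.hyps v q h(1) by (simp add: h(2) C.l_distr)
      also have "\<dots> = q_sum (\<lambda>w. \<psi> (x' w \<oplus>\<^bsub>P\<^esub> y' w))"
        using x' y' q h(1) by (intro C.finsum_cong') (auto simp: h(2))
      finally show "movable (\<psi> (x \<oplus>\<^bsub>P\<^esub> y) \<cdot> q v)"
        using x' y' by (intro exI[of _ "\<lambda>w. x' w \<oplus>\<^bsub>P\<^esub> y' w"]) auto
    qed
  next
    case (smult c x)
    show ?case
    proof
      fix v assume v: "v \<in> N"
      obtain x' where x': "\<forall>w\<in>N. x' w \<in> carrier P" "\<psi> x \<cdot> q v = q_sum (\<lambda>w. \<psi> (x' w))"
        using bspec[OF smult.IH v] by blast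
      have "\<psi> (c \<odot>\<^bsub>P\<^esub> x) \<cdot> q v = c \<odot>\<^bsub>C\<^esub> (q_sum (\<lambda>w. \<psi> (x' w)))"
        using x' smult.hyps v q h(1) by (simp add: h(5) C.smult_mult_left)
      also have "\<dots> = (\<Oplus>\<^bsub>C\<^esub>w\<in>N. c \<odot>\<^bsub>C\<^esub> (q w \<cdot> \<psi> (x' w)))"
        by (rule finsum_additive[OF C.abelian_group_axioms C.abelian_group_axioms, where h = "\<lambda>x. c \<odot>\<^bsub>C\<^esub> x"])
          (use smult.hyps x' q h(1) in \<open>auto simp: C.smult_r_distr\<close>)
      also have "\<dots> = q_sum (\<lambda>w. \<psi> (c \<odot>\<^bsub>P\<^esub> x' w))"
        using x' q h(1) smult.hyps by (intro C.finsum_cong') (auto simp: h(5) C.smult_mult_right)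
      finally show "movable (\<psi> (c \<odot>\<^bsub>P\<^esub> x) \<cdot> q v)"
        using x' smult.hyps by (intro exI[of _ "\<lambda>w. c \<odot>\<^bsub>P\<^esub> x' w"]) auto
    qed
  next
    case (mult x y)
    show ?case
    proof
      fix v assume v: "v \<in> N"
      obtain y' where y': "\<forall>w\<in>N. y' w \<in> carrier P" "\<psi> y \<cdot> q v = q_sum (\<lambda>w. \<psi> (y' w))"
        using bspec[OF mult.IH(2) v] by blast
      obtain X where X: "\<forall>w\<in>N. \<forall>u\<in>N. X w u \<in> carrier P"
        "\<forall>w\<in>N. \<psi> x \<cdot> q w = q_sum (\<lambda>u. \<psi> (X w u))"
        using bchoice[OF mult.IH(1)] by blast
      let ?z = "\<lambda>u. \<Oplus>\<^bsub>P\<^esub>w\<in>N. X w u \<bullet> y' w"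
      have Xy: "X w u \<bullet> y' w \<in> carrier P" if "w \<in> N" "u \<in> N" for w u using X(1) y'(1) that by simp
      have "\<psi> (x \<bullet> y) \<cdot> q v = \<psi> x \<cdot> q_sum (\<lambda>w. \<psi> (y' w))"
        using mult.hyps h(1) q v y'(2) by (simp add: h(3) C.m_assoc)
      also have "\<dots> = (\<Oplus>\<^bsub>C\<^esub>w\<in>N. \<psi> x \<cdot> (q w \<cdot> \<psi> (y' w)))"
        using mult.hyps h(1) q y'(1) N(1) by (intro C.finsum_rdistr) auto
      also have "\<dots> = (\<Oplus>\<^bsub>C\<^esub>w\<in>N. \<Oplus>\<^bsub>C\<^esub>u\<in>N. q u \<cdot> \<psi> (X w u \<bullet> y' w))"
      proof (rule C.finsum_cong'[OF refl])
        fix w assume w: "w \<in> N"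
        have "\<psi> x \<cdot> (q w \<cdot> \<psi> (y' w)) = q_sum (\<lambda>u. \<psi> (X w u)) \<cdot> \<psi> (y' w)"
          using mult.hyps h(1) q y'(1) w X(2) by (simp add: C.m_assoc[symmetric])
        also have "\<dots> = (\<Oplus>\<^bsub>C\<^esub>u\<in>N. q u \<cdot> \<psi> (X w u) \<cdot> \<psi> (y' w))"
          using h(1) q y'(1) w X(1) N(1) by (intro C.finsum_ldistr) auto
        also have "\<dots> = q_sum (\<lambda>u. \<psi> (X w u \<bullet> y' w))"
          using h(1) q y'(1) w X(1) by (intro C.finsum_cong') (auto simp: h(3) C.m_assoc)
        finally show "\<psi> x \<cdot> (q w \<cdot> \<psi> (y' w)) = q_sum (\<lambda>u. \<psi> (X w u \<bullet> y' w))" .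
      qed (use Xy h(1) q in \<open>auto intro!: C.finsum_closed\<close>)
      also have "\<dots> = (\<Oplus>\<^bsub>C\<^esub>u\<in>N. \<Oplus>\<^bsub>C\<^esub>w\<in>N. q u \<cdot> \<psi> (X w u \<bullet> y' w))"
        by (rule C.finsum_swap[OF N(1) N(1)]) (use Xy h(1) q in auto)
      also have "\<dots> = q_sum (\<lambda>u. \<psi> (?z u))"
      proof (rule C.finsum_cong'[OF refl])
        fix u assume u: "u \<in> N"
        have "\<psi> (?z u) = (\<Oplus>\<^bsub>C\<^esub>w\<in>N. \<psi> (X w u \<bullet> y' w))"
          by (rule finsum_additive[OF PP.abelian_group_axioms C.abelian_group_axioms]) (use h Xy u in auto)
        then show "(\<Oplus>\<^bsub>C\<^esub>w\<in>N. q u \<cdot> \<psi> (X w u \<bullet> y' w)) = q u \<cdot> \<psi> (?z u)"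
          using Xy u q h(1) N(1) by (simp add: C.finsum_rdistr Pi_def)
      qed (use Xy h(1) q in \<open>auto intro!: PP.finsum_closed\<close>)
      finally show "movable (\<psi> (x \<bullet> y) \<cdot> q v)"
        using Xy by (intro exI[of _ ?z]) (auto intro!: PP.finsum_closed)
    qed
  next
    case (vertex u)
    show ?case
    proof
      fix v assume v: "v \<in> N"
      have e: "\<psi> (vertex_elt K u) \<cdot> q v = (if u = v then q v else \<zero>\<^bsub>C\<^esub>)"
      proof -
        have "\<psi> (vertex_elt K u) \<cdot> q v = \<psi> (vertex_elt K u) \<cdot> (\<psi> (vertex_elt K v) \<cdot> q v)"
          by (simp add: q_left[OF v])
        also have "\<dots> = \<psi> (vertex_elt K u \<bullet> vertex_elt K v) \<cdot> q v"
          using vertex_closed[OF vertex] vt(2)[OF v] h(1) q[OF v] by (simp add: h(3) C.m_assoc)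
        also have "\<dots> = (if u = v then q v else \<zero>\<^bsub>C\<^esub>)"
          using vertex v N(2) q[OF v] q_left[OF v] by (auto simp: vertex_mult h(8))
        finally show ?thesis .
      qed
      show "movable (\<psi> (vertex_elt K u) \<cdot> q v)"
        using single[OF v vt(1)[OF v] q_right[OF v, symmetric]] none unfolding e by auto
    qed
  next
    case (arrow a)
    show ?case
    proof
      fix v assume v: "v \<in> N"
      show "movable (\<psi> (arrow_elt K Q a) \<cdot> q v)"
      proof (cases "tail Q a = v")
        case True
        then show ?thesis
          using rel[OF arrow] rel0[OF arrow] v single none by (cases "head Q a \<in> N") auto
      next
        case False
        have "\<psi> (arrow_elt K Q a) \<cdot> q v = \<psi> (arrow_elt K Q a) \<cdot> (\<psi> (vertex_elt K v) \<cdot> q v)"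
          by (simp add: q_left[OF v])
        also have "\<dots> = \<psi> (arrow_elt K Q a \<bullet> vertex_elt K v) \<cdot> q v"
          using arrow_closed[OF arrow] vt(2)[OF v] h(1) q[OF v] by (simp add: h(3) C.m_assoc)
        also have "\<dots> = \<zero>\<^bsub>C\<^esub>"
          using False arrow v N(2) q[OF v] arrow_mult_vertex(1)[OF arrow, of v] by (auto simp: h(8))
        finally show ?thesis using none by simp
      qed
    qed
  qed
qed

text \<open>
  Moving \<open>z\<close> to the right of each \<open>q\<^sub>v\<close> produces coefficients that lie in the image of the path algebra
  again, and these are absorbed into the \<open>s\<^sub>v\<close> by induction.
\<close>

lemma NF_mult_path: "x \<in> NF ==> \<forall>z\<in>carrier P. \<psi> z \<cdot> x \<in> NF"
proof (induction rule: normal_forms.induct)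
  interpret C: ring C by (rule C_alg)
  case zero
  then show ?case using alg_homD(1)[OF \<psi>] normal_forms.zero by auto
next
  interpret C: ring C by (rule C_alg)
  interpret PP: ring P by (rule P_mod_alg)
  note h = alg_homD[OF \<psi>]
  case (step y s)
  show ?case
  proof
    fix z assume z: "z \<in> carrier P"
    obtain Z where Z: "\<forall>v\<in>N. \<forall>w\<in>N. Z v w \<in> carrier P"
      and eq: "\<forall>v\<in>N. \<psi> z \<cdot> q v = q_sum (\<lambda>w. \<psi> (Z v w))"
      using bchoice[OF move_left[OF z]] by blast
    \<comment> \<open>Inserting the idempotents \<open>e\<^sub>t\<^sub>w\<close> is harmless as \<open>q\<^sub>w e\<^sub>t\<^sub>w = q\<^sub>w\<close>, and makes the coefficients normal.\<close>
    define Z' where "Z' v w = vertex_elt K (t w) \<bullet> Z v w" for v w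
    have Z': "Z' v w \<in> carrier P" if "v \<in> N" "w \<in> N" for v w using Z vt that by (simp add: Z'_def)
    have qZ: "q w \<cdot> \<psi> (Z v w) = q w \<cdot> \<psi> (Z' v w)" if "v \<in> N" "w \<in> N" for v w
      using that Z vt h(1) q q_right[OF that(2)] by (simp add: Z'_def h(3) C.m_assoc[symmetric])
    have eZ: "\<psi> (vertex_elt K (t w)) \<cdot> \<psi> (Z' v w) = \<psi> (Z' v w)" if "v \<in> N" "w \<in> N" for v w
    proof -
      have "vertex_elt K (t w) \<bullet> Z' v w = Z' v w"
        using that Z vt t by (simp add: Z'_def PP.m_assoc[symmetric] vertex_mult)
      then show ?thesis using h(3)[OF vt(1)[OF that(2)] Z'[OF that]] by simp
    qed
    define s' where "s' w = (\<Oplus>\<^bsub>C\<^esub>v\<in>N. \<psi> (Z' v w) \<cdot> s v)" for w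
    note sc = step.hyps(3)
    have tm: "\<psi> (Z' v w) \<cdot> s v \<in> carrier C" if "v \<in> N" "w \<in> N" for v w using Z'[OF that] h(1) sc that by simp
    have s'c: "s' w \<in> carrier C" if "w \<in> N" for w unfolding s'_def using tm that by (intro C.finsum_closed) auto
    have s'N: "s' w \<in> NF" if "w \<in> N" for w
      unfolding s'_def using step.IH Z' that N(1) by (intro NF_sum) auto
    have s'e: "\<psi> (vertex_elt K (t w)) \<cdot> s' w = s' w" if w: "w \<in> N" for w
    proof -
      have "\<psi> (vertex_elt K (t w)) \<cdot> s' w = (\<Oplus>\<^bsub>C\<^esub>v\<in>N. \<psi> (vertex_elt K (t w)) \<cdot> (\<psi> (Z' v w) \<cdot> s v))"
        unfolding s'_def using tm w vt h(1) N(1) by (intro C.finsum_rdistr) auto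
      also have "\<dots> = s' w" unfolding s'_def
        using tm w vt h(1) sc Z' by (intro C.finsum_cong') (auto simp: C.m_assoc[symmetric] eZ)
      finally show ?thesis .
    qed
    have "\<psi> z \<cdot> q_sum s = (\<Oplus>\<^bsub>C\<^esub>v\<in>N. \<psi> z \<cdot> (q v \<cdot> s v))"
      using z h(1) q sc N(1) by (intro C.finsum_rdistr) auto
    also have "\<dots> = (\<Oplus>\<^bsub>C\<^esub>v\<in>N. \<Oplus>\<^bsub>C\<^esub>w\<in>N. q w \<cdot> (\<psi> (Z' v w) \<cdot> s v))"
    proof (rule C.finsum_cong'[OF refl])
      fix v assume v: "v \<in> N"
      have "\<psi> z \<cdot> (q v \<cdot> s v) = q_sum (\<lambda>w. \<psi> (Z v w)) \<cdot> s v"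
        using z h(1) q sc v eq by (simp add: C.m_assoc[symmetric])
      also have "\<dots> = (\<Oplus>\<^bsub>C\<^esub>w\<in>N. q w \<cdot> \<psi> (Z v w) \<cdot> s v)"
        using h(1) q sc v Z N(1) by (intro C.finsum_ldistr) auto
      also have "\<dots> = q_sum (\<lambda>w. (\<psi> (Z' v w) \<cdot> s v))"
        using h(1) q sc v Z' by (intro C.finsum_cong') (auto simp: qZ C.m_assoc)
      finally show "\<psi> z \<cdot> (q v \<cdot> s v) = q_sum (\<lambda>w. (\<psi> (Z' v w) \<cdot> s v))" .
    qed (use tm q in \<open>auto intro!: C.finsum_closed\<close>)
    also have "\<dots> = (\<Oplus>\<^bsub>C\<^esub>w\<in>N. \<Oplus>\<^bsub>C\<^esub>v\<in>N. q w \<cdot> (\<psi> (Z' v w) \<cdot> s v))"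
      by (rule C.finsum_swap[OF N(1) N(1)]) (use tm q in auto)
    also have "\<dots> = q_sum s'"
      unfolding s'_def using tm q N(1)
      by (intro C.finsum_cong' C.finsum_rdistr[symmetric]) (auto intro!: C.finsum_closed C.m_closed)
    finally have main: "\<psi> z \<cdot> q_sum s = q_sum s'" .
    have "\<psi> (z \<bullet> y) \<oplus>\<^bsub>C\<^esub> q_sum s' \<in> NF"
      by (rule normal_forms.step) (use z step.hyps(1) s'N s'c s'e in auto)
    then show "\<psi> z \<cdot> (\<psi> y \<oplus>\<^bsub>C\<^esub> q_sum s) \<in> NF"
      using z step.hyps(1) h(1) sum_closed[of s] sc main by (simp add: h(3) C.r_distr)
  qed
qed

text \<open>
  \<open>q\<^sub>v x = q\<^sub>v (e\<^sub>t\<^sub>v x)\<close> is a normal form with the single coefficient \<open>e\<^sub>t\<^sub>v x\<close>.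
\<close>

lemma NF_mult_q:
  assumes v: "v \<in> N" and x: "x \<in> NF"
  shows "q v \<cdot> x \<in> NF"
proof -
  interpret C: ring C by (rule C_alg)
  interpret PP: ring P by (rule P_mod_alg)
  note h = alg_homD[OF \<psi>]
  define e where "e = \<psi> (vertex_elt K (t v))"
  have e: "e \<in> carrier C" unfolding e_def using h(1) vt v by simp
  have xc: "x \<in> carrier C" by (rule NF_closed[OF x])
  have ex: "e \<cdot> x \<in> NF" unfolding e_def using NF_mult_path[OF x] vt v by auto
  have ee: "e \<cdot> e = e"
    using h(3)[OF vt(1)[OF v] vt(1)[OF v]] t[OF v] by (simp add: e_def vertex_mult)
  define s where "s w = (if w = v then e \<cdot> x else \<zero>\<^bsub>C\<^esub>)" for w
  have sN: "s w \<in> NF" for w unfolding s_def using ex normal_forms.zero by auto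
  have sc: "s w \<in> carrier C" for w using NF_closed[OF sN] .
  have se: "\<psi> (vertex_elt K (t w)) \<cdot> s w = s w" if "w \<in> N" for w
    unfolding s_def using h(1)[OF vt(1)[OF that]] e xc by (auto simp: e_def[symmetric] C.m_assoc[symmetric] ee)
  have "\<psi> \<zero>\<^bsub>P\<^esub> \<oplus>\<^bsub>C\<^esub> q_sum s \<in> NF"
    by (rule normal_forms.step) (use sN sc se in auto)
  moreover have "q_sum s = q v \<cdot> s v"
    by (rule C.finsum_single[OF N(1) v]) (use q v e xc in \<open>auto simp: s_def\<close>)
  moreover have "q v \<cdot> s v = q v \<cdot> x"
    using q[OF v] e xc q_right[OF v] by (simp add: s_def C.m_assoc[symmetric] e_def)
  ultimately show ?thesis using q[OF v] xc by (simp add: h(8))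
qed

text \<open>
  Left multiplication by generators preserves normal forms, hence so does left multiplication by every
  element of \<open>C\<close>; now multiply the normal form \<open>1\<close>.
\<close>

lemma NF_all:
  assumes gen: "\<And>U. U \<subseteq> carrier C ==> \<psi> ` carrier P \<subseteq> U ==> q ` N \<subseteq> U ==>
      (\<And>x y. x \<in> U ==> y \<in> U ==> x \<oplus>\<^bsub>C\<^esub> y \<in> U) ==> (\<And>x y. x \<in> U ==> y \<in> U ==> x \<cdot> y \<in> U) ==>
      U = carrier C"
  shows "NF = carrier C"
proof -
  interpret C: ring C by (rule C_alg)
  interpret PP: ring P by (rule P_mod_alg)
  note h = alg_homD[OF \<psi>]
  define U where "U = {x \<in> carrier C. \<forall>y\<in>NF. x \<cdot> y \<in> NF}"
  have "U = carrier C"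
  proof (rule gen)
    show "\<psi> ` carrier P \<subseteq> U" using NF_mult_path h(1) by (auto simp: U_def)
    show "q ` N \<subseteq> U" using NF_mult_q q by (auto simp: U_def)
    show "x \<oplus>\<^bsub>C\<^esub> y \<in> U" if "x \<in> U" "y \<in> U" for x y
      using that NF_closed NF_add by (auto simp: U_def C.l_distr)
    show "x \<cdot> y \<in> U" if "x \<in> U" "y \<in> U" for x y
      using that NF_closed by (auto simp: U_def C.m_assoc)
  qed (auto simp: U_def)
  moreover have "\<one>\<^bsub>C\<^esub> \<in> NF"
  proof -
    have "\<psi> \<one>\<^bsub>P\<^esub> \<oplus>\<^bsub>C\<^esub> q_sum (\<lambda>w. \<zero>\<^bsub>C\<^esub>) \<in> NF"
      by (rule normal_forms.step) (use vt h(1) normal_forms.zero in auto)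
    moreover have "q_sum (\<lambda>w. \<zero>\<^bsub>C\<^esub>) = \<zero>\<^bsub>C\<^esub>" by (rule C.finsum_all_zero) (use q in auto)
    ultimately show ?thesis by (simp add: h(4))
  qed
  ultimately have "x \<in> NF" if "x \<in> carrier C" for x
  proof -
    have "x \<in> U" using that \<open>U = carrier C\<close> by simp
    then have "x \<cdot> \<one>\<^bsub>C\<^esub> \<in> NF" using \<open>\<one>\<^bsub>C\<^esub> \<in> NF\<close> unfolding U_def by blast
    then show ?thesis using that by simp
  qed
  then show ?thesis using NF_closed by blast
qed

text \<open>
  A homomorphism \<open>\<sigma>\<close> from \<open>C\<close> is bijective if normal forms in the target exist, by recursion along
  some exhaustive filtration, and are unique.
\<close>

theorem normal_form_iso:
  assumes \<sigma>: "alg_hom C B \<sigma>"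
    and gen: "\<And>U. U \<subseteq> carrier C ==> \<psi> ` carrier P \<subseteq> U ==> q ` N \<subseteq> U ==>
      (\<And>x y. x \<in> U ==> y \<in> U ==> x \<oplus>\<^bsub>C\<^esub> y \<in> U) ==> (\<And>x y. x \<in> U ==> y \<in> U ==> x \<cdot> y \<in> U) ==>
      U = carrier C"
    and unique: "\<And>y x. y \<in> carrier P ==> (\<And>v. v \<in> N ==> x v \<in> carrier B) ==>
      (\<And>v. v \<in> N ==> \<sigma> (\<psi> (vertex_elt K (t v))) \<otimes>\<^bsub>B\<^esub> x v = x v) ==>
      \<sigma> (\<psi> y) \<oplus>\<^bsub>B\<^esub> (\<Oplus>\<^bsub>B\<^esub>v\<in>N. \<sigma> (q v) \<otimes>\<^bsub>B\<^esub> x v) = \<zero>\<^bsub>B\<^esub> ==>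
      \<psi> y = \<zero>\<^bsub>C\<^esub> \<and> (\<forall>v\<in>N. x v = \<zero>\<^bsub>B\<^esub>)"
    and fil: "\<And>b. b \<in> carrier B ==> \<exists>n. b \<in> Fil n" "Fil 0 = {\<zero>\<^bsub>B\<^esub>}"
      "\<And>n b. b \<in> Fil (Suc n) ==> \<exists>y\<in>carrier P. \<exists>x. (\<forall>v\<in>N. x v \<in> Fil n) \<and>
        b = \<sigma> (\<psi> y) \<oplus>\<^bsub>B\<^esub> (\<Oplus>\<^bsub>B\<^esub>v\<in>N. \<sigma> (q v) \<otimes>\<^bsub>B\<^esub> x v)"
  shows "bij_betw \<sigma> (carrier C) (carrier B)"
proof -
  note h = alg_homD[OF \<psi>] and r = alg_homD[OF \<sigma>]
  interpret C: ring C by (rule C_alg)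
  interpret B: ring B using r(7) by (simp add: k_algebra_def)
  have NF: "NF = carrier C" by (rule NF_all[OF gen])
  have \<sigma>sum: "\<sigma> (q_sum s) = (\<Oplus>\<^bsub>B\<^esub>v\<in>N. \<sigma> (q v) \<otimes>\<^bsub>B\<^esub> \<sigma> (s v))"
    if "\<And>v. v \<in> N ==> s v \<in> carrier C" for s
  proof -
    have "\<sigma> (q_sum s) = (\<Oplus>\<^bsub>B\<^esub>v\<in>N. \<sigma> (q v \<cdot> s v))"
      by (rule finsum_additive[OF C.abelian_group_axioms B.abelian_group_axioms]) (use r that q in auto)
    also have "\<dots> = (\<Oplus>\<^bsub>B\<^esub>v\<in>N. \<sigma> (q v) \<otimes>\<^bsub>B\<^esub> \<sigma> (s v))"
      using r that q by (intro B.finsum_cong') auto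
    finally show ?thesis .
  qed
  have ker: "\<sigma> x = \<zero>\<^bsub>B\<^esub> \<longrightarrow> x = \<zero>\<^bsub>C\<^esub>" if "x \<in> NF" for x
    using that
  proof (induction rule: normal_forms.induct)
    case (step y s)
    show ?case
    proof
      assume "\<sigma> (\<psi> y \<oplus>\<^bsub>C\<^esub> q_sum s) = \<zero>\<^bsub>B\<^esub>"
      then have z: "\<sigma> (\<psi> y) \<oplus>\<^bsub>B\<^esub> (\<Oplus>\<^bsub>B\<^esub>v\<in>N. \<sigma> (q v) \<otimes>\<^bsub>B\<^esub> \<sigma> (s v)) = \<zero>\<^bsub>B\<^esub>"
        using r(2)[OF h(1)[OF step.hyps(1)] sum_closed[of s]] step.hyps(3) \<sigma>sum[of s] by simp
      have e: "\<sigma> (\<psi> (vertex_elt K (t v))) \<otimes>\<^bsub>B\<^esub> \<sigma> (s v) = \<sigma> (s v)" if "v \<in> N" for v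
        using r(3)[OF h(1)[OF vt(1)[OF that]] step.hyps(3)[OF that]] step.hyps(4)[OF that] by simp
      have "\<psi> y = \<zero>\<^bsub>C\<^esub> \<and> (\<forall>v\<in>N. \<sigma> (s v) = \<zero>\<^bsub>B\<^esub>)"
        by (rule unique[OF step.hyps(1) r(1)[OF step.hyps(3)] e z])
      then have "\<psi> y = \<zero>\<^bsub>C\<^esub>" "\<And>v. v \<in> N ==> s v = \<zero>\<^bsub>C\<^esub>" using step.IH by blast+
      then show "\<psi> y \<oplus>\<^bsub>C\<^esub> q_sum s = \<zero>\<^bsub>C\<^esub>"
        using q by (simp add: C.finsum_all_zero)
    qed
  qed simp
  have inj: "inj_on \<sigma> (carrier C)"
  proof (rule inj_onI)
    fix x y assume xy: "x \<in> carrier C" "y \<in> carrier C" "\<sigma> x = \<sigma> y"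
    have "\<sigma> (x \<ominus>\<^bsub>C\<^esub> y) \<oplus>\<^bsub>B\<^esub> \<sigma> y = \<sigma> x"
      using r(2)[of "x \<ominus>\<^bsub>C\<^esub> y" y] xy by (simp add: C.minus_eq C.a_assoc C.l_neg)
    then have "\<sigma> (x \<ominus>\<^bsub>C\<^esub> y) = \<zero>\<^bsub>B\<^esub>" using xy r(1) by (metis B.add.r_cancel_one' C.minus_closed)
    then have "x \<ominus>\<^bsub>C\<^esub> y = \<zero>\<^bsub>C\<^esub>" using ker[of "x \<ominus>\<^bsub>C\<^esub> y"] xy unfolding NF by simp
    then show "x = y" by (rule C.minus_zero_eq[OF xy(1,2)])
  qed
  have surj: "b \<in> \<sigma> ` carrier C" if "b \<in> Fil n" for b n
    using that
  proof (induction n arbitrary: b)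
    case 0
    then have "b = \<sigma> \<zero>\<^bsub>C\<^esub>" using fil(2) r(8) by simp
    then show ?case by blast
  next
    case (Suc n)
    obtain y x where y: "y \<in> carrier P" "\<forall>v\<in>N. x v \<in> Fil n"
      "b = \<sigma> (\<psi> y) \<oplus>\<^bsub>B\<^esub> (\<Oplus>\<^bsub>B\<^esub>v\<in>N. \<sigma> (q v) \<otimes>\<^bsub>B\<^esub> x v)" using fil(3)[OF Suc.prems] by blast
    have "\<forall>v\<in>N. \<exists>s. s \<in> carrier C \<and> x v = \<sigma> s" using Suc.IH y(2) by blast
    then obtain s where s: "\<forall>v\<in>N. s v \<in> carrier C \<and> x v = \<sigma> (s v)" by metis
    have "(\<Oplus>\<^bsub>B\<^esub>v\<in>N. \<sigma> (q v) \<otimes>\<^bsub>B\<^esub> x v) = (\<Oplus>\<^bsub>B\<^esub>v\<in>N. \<sigma> (q v) \<otimes>\<^bsub>B\<^esub> \<sigma> (s v))"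
      using s q r(1) by (intro B.finsum_cong') auto
    then have b: "b = \<sigma> (\<psi> y \<oplus>\<^bsub>C\<^esub> q_sum s)"
      using s y(1,3) h(1) sum_closed[of s] \<sigma>sum[of s] by (simp add: r(2))
    have "\<psi> y \<oplus>\<^bsub>C\<^esub> q_sum s \<in> carrier C"
      using s y(1) h(1) sum_closed[of s] by simp
    then show ?case unfolding b by (rule imageI)
  qed
  have "\<sigma> ` carrier C = carrier B" using surj fil(1) r(1) by blast
  then show ?thesis using inj by (simp add: bij_betw_def)
qed

end

end

section \<open>Quotient algebras and the extended quiver\<close>

context scalar_field
begin

lemma ideal_subspace:
  assumes B: "k_algebra K B" and J: "ideal J B"
  shows "subspace K B J"
proof -
  interpret Br: ring B using B by (simp add: k_algebra_def)
  interpret B: k_algebra K B by (rule B)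
  interpret J: ideal J B by (rule J)
  have "c \<odot>\<^bsub>B\<^esub> x \<in> J" if c: "c \<in> carrier K" and x: "x \<in> J" for c x
  proof -
    have xB: "x \<in> carrier B" using x J.Icarr by simp
    have "(c \<odot>\<^bsub>B\<^esub> \<one>\<^bsub>B\<^esub>) \<otimes>\<^bsub>B\<^esub> x \<in> J" using c x by (intro J.I_l_closed) auto
    then show ?thesis using c xB by (simp add: B.smult_mult_left)
  qed
  then show ?thesis unfolding subspace_def using J.a_subset J.a_closed J.zero_closed by auto
qed

lemma alg_quot_sel:
  "carrier (alg_quot B J) = (\<lambda>x. J +>\<^bsub>B\<^esub> x) ` carrier B" "\<zero>\<^bsub>alg_quot B J\<^esub> = J"
  "add (alg_quot B J) = set_add B" "mult (alg_quot B J) = mult (B Quot J)" "\<one>\<^bsub>alg_quot B J\<^esub> = \<one>\<^bsub>B Quot J\<^esub>"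
  "smult (alg_quot B J) = (\<lambda>c. coset_map B J (\<lambda>x. c \<odot>\<^bsub>B\<^esub> x))"
  by (auto simp: alg_quot_def Let_def FactRing_def A_RCOSETS_def')

lemma alg_quot_algebra:
  assumes B: "k_algebra K B" and J: "ideal J B"
  shows "k_algebra K (alg_quot B J)"
    "x \<in> carrier B ==> y \<in> carrier B ==> (J +>\<^bsub>B\<^esub> x) \<oplus>\<^bsub>alg_quot B J\<^esub> (J +>\<^bsub>B\<^esub> y) = J +>\<^bsub>B\<^esub> (x \<oplus>\<^bsub>B\<^esub> y)"
    "x \<in> carrier B ==> y \<in> carrier B ==> (J +>\<^bsub>B\<^esub> x) \<otimes>\<^bsub>alg_quot B J\<^esub> (J +>\<^bsub>B\<^esub> y) = J +>\<^bsub>B\<^esub> (x \<otimes>\<^bsub>B\<^esub> y)"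
    "\<one>\<^bsub>alg_quot B J\<^esub> = J +>\<^bsub>B\<^esub> \<one>\<^bsub>B\<^esub>"
    "c \<in> carrier K ==> x \<in> carrier B ==> c \<odot>\<^bsub>alg_quot B J\<^esub> (J +>\<^bsub>B\<^esub> x) = J +>\<^bsub>B\<^esub> (c \<odot>\<^bsub>B\<^esub> x)"
proof -
  let ?C = "alg_quot B J"
  interpret Br: ring B using B by (simp add: k_algebra_def)
  interpret B: k_algebra K B by (rule B)
  interpret J: ideal J B by (rule J)
  interpret R: ring "B Quot J" by (rule J.quotient_is_ring)
  have mB: "module K B" using B by (simp add: k_algebra_def)
  note S = ideal_subspace[OF B J]
  have top: "subspace K B (carrier B)" unfolding subspace_def by auto
  show add: "x \<in> carrier B ==> y \<in> carrier B ==> (J +>\<^bsub>B\<^esub> x) \<oplus>\<^bsub>?C\<^esub> (J +>\<^bsub>B\<^esub> y) = J +>\<^bsub>B\<^esub> (x \<oplus>\<^bsub>B\<^esub> y)" for x y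
    unfolding alg_quot_sel by (rule coset_add[OF mB S])
  show mult: "x \<in> carrier B ==> y \<in> carrier B ==> (J +>\<^bsub>B\<^esub> x) \<otimes>\<^bsub>?C\<^esub> (J +>\<^bsub>B\<^esub> y) = J +>\<^bsub>B\<^esub> (x \<otimes>\<^bsub>B\<^esub> y)" for x y
    unfolding alg_quot_sel using ring_hom_mult[OF J.rcos_ring_hom, of x y] by simp
  show one: "\<one>\<^bsub>?C\<^esub> = J +>\<^bsub>B\<^esub> \<one>\<^bsub>B\<^esub>"
    unfolding alg_quot_sel using ring_hom_one[OF J.rcos_ring_hom] by simp
  show smult: "c \<in> carrier K ==> x \<in> carrier B ==> c \<odot>\<^bsub>?C\<^esub> (J +>\<^bsub>B\<^esub> x) = J +>\<^bsub>B\<^esub> (c \<odot>\<^bsub>B\<^esub> x)" for c x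
    unfolding alg_quot_sel by (rule coset_smult[OF mB S])
  have car: "X \<in> carrier ?C ==> \<exists>x\<in>carrier B. X = J +>\<^bsub>B\<^esub> x" for X by (auto simp: alg_quot_sel(1))
  have cl: "x \<in> carrier B ==> J +>\<^bsub>B\<^esub> x \<in> carrier ?C" for x by (auto simp: alg_quot_sel(1))
  have mod: "module K ?C"
  proof (rule module_transfer[where h = "\<lambda>x. x", OF quot_space_module(1)[OF mB S top]])
    show "\<zero>\<^bsub>?C\<^esub> \<in> carrier ?C"
      using cl[OF Br.zero_closed] coset_zero[OF mB S] by (simp add: alg_quot_sel(2))
    show "X \<oplus>\<^bsub>?C\<^esub> Y \<in> carrier ?C" if "X \<in> carrier ?C" "Y \<in> carrier ?C" for X Y
      using car[OF that(1)] car[OF that(2)] add cl by auto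
    show "c \<odot>\<^bsub>?C\<^esub> X \<in> carrier ?C" if "c \<in> carrier K" "X \<in> carrier ?C" for c X
      using car[OF that(2)] that(1) smult cl by auto
  qed (auto simp: alg_quot_sel quot_space_def)
  interpret C: module K ?C by (rule mod)
  have q: "carrier ?C = carrier (B Quot J)" "mult ?C = mult (B Quot J)" "one ?C = one (B Quot J)" "add ?C = add (B Quot J)"
    by (simp_all add: alg_quot_def Let_def)
  have "ring ?C"
    by (intro ringI monoidI C.M.abelian_group_axioms) (simp_all add: q R.m_assoc R.l_distr R.r_distr)
  then show "k_algebra K ?C"
  proof (intro k_algebra.intro k_algebra_axioms.intro mod)
    fix c X Y assume c: "c \<in> carrier K" and "X \<in> carrier ?C" "Y \<in> carrier ?C"
    then obtain x y where x: "x \<in> carrier B" "X = J +>\<^bsub>B\<^esub> x" "y \<in> carrier B" "Y = J +>\<^bsub>B\<^esub> y" using car by metis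
    show "(c \<odot>\<^bsub>?C\<^esub> X) \<otimes>\<^bsub>?C\<^esub> Y = c \<odot>\<^bsub>?C\<^esub> (X \<otimes>\<^bsub>?C\<^esub> Y)" "X \<otimes>\<^bsub>?C\<^esub> (c \<odot>\<^bsub>?C\<^esub> Y) = c \<odot>\<^bsub>?C\<^esub> (X \<otimes>\<^bsub>?C\<^esub> Y)"
      using x c by (simp_all add: mult smult B.smult_mult_left B.smult_mult_right)
  qed
qed

lemma alg_quot_lift:
  assumes B: "k_algebra K B" and J: "ideal J B" and D: "k_algebra K D"
    and \<sigma>: "\<sigma> \<in> ring_hom B D" "\<And>c x. c \<in> carrier K ==> x \<in> carrier B ==> \<sigma> (c \<odot>\<^bsub>B\<^esub> x) = c \<odot>\<^bsub>D\<^esub> \<sigma> x"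
    and ker: "\<And>x. x \<in> J ==> \<sigma> x = \<zero>\<^bsub>D\<^esub>"
  obtains \<sigma>' where "\<sigma>' \<in> ring_hom (alg_quot B J) D" "\<And>x. x \<in> carrier B ==> \<sigma>' (J +>\<^bsub>B\<^esub> x) = \<sigma> x"
    "\<And>c X. c \<in> carrier K ==> X \<in> carrier (alg_quot B J) ==> \<sigma>' (c \<odot>\<^bsub>alg_quot B J\<^esub> X) = c \<odot>\<^bsub>D\<^esub> \<sigma>' X"
proof -
  let ?C = "alg_quot B J"
  interpret Br: ring B using B by (simp add: k_algebra_def)
  interpret B: k_algebra K B by (rule B)
  interpret D: ring D using D by (simp add: k_algebra_def)
  interpret J: ideal J B by (rule J)
  note Q = alg_quot_algebra[OF B J]
  note H = ring_hom_closed[OF \<sigma>(1)] ring_hom_add[OF \<sigma>(1)] ring_hom_mult[OF \<sigma>(1)] ring_hom_one[OF \<sigma>(1)]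
  define \<sigma>' where "\<sigma>' X = \<sigma> (SOME x. x \<in> carrier B \<and> J +>\<^bsub>B\<^esub> x = X)" for X
  have val: "\<sigma>' (J +>\<^bsub>B\<^esub> x) = \<sigma> x" if x: "x \<in> carrier B" for x
  proof -
    define y where "y = (SOME y. y \<in> carrier B \<and> J +>\<^bsub>B\<^esub> y = J +>\<^bsub>B\<^esub> x)"
    have y: "y \<in> carrier B" "J +>\<^bsub>B\<^esub> y = J +>\<^bsub>B\<^esub> x"
      using someI[of "\<lambda>y. y \<in> carrier B \<and> J +>\<^bsub>B\<^esub> y = J +>\<^bsub>B\<^esub> x" x] x unfolding y_def by auto
    have "\<zero>\<^bsub>B\<^esub> \<oplus>\<^bsub>B\<^esub> y \<in> J +>\<^bsub>B\<^esub> y" using J.zero_closed unfolding a_r_coset_def' by blast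
    then have "y \<in> J +>\<^bsub>B\<^esub> x" using y by simp
    then obtain b where b: "b \<in> J" "y = b \<oplus>\<^bsub>B\<^esub> x" unfolding a_r_coset_def' by blast
    have "\<sigma> y = \<sigma> b \<oplus>\<^bsub>D\<^esub> \<sigma> x" using b x J.Icarr H(2) by simp
    then show ?thesis using ker[OF b(1)] H(1)[OF x] by (simp add: \<sigma>'_def y_def[symmetric])
  qed
  have car: "X \<in> carrier ?C ==> \<exists>x\<in>carrier B. X = J +>\<^bsub>B\<^esub> x" for X by (auto simp: alg_quot_sel(1))
  show thesis
  proof (rule that)
    show "\<sigma>' \<in> ring_hom ?C D"
    proof (rule ring_hom_memI)
      fix X assume "X \<in> carrier ?C"
      then show "\<sigma>' X \<in> carrier D" using car[of X] val H(1) by auto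
    next
      fix X Y assume "X \<in> carrier ?C" "Y \<in> carrier ?C"
      then obtain x y where x: "x \<in> carrier B" "X = J +>\<^bsub>B\<^esub> x" "y \<in> carrier B" "Y = J +>\<^bsub>B\<^esub> y" using car by metis
      show "\<sigma>' (X \<otimes>\<^bsub>?C\<^esub> Y) = \<sigma>' X \<otimes>\<^bsub>D\<^esub> \<sigma>' Y" "\<sigma>' (X \<oplus>\<^bsub>?C\<^esub> Y) = \<sigma>' X \<oplus>\<^bsub>D\<^esub> \<sigma>' Y"
        using x by (simp_all add: Q val H)
    next
      show "\<sigma>' \<one>\<^bsub>?C\<^esub> = \<one>\<^bsub>D\<^esub>" by (simp add: Q(4) val H)
    qed
    show "\<sigma>' (J +>\<^bsub>B\<^esub> x) = \<sigma> x" if "x \<in> carrier B" for x by (rule val[OF that])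
    show "\<sigma>' (c \<odot>\<^bsub>?C\<^esub> X) = c \<odot>\<^bsub>D\<^esub> \<sigma>' X" if "c \<in> carrier K" "X \<in> carrier ?C" for c X
      using car[OF that(2)] that(1) by (auto simp: Q val \<sigma>(2))
  qed
qed

lemma alg_iso_inverse:
  assumes C: "k_algebra K C" and \<sigma>: "\<sigma> \<in> ring_hom C D"
    "\<And>c x. c \<in> carrier K ==> x \<in> carrier C ==> \<sigma> (c \<odot>\<^bsub>C\<^esub> x) = c \<odot>\<^bsub>D\<^esub> \<sigma> x"
    and bij: "bij_betw \<sigma> (carrier C) (carrier D)"
  shows "inv_into (carrier C) \<sigma> \<in> alg_iso K D C"
proof -
  interpret Cr: ring C using C by (simp add: k_algebra_def)
  interpret C: k_algebra K C by (rule C)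
  have "\<sigma> \<in> ring_iso C D" using \<sigma>(1) bij by (simp add: ring_iso_def)
  then have iso: "inv_into (carrier C) \<sigma> \<in> ring_iso D C" by (rule ring_iso_set_sym[OF Cr.ring_axioms])
  have "inv_into (carrier C) \<sigma> (c \<odot>\<^bsub>D\<^esub> x) = c \<odot>\<^bsub>C\<^esub> inv_into (carrier C) \<sigma> x"
    if c: "c \<in> carrier K" and x: "x \<in> carrier D" for c x
  proof -
    obtain y where y: "y \<in> carrier C" "x = \<sigma> y" using x bij by (auto simp: bij_betw_def)
    have "inv_into (carrier C) \<sigma> (\<sigma> z) = z" if "z \<in> carrier C" for z
      using bij that by (simp add: bij_betw_def)
    then show ?thesis using y c \<sigma>(2)[OF c y(1), symmetric] by simp
  qed
  then show ?thesis using iso by (simp add: alg_iso_def)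
qed

end

context quiver_alg
begin

context
  fixes N :: "'v set" and t :: "'v => 'v"
  assumes N: "N \<subseteq> verts Q" and t: "\<And>v. v \<in> N ==> t v \<in> verts Q"
begin

abbreviation Q' :: "('v, 'e + 'v) pre_digraph" where "Q' \<equiv> ext_quiver Q N t"
abbreviation P' :: "('k, 'v \<times> ('e + 'v) list => 'k) module" where "P' \<equiv> path_algebra K Q'"

lemma ext_quiver_sel [simp]:
  "verts Q' = verts Q" "arcs Q' = Inl ` arcs Q \<union> Inr ` N" "tail Q' (Inl a) = tail Q a" "tail Q' (Inr v) = t v"
  "head Q' (Inl a) = head Q a" "head Q' (Inr v) = v"
  by (simp_all add: ext_quiver_def)

lemma ext_quiver_fin: "fin_digraph Q'"
  by unfold_locales (use N t finite_subset[OF N] in auto)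

lemma ext_quiver_alg: "quiver_alg K Q'"
  by (intro quiver_alg.intro scalar_field_axioms ext_quiver_fin)

lemma finite_N: "finite N"
  by (rule finite_subset[OF N]) simp

lemma ext_elt_path: fixes u :: 'v and p :: "'e list" shows "ext_elt K (path_elt K (u, p)) = path_elt K (u, map Inl p)"
proof
  fix x :: "'v \<times> ('e + 'v) list"
  obtain w r where x: "x = (w, r)" by fastforce
  have "(\<forall>b\<in>set r. isl b) \<and> map projl r = p \<longleftrightarrow> r = map Inl p"
  proof
    assume r: "(\<forall>b\<in>set r. isl b) \<and> map projl r = p"
    then have "map Inl (map projl r) = r" by (intro nth_equalityI) auto
    then show "r = map Inl p" using r by simp
  qed (auto simp: comp_def)
  then show "ext_elt K (path_elt K (u, p)) x = path_elt K (u, map Inl p) x"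
    by (auto simp: x ext_elt_def path_elt_def)
qed

text \<open>
  Multiplicativity comes from the universal property: \<open>ext_elt\<close> agrees on paths with the
  homomorphism that sends each arrow to its copy in the extended quiver.
\<close>

lemma ext_elt_alg_hom: "alg_hom P P' (ext_elt K)"
proof -
  interpret X: quiver_alg K Q' by (rule ext_quiver_alg)
  let ?R = "\<lambda>a. arrow_elt K Q' (Inl a)"
  have rep: "quiver_rep P' (vertex_elt K) ?R"
    unfolding quiver_rep_def
    using X.P_k_algebra X.vertex_closed X.arrow_closed X.vertex_mult X.one_eq X.arrow_mult_vertex by auto
  interpret P'm: module K P' by (rule X.P_module)
  have pv: "pval P' (vertex_elt K) ?R u p = path_elt K (u, map Inl p) \<and> (u, map Inl p) \<in> paths Q'"
    if "(u, p) \<in> paths Q" for u p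
    using that
  proof (induction p arbitrary: u)
    case Nil
    then show ?case by (simp add: vertex_elt_def paths_Nil X.paths_Nil)
  next
    case (Cons e p)
    then have e: "e \<in> arcs Q" "tail Q e = u" "(head Q e, p) \<in> paths Q" by (auto simp: paths_Cons)
    then have "(u, map Inl (e # p)) \<in> paths Q'" using Cons.IH[OF e(3)] by (simp add: X.paths_Cons)
    then show ?case using X.path_elt_Cons[of u "Inl e" "map Inl p"] Cons.IH[OF e(3)] by simp
  qed
  have eq: "path_hom P' (vertex_elt K) ?R f = ext_elt K f" if "f \<in> carrier P" for f
    using that
  proof (induction rule: P_linear_induct)
    case zero
    have "path_hom P' (vertex_elt K) ?R \<zero>\<^bsub>P\<^esub> = \<zero>\<^bsub>P'\<^esub>" by (rule path_hom_zero[OF rep])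
    then show ?case by (simp add: P_sel(4) X.P_sel(4) ext_elt_def fun_eq_iff)
  next
    case (add x y)
    then have "path_hom P' (vertex_elt K) ?R (x \<oplus>\<^bsub>P\<^esub> y) = ext_elt K x \<oplus>\<^bsub>P'\<^esub> ext_elt K y"
      using path_hom_add[OF rep] by simp
    also have "\<dots> = ext_elt K (x \<oplus>\<^bsub>P\<^esub> y)"
      by (rule ext, clarify) (auto simp only: X.P_sel(5) P_sel(5) ext_elt_def split_conv if_cancel K.l_zero K.zero_closed split: if_split)
    finally show ?case .
  next
    case (smult c x)
    then have "path_hom P' (vertex_elt K) ?R (c \<odot>\<^bsub>P\<^esub> x) = c \<odot>\<^bsub>P'\<^esub> ext_elt K x"
      using path_hom_smult[OF rep] by simp
    also have "\<dots> = ext_elt K (c \<odot>\<^bsub>P\<^esub> x)"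
      by (rule ext, clarify) (use smult in \<open>auto simp only: X.P_sel(6) P_sel(6) ext_elt_def split_conv K.r_null split: if_split\<close>)
    finally show ?case .
  next
    case (path p)
    then show ?case
      using pv[of "fst p" "snd p"] path_hom_path[OF rep path] ext_elt_path[of "fst p" "snd p"] by simp
  qed
  have h: "alg_hom P P' (path_hom P' (vertex_elt K) ?R)" by (rule path_hom_alg_hom[OF rep])
  interpret PP: k_algebra K P by (rule P_k_algebra)
  interpret PP: ring P by (rule P_mod_alg)
  note hD = alg_homD[OF h]
  show ?thesis
    unfolding alg_hom_def
  proof (intro conjI P_k_algebra X.P_k_algebra ballI ring_hom_memI)
    show "ext_elt K x \<in> carrier P'" if "x \<in> carrier P" for x
      using hD(1)[OF that] eq[OF that] by simp
    show "ext_elt K (x \<bullet> y) = ext_elt K x \<otimes>\<^bsub>P'\<^esub> ext_elt K y" if "x \<in> carrier P" "y \<in> carrier P" for x y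
      using hD(3)[OF that] eq[OF that(1)] eq[OF that(2)] eq[OF PP.m_closed[OF that]] by simp
    show "ext_elt K (x \<oplus>\<^bsub>P\<^esub> y) = ext_elt K x \<oplus>\<^bsub>P'\<^esub> ext_elt K y" if "x \<in> carrier P" "y \<in> carrier P" for x y
      using hD(2)[OF that] eq[OF that(1)] eq[OF that(2)] eq[OF PP.a_closed[OF that]] by simp
    show "ext_elt K \<one>\<^bsub>P\<^esub> = \<one>\<^bsub>P'\<^esub>" using hD(4) eq[OF PP.one_closed] by simp
    show "ext_elt K (c \<odot>\<^bsub>P\<^esub> x) = c \<odot>\<^bsub>P'\<^esub> ext_elt K x" if "c \<in> carrier K" "x \<in> carrier P" for c x
      using hD(5)[OF that] eq[OF that(2)] eq[OF PP.smult_closed[OF that]] by simp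
  qed
qed

lemma ext_elt_vertex:
  fixes v :: 'v
  shows "ext_elt K (vertex_elt K v :: 'v \<times> 'e list => 'k) = vertex_elt K v"
  using ext_elt_path[of v "[]"] by (simp add: vertex_elt_def)

lemma ext_elt_arrow: "ext_elt K (arrow_elt K Q a) = arrow_elt K Q' (Inl a)"
  using ext_elt_path[of "tail Q a" "[a]"] by (simp add: arrow_elt_def)

definition ext_hom :: "('k, 'b, 'y) module_scheme => (('v \<times> 'e list => 'k) => 'b) => ('v => 'b) =>
    ('v \<times> ('e + 'v) list => 'k) => 'b"
  where "ext_hom B \<phi> q = quiver_alg.path_hom K Q' B (\<lambda>v. \<phi> (vertex_elt K v)) (case_sum (\<lambda>a. \<phi> (arrow_elt K Q a)) q)"

context
  fixes B :: "('k, 'b, 'y) module_scheme" and \<phi> q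
  assumes \<phi>: "alg_hom P B \<phi>" and q: "\<And>v. v \<in> N ==> q v \<in> carrier B"
    and q_left: "\<And>v. v \<in> N ==> \<phi> (vertex_elt K v) \<otimes>\<^bsub>B\<^esub> q v = q v"
    and q_right: "\<And>v. v \<in> N ==> q v \<otimes>\<^bsub>B\<^esub> \<phi> (vertex_elt K (t v)) = q v"
begin

lemma ext_hom_props:
  "quiver_alg.alg_hom K P' B (ext_hom B \<phi> q)"
  "y \<in> carrier P ==> ext_hom B \<phi> q (ext_elt K y) = \<phi> y"
  "v \<in> N ==> ext_hom B \<phi> q (arrow_elt K Q' (Inr v)) = q v"
proof -
  interpret X: quiver_alg K Q' by (rule ext_quiver_alg)
  let ?E = "\<lambda>v. \<phi> (vertex_elt K v)" and ?R = "case_sum (\<lambda>a. \<phi> (arrow_elt K Q a)) q"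
  note rep0 = alg_hom_rep[OF \<phi>, unfolded quiver_rep_def]
  have rep: "X.quiver_rep B ?E ?R"
    unfolding X.quiver_rep_def using rep0 q q_left q_right by auto
  show h: "X.alg_hom P' B (ext_hom B \<phi> q)" unfolding ext_hom_def by (rule X.path_hom_alg_hom[OF rep])
  show arr: "ext_hom B \<phi> q (arrow_elt K Q' (Inr v)) = q v" if "v \<in> N" for v
    unfolding ext_hom_def using X.path_hom_arrow[OF rep, of "Inr v"] that by simp
  note e = alg_homD[OF ext_elt_alg_hom] and hD = X.alg_homD[OF h]
  have comp: "alg_hom P B (\<lambda>y. ext_hom B \<phi> q (ext_elt K y))"
    unfolding alg_hom_def using e hD P_k_algebra by (auto intro!: ring_hom_memI)
  show "ext_hom B \<phi> q (ext_elt K y) = \<phi> y" if "y \<in> carrier P" for y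
  proof (rule P_hom_unique[OF comp \<phi> _ _ that])
    show "ext_hom B \<phi> q (ext_elt K (vertex_elt K v)) = \<phi> (vertex_elt K v)" if "v \<in> verts Q" for v
      unfolding ext_hom_def ext_elt_vertex using X.path_hom_vertex[OF rep, of v] that by simp
    show "ext_hom B \<phi> q (ext_elt K (arrow_elt K Q a)) = \<phi> (arrow_elt K Q a)" if "a \<in> arcs Q" for a
      unfolding ext_hom_def ext_elt_arrow using X.path_hom_arrow[OF rep, of "Inl a"] that by simp
  qed
qed

text \<open>
  The recognition theorem for normal forms, applied to the quotient of the extended path algebra by
  \<open>J\<close>. The hypotheses on \<open>J\<close> say that it contains the image of the kernel of \<open>\<phi>\<close> and the relations that
  move new arrows to the left, and that the extension of \<open>\<phi>\<close> to the new arrows annihilates it.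
\<close>

theorem ext_quiver_iso:
  assumes J: "ideal J P'" and J_ker: "\<And>x. x \<in> J ==> ext_hom B \<phi> q x = \<zero>\<^bsub>B\<^esub>"
    and J_I: "\<And>y. y \<in> carrier P ==> \<phi> y = \<zero>\<^bsub>B\<^esub> ==> ext_elt K y \<in> J"
    and J_rel: "\<And>a. a \<in> arcs Q ==> tail Q a \<in> N ==> head Q a \<in> N ==> \<exists>z\<in>carrier P.
      arrow_elt K Q' (Inl a) \<otimes>\<^bsub>P'\<^esub> arrow_elt K Q' (Inr (tail Q a)) \<ominus>\<^bsub>P'\<^esub>
      arrow_elt K Q' (Inr (head Q a)) \<otimes>\<^bsub>P'\<^esub> ext_elt K z \<in> J"
    and J_rel0: "\<And>a. a \<in> arcs Q ==> tail Q a \<in> N ==> head Q a \<notin> N ==>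
      arrow_elt K Q' (Inl a) \<otimes>\<^bsub>P'\<^esub> arrow_elt K Q' (Inr (tail Q a)) \<in> J"
    and unique: "\<And>y x. y \<in> carrier P ==> (\<And>v. v \<in> N ==> x v \<in> carrier B) ==>
      (\<And>v. v \<in> N ==> \<phi> (vertex_elt K (t v)) \<otimes>\<^bsub>B\<^esub> x v = x v) ==>
      \<phi> y \<oplus>\<^bsub>B\<^esub> (\<Oplus>\<^bsub>B\<^esub>v\<in>N. q v \<otimes>\<^bsub>B\<^esub> x v) = \<zero>\<^bsub>B\<^esub> ==> \<phi> y = \<zero>\<^bsub>B\<^esub> \<and> (\<forall>v\<in>N. x v = \<zero>\<^bsub>B\<^esub>)"
    and fil: "\<And>b. b \<in> carrier B ==> \<exists>n. b \<in> Fil n" "Fil 0 = {\<zero>\<^bsub>B\<^esub>}"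
      "\<And>n. Fil n \<subseteq> carrier B"
      "\<And>n b. b \<in> Fil (Suc n) ==> \<exists>y\<in>carrier P. \<exists>x. (\<forall>v\<in>N. x v \<in> Fil n) \<and>
        b = \<phi> y \<oplus>\<^bsub>B\<^esub> (\<Oplus>\<^bsub>B\<^esub>v\<in>N. q v \<otimes>\<^bsub>B\<^esub> x v)"
  shows "\<exists>F. F \<in> alg_iso K B (alg_quot P' J)"
proof -
  interpret X: quiver_alg K Q' by (rule ext_quiver_alg)
  interpret P'r: ring P' by (rule X.P_mod_alg)
  interpret P': k_algebra K P' by (rule X.P_k_algebra)
  let ?C = "alg_quot P' J" and ?\<pi> = "\<lambda>x. J +>\<^bsub>P'\<^esub> x"
  note Qa = alg_quot_algebra[OF X.P_k_algebra J]
  note S = ideal_subspace[OF X.P_k_algebra J]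
  note e = alg_homD[OF ext_elt_alg_hom] and rD = X.alg_homD[OF ext_hom_props(1)] and pD = alg_homD[OF \<phi>]
  have aB: "k_algebra K B" by (rule pD)
  interpret Cr: ring ?C using Qa(1) by (simp add: k_algebra_def)
  interpret C: k_algebra K ?C by (rule Qa)
  interpret Br: ring B using aB by (simp add: k_algebra_def)
  obtain \<sigma> where \<sigma>: "\<sigma> \<in> ring_hom ?C B" "\<And>x. x \<in> carrier P' ==> \<sigma> (?\<pi> x) = ext_hom B \<phi> q x"
    "\<And>c X. c \<in> carrier K ==> X \<in> carrier ?C ==> \<sigma> (c \<odot>\<^bsub>?C\<^esub> X) = c \<odot>\<^bsub>B\<^esub> \<sigma> X"
  proof (rule alg_quot_lift[OF X.P_k_algebra J aB _ _ J_ker])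
    show "ext_hom B \<phi> q \<in> ring_hom P' B" using ext_hom_props(1) by (simp add: X.alg_hom_def)
    show "ext_hom B \<phi> q (c \<odot>\<^bsub>P'\<^esub> x) = c \<odot>\<^bsub>B\<^esub> ext_hom B \<phi> q x" if "c \<in> carrier K" "x \<in> carrier P'" for c x
      using rD(5) that by simp
  qed auto
  have \<pi>c: "?\<pi> x \<in> carrier ?C" if "x \<in> carrier P'" for x using that by (auto simp: alg_quot_sel(1))
  have \<pi>0: "?\<pi> x = \<zero>\<^bsub>?C\<^esub>" if "x \<in> J" for x
    using coset_eqI[OF X.P_module S, of x "\<zero>\<^bsub>P'\<^esub>" x] that subspaceD(2)[OF S that] coset_zero[OF X.P_module S]
    by (simp add: alg_quot_sel(2))
  define \<psi> where "\<psi> y = ?\<pi> (ext_elt K y)" for y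
  define qC where "qC v = ?\<pi> (arrow_elt K Q' (Inr v))" for v
  have arr: "arrow_elt K Q' (Inr v) \<in> carrier P'" if "v \<in> N" for v using that by (intro X.arrow_closed) auto
  have arrl: "arrow_elt K Q' (Inl a) \<in> carrier P'" if "a \<in> arcs Q" for a using that by (intro X.arrow_closed) auto
  have \<psi>: "alg_hom P ?C \<psi>"
    unfolding alg_hom_def \<psi>_def using P_k_algebra Qa e by (auto intro!: ring_hom_memI \<pi>c)
  have \<sigma>\<psi>: "\<sigma> (\<psi> y) = \<phi> y" if "y \<in> carrier P" for y
    using that e(1) ext_hom_props(2) by (simp add: \<psi>_def \<sigma>(2))
  have \<sigma>q: "\<sigma> (qC v) = q v" if "v \<in> N" for v using that arr ext_hom_props(3) by (simp add: qC_def \<sigma>(2))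
  have vN: "v \<in> N ==> v \<in> verts Q" for v using N by auto
  have cancel: "?\<pi> x = ?\<pi> y" if "x \<ominus>\<^bsub>P'\<^esub> y \<in> J" "x \<in> carrier P'" "y \<in> carrier P'" for x y
    by (rule coset_eqI[OF X.P_module S that(2,3,1)]) (use that in \<open>simp add: P'r.minus_eq P'r.a_assoc P'r.l_neg\<close>)
  have "bij_betw \<sigma> (carrier ?C) (carrier B)"
  proof (rule normal_form_iso[OF \<psi> finite_N N t, where q = qC and Fil = Fil])
    show "qC v \<in> carrier ?C" if "v \<in> N" for v unfolding qC_def by (rule \<pi>c[OF arr[OF that]])
    show "\<psi> (vertex_elt K v) \<otimes>\<^bsub>?C\<^esub> qC v = qC v" if "v \<in> N" for v
      using that arr X.vertex_closed[of v] X.arrow_mult_vertex(2)[of "Inr v" v] vN[OF that]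
      by (simp add: \<psi>_def qC_def ext_elt_vertex Qa)
    show "qC v \<otimes>\<^bsub>?C\<^esub> \<psi> (vertex_elt K (t v)) = qC v" if "v \<in> N" for v
      using that arr X.vertex_closed[of "t v"] X.arrow_mult_vertex(1)[of "Inr v" "t v"] t[OF that]
      by (simp add: \<psi>_def qC_def ext_elt_vertex Qa)
    show "\<exists>z\<in>carrier P. \<psi> (arrow_elt K Q a) \<otimes>\<^bsub>?C\<^esub> qC (tail Q a) = qC (head Q a) \<otimes>\<^bsub>?C\<^esub> \<psi> z"
      if a: "a \<in> arcs Q" "tail Q a \<in> N" "head Q a \<in> N" for a
    proof -
      obtain z where z: "z \<in> carrier P" "arrow_elt K Q' (Inl a) \<otimes>\<^bsub>P'\<^esub> arrow_elt K Q' (Inr (tail Q a)) \<ominus>\<^bsub>P'\<^esub>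
        arrow_elt K Q' (Inr (head Q a)) \<otimes>\<^bsub>P'\<^esub> ext_elt K z \<in> J" using J_rel[OF a] by blast
      show ?thesis
        using cancel[OF z(2)] arr[OF a(2)] arr[OF a(3)] arrl[OF a(1)] e(1)[OF z(1)]
        by (intro bexI[OF _ z(1)]) (simp add: \<psi>_def qC_def ext_elt_arrow Qa)
    qed
    show "\<psi> (arrow_elt K Q a) \<otimes>\<^bsub>?C\<^esub> qC (tail Q a) = \<zero>\<^bsub>?C\<^esub>"
      if a: "a \<in> arcs Q" "tail Q a \<in> N" "head Q a \<notin> N" for a
      using \<pi>0[OF J_rel0[OF a]] arr[OF a(2)] arrl[OF a(1)] by (simp add: \<psi>_def qC_def ext_elt_arrow Qa)
    show "alg_hom ?C B \<sigma>" unfolding alg_hom_def using Qa(1) aB \<sigma> by auto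
    show "U = carrier ?C" if U: "U \<subseteq> carrier ?C" "\<psi> ` carrier P \<subseteq> U" "qC ` N \<subseteq> U"
      "\<And>x y. x \<in> U ==> y \<in> U ==> x \<oplus>\<^bsub>?C\<^esub> y \<in> U" "\<And>x y. x \<in> U ==> y \<in> U ==> x \<otimes>\<^bsub>?C\<^esub> y \<in> U" for U
    proof -
      interpret PPr: ring P by (rule P_mod_alg)
      interpret PP: k_algebra K P by (rule P_k_algebra)
      have U\<psi>: "\<psi> y \<in> U" if "y \<in> carrier P" for y using U(2) that by blast
      have "?\<pi> x \<in> U" if "x \<in> carrier P'" for x
        using that
      proof (induction rule: X.P_generated)
        case zero
        then show ?case using U\<psi>[OF PPr.zero_closed] by (simp add: \<psi>_def e(8))
      next
        case (add x y)
        then show ?case using U(4)[of "?\<pi> x" "?\<pi> y"] by (simp add: Qa)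
      next
        case (smult c x)
        have "\<psi> (c \<odot>\<^bsub>P\<^esub> \<one>\<^bsub>P\<^esub>) \<otimes>\<^bsub>?C\<^esub> ?\<pi> x \<in> U" using smult by (intro U(5) U\<psi>) auto
        also have "\<psi> (c \<odot>\<^bsub>P\<^esub> \<one>\<^bsub>P\<^esub>) \<otimes>\<^bsub>?C\<^esub> ?\<pi> x = ?\<pi> (c \<odot>\<^bsub>P'\<^esub> x)"
          using smult by (simp add: \<psi>_def e(4,5) Qa P'.smult_mult_left)
        finally show ?case .
      next
        case (mult x y)
        then show ?case using U(5)[of "?\<pi> x" "?\<pi> y"] by (simp add: Qa)
      next
        case (vertex v)
        then show ?case using U\<psi>[OF vertex_closed, of v] by (simp add: \<psi>_def ext_elt_vertex)
      next
        case (arrow b)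
        then consider a where "b = Inl a" "a \<in> arcs Q" | v where "b = Inr v" "v \<in> N" by auto
        then show ?case
        proof cases
          case 1
          then show ?thesis using U\<psi>[OF arrow_closed, of a] by (simp add: \<psi>_def ext_elt_arrow)
        next
          case 2
          then show ?thesis using U(3) by (auto simp: qC_def)
        qed
      qed
      then show ?thesis using U(1) by (auto simp: alg_quot_sel(1))
    qed
    show "\<psi> y = \<zero>\<^bsub>?C\<^esub> \<and> (\<forall>v\<in>N. x v = \<zero>\<^bsub>B\<^esub>)"
      if y: "y \<in> carrier P" and x: "\<And>v. v \<in> N ==> x v \<in> carrier B"
        "\<And>v. v \<in> N ==> \<sigma> (\<psi> (vertex_elt K (t v))) \<otimes>\<^bsub>B\<^esub> x v = x v"
        and z: "\<sigma> (\<psi> y) \<oplus>\<^bsub>B\<^esub> (\<Oplus>\<^bsub>B\<^esub>v\<in>N. \<sigma> (qC v) \<otimes>\<^bsub>B\<^esub> x v) = \<zero>\<^bsub>B\<^esub>" for y x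
    proof -
      have sum: "(\<Oplus>\<^bsub>B\<^esub>v\<in>N. \<sigma> (qC v) \<otimes>\<^bsub>B\<^esub> x v) = (\<Oplus>\<^bsub>B\<^esub>v\<in>N. q v \<otimes>\<^bsub>B\<^esub> x v)"
        using x(1) q by (intro Br.finsum_cong') (auto simp: \<sigma>q)
      have xt: "\<phi> (vertex_elt K (t v)) \<otimes>\<^bsub>B\<^esub> x v = x v" if "v \<in> N" for v
        using x(2)[OF that] \<sigma>\<psi>[OF vertex_closed[OF t[OF that]]] by simp
      have z': "\<phi> y \<oplus>\<^bsub>B\<^esub> (\<Oplus>\<^bsub>B\<^esub>v\<in>N. q v \<otimes>\<^bsub>B\<^esub> x v) = \<zero>\<^bsub>B\<^esub>" using z \<sigma>\<psi>[OF y] sum by simp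
      have "\<phi> y = \<zero>\<^bsub>B\<^esub> \<and> (\<forall>v\<in>N. x v = \<zero>\<^bsub>B\<^esub>)" by (rule unique[OF y _ _ z']) (use x(1) xt in auto)
      then show ?thesis using \<pi>0[OF J_I[OF y]] by (simp add: \<psi>_def)
    qed
    show "\<exists>y\<in>carrier P. \<exists>x. (\<forall>v\<in>N. x v \<in> Fil n) \<and> b = \<sigma> (\<psi> y) \<oplus>\<^bsub>B\<^esub> (\<Oplus>\<^bsub>B\<^esub>v\<in>N. \<sigma> (qC v) \<otimes>\<^bsub>B\<^esub> x v)"
      if b: "b \<in> Fil (Suc n)" for b n
    proof -
      obtain y x where y: "y \<in> carrier P" "\<forall>v\<in>N. x v \<in> Fil n" "b = \<phi> y \<oplus>\<^bsub>B\<^esub> (\<Oplus>\<^bsub>B\<^esub>v\<in>N. q v \<otimes>\<^bsub>B\<^esub> x v)"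
        using fil(4)[OF b] by blast
      have "(\<Oplus>\<^bsub>B\<^esub>v\<in>N. \<sigma> (qC v) \<otimes>\<^bsub>B\<^esub> x v) = (\<Oplus>\<^bsub>B\<^esub>v\<in>N. q v \<otimes>\<^bsub>B\<^esub> x v)"
        using y(2) fil(3)[of n] q by (intro Br.finsum_cong') (auto simp: \<sigma>q)
      then have "b = \<sigma> (\<psi> y) \<oplus>\<^bsub>B\<^esub> (\<Oplus>\<^bsub>B\<^esub>v\<in>N. \<sigma> (qC v) \<otimes>\<^bsub>B\<^esub> x v)"
        using y(3) \<sigma>\<psi>[OF y(1)] by simp
      then show ?thesis using y(1,2) by blast
    qed
  qed (use fil in auto)
  then show ?thesis using alg_iso_inverse[OF Qa(1) \<sigma>(1,3)] by blast
qed

end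

end

end

section \<open>The total preprojective algebra in terms of a decomposition\<close>

text \<open>
  A module with a decomposition into the \<open>X v\<close>, given by inclusions and projections, together with a
  surjection \<open>h\<close> from the path algebra to \<open>End(M)\<close> that maps each vertex to its projector.
\<close>

locale summand_quiver = ext_functor K A d + quiver_alg K Q
  for K :: "('k, 'z) ring_scheme" (structure) and A :: "('k, 'a, 'y) module_scheme" and d :: nat
    and Q :: "('v, 'e) pre_digraph" +
  fixes M :: "('k, 'a, 'k vec) rmod" and X :: "'v => ('k, 'a, 'k vec) rmod"
    and inc pr :: "'v => 'k vec => 'k vec"
    and t :: "'v => 'v" and \<theta> :: "'v => 'k vec => 'k vec"
    and h :: "('v \<times> 'e list => 'k) => 'k vec => 'k vec"
  assumes M: "fdmod M" and X: "v \<in> verts Q ==> fdmod (X v)"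
    and inc: "v \<in> verts Q ==> inc v \<in> Hom K A (X v) M"
    and pr: "v \<in> verts Q ==> pr v \<in> Hom K A M (X v)"
    and pr_inc: "v \<in> verts Q ==> w \<in> verts Q ==> x \<in> carrier (X v) ==>
      pr w (inc v x) = (if v = w then x else \<zero>\<^bsub>X w\<^esub>)"
    and inc_pr_sum: "(\<Oplus>\<^bsub>hom_space K A M M\<^esub>v\<in>verts Q. compose (carrier M) (inc v) (pr v)) = id_map M"
    and t\<theta>: "v \<in> verts Q ==> \<not> injective K A (X v) ==>
      t v \<in> verts Q \<and> \<theta> v \<in> mod_iso K A (tau K A d (X v)) (X (t v))"
    and h_Hom: "y \<in> carrier P ==> h y \<in> Hom K A M M"
    and h_add: "y \<in> carrier P ==> z \<in> carrier P ==> h (y \<oplus>\<^bsub>P\<^esub> z) = h y \<oplus>\<^bsub>hom_space K A M M\<^esub> h z"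
    and h_mult: "y \<in> carrier P ==> z \<in> carrier P ==> h (y \<otimes>\<^bsub>P\<^esub> z) = compose (carrier M) (h y) (h z)"
    and h_smult: "c \<in> carrier K ==> y \<in> carrier P ==> h (c \<odot>\<^bsub>P\<^esub> y) = c \<odot>\<^bsub>hom_space K A M M\<^esub> h y"
    and h_one: "h \<one>\<^bsub>P\<^esub> = id_map M"
    and h_onto: "f \<in> Hom K A M M ==> \<exists>y\<in>carrier P. h y = f"
    and h_vertex: "v \<in> verts Q ==> h (vertex_elt K v) = compose (carrier M) (inc v) (pr v)"
begin

abbreviation N :: "'v set" where "N \<equiv> noninj_verts K A Q X"
abbreviation HM :: "nat => ('k, 'k vec => 'k vec) module" where "HM n \<equiv> hom_space K A M (T n M)"
abbreviation \<Psi>M :: "('k, nat => 'k vec => 'k vec) module" where "\<Psi>M \<equiv> Psi K A d M"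
abbreviation times_M :: "(nat => 'k vec => 'k vec) => (nat => 'k vec => 'k vec) => nat => 'k vec => 'k vec"
    (infixl "\<cdot>" 70)
  where "G \<cdot> F \<equiv> G \<otimes>\<^bsub>\<Psi>M\<^esub> F"
abbreviation QE :: "('v, 'e + 'v) pre_digraph" where "QE \<equiv> ext_quiver Q N t"
abbreviation PE :: "('k, 'v \<times> ('e + 'v) list => 'k) module" where "PE \<equiv> path_algebra K QE"
abbreviation old_arrow :: "'e => 'v \<times> ('e + 'v) list => 'k" where "old_arrow a \<equiv> arrow_elt K QE (Inl a)"
abbreviation new_arrow :: "'v => 'v \<times> ('e + 'v) list => 'k" where "new_arrow v \<equiv> arrow_elt K QE (Inr v)"
abbreviation zM :: "nat => 'k vec => 'k vec" where "zM n \<equiv> zero_map M (T n M)"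

lemma N: "N \<subseteq> verts Q" "v \<in> N ==> v \<in> verts Q" "v \<in> N ==> t v \<in> verts Q"
  "v \<in> N ==> \<theta> v \<in> mod_iso K A (\<tau> (X v)) (X (t v))" "v \<in> verts Q ==> v \<notin> N ==> injective K A (X v)"
  using t\<theta> by (auto simp: noninj_verts_def)

lemma fin_N: "finite N"
  by (rule finite_subset[OF N(1)]) simp

lemma rM: "right_module K A M" "right_module K A (\<tau> M)" "right_module K A (T n M)" "fdmod (\<tau> M)" "fdmod (T n M)"
  using M T_fdmod[OF M] tau_fdmod[OF M] fdmodD(1) by auto

lemma rX: "v \<in> verts Q ==> right_module K A (X v)" "v \<in> verts Q ==> fdmod (\<tau> (X v))"
  "v \<in> verts Q ==> right_module K A (\<tau> (X v))"
  using X tau_fdmod fdmodD(1) by blast+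

lemma T_tau: "T n (\<tau> Y) = T (Suc n) Y"
  using T_add[of n 1 Y] T_Suc[of 0 Y] by simp

definition \<theta>inv :: "'v => 'k vec => 'k vec"
  where "\<theta>inv v = restrict (inv_into (carrier (\<tau> (X v))) (\<theta> v)) (carrier (X (t v)))"

lemma \<theta>:
  assumes v: "v \<in> N"
  shows "\<theta> v \<in> Hom K A (\<tau> (X v)) (X (t v))" "\<theta>inv v \<in> Hom K A (X (t v)) (\<tau> (X v))"
    "x \<in> carrier (\<tau> (X v)) ==> \<theta>inv v (\<theta> v x) = x" "y \<in> carrier (X (t v)) ==> \<theta> v (\<theta>inv v y) = y"
proof -
  note D = mod_isoD[OF N(4)[OF v] rX(3)[OF N(2)[OF v]] rX(1)[OF N(3)[OF v]], folded \<theta>inv_def]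
  show "\<theta> v \<in> Hom K A (\<tau> (X v)) (X (t v))" "\<theta>inv v \<in> Hom K A (X (t v)) (\<tau> (X v))" using D by auto
  show "x \<in> carrier (\<tau> (X v)) ==> \<theta>inv v (\<theta> v x) = x" using fun_cong[OF D(3), of x] by (simp add: compose_eq)
  show "y \<in> carrier (X (t v)) ==> \<theta> v (\<theta>inv v y) = y" using fun_cong[OF D(4), of y] by (simp add: compose_eq)
qed

lemma tau_map_apply_compose:
  assumes "fdmod U" "fdmod V" "fdmod W" "f \<in> Hom K A U V" "g \<in> Hom K A V W" "x \<in> carrier (\<tau> U)"
  shows "\<tau>map V W g (\<tau>map U V f x) = \<tau>map U W (compose (carrier U) g f) x"
  using fun_cong[OF tau_map_compose[OF assms(1-5)], of x] assms(6) by (simp add: compose_eq)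

text \<open>
  The components of \<open>q\<^sub>v\<close> and of its partial inverse: \<open>qmap v\<close> is the composite
  \<open>M \<rightarrow> X (t v) \<cong> \<tau>\<^sup>-(X v) \<rightarrow> \<tau>\<^sup>-M\<close>, and \<open>cmap v\<close> goes back.
\<close>

definition qmap :: "'v => 'k vec => 'k vec"
  where "qmap v = (\<lambda>x\<in>carrier M. \<tau>map (X v) M (inc v) (\<theta>inv v (pr (t v) x)))"

definition cmap :: "'v => 'k vec => 'k vec"
  where "cmap v = (\<lambda>y\<in>carrier (\<tau> M). inc (t v) (\<theta> v (\<tau>map M (X v) (pr v) y)))"

lemma qmap_Hom: "v \<in> N ==> qmap v \<in> Hom K A M (\<tau> M)"
  and cmap_Hom: "v \<in> N ==> cmap v \<in> Hom K A (\<tau> M) M"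
proof -
  assume v: "v \<in> N"
  note V = N(2,3)[OF v]
  note a = tau_map_Hom[OF X[OF V(1)] M inc[OF V(1)]] and b = tau_map_Hom[OF M X[OF V(1)] pr[OF V(1)]]
  have "qmap v = compose (carrier M) (compose (carrier (X (t v))) (\<tau>map (X v) M (inc v)) (\<theta>inv v)) (pr (t v))"
    using HomD(1)[OF pr[OF V(2)]] by (auto simp: qmap_def compose_def fun_eq_iff)
  then show "qmap v \<in> Hom K A M (\<tau> M)"
    using compose_Hom[OF rM(1) pr[OF V(2)] compose_Hom[OF rX(1)[OF V(2)] \<theta>(2)[OF v] a]] by simp
  have "cmap v = compose (carrier (\<tau> M)) (compose (carrier (\<tau> (X v))) (inc (t v)) (\<theta> v)) (\<tau>map M (X v) (pr v))"
    using HomD(1)[OF b] by (auto simp: cmap_def compose_def fun_eq_iff)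
  then show "cmap v \<in> Hom K A (\<tau> M) M"
    using compose_Hom[OF rM(2) b compose_Hom[OF rX(3)[OF V(1)] \<theta>(1)[OF v] inc[OF V(2)]]] by simp
qed

lemma inc_pr_Hom: "v \<in> verts Q ==> compose (carrier M) (inc v) (pr v) \<in> Hom K A M M"
  by (rule compose_Hom[OF rM(1) pr inc])

text \<open>
  \<open>\<tau>\<^sup>-\<close> preserves the orthogonality of inclusions and projections, so the \<open>qmap v\<close> embed the \<open>X (t v)\<close>
  independently into \<open>\<tau>\<^sup>-M\<close>.
\<close>

lemma cmap_qmap:
  assumes v: "v \<in> N" and w: "w \<in> N"
  shows "compose (carrier M) (cmap w) (qmap v) =
    (if v = w then compose (carrier M) (inc (t v)) (pr (t v)) else zero_map M M)"
proof
  fix x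
  note V = N(2,3)[OF v] and W = N(2,3)[OF w]
  show "compose (carrier M) (cmap w) (qmap v) x =
    (if v = w then compose (carrier M) (inc (t v)) (pr (t v)) else zero_map M M) x"
  proof (cases "x \<in> carrier M")
    case True
    define y where "y = \<theta>inv v (pr (t v) x)"
    have y: "y \<in> carrier (\<tau> (X v))" unfolding y_def by (intro HomD(1)[OF \<theta>(2)[OF v]] HomD(1)[OF pr[OF V(2)]] True)
    have q: "qmap v x = \<tau>map (X v) M (inc v) y" "qmap v x \<in> carrier (\<tau> M)"
      using True HomD(1)[OF qmap_Hom[OF v]] by (simp_all add: qmap_def y_def)
    have pi: "compose (carrier (X v)) (pr w) (inc v) = (if v = w then id_map (X v) else zero_map (X v) (X w))"
      using pr_inc[OF V(1) W(1)] by (auto simp: compose_def id_map_def zero_map_def fun_eq_iff)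
    have "\<tau>map M (X w) (pr w) (qmap v x) = \<tau>map (X v) (X w) (compose (carrier (X v)) (pr w) (inc v)) y"
      unfolding q(1) by (rule tau_map_apply_compose[OF X[OF V(1)] M X[OF W(1)] inc[OF V(1)] pr[OF W(1)] y])
    also have "\<dots> = (if v = w then y else \<zero>\<^bsub>\<tau> (X w)\<^esub>)"
      using y tau_map_id[OF X[OF W(1)]] Tm_zero[OF X[OF V(1)] X[OF W(1)], of 1] unfolding pi by (auto simp: T_Suc)
    finally have "cmap w (qmap v x) = (if v = w then inc (t v) (\<theta> v y) else inc (t w) (\<theta> w \<zero>\<^bsub>\<tau> (X w)\<^esub>))"
      using q(2) by (simp add: cmap_def)
    moreover have "\<theta> v y = pr (t v) x" unfolding y_def by (intro \<theta>(4)[OF v] HomD(1)[OF pr[OF V(2)]] True)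
    moreover have "inc (t w) (\<theta> w \<zero>\<^bsub>\<tau> (X w)\<^esub>) = \<zero>\<^bsub>M\<^esub>"
      using linear_maps_zero[OF fdmodD(3) fdmodD(3) Hom_linear, OF rX(2)[OF W(1)] X[OF W(2)] \<theta>(1)[OF w]]
        linear_maps_zero[OF fdmodD(3) fdmodD(3) Hom_linear, OF X[OF W(2)] M inc[OF W(2)]] by simp
    ultimately show ?thesis using True by (auto simp: compose_eq)
  qed (auto simp: compose_def zero_map_def)
qed

text \<open>
  Applying \<open>\<tau>\<^sup>-\<close> to \<open>\<Sum>\<^sub>v inc\<^sub>v pr\<^sub>v = 1\<close> decomposes \<open>\<tau>\<^sup>-M\<close>. The summands of injective \<open>X v\<close> disappear as they
  factor through \<open>\<tau>\<^sup>-(X v) = 0\<close>, and the others are \<open>qmap v \<circ> cmap v\<close>.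
\<close>

lemma qmap_cmap_sum: "(\<Oplus>\<^bsub>hom_space K A (\<tau> M) (\<tau> M)\<^esub>v\<in>N. compose (carrier (\<tau> M)) (qmap v) (cmap v)) = id_map (\<tau> M)"
proof -
  let ?H = "hom_space K A (\<tau> M) (\<tau> M)"
  let ?e = "\<lambda>v. \<tau>map M M (compose (carrier M) (inc v) (pr v))"
  interpret H: abelian_group ?H by (rule module_abelian_group[OF hom_space_module[OF rM(2,2)]])
  have e: "?e v \<in> Hom K A (\<tau> M) (\<tau> M)" if "v \<in> verts Q" for v by (rule tau_map_Hom[OF M M inc_pr_Hom[OF that]])
  have ap: "\<tau>map M M (compose (carrier M) (inc v) (pr v)) y = \<tau>map (X v) M (inc v) (\<tau>map M (X v) (pr v) y)"
    if "v \<in> verts Q" "y \<in> carrier (\<tau> M)" for v y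
    by (rule tau_map_apply_compose[symmetric]) (use that M X inc pr in auto)
  have qc: "compose (carrier (\<tau> M)) (qmap v) (cmap v) = ?e v" if v: "v \<in> N" for v
  proof (rule Hom_eqI[OF compose_Hom[OF rM(2) cmap_Hom[OF v] qmap_Hom[OF v]] e[OF N(2)[OF v]]])
    fix y assume y: "y \<in> carrier (\<tau> M)"
    note V = N(2,3)[OF v]
    define z where "z = \<tau>map M (X v) (pr v) y"
    have z: "z \<in> carrier (\<tau> (X v))" unfolding z_def by (rule HomD(1)[OF tau_map_Hom[OF M X[OF V(1)] pr[OF V(1)]] y])
    have \<theta>z: "\<theta> v z \<in> carrier (X (t v))" by (rule HomD(1)[OF \<theta>(1)[OF v] z])
    have "cmap v y = inc (t v) (\<theta> v z)" "cmap v y \<in> carrier M"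
      using y HomD(1)[OF cmap_Hom[OF v]] by (simp_all add: cmap_def z_def)
    then have "qmap v (cmap v y) = \<tau>map (X v) M (inc v) (\<theta>inv v (pr (t v) (inc (t v) (\<theta> v z))))" by (simp add: qmap_def)
    then show "compose (carrier (\<tau> M)) (qmap v) (cmap v) y = ?e v y"
      using y pr_inc[OF V(2,2) \<theta>z] \<theta>(3)[OF v z] ap[OF V(1) y] by (simp add: compose_eq z_def)
  qed
  have zero: "?e v = \<zero>\<^bsub>?H\<^esub>" if v: "v \<in> verts Q" "v \<notin> N" for v
  proof (rule Hom_eqI[OF e[OF v(1)]])
    show "\<zero>\<^bsub>?H\<^esub> \<in> Hom K A (\<tau> M) (\<tau> M)" using H.zero_closed by simp
    fix y assume y: "y \<in> carrier (\<tau> M)"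
    have "\<tau>map M (X v) (pr v) y \<in> carrier (\<tau> (X v))" by (rule HomD(1)[OF tau_map_Hom[OF M X[OF v(1)] pr[OF v(1)]] y])
    then have "\<tau>map M (X v) (pr v) y = \<zero>\<^bsub>\<tau> (X v)\<^esub>" using tau_injective[OF X[OF v(1)] N(5)[OF v]] by simp
    then have "?e v y = \<zero>\<^bsub>\<tau> M\<^esub>"
      using ap[OF v(1) y] linear_maps_zero[OF fdmodD(3) fdmodD(3) Hom_linear, OF rX(2)[OF v(1)] rM(4)
        tau_map_Hom[OF X[OF v(1)] M inc[OF v(1)]]] by simp
    then show "?e v y = \<zero>\<^bsub>?H\<^esub> y" using y by simp
  qed
  have "id_map (\<tau> M) = \<tau>map M M (\<Oplus>\<^bsub>hom_space K A M M\<^esub>v\<in>verts Q. compose (carrier M) (inc v) (pr v))"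
    unfolding inc_pr_sum by (simp add: tau_map_id[OF M])
  also have "\<dots> = finsum ?H ?e (verts Q)"
    using Tm_finsum[OF M M, of "verts Q" "\<lambda>v. compose (carrier M) (inc v) (pr v)" 1] inc_pr_Hom by (simp add: T_Suc)
  also have "\<dots> = finsum ?H ?e N"
    by (rule H.add.finprod_mono_neutral_cong_right[OF _ N(1)]) (use zero e in auto)
  also have "\<dots> = finsum ?H (\<lambda>v. compose (carrier (\<tau> M)) (qmap v) (cmap v)) N"
    by (rule H.finsum_cong') (use qc e N(2) in auto)
  finally show ?thesis by simp
qed

end

context summand_quiver
begin

lemma HM: "module K (HM n)" "abelian_group (HM n)" "abelian_monoid (HM n)"
  using H_module[OF M] H_ab[OF M] by auto

lemma compose_zM:
  assumes "g \<in> Hom K A (T i M) (T j M)"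
  shows "compose (carrier M) g (zM i) = zM j"
  using linear_maps_zero[OF fdmodD(3) fdmodD(3) Hom_linear, OF rM(5) rM(5) assms]
  unfolding compose_def zero_map_def by (intro restrict_ext) simp

definition deg0 :: "('k vec => 'k vec) => nat => 'k vec => 'k vec"
  where "deg0 f = (\<lambda>i. if i = 0 then f else zM i)"

definition qelt :: "'v => nat => 'k vec => 'k vec"
  where "qelt v = (\<lambda>i. if i = 1 then qmap v else zM i)"

lemma finite_degrees: "(\<And>i. n \<le> i ==> F i = zM i) ==> finite {i. F i \<noteq> zM i}"
  by (rule finite_subset[of _ "{..<n}"]) (auto simp: not_le[symmetric])

lemma PsiI: "(\<And>i. F i \<in> Hom K A M (T i M)) ==> (\<And>i. n \<le> i ==> F i = zM i) ==> F \<in> carrier \<Psi>M"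
  using finite_degrees[of n F] by (simp add: Psi_sel[OF M])

lemma deg0_closed: "f \<in> Hom K A M M ==> deg0 f \<in> carrier \<Psi>M"
  by (rule PsiI[of _ 1]) (auto simp: deg0_def intro: H_closed(1)[OF M])

lemma qelt_closed: "v \<in> N ==> qelt v \<in> carrier \<Psi>M"
  by (rule PsiI[of _ 2]) (use qmap_Hom in \<open>auto simp: qelt_def T_Suc intro: H_closed(1)[OF M]\<close>)

lemma deg0_mult:
  assumes f: "f \<in> Hom K A M M" and x: "x \<in> carrier \<Psi>M"
  shows "(deg0 f \<cdot> x) n = compose (carrier M) (Tm n M M f) (x n)"
  using Psi_single[OF M PsiD(1)[OF M deg0_closed[OF f]] PsiD(1)[OF M x], of n n] by (simp add: deg0_def)

lemma mult_deg0:
  assumes f: "f \<in> Hom K A M M" and x: "x \<in> carrier \<Psi>M"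
  shows "(x \<cdot> deg0 f) n = compose (carrier M) (x n) f"
  using Psi_single[OF M PsiD(1)[OF M x] PsiD(1)[OF M deg0_closed[OF f]], of 0 n] by (simp add: deg0_def)

lemma qelt_mult:
  assumes v: "v \<in> N" and x: "x \<in> carrier \<Psi>M"
  shows "(qelt v \<cdot> x) 0 = zM 0"
    "(qelt v \<cdot> x) (Suc n) = compose (carrier M) (Tm n M (\<tau> M) (qmap v)) (x n)"
proof -
  note D = PsiD(1)[OF M qelt_closed[OF v]] PsiD(1)[OF M x]
  note s = Psi_single[OF M D]
  have "(qelt v \<cdot> x) 0 = compose (carrier M) (Tm 0 M (T 0 M) (qelt v 0)) (x 0)" using s[of 0 0] by simp
  also have "\<dots> = zM 0"
    using star_bilinear(5)[OF M D(1) D(1) D(2) D(2) K.one_closed, of 0 0] by (simp add: qelt_def)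
  finally show "(qelt v \<cdot> x) 0 = zM 0" .
  show "(qelt v \<cdot> x) (Suc n) = compose (carrier M) (Tm n M (\<tau> M) (qmap v)) (x n)"
  proof -
    have "qelt v (Suc n - i) = zM (Suc n - i)" if "i \<le> Suc n" "i \<noteq> n" for i
    proof -
      have "Suc n - i \<noteq> 1" using that by arith
      then show ?thesis by (simp add: qelt_def)
    qed
    then have "(qelt v \<cdot> x) (Suc n) = compose (carrier M) (Tm n M (T (Suc n - n) M) (qelt v (Suc n - n))) (x n)"
      by (intro s) auto
    then show ?thesis by (simp add: qelt_def T_Suc Suc_diff_le)
  qed
qed

lemma Psi_finsum:
  assumes "\<And>v. v \<in> I ==> u v \<in> carrier \<Psi>M"
  shows "(\<Oplus>\<^bsub>\<Psi>M\<^esub>v\<in>I. u v) n = (\<Oplus>\<^bsub>HM n\<^esub>v\<in>I. u v n)"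
  by (rule finsum_additive[OF module_abelian_group[OF Psi_module[OF M]] HM(2), where h = "\<lambda>F. F n"])
    (use assms PsiD(1)[OF M] Psi_sel(4)[OF M] in auto)

definition \<phi>M :: "('v \<times> 'e list => 'k) => nat => 'k vec => 'k vec"
  where "\<phi>M y = deg0 (h y)"

lemma \<phi>M_hom: "alg_hom P \<Psi>M \<phi>M"
  unfolding alg_hom_def
proof (intro conjI ballI P_k_algebra Psi_k_algebra[OF M] ring_hom_memI)
  interpret PP: ring P by (rule P_mod_alg)
  have z: "zM i \<oplus>\<^bsub>HM i\<^esub> zM i = zM i" for i
    using abelian_monoid.l_zero[OF HM(3), of "zM i" i] H_closed(1)[OF M, of i] by simp
  show "\<phi>M x \<in> carrier \<Psi>M" if "x \<in> carrier P" for x using that by (simp add: \<phi>M_def deg0_closed h_Hom)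
  show "\<phi>M (x \<bullet> y) = \<phi>M x \<cdot> \<phi>M y" if x: "x \<in> carrier P" and y: "y \<in> carrier P" for x y
  proof
    fix n show "\<phi>M (x \<bullet> y) n = (\<phi>M x \<cdot> \<phi>M y) n"
      using compose_zM[OF Tm_Hom[OF M M h_Hom[OF x], of n]]
      unfolding \<phi>M_def deg0_mult[OF h_Hom[OF x] deg0_closed[OF h_Hom[OF y]]]
      by (cases n) (simp_all add: deg0_def h_mult x y)
  qed
  show "\<phi>M (x \<oplus>\<^bsub>P\<^esub> y) = \<phi>M x \<oplus>\<^bsub>\<Psi>M\<^esub> \<phi>M y" if x: "x \<in> carrier P" and y: "y \<in> carrier P" for x y
    using h_add[OF x y] z by (auto simp: \<phi>M_def deg0_def Psi_sel(4)[OF M] fun_eq_iff[where f = "\<lambda>i. if i = 0 then _ i else _ i"] intro!: ext)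
  show "\<phi>M \<one>\<^bsub>P\<^esub> = \<one>\<^bsub>\<Psi>M\<^esub>" by (simp add: \<phi>M_def deg0_def h_one Psi_sel(2)[OF M])
  show "\<phi>M (c \<odot>\<^bsub>P\<^esub> x) = c \<odot>\<^bsub>\<Psi>M\<^esub> \<phi>M x" if c: "c \<in> carrier K" and x: "x \<in> carrier P" for c x
  proof
    fix n show "\<phi>M (c \<odot>\<^bsub>P\<^esub> x) n = (c \<odot>\<^bsub>\<Psi>M\<^esub> \<phi>M x) n"
      using module.smult_r_null[OF HM(1) c] by (cases n) (simp_all add: \<phi>M_def deg0_def Psi_sel(5)[OF M] h_smult c x)
  qed
qed

lemma \<phi>M_zero_iff:
  assumes "y \<in> carrier P"
  shows "\<phi>M y = \<zero>\<^bsub>\<Psi>M\<^esub> \<longleftrightarrow> h y = zero_map M M"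
proof
  assume "\<phi>M y = \<zero>\<^bsub>\<Psi>M\<^esub>"
  from fun_cong[OF this, of 0] show "h y = zero_map M M" by (simp add: \<phi>M_def deg0_def Psi_sel(3)[OF M])
qed (auto simp: \<phi>M_def deg0_def Psi_sel(3)[OF M])

lemma inc_pr_idem:
  assumes v: "v \<in> verts Q" and x: "x \<in> carrier M"
  shows "pr v (inc v (pr v x)) = pr v x"
  using pr_inc[OF v v HomD(1)[OF pr[OF v] x]] by simp

lemma qelt_left:
  assumes v: "v \<in> N"
  shows "\<phi>M (vertex_elt K v) \<cdot> qelt v = qelt v"
proof
  fix n
  note V = N(2,3)[OF v]
  note e = inc_pr_Hom[OF V(1)]
  have L: "(\<phi>M (vertex_elt K v) \<cdot> qelt v) n =
    compose (carrier M) (Tm n M M (compose (carrier M) (inc v) (pr v))) (qelt v n)"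
    unfolding \<phi>M_def h_vertex[OF V(1)] by (rule deg0_mult[OF e qelt_closed[OF v]])
  show "(\<phi>M (vertex_elt K v) \<cdot> qelt v) n = qelt v n"
  proof (cases "n = 1")
    case True
    have "compose (carrier M) (\<tau>map M M (compose (carrier M) (inc v) (pr v))) (qmap v) = qmap v"
    proof (rule Hom_eqI[OF compose_Hom[OF rM(1) qmap_Hom[OF v] tau_map_Hom[OF M M e]] qmap_Hom[OF v]])
      fix x assume x: "x \<in> carrier M"
      define y where "y = \<theta>inv v (pr (t v) x)"
      have y: "y \<in> carrier (\<tau> (X v))" unfolding y_def by (intro HomD(1)[OF \<theta>(2)[OF v]] HomD(1)[OF pr[OF V(2)]] x)
      have "\<tau>map M M (compose (carrier M) (inc v) (pr v)) (\<tau>map (X v) M (inc v) y) =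
        \<tau>map (X v) M (compose (carrier (X v)) (compose (carrier M) (inc v) (pr v)) (inc v)) y"
        by (rule tau_map_apply_compose[OF X[OF V(1)] M M inc[OF V(1)] e y])
      also have "compose (carrier (X v)) (compose (carrier M) (inc v) (pr v)) (inc v) = inc v"
        using HomD(1)[OF inc[OF V(1)]] pr_inc[OF V(1) V(1)]
        by (intro extensionalityI[OF compose_extensional HomD(2)[OF inc[OF V(1)]]]) (simp add: compose_eq)
      finally show "compose (carrier M) (\<tau>map M M (compose (carrier M) (inc v) (pr v))) (qmap v) x = qmap v x"
        using x by (simp add: compose_eq qmap_def y_def)
    qed
    then show ?thesis using L True by (simp add: qelt_def)
  next
    case False
    note eT = Tm_Hom[OF M M e, of n]
    show ?thesis using compose_zM[OF eT] L False by (simp add: qelt_def)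
  qed
qed

lemma qelt_right:
  assumes v: "v \<in> N"
  shows "qelt v \<cdot> \<phi>M (vertex_elt K (t v)) = qelt v"
proof
  fix n
  note V = N(2,3)[OF v]
  note e = inc_pr_Hom[OF V(2)]
  have L: "(qelt v \<cdot> \<phi>M (vertex_elt K (t v))) n =
    compose (carrier M) (qelt v n) (compose (carrier M) (inc (t v)) (pr (t v)))"
    unfolding \<phi>M_def h_vertex[OF V(2)] by (rule mult_deg0[OF e qelt_closed[OF v]])
  show "(qelt v \<cdot> \<phi>M (vertex_elt K (t v))) n = qelt v n"
    unfolding L unfolding qelt_def using HomD(1)[OF inc[OF V(2)]] HomD(1)[OF pr[OF V(2)]] inc_pr_idem[OF V(2)]
    by (cases "n = 1") (auto simp: qmap_def zero_map_def compose_def intro!: restrict_ext)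
qed

text \<open>
  The defining relation of \<open>q\<close>: both sides are the composite
  \<open>M \<rightarrow> X (t v) \<cong> \<tau>\<^sup>-(X v) \<rightarrow> \<tau>\<^sup>-M\<close> whose last map is \<open>\<tau>\<^sup>-\<close> of the restriction of \<open>h y\<close> to \<open>X v\<close>.
\<close>

lemma arrow_relation:
  assumes v: "v \<in> N" and w: "w \<in> verts Q" and y: "y \<in> carrier P"
    and yv: "h y = compose (carrier M) (inc w) (compose (carrier M) f (pr v))" and f: "f \<in> Hom K A (X v) (X w)"
  shows "w \<in> N ==> z \<in> carrier P ==>
      (\<And>x. x \<in> carrier M ==> h z x = inc (t w) (\<theta> w (\<tau>map (X v) (X w) f (\<theta>inv v (pr (t v) x))))) ==>
      \<phi>M y \<cdot> qelt v = qelt w \<cdot> \<phi>M z"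
    "w \<notin> N ==> \<phi>M y \<cdot> qelt v = \<zero>\<^bsub>\<Psi>M\<^esub>"
proof -
  note V = N(2,3)[OF v]
  note hy = h_Hom[OF y]
  have eq: "\<tau>map M M (h y) (qmap v x) = \<tau>map (X w) M (inc w) (\<tau>map (X v) (X w) f (\<theta>inv v (pr (t v) x)))"
    if x: "x \<in> carrier M" for x
  proof -
    define u where "u = \<theta>inv v (pr (t v) x)"
    have u: "u \<in> carrier (\<tau> (X v))" unfolding u_def by (intro HomD(1)[OF \<theta>(2)[OF v]] HomD(1)[OF pr[OF V(2)]] x)
    have "\<tau>map M M (h y) (qmap v x) = \<tau>map (X v) M (compose (carrier (X v)) (h y) (inc v)) u"
      using tau_map_apply_compose[OF X[OF V(1)] M M inc[OF V(1)] hy u] x by (simp add: qmap_def u_def)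
    also have "compose (carrier (X v)) (h y) (inc v) = compose (carrier (X v)) (inc w) f"
      using HomD(1)[OF inc[OF V(1)]] pr_inc[OF V(1) V(1)] unfolding yv compose_def by (intro restrict_ext) simp
    also have "\<tau>map (X v) M \<dots> u = \<tau>map (X w) M (inc w) (\<tau>map (X v) (X w) f u)"
      by (rule tau_map_apply_compose[OF X[OF V(1)] X[OF w] M f inc[OF w] u, symmetric])
    finally show ?thesis by (simp add: u_def)
  qed
  have L: "(\<phi>M y \<cdot> qelt v) n = (if n = 1 then compose (carrier M) (\<tau>map M M (h y)) (qmap v) else zM n)" for n
  proof -
    note hT = Tm_Hom[OF M M hy, of n]
    show ?thesis
      unfolding \<phi>M_def deg0_mult[OF hy qelt_closed[OF v]]
      using compose_zM[OF hT] by (auto simp: qelt_def)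
  qed
  show "\<phi>M y \<cdot> qelt v = qelt w \<cdot> \<phi>M z" if w': "w \<in> N" and z: "z \<in> carrier P"
    and hz: "\<And>x. x \<in> carrier M ==> h z x = inc (t w) (\<theta> w (\<tau>map (X v) (X w) f (\<theta>inv v (pr (t v) x))))"
  proof
    fix n
    note W = N(3)[OF w']
    have "\<theta>inv w (pr (t w) (h z x)) = \<tau>map (X v) (X w) f (\<theta>inv v (pr (t v) x))" if x: "x \<in> carrier M" for x
    proof -
      have a: "\<tau>map (X v) (X w) f (\<theta>inv v (pr (t v) x)) \<in> carrier (\<tau> (X w))"
        by (intro HomD(1)[OF tau_map_Hom[OF X[OF V(1)] X[OF w] f]] HomD(1)[OF \<theta>(2)[OF v]] HomD(1)[OF pr[OF V(2)]] x)
      then show ?thesis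
        unfolding hz[OF x] using pr_inc[OF W W HomD(1)[OF \<theta>(1)[OF w'] a]] \<theta>(3)[OF w' a] by simp
    qed
    then have "compose (carrier M) (\<tau>map M M (h y)) (qmap v) = compose (carrier M) (qmap w) (h z)"
      using eq HomD(1)[OF h_Hom[OF z]]
      by (intro extensionalityI[OF compose_extensional compose_extensional]) (simp add: compose_eq qmap_def[of w])
    then show "(\<phi>M y \<cdot> qelt v) n = (qelt w \<cdot> \<phi>M z) n"
      unfolding L unfolding \<phi>M_def mult_deg0[OF h_Hom[OF z] qelt_closed[OF w']]
      using HomD(1)[OF h_Hom[OF z]] by (auto simp: qelt_def zero_map_def compose_def fun_eq_iff)
  qed
  show "\<phi>M y \<cdot> qelt v = \<zero>\<^bsub>\<Psi>M\<^esub>" if w': "w \<notin> N"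
  proof
    fix n
    have "\<tau>map M M (h y) (qmap v x) = \<zero>\<^bsub>\<tau> M\<^esub>" if x: "x \<in> carrier M" for x
    proof -
      have "\<tau>map (X v) (X w) f (\<theta>inv v (pr (t v) x)) \<in> carrier (\<tau> (X w))"
        by (intro HomD(1)[OF tau_map_Hom[OF X[OF V(1)] X[OF w] f]] HomD(1)[OF \<theta>(2)[OF v]] HomD(1)[OF pr[OF V(2)]] x)
      then have "\<tau>map (X v) (X w) f (\<theta>inv v (pr (t v) x)) = \<zero>\<^bsub>\<tau> (X w)\<^esub>"
        using tau_injective[OF X[OF w] N(5)[OF w w']] by simp
      then show ?thesis
        using eq[OF x] linear_maps_zero[OF fdmodD(3) fdmodD(3) Hom_linear, OF rX(2)[OF w] rM(4)
          tau_map_Hom[OF X[OF w] M inc[OF w]]] by simp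
    qed
    then show "(\<phi>M y \<cdot> qelt v) n = \<zero>\<^bsub>\<Psi>M\<^esub> n"
      unfolding L by (auto simp: Psi_sel(3)[OF M] T_Suc zero_map_def compose_def fun_eq_iff)
  qed
qed

text \<open>
  Each component \<open>x\<^sub>v\<close> is recovered from \<open>\<Sum>\<^sub>v q\<^sub>v x\<^sub>v\<close> by composing with \<open>\<tau>\<^sup>-\<^sup>n\<close> of \<open>cmap v\<close>, and
  the sum has no part of degree \<open>0\<close>, where \<open>\<phi>M\<close> lives.
\<close>

lemma normal_form_unique:
  assumes y: "y \<in> carrier P" and x: "\<And>v. v \<in> N ==> x v \<in> carrier \<Psi>M"
    and xt: "\<And>v. v \<in> N ==> \<phi>M (vertex_elt K (t v)) \<cdot> x v = x v"
    and sum: "\<phi>M y \<oplus>\<^bsub>\<Psi>M\<^esub> (\<Oplus>\<^bsub>\<Psi>M\<^esub>v\<in>N. qelt v \<cdot> x v) = \<zero>\<^bsub>\<Psi>M\<^esub>"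
  shows "\<phi>M y = \<zero>\<^bsub>\<Psi>M\<^esub> \<and> (\<forall>v\<in>N. x v = \<zero>\<^bsub>\<Psi>M\<^esub>)"
proof
  note qx = Psi_mult_closed[OF M qelt_closed x]
  have sum_n: "\<phi>M y n \<oplus>\<^bsub>HM n\<^esub> (\<Oplus>\<^bsub>HM n\<^esub>v\<in>N. (qelt v \<cdot> x v) n) = zM n" for n
    using fun_cong[OF sum, of n] Psi_finsum[of N "\<lambda>v. qelt v \<cdot> x v" n] qx by (simp add: Psi_sel(3,4)[OF M])
  have "(\<Oplus>\<^bsub>HM 0\<^esub>v\<in>N. (qelt v \<cdot> x v) 0) = \<zero>\<^bsub>HM 0\<^esub>"
    using qelt_mult(1)[OF _ x] by (intro abelian_monoid.finsum_all_zero[OF HM(3)]) auto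
  then have "h y = zero_map M M"
    using sum_n[of 0] abelian_monoid.r_zero[OF HM(3), of "h y" 0] h_Hom[OF y] by (simp add: \<phi>M_def deg0_def)
  then show "\<phi>M y = \<zero>\<^bsub>\<Psi>M\<^esub>" by (simp add: \<phi>M_zero_iff[OF y])
  show "\<forall>v\<in>N. x v = \<zero>\<^bsub>\<Psi>M\<^esub>"
  proof (rule ballI, rule ext)
    fix w n assume w: "w \<in> N"
    note xn = PsiD(1)[OF M x]
    let ?b = "\<lambda>v. Tm n M (\<tau> M) (qmap v)" and ?c = "Tm n (\<tau> M) M (cmap w)"
    have b: "?b v \<in> Hom K A (T n M) (T (Suc n) M)" if "v \<in> N" for v
      using Tm_Hom[OF M rM(4) qmap_Hom[OF that], of n] by (simp add: T_tau)
    have c: "?c \<in> Hom K A (T (Suc n) M) (T n M)" using Tm_Hom[OF rM(4) M cmap_Hom[OF w], of n] by (simp add: T_tau)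
    have bx: "compose (carrier M) (?b v) (x v n) \<in> Hom K A M (T (Suc n) M)" if "v \<in> N" for v
      by (rule compose_Hom[OF rM(1) xn[OF that] b[OF that]])
    have y_n: "\<phi>M y (Suc n) = zM (Suc n)" by (simp add: \<phi>M_def deg0_def)
    have 0: "(\<Oplus>\<^bsub>HM (Suc n)\<^esub>v\<in>N. compose (carrier M) (?b v) (x v n)) = zM (Suc n)"
    proof -
      have B: "(\<Oplus>\<^bsub>HM (Suc n)\<^esub>v\<in>N. compose (carrier M) (?b v) (x v n)) \<in> carrier (HM (Suc n))"
        using H_closed(4)[OF M bx] by simp
      have "(\<Oplus>\<^bsub>HM (Suc n)\<^esub>v\<in>N. (qelt v \<cdot> x v) (Suc n)) =
        (\<Oplus>\<^bsub>HM (Suc n)\<^esub>v\<in>N. compose (carrier M) (?b v) (x v n))"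
        by (rule abelian_monoid.finsum_cong'[OF HM(3)]) (use bx qelt_mult(2)[OF _ x] in auto)
      moreover have "zM (Suc n) = \<zero>\<^bsub>HM (Suc n)\<^esub>" by simp
      ultimately show ?thesis
        using sum_n[of "Suc n"] abelian_monoid.l_zero[OF HM(3) B] y_n by simp
    qed
    have cb: "compose (carrier M) ?c (compose (carrier M) (?b v) (x v n)) = (if v = w then x w n else \<zero>\<^bsub>HM n\<^esub>)" if v: "v \<in> N" for v
    proof -
      have "compose (carrier M) ?c (compose (carrier M) (?b v) (x v n)) =
        compose (carrier M) (compose (carrier (T n M)) ?c (?b v)) (x v n)"
        by (rule compose_Hom_assoc[OF xn[OF v]])
      also have "compose (carrier (T n M)) ?c (?b v) = Tm n M M (compose (carrier M) (cmap w) (qmap v))"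
        by (rule Tm_compose[OF M rM(4) M qmap_Hom[OF v] cmap_Hom[OF w], symmetric])
      also have "compose (carrier M) (Tm n M M (compose (carrier M) (cmap w) (qmap v))) (x v n) = (if v = w then x w n else \<zero>\<^bsub>HM n\<^esub>)"
      proof (cases "v = w")
        case True
        have "compose (carrier M) (Tm n M M (compose (carrier M) (inc (t w)) (pr (t w)))) (x w n) =
          (\<phi>M (vertex_elt K (t w)) \<cdot> x w) n"
          unfolding \<phi>M_def h_vertex[OF N(3)[OF w]] by (rule deg0_mult[symmetric, OF inc_pr_Hom[OF N(3)[OF w]] x[OF w]])
        then show ?thesis using True cmap_qmap[OF v w] xt[OF w] by simp
      next
        case False
        have "compose (carrier M) (zero_map (T n M) (T n M)) (x v n) = zM n"
          using HomD(1)[OF xn[OF v, of n]] unfolding zero_map_def compose_def by (intro restrict_ext) simp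
        then show ?thesis using False cmap_qmap[OF v w] Tm_zero[OF M M, of n] by simp
      qed
      finally show ?thesis .
    qed
    have "zM n = compose (carrier M) ?c (zM (Suc n))"
      using compose_zM[OF c] by simp
    also have "\<dots> = (\<Oplus>\<^bsub>HM n\<^esub>v\<in>N. compose (carrier M) ?c (compose (carrier M) (?b v) (x v n)))"
      unfolding 0[symmetric] by (rule compose_finsum[OF rM(1) rM(3) rM(3) bx c])
    also have "\<dots> = compose (carrier M) ?c (compose (carrier M) (?b w) (x w n))"
    proof (rule abelian_monoid.finsum_single[OF HM(3) fin_N w])
      show "compose (carrier M) ?c (compose (carrier M) (?b w) (x w n)) \<in> carrier (HM n)"
        using cb[OF w] xn[OF w] by simp
    qed (use cb in auto)
    also have "\<dots> = x w n" using cb[OF w] by simp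
    finally show "x w n = \<zero>\<^bsub>\<Psi>M\<^esub> n" by (simp add: Psi_sel(3)[OF M])
  qed
qed

text \<open>
  Elements of degree less than \<open>n\<close>, the filtration along which normal forms are constructed.
\<close>

definition FilM :: "nat => (nat => 'k vec => 'k vec) set"
  where "FilM n = {F \<in> carrier \<Psi>M. \<forall>i\<ge>n. F i = zM i}"

lemma FilM: "F \<in> carrier \<Psi>M ==> \<exists>n. F \<in> FilM n" "FilM 0 = {\<zero>\<^bsub>\<Psi>M\<^esub>}" "FilM n \<subseteq> carrier \<Psi>M"
proof -
  show "\<exists>n. F \<in> FilM n" if F: "F \<in> carrier \<Psi>M"
  proof -
    obtain n where "\<forall>i\<in>{i. F i \<noteq> zM i}. i < n" using PsiD(2)[OF M F] finite_nat_set_iff_bounded by blast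
    then have "F \<in> FilM n" using F by (fastforce simp: FilM_def)
    then show ?thesis ..
  qed
  have "\<zero>\<^bsub>\<Psi>M\<^esub> \<in> carrier \<Psi>M" using abelian_groupE(2)[OF module_abelian_group[OF Psi_module[OF M]]] .
  then show "FilM 0 = {\<zero>\<^bsub>\<Psi>M\<^esub>}" by (auto simp: FilM_def Psi_sel(3)[OF M] fun_eq_iff)
qed (auto simp: FilM_def)

text \<open>
  The degree \<open>0\<close> part comes from the path algebra. In degree \<open>k + 1\<close> the decomposition \<open>qmap_cmap_sum\<close>,
  carried to \<open>\<tau>\<^sup>-\<^sup>k\<^sup>-\<^sup>1M\<close>, shows that the components \<open>\<tau>\<^sup>-\<^sup>k(cmap v) \<circ> F\<^sub>k\<^sub>+\<^sub>1\<close> are the coefficients.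
\<close>

lemma normal_form_exists:
  assumes F: "F \<in> FilM (Suc n)"
  shows "\<exists>y\<in>carrier P. \<exists>x. (\<forall>v\<in>N. x v \<in> FilM n) \<and> F = \<phi>M y \<oplus>\<^bsub>\<Psi>M\<^esub> (\<Oplus>\<^bsub>\<Psi>M\<^esub>v\<in>N. qelt v \<cdot> x v)"
proof -
  have FP: "F \<in> carrier \<Psi>M" and Fz: "\<And>i. Suc n \<le> i ==> F i = zM i" using F by (auto simp: FilM_def)
  note FH = PsiD(1)[OF M FP]
  obtain y where y: "y \<in> carrier P" "h y = F 0" using h_onto[of "F 0"] FH[of 0] by auto
  define x where "x v i = compose (carrier M) (Tm i (\<tau> M) M (cmap v)) (F (Suc i))" for v i
  have c: "Tm i (\<tau> M) M (cmap v) \<in> Hom K A (T (Suc i) M) (T i M)" if "v \<in> N" for v i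
    using Tm_Hom[OF rM(4) M cmap_Hom[OF that], of i] by (simp add: T_tau)
  have b: "Tm i M (\<tau> M) (qmap v) \<in> Hom K A (T i M) (T (Suc i) M)" if "v \<in> N" for v i
    using Tm_Hom[OF M rM(4) qmap_Hom[OF that], of i] by (simp add: T_tau)
  have xz: "x v i = zM i" if v: "v \<in> N" and i: "n \<le> i" for v i
    using compose_zM[OF c[OF v]] Fz[of "Suc i"] i by (simp add: x_def)
  have xP: "x v \<in> carrier \<Psi>M" if v: "v \<in> N" for v
    by (rule PsiI[of _ n]) (use xz[OF v] compose_Hom[OF rM(1) FH c[OF v]] in \<open>auto simp: x_def\<close>)
  note qx = Psi_mult_closed[OF M qelt_closed xP]
  have "F = \<phi>M y \<oplus>\<^bsub>\<Psi>M\<^esub> (\<Oplus>\<^bsub>\<Psi>M\<^esub>v\<in>N. qelt v \<cdot> x v)"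
  proof
    fix i
    have R: "(\<phi>M y \<oplus>\<^bsub>\<Psi>M\<^esub> (\<Oplus>\<^bsub>\<Psi>M\<^esub>v\<in>N. qelt v \<cdot> x v)) i =
      \<phi>M y i \<oplus>\<^bsub>HM i\<^esub> (\<Oplus>\<^bsub>HM i\<^esub>v\<in>N. (qelt v \<cdot> x v) i)"
      using Psi_finsum[of N "\<lambda>v. qelt v \<cdot> x v" i] qx by (simp add: Psi_sel(4)[OF M])
    show "F i = (\<phi>M y \<oplus>\<^bsub>\<Psi>M\<^esub> (\<Oplus>\<^bsub>\<Psi>M\<^esub>v\<in>N. qelt v \<cdot> x v)) i"
    proof (cases i)
      case 0
      have "(\<Oplus>\<^bsub>HM 0\<^esub>v\<in>N. (qelt v \<cdot> x v) 0) = \<zero>\<^bsub>HM 0\<^esub>"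
        using qelt_mult(1)[OF _ xP] by (intro abelian_monoid.finsum_all_zero[OF HM(3)]) auto
      then show ?thesis
        unfolding R unfolding 0 using abelian_monoid.r_zero[OF HM(3), of "F 0" 0] FH[of 0] y(2) by (simp add: \<phi>M_def deg0_def)
    next
      case (Suc k)
      let ?bc = "\<lambda>v. compose (carrier (T (Suc k) M)) (Tm k M (\<tau> M) (qmap v)) (Tm k (\<tau> M) M (cmap v))"
      have bc: "?bc v = Tm k (\<tau> M) (\<tau> M) (compose (carrier (\<tau> M)) (qmap v) (cmap v))" if v: "v \<in> N" for v
        using Tm_compose[OF rM(4) M rM(4) cmap_Hom[OF v] qmap_Hom[OF v], of k] by (simp add: T_tau)
      have bcH: "?bc v \<in> Hom K A (T (Suc k) M) (T (Suc k) M)" if v: "v \<in> N" for v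
        by (rule compose_Hom[OF rM(3) c[OF v] b[OF v]])
      have "id_map (T (Suc k) M) = Tm k (\<tau> M) (\<tau> M) (\<Oplus>\<^bsub>hom_space K A (\<tau> M) (\<tau> M)\<^esub>v\<in>N. compose (carrier (\<tau> M)) (qmap v) (cmap v))"
        unfolding qmap_cmap_sum using Tm_id[OF rM(4), of k] by (simp add: T_tau)
      also have "\<dots> = (\<Oplus>\<^bsub>hom_space K A (T k (\<tau> M)) (T k (\<tau> M))\<^esub>v\<in>N. Tm k (\<tau> M) (\<tau> M) (compose (carrier (\<tau> M)) (qmap v) (cmap v)))"
        by (rule Tm_finsum[OF rM(4) rM(4)]) (rule compose_Hom[OF rM(2) cmap_Hom qmap_Hom])
      also have "\<dots> = (\<Oplus>\<^bsub>hom_space K A (T (Suc k) M) (T (Suc k) M)\<^esub>v\<in>N. ?bc v)"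
        unfolding T_tau using bc bcH
        by (intro abelian_monoid.finsum_cong') (auto intro: abelian_group.axioms module_abelian_group[OF hom_space_module[OF rM(3) rM(3)]])
      finally have id: "id_map (T (Suc k) M) = (\<Oplus>\<^bsub>hom_space K A (T (Suc k) M) (T (Suc k) M)\<^esub>v\<in>N. ?bc v)" .
      have "F (Suc k) = compose (carrier M) (id_map (T (Suc k) M)) (F (Suc k))" using compose_id_map(2)[OF FH] by simp
      also have "\<dots> = (\<Oplus>\<^bsub>HM (Suc k)\<^esub>v\<in>N. compose (carrier M) (?bc v) (F (Suc k)))"
        unfolding id by (rule finsum_compose[OF rM(1) rM(3) rM(3) bcH FH])
      also have "\<dots> = (\<Oplus>\<^bsub>HM (Suc k)\<^esub>v\<in>N. (qelt v \<cdot> x v) (Suc k))"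
      proof (rule abelian_monoid.finsum_cong'[OF HM(3) refl])
        show "(\<lambda>v. (qelt v \<cdot> x v) (Suc k)) \<in> N \<rightarrow> carrier (HM (Suc k))" using PsiD(1)[OF M qx] by simp
        fix v assume v: "v \<in> N"
        show "compose (carrier M) (?bc v) (F (Suc k)) = (qelt v \<cdot> x v) (Suc k)"
          unfolding qelt_mult(2)[OF v xP[OF v]] x_def by (rule compose_Hom_assoc[symmetric, OF FH])
      qed
      also have "\<dots> = \<phi>M y (Suc k) \<oplus>\<^bsub>HM (Suc k)\<^esub> (\<Oplus>\<^bsub>HM (Suc k)\<^esub>v\<in>N. (qelt v \<cdot> x v) (Suc k))"
      proof -
        have "(\<Oplus>\<^bsub>HM (Suc k)\<^esub>v\<in>N. (qelt v \<cdot> x v) (Suc k)) \<in> carrier (HM (Suc k))"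
          using H_closed(4)[OF M, of N "\<lambda>v. (qelt v \<cdot> x v) (Suc k)"] PsiD(1)[OF M qx] by simp
        from abelian_monoid.l_zero[OF HM(3) this] show ?thesis by (simp add: \<phi>M_def deg0_def)
      qed
      finally show ?thesis unfolding R unfolding Suc .
    qed
  qed
  moreover have "\<forall>v\<in>N. x v \<in> FilM n" by (simp add: FilM_def xP xz)
  ultimately show ?thesis using y(1) by blast
qed

theorem Psi_ext_quiver_iso:
  assumes J: "ideal J PE"
    and J_ker: "\<And>x. x \<in> J ==> ext_hom N t \<Psi>M \<phi>M qelt x = \<zero>\<^bsub>\<Psi>M\<^esub>"
    and J_I: "\<And>y. y \<in> carrier P ==> h y = zero_map M M ==> ext_elt K y \<in> J"
    and J_rel: "\<And>a. a \<in> arcs Q ==> tail Q a \<in> N ==> head Q a \<in> N ==> \<exists>z\<in>carrier P.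
      old_arrow a \<otimes>\<^bsub>PE\<^esub>
        new_arrow (tail Q a) \<ominus>\<^bsub>PE\<^esub>
      new_arrow (head Q a) \<otimes>\<^bsub>PE\<^esub> ext_elt K z \<in> J"
    and J_rel0: "\<And>a. a \<in> arcs Q ==> tail Q a \<in> N ==> head Q a \<notin> N ==>
      old_arrow a \<otimes>\<^bsub>PE\<^esub>
        new_arrow (tail Q a) \<in> J"
  shows "\<exists>F. F \<in> alg_iso K \<Psi>M (alg_quot PE J)"
  by (rule ext_quiver_iso[OF N(1) N(3) \<phi>M_hom qelt_closed qelt_left qelt_right J J_ker _ J_rel J_rel0
        normal_form_unique FilM(1) FilM(2) FilM(3) normal_form_exists])
    (use J_I \<phi>M_zero_iff in auto)

end

context scalar_field
begin

lemma alg_quot_minus: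
  assumes B: "k_algebra K B" and J: "ideal J B" and x: "x \<in> carrier B" and y: "y \<in> carrier B"
  shows "(J +>\<^bsub>B\<^esub> x) \<ominus>\<^bsub>alg_quot B J\<^esub> (J +>\<^bsub>B\<^esub> y) = J +>\<^bsub>B\<^esub> (x \<ominus>\<^bsub>B\<^esub> y)"
proof -
  note Q = alg_quot_algebra[OF B J]
  interpret Br: ring B using B by (simp add: k_algebra_def)
  interpret C: ring "alg_quot B J" using Q(1) by (simp add: k_algebra_def)
  have mB: "module K B" using B by (simp add: k_algebra_def)
  have cl: "J +>\<^bsub>B\<^esub> z \<in> carrier (alg_quot B J)" if "z \<in> carrier B" for z using that by (auto simp: alg_quot_sel(1))
  have "(J +>\<^bsub>B\<^esub> (\<ominus>\<^bsub>B\<^esub> y)) \<oplus>\<^bsub>alg_quot B J\<^esub> (J +>\<^bsub>B\<^esub> y) = \<zero>\<^bsub>alg_quot B J\<^esub>"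
    using y coset_zero[OF mB ideal_subspace[OF B J]] by (simp add: Q(2) Br.l_neg alg_quot_sel(2))
  then have "\<ominus>\<^bsub>alg_quot B J\<^esub> (J +>\<^bsub>B\<^esub> y) = J +>\<^bsub>B\<^esub> (\<ominus>\<^bsub>B\<^esub> y)"
    by (rule C.minus_equality[OF _ cl[OF y] cl[OF Br.a_inv_closed[OF y]]])
  then show ?thesis using x y by (simp add: a_minus_def Q(2))
qed

lemma coset_self:
  assumes "ideal J B" "x \<in> carrier B"
  shows "x \<in> J +>\<^bsub>B\<^esub> x"
proof -
  interpret J: ideal J B by (rule assms)
  have "\<zero>\<^bsub>B\<^esub> \<oplus>\<^bsub>B\<^esub> x \<in> J +>\<^bsub>B\<^esub> x" unfolding a_r_coset_def' by (rule UN_I[OF additive_subgroup.zero_closed[OF ideal.axioms(1)[OF assms(1)]]]) (rule singletonI)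
  then show ?thesis unfolding J.l_zero[OF assms(2)] .
qed

end

context summand_quiver
begin

text \<open>
  The morphism between indecomposable summands that an arrow stands for.
\<close>

definition amap :: "'e => 'k vec => 'k vec"
  where "amap a = (\<lambda>x\<in>carrier (X (tail Q a)). pr (head Q a) (h (arrow_elt K Q a) (inc (tail Q a) x)))"

lemma arrow_verts: "a \<in> arcs Q ==> tail Q a \<in> verts Q" "a \<in> arcs Q ==> head Q a \<in> verts Q"
  by auto

lemma amap_Hom:
  assumes a: "a \<in> arcs Q"
  shows "amap a \<in> Hom K A (X (tail Q a)) (X (head Q a))"
proof -
  note V = arrow_verts[OF a]
  note ha = h_Hom[OF arrow_closed[OF a]]
  have "amap a = compose (carrier (X (tail Q a))) (compose (carrier M) (pr (head Q a)) (h (arrow_elt K Q a))) (inc (tail Q a))"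
    unfolding amap_def using HomD(1)[OF inc[OF V(1)]] unfolding compose_def by (intro restrict_ext) simp
  then show ?thesis using compose_Hom[OF rX(1)[OF V(1)] inc[OF V(1)] compose_Hom[OF rM(1) ha pr[OF V(2)]]] by simp
qed

lemma h_arrow:
  assumes a: "a \<in> arcs Q"
  shows "h (arrow_elt K Q a) = compose (carrier M) (inc (head Q a)) (compose (carrier M) (amap a) (pr (tail Q a)))"
proof -
  note V = arrow_verts[OF a]
  note ac = arrow_closed[OF a]
  note ha = h_Hom[OF ac]
  interpret PP: ring P by (rule P_mod_alg)
  have "arrow_elt K Q a = vertex_elt K (head Q a) \<bullet> (arrow_elt K Q a \<bullet> vertex_elt K (tail Q a))"
    using arrow_mult_vertex[OF a] V by simp
  then have "h (arrow_elt K Q a) = h (vertex_elt K (head Q a) \<bullet> (arrow_elt K Q a \<bullet> vertex_elt K (tail Q a)))" by simp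
  also have "\<dots> = compose (carrier M) (compose (carrier M) (inc (head Q a)) (pr (head Q a)))
    (compose (carrier M) (h (arrow_elt K Q a)) (compose (carrier M) (inc (tail Q a)) (pr (tail Q a))))"
    using V ac by (simp add: h_mult h_vertex vertex_closed)
  also have "\<dots> = compose (carrier M) (inc (head Q a)) (compose (carrier M) (amap a) (pr (tail Q a)))"
    using HomD(1)[OF ha] HomD(1)[OF inc[OF V(1)]] HomD(1)[OF pr[OF V(1)]]
    unfolding compose_def amap_def by (intro restrict_ext) simp
  finally show ?thesis .
qed

text \<open>
  The kernel \<open>Z\<close> of the homomorphism to \<open>\<Psi>\<close> contains \<open>I\<close> and all relations, hence the ideal they generate.
  Conversely this ideal contains what is required to move new arrows to the left. Each \<open>R a\<close> is a
  whole coset of \<open>I'\<close>, which is harmless since \<open>I'\<close> itself lies in \<open>Z\<close>.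
\<close>

theorem Psi_iso_relations:
  assumes I: "ideal I P" and ker: "\<And>y. y \<in> carrier P ==> h y = zero_map M M \<longleftrightarrow> y \<in> I"
    and z: "\<And>a. a \<in> arcs Q ==> tail Q a \<in> N ==> head Q a \<in> N ==> z a \<in> carrier P \<and>
      (\<forall>x\<in>carrier M. h (z a) x = inc (t (head Q a)) (\<theta> (head Q a)
        (\<tau>map (X (tail Q a)) (X (head Q a)) (amap a) (\<theta>inv (tail Q a) (pr (t (tail Q a)) x)))))"
  defines "I' \<equiv> genideal PE (ext_elt K ` I)"
  assumes R1: "\<And>a. a \<in> arcs Q ==> tail Q a \<in> N ==> head Q a \<in> N ==> R a = I' +>\<^bsub>PE\<^esub>
        (old_arrow a \<otimes>\<^bsub>PE\<^esub> new_arrow (tail Q a) \<ominus>\<^bsub>PE\<^esub>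
         new_arrow (head Q a) \<otimes>\<^bsub>PE\<^esub> ext_elt K (z a))"
    and R2: "\<And>a. a \<in> arcs Q ==> tail Q a \<in> N ==> head Q a \<notin> N ==> R a = I' +>\<^bsub>PE\<^esub>
        (old_arrow a \<otimes>\<^bsub>PE\<^esub> new_arrow (tail Q a))"
    and R3: "\<And>a. a \<in> arcs Q ==> tail Q a \<notin> N ==> R a = I'"
  shows "\<exists>F. F \<in> alg_iso K \<Psi>M (alg_quot PE (genideal PE (ext_elt K ` I \<union> (\<Union>a\<in>arcs Q. R a))))"
proof -
  interpret Y: quiver_alg K QE by (rule ext_quiver_alg[OF N(1)]) (rule N(3))
  interpret PEr: ring PE by (rule Y.P_mod_alg)
  interpret \<Psi>r: ring \<Psi>M using Psi_k_algebra[OF M] by (simp add: k_algebra_def)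
  let ?\<rho> = "ext_hom N t \<Psi>M \<phi>M qelt"
  let ?l = old_arrow and ?r = new_arrow
  let ?S = "ext_elt K ` I \<union> (\<Union>a\<in>arcs Q. R a)"
  note \<rho> = ext_hom_props[OF N(1) N(3) \<phi>M_hom qelt_closed qelt_left qelt_right]
  have \<rho>h: "Y.alg_hom PE \<Psi>M ?\<rho>" and \<rho>e: "y \<in> carrier P ==> ?\<rho> (ext_elt K y) = \<phi>M y"
    and \<rho>q: "v \<in> N ==> ?\<rho> (?r v) = qelt v" for y v
    by (rule \<rho>; assumption?)+
  note \<rho>D = Y.alg_homD[OF \<rho>h]
  have "alg_hom P PE (ext_elt K)" by (rule ext_elt_alg_hom[OF N(1)]) (rule N(3))
  note e = alg_homD[OF this]
  have Ic: "I \<subseteq> carrier P" using ideal.Icarr[OF I] by blast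
  have eI: "ext_elt K ` I \<subseteq> carrier PE" using e(1) Ic by blast
  have lc: "?l a \<in> carrier PE" if "a \<in> arcs Q" for a
    using that by (intro Y.arrow_closed) (simp add: ext_quiver_def)
  have rc: "?r v \<in> carrier PE" if "v \<in> N" for v
    using that by (intro Y.arrow_closed) (simp add: ext_quiver_def)
  have l: "ext_elt K (arrow_elt K Q a) = ?l a" for a by (rule ext_elt_arrow[OF N(1)]) (rule N(3))
  have I': "ideal I' PE" unfolding I'_def by (rule PEr.genideal_ideal[OF eI])
  define Z where "Z = a_kernel PE \<Psi>M ?\<rho>"
  interpret \<rho>: ring_hom_ring PE \<Psi>M ?\<rho>
    by (rule ring_hom_ringI2) (use \<rho>h PEr.ring_axioms \<Psi>r.ring_axioms in \<open>auto simp: Y.alg_hom_def\<close>)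
  have Z: "ideal Z PE" unfolding Z_def by (rule \<rho>.kernel_is_ideal)
  have Z_iff: "x \<in> Z \<longleftrightarrow> x \<in> carrier PE \<and> ?\<rho> x = \<zero>\<^bsub>\<Psi>M\<^esub>" for x
    by (simp only: Z_def a_kernel_def' mem_Collect_eq)
  have eZ: "ext_elt K ` I \<subseteq> Z"
  proof
    fix x assume "x \<in> ext_elt K ` I"
    then obtain y where y: "y \<in> I" "x = ext_elt K y" by blast
    then have "y \<in> carrier P" using Ic by blast
    then show "x \<in> Z" unfolding Z_iff using y e(1) \<rho>e \<phi>M_zero_iff ker by simp
  qed
  have I'Z: "I' \<subseteq> Z" unfolding I'_def by (rule PEr.genideal_minimal[OF Z eZ])
  have cosZ: "I' +>\<^bsub>PE\<^esub> x \<subseteq> Z" if "x \<in> Z" for x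
  proof
    fix y assume "y \<in> I' +>\<^bsub>PE\<^esub> x"
    then obtain b where b: "b \<in> I'" "y = b \<oplus>\<^bsub>PE\<^esub> x" unfolding a_r_coset_def' by blast
    show "y \<in> Z" unfolding b(2) by (rule additive_subgroup.a_closed[OF ideal.axioms(1)[OF Z] subsetD[OF I'Z b(1)] that])
  qed
  let ?u = "\<lambda>a. ?l a \<otimes>\<^bsub>PE\<^esub> ?r (tail Q a)"
  let ?w = "\<lambda>a. ?u a \<ominus>\<^bsub>PE\<^esub> ?r (head Q a) \<otimes>\<^bsub>PE\<^esub> ext_elt K (z a)"
  have uc: "?u a \<in> carrier PE" if "a \<in> arcs Q" "tail Q a \<in> N" for a using lc rc that by simp
  have wc: "?w a \<in> carrier PE" if "a \<in> arcs Q" "tail Q a \<in> N" "head Q a \<in> N" for a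
    using uc[OF that(1,2)] rc[OF that(3)] e(1) z[OF that] by simp
  have \<rho>u: "?\<rho> (?u a) = \<phi>M (arrow_elt K Q a) \<cdot> qelt (tail Q a)" if "a \<in> arcs Q" "tail Q a \<in> N" for a
    using that lc rc \<rho>q \<rho>e[OF arrow_closed, of a] by (simp add: \<rho>D(3) l)
  have wZ: "?w a \<in> Z" if a: "a \<in> arcs Q" "tail Q a \<in> N" "head Q a \<in> N" for a
  proof -
    note za = z[OF a]
    have eq: "\<phi>M (arrow_elt K Q a) \<cdot> qelt (tail Q a) = qelt (head Q a) \<cdot> \<phi>M (z a)"
      by (rule arrow_relation(1)[OF a(2) N(2)[OF a(3)] arrow_closed[OF a(1)] h_arrow[OF a(1)] amap_Hom[OF a(1)] a(3)])
        (use za in auto)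
    have "?\<rho> (?r (head Q a) \<otimes>\<^bsub>PE\<^esub> ext_elt K (z a)) = qelt (head Q a) \<cdot> \<phi>M (z a)"
      using rc[OF a(3)] e(1) za \<rho>q[OF a(3)] \<rho>e by (simp add: \<rho>D(3))
    moreover have "qelt (head Q a) \<cdot> \<phi>M (z a) \<in> carrier \<Psi>M"
      using qelt_closed[OF a(3)] alg_homD(1)[OF \<phi>M_hom] za by simp
    ultimately show ?thesis
      using wc[OF a] uc[OF a(1,2)] rc[OF a(3)] e(1) za \<rho>u[OF a(1,2)] eq
      by (simp add: Z_iff a_minus_def \<Psi>r.r_neg)
  qed
  have uZ: "?u a \<in> Z" if a: "a \<in> arcs Q" "tail Q a \<in> N" "head Q a \<notin> N" for a
    using arrow_relation(2)[OF a(2) arrow_verts(2)[OF a(1)] arrow_closed[OF a(1)] h_arrow[OF a(1)] amap_Hom[OF a(1)] a(3)]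
      \<rho>u[OF a(1,2)] uc[OF a(1,2)] by (simp add: Z_iff)
  have RZ: "R a \<subseteq> Z" if a: "a \<in> arcs Q" for a
    using R1[OF a] R2[OF a] R3[OF a] cosZ[OF wZ[OF a]] cosZ[OF uZ[OF a]] I'Z
    by (cases "tail Q a \<in> N"; cases "head Q a \<in> N") auto
  then have SZ: "?S \<subseteq> Z" using eZ by blast
  have Sc: "?S \<subseteq> carrier PE" using SZ by (auto simp: Z_iff)
  note SJ = PEr.genideal_self[OF Sc]
  show ?thesis
  proof (rule Psi_ext_quiver_iso[OF PEr.genideal_ideal[OF Sc]])
    show "?\<rho> x = \<zero>\<^bsub>\<Psi>M\<^esub>" if "x \<in> genideal PE ?S" for x
      using that PEr.genideal_minimal[OF Z SZ] by (auto simp: Z_iff)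
    show "ext_elt K y \<in> genideal PE ?S" if "y \<in> carrier P" "h y = zero_map M M" for y
      using that ker SJ by blast
    show "\<exists>z\<in>carrier P. ?u a \<ominus>\<^bsub>PE\<^esub> ?r (head Q a) \<otimes>\<^bsub>PE\<^esub> ext_elt K z \<in> genideal PE ?S"
      if a: "a \<in> arcs Q" "tail Q a \<in> N" "head Q a \<in> N" for a
    proof -
      have "?w a \<in> R a" unfolding R1[OF a] by (rule coset_self[OF I' wc[OF a]])
      then show ?thesis using z[OF a] a(1) SJ by blast
    qed
    show "?u a \<in> genideal PE ?S" if a: "a \<in> arcs Q" "tail Q a \<in> N" "head Q a \<notin> N" for a
    proof -
      have "?u a \<in> R a" unfolding R2[OF a] by (rule coset_self[OF I' uc[OF a(1,2)]])
      then show ?thesis using a(1) SJ by blast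
    qed
  qed
qed

end

section \<open>The preprojective algebra as a module\<close>

context ext_functor
begin

lemma regular_fdmod: "fdmod (regular_module A)"
proof -
  interpret A: k_algebra K A by (rule alg)
  interpret A: ring A by (rule A_ring)
  let ?R = "regular_module A"
  have sel: "carrier ?R = carrier A" "add ?R = add A" "zero ?R = zero A" "smult ?R = smult A" "ract ?R = mult A"
    by (simp_all add: regular_module_def with_action_def)
  have m: "module K ?R"
    by (rule module_transfer[where h = "\<lambda>x. x", OF A_module]) (auto simp: sel)
  have "right_module K A ?R"
    by (rule right_moduleI[OF m A_module])
      (auto simp: sel A.l_distr A.r_distr A.smult_mult_left A.smult_mult_right A.m_assoc)
  moreover have "fin_dim K ?R"
    using fdA by (simp add: fin_dim_def is_coord_def linear_maps_def sel)
  ultimately show ?thesis by (simp add: fdmod_def)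
qed

lemma direct_sum_prod:
  "carrier (direct_sum J X) = carrier (prod_module J X)" "add (direct_sum J X) = add (prod_module J X)"
  "zero (direct_sum J X) = zero (prod_module J X)" "smult (direct_sum J X) = smult (prod_module J X)"
  by (simp_all add: direct_sum_def prod_module_def)

lemma direct_sum_fdmod:
  assumes J: "finite J" and X: "\<And>i. i \<in> J ==> fdmod (X i)"
  shows "fdmod (direct_sum J X)"
proof -
  note D = right_moduleD[OF fdmodD(1)[OF X]] right_moduleD_scalar[OF fdmodD(1)[OF X] A_module]
  have pm: "module K (prod_module J X)" by (intro prod_module_module K.is_cring fdmodD(3) X)
  have m: "module K (direct_sum J X)"
    using module.smult_closed[OF pm] abelian_groupE(1,2)[OF module_abelian_group[OF pm]]
    by (intro module_transfer[where h = "\<lambda>x. x", OF pm]) (auto simp: direct_sum_prod)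
  have "right_module K A (direct_sum J X)"
    by (rule right_moduleI[OF m A_module])
      (auto simp: direct_sum_def PiE_iff D intro!: extensionalityI[where A = J])
  moreover have "fin_dim K (direct_sum J X)"
    using fin_dim_prod_module[OF J fdmodD(3)[OF X] fdmodD(2)[OF X]]
    by (simp add: fin_dim_def is_coord_def linear_maps_def direct_sum_prod)
  ultimately show ?thesis by (simp add: fdmod_def)
qed

text \<open>
  That \<open>\<Pi>\<close> is a finite dimensional right module is read off from its decomposition, along which
  the module axioms are transported.
\<close>

lemma preprojective_fdmod:
  assumes D: "fdmod D" and \<Delta>: "\<Delta> \<in> mod_iso K A (preprojective_module K A d) D"
  shows "fdmod (preprojective_module K A d)"
proof -
  let ?R = "regular_module A" and ?M = "preprojective_module K A d"
  define S where "S = std_module K ?R"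
  note R = regular_fdmod
  have S: "fdmod S" unfolding S_def by (rule fdmod_coord(1)[OF R])
  interpret A: k_algebra K A by (rule alg)
  interpret A: ring A by (rule A_ring)
  interpret Pr: ring "Psi K A d S" using Psi_k_algebra[OF S] by (simp add: k_algebra_def)
  interpret Pm: module K "Psi K A d S" by (rule Psi_module[OF S])
  have Pd: "preprojective K A d = Psi K A d S" by (simp add: preprojective_def S_def)
  have sel: "carrier ?M = carrier (Psi K A d S)" "add ?M = add (Psi K A d S)" "zero ?M = zero (Psi K A d S)"
    "smult ?M = smult (Psi K A d S)" "ract ?M p a = p \<otimes>\<^bsub>Psi K A d S\<^esub> to_preprojective K A d a" for p a
    by (simp_all add: preprojective_module_def with_action_def Pd)
  have tp: "to_preprojective K A d a \<in> carrier (Psi K A d S)" if a: "a \<in> carrier A" for a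
  proof -
    have "(\<lambda>x\<in>carrier A. a \<otimes>\<^bsub>A\<^esub> x) \<in> Hom K A ?R ?R"
      by (rule HomI) (use a in \<open>auto simp: regular_module_def with_action_def A.r_distr A.smult_mult_right A.m_assoc\<close>)
    note f = std_map_Hom[OF R R this, folded S_def]
    have "finite {i. (to_preprojective K A d a) i \<noteq> zero_map S (T i S)}"
      by (rule finite_subset[of _ "{0}"]) (auto simp: to_preprojective_def Let_def S_def)
    then show ?thesis
      using f H_closed(1)[OF S] unfolding Psi_sel(1)[OF S] to_preprojective_def Let_def S_def[symmetric] by simp
  qed
  have \<Delta>': "\<Delta> \<in> Hom K A ?M D" "bij_betw \<Delta> (carrier ?M) (carrier D)" using \<Delta> by (auto simp: mod_iso_def)
  note h = HomD[OF \<Delta>'(1)]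
  have "\<Delta> \<in> linear_maps K (Psi K A d S) D" using Hom_linear[OF \<Delta>'(1)] by (simp add: linear_maps_def sel)
  note z = linear_maps_zero[OF Pm.module_axioms fdmodD(3)[OF D] this]
  have rm: "right_module K A ?M"
  proof (rule right_module_transfer[OF fdmodD(1)[OF D] A_module h(1) bij_betw_imp_inj_on[OF \<Delta>'(2)]])
    show "\<Delta> \<zero>\<^bsub>?M\<^esub> = \<zero>\<^bsub>D\<^esub>" using z by (simp add: sel)
  qed (use h(3-5) tp A_ring in \<open>auto simp: sel\<close>)
  moreover have "fin_dim K ?M"
    by (rule fin_dim_injective[where h = \<Delta>, OF fdmodD(3,2)[OF D] right_moduleD(1)[OF rm] h(1) bij_betw_imp_inj_on[OF \<Delta>'(2)] h(3,4)])
  ultimately show ?thesis by (simp add: fdmod_def)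
qed

end

section \<open>Presentations of the endomorphism algebra\<close>

context ext_functor
begin

text \<open>
  A decomposition \<open>\<Delta> : M \<cong> \<Oplus>\<^sub>v X v\<close> in terms of inclusions and projections, for the copy of \<open>M\<close>
  that lives on some \<open>K\<^sup>n\<close>.
\<close>

definition incl_map :: "('k, 'a, 'm) rmod => 'v set => ('v => ('k, 'a, 'k vec) rmod) =>
    ('m => 'v => nat => 'k) => 'v => 'k vec => 'k vec"
  where "incl_map M V X \<Delta> v = (\<lambda>x\<in>carrier (X v). coord K M (inv_into (carrier M) \<Delta> (inj_summand V X v x)))"

definition proj_map :: "('k, 'a, 'm) rmod => ('m => 'v => nat => 'k) => 'v => 'k vec => 'k vec"
  where "proj_map M \<Delta> v = (\<lambda>y\<in>carrier (std_module K M). \<Delta> (unstd M y) v)"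

context
  fixes M :: "('k, 'a, 'm) rmod" and V :: "'v set" and X :: "'v => ('k, 'a, 'k vec) rmod" and \<Delta>
  assumes M: "fdmod M" and V: "finite V" and X: "\<forall>v\<in>V. fdmod (X v)"
    and \<Delta>: "\<Delta> \<in> mod_iso K A M (direct_sum V X)"
begin

abbreviation SM :: "('k, 'a, 'k vec) rmod" where "SM \<equiv> std_module K M"

abbreviation incl :: "'v => 'k vec => 'k vec" where "incl \<equiv> incl_map M V X \<Delta>"
abbreviation proj :: "'v => 'k vec => 'k vec" where "proj \<equiv> proj_map M \<Delta>"

lemma X_fdmod: "v \<in> V ==> fdmod (X v)"
  using X by blast

lemma SM: "fdmod SM"
  by (rule fdmod_coord(1)[OF M])

lemma DS: "fdmod (direct_sum V X)"
  by (rule direct_sum_fdmod[OF V X_fdmod])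

lemma \<Delta>_inv:
  "\<Delta> \<in> Hom K A M (direct_sum V X)"
  "restrict (inv_into (carrier M) \<Delta>) (carrier (direct_sum V X)) \<in> Hom K A (direct_sum V X) M"
  "m \<in> carrier M ==> inv_into (carrier M) \<Delta> (\<Delta> m) = m"
  "z \<in> carrier (direct_sum V X) ==> \<Delta> (inv_into (carrier M) \<Delta> z) = z"
  "z \<in> carrier (direct_sum V X) ==> inv_into (carrier M) \<Delta> z \<in> carrier M"
proof -
  note D = mod_isoD[OF \<Delta> fdmodD(1)[OF M] fdmodD(1)[OF DS]]
  have bij: "bij_betw \<Delta> (carrier M) (carrier (direct_sum V X))" using \<Delta> by (simp add: mod_iso_def)
  show "\<Delta> \<in> Hom K A M (direct_sum V X)"
    "restrict (inv_into (carrier M) \<Delta>) (carrier (direct_sum V X)) \<in> Hom K A (direct_sum V X) M" using D by auto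
  show "m \<in> carrier M ==> inv_into (carrier M) \<Delta> (\<Delta> m) = m" using bij by (simp add: bij_betw_def)
  show "z \<in> carrier (direct_sum V X) ==> \<Delta> (inv_into (carrier M) \<Delta> z) = z"
    "z \<in> carrier (direct_sum V X) ==> inv_into (carrier M) \<Delta> z \<in> carrier M"
    using bij by (auto simp: bij_betw_def f_inv_into_f inv_into_into)
qed

lemma inj_summand_Hom: "v \<in> V ==> inj_summand V X v \<in> Hom K A (X v) (direct_sum V X)"
proof -
  assume v: "v \<in> V"
  note D = right_moduleD[OF fdmodD(1)[OF X_fdmod]] 
  have z: "\<zero>\<^bsub>X j\<^esub> \<in> carrier (X j)" "\<zero>\<^bsub>X j\<^esub> \<oplus>\<^bsub>X j\<^esub> \<zero>\<^bsub>X j\<^esub> = \<zero>\<^bsub>X j\<^esub>" if "j \<in> V" for j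
    using abelian_groupE(2,5)[OF module_abelian_group[OF fdmodD(3)[OF X_fdmod[OF that]]]] by auto
  note za = right_module_zero_act[OF fdmodD(1)[OF X_fdmod]] and zs = module.smult_r_null[OF fdmodD(3)[OF X_fdmod]]
  interpret Xv: module K "X v" by (rule fdmodD(3)[OF X_fdmod[OF v]])
  show ?thesis
    by (rule HomI) (use v in \<open>auto simp: inj_summand_def direct_sum_def z za zs D intro!: restrict_ext\<close>)
qed

lemma proj_summand_Hom: "v \<in> V ==> (\<lambda>z\<in>carrier (direct_sum V X). z v) \<in> Hom K A (direct_sum V X) (X v)"
proof -
  assume v: "v \<in> V"
  interpret D: module K "direct_sum V X" by (rule fdmodD(3)[OF DS])
  note cl = D.a_closed D.smult_closed right_moduleD(2)[OF fdmodD(1)[OF DS]]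
  show ?thesis
    by (rule HomI) (use v in \<open>auto simp: cl\<close>, use v in \<open>auto simp: direct_sum_def PiE_iff\<close>)
qed

lemma incl_Hom: "v \<in> V ==> incl v \<in> Hom K A (X v) SM"
proof -
  assume v: "v \<in> V"
  note c = compose_Hom[OF fdmodD(1)[OF X_fdmod[OF v]] inj_summand_Hom[OF v] \<Delta>_inv(2)]
  have "incl v = compose (carrier (X v)) (coord K M) (compose (carrier (X v))
      (restrict (inv_into (carrier M) \<Delta>) (carrier (direct_sum V X))) (inj_summand V X v))"
    using HomD(1)[OF inj_summand_Hom[OF v]] unfolding incl_map_def compose_def by (intro restrict_ext) simp
  then show ?thesis using compose_Hom[OF fdmodD(1)[OF X_fdmod[OF v]] c coord_unstd(1)[OF M]] by simp
qed

lemma proj_Hom: "v \<in> V ==> proj v \<in> Hom K A SM (X v)"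
proof -
  assume v: "v \<in> V"
  note c = compose_Hom[OF fdmodD(1)[OF SM] coord_unstd(2)[OF M] \<Delta>_inv(1)]
  have "proj v = compose (carrier SM) (\<lambda>z\<in>carrier (direct_sum V X). z v) (compose (carrier SM) \<Delta> (unstd M))"
    using HomD(1)[OF coord_unstd(2)[OF M]] HomD(1)[OF \<Delta>_inv(1)] unfolding proj_map_def compose_def
    by (intro restrict_ext) simp
  then show ?thesis using compose_Hom[OF fdmodD(1)[OF SM] c proj_summand_Hom[OF v]] by simp
qed

lemma proj_incl:
  assumes v: "v \<in> V" and w: "w \<in> V" and x: "x \<in> carrier (X v)"
  shows "proj w (incl v x) = (if v = w then x else \<zero>\<^bsub>X w\<^esub>)"
proof -
  have z: "inj_summand V X v x \<in> carrier (direct_sum V X)" by (rule HomD(1)[OF inj_summand_Hom[OF v] x])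
  note m = \<Delta>_inv(5)[OF z]
  have "incl v x = coord K M (inv_into (carrier M) \<Delta> (inj_summand V X v x))" "incl v x \<in> carrier SM"
    using x HomD(1)[OF incl_Hom[OF v] x] by (simp_all add: incl_map_def)
  then show ?thesis
    using m unstd_coord(1)[OF M m] \<Delta>_inv(4)[OF z] x w by (auto simp: proj_map_def inj_summand_def)
qed

lemma std_summand_to_end:
  assumes v: "v \<in> V" and w: "w \<in> V" and f: "\<And>x. x \<in> carrier (X v) ==> f x \<in> carrier (X w)"
    and y: "y \<in> carrier SM"
  shows "std_map K M M (summand_to_end M V X \<Delta> v w f) y = incl w (f (proj v y))"
proof -
  have u: "unstd M y \<in> carrier M" by (rule HomD(1)[OF coord_unstd(2)[OF M] y])
  have "proj_summand V X v (\<Delta> (unstd M y)) = proj v y"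
    using HomD(1)[OF \<Delta>_inv(1) u] y by (simp add: proj_summand_def proj_map_def)
  then show ?thesis
    using f[OF HomD(1)[OF proj_Hom[OF v] y]] u y by (simp add: std_map_apply summand_to_end_def incl_map_def)
qed

lemma end_to_summand_std:
  assumes v: "v \<in> V" and w: "w \<in> V" and g: "g \<in> Hom K A M M" and x: "x \<in> carrier (X v)"
  shows "end_to_summand M V X \<Delta> v w g x = proj w (std_map K M M g (incl v x))"
proof -
  have z: "inj_summand V X v x \<in> carrier (direct_sum V X)" by (rule HomD(1)[OF inj_summand_Hom[OF v] x])
  define m where "m = inv_into (carrier M) \<Delta> (inj_summand V X v x)"
  have m: "m \<in> carrier M" unfolding m_def by (rule \<Delta>_inv(5)[OF z])
  note gm = HomD(1)[OF g m]
  have i: "incl v x = coord K M m" "incl v x \<in> carrier SM"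
    using x HomD(1)[OF incl_Hom[OF v] x] by (simp_all add: incl_map_def m_def)
  have "std_map K M M g (incl v x) = coord K M (g m)"
    using i unstd_coord(1)[OF M m] by (simp add: std_map_apply)
  moreover have "proj w (coord K M (g m)) = \<Delta> (g m) w"
    using HomD(1)[OF coord_unstd(1)[OF M] gm] unstd_coord(1)[OF M gm] by (simp add: proj_map_def)
  moreover have "end_to_summand M V X \<Delta> v w g x = \<Delta> (g m) w"
    using x HomD(1)[OF \<Delta>_inv(1) gm] by (simp add: end_to_summand_def proj_summand_def m_def)
  ultimately show ?thesis by simp
qed

lemma incl_proj_sum: "(\<Oplus>\<^bsub>hom_space K A SM SM\<^esub>v\<in>V. compose (carrier SM) (incl v) (proj v)) = id_map SM"
proof -
  let ?H = "hom_space K A SM SM"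
  note rSM = fdmodD(1)[OF SM]
  have c: "compose (carrier SM) (incl v) (proj v) \<in> Hom K A SM SM" if "v \<in> V" for v
    by (rule compose_Hom[OF rSM proj_Hom[OF that] incl_Hom[OF that]])
  interpret H: abelian_group ?H by (rule module_abelian_group[OF hom_space_module[OF rSM rSM]])
  let ?s = "\<Oplus>\<^bsub>?H\<^esub>v\<in>V. compose (carrier SM) (incl v) (proj v)"
  have s: "?s \<in> Hom K A SM SM" using H.finsum_closed[of "\<lambda>v. compose (carrier SM) (incl v) (proj v)" V] c by simp
  show ?thesis
  proof (rule Hom_eqI[OF s id_Hom[OF rSM]])
    fix y assume y: "y \<in> carrier SM"
    have sy: "?s y \<in> carrier SM" by (rule HomD(1)[OF s y])
    have pp: "proj w (?s y) = proj w y" if w: "w \<in> V" for w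
    proof -
      interpret Xw: abelian_group "X w" by (rule module_abelian_group[OF fdmodD(3)[OF X_fdmod[OF w]]])
      have "proj w (?s y) = compose (carrier SM) (proj w) ?s y" using y by (simp add: compose_eq)
      also have "compose (carrier SM) (proj w) ?s = (\<Oplus>\<^bsub>hom_space K A SM (X w)\<^esub>v\<in>V. compose (carrier SM) (proj w) (compose (carrier SM) (incl v) (proj v)))"
        by (rule compose_finsum[OF rSM rSM fdmodD(1)[OF X_fdmod[OF w]] c proj_Hom[OF w]])
      also have "\<dots> y = (\<Oplus>\<^bsub>X w\<^esub>v\<in>V. compose (carrier SM) (proj w) (compose (carrier SM) (incl v) (proj v)) y)"
        by (rule finsum_hom_apply[OF rSM fdmodD(1)[OF X_fdmod[OF w]] compose_Hom[OF rSM c proj_Hom[OF w]] y])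
      also have "\<dots> = compose (carrier SM) (proj w) (compose (carrier SM) (incl w) (proj w)) y"
      proof (rule Xw.finsum_single[OF V w])
        show "compose (carrier SM) (proj w) (compose (carrier SM) (incl w) (proj w)) y \<in> carrier (X w)"
          by (rule HomD(1)[OF compose_Hom[OF rSM c[OF w] proj_Hom[OF w]] y])
        show "compose (carrier SM) (proj w) (compose (carrier SM) (incl v) (proj v)) y = \<zero>\<^bsub>X w\<^esub>"
          if "v \<in> V" "v \<noteq> w" for v
          using proj_incl[OF that(1) w HomD(1)[OF proj_Hom[OF that(1)] y]] that(2) y by (simp add: compose_eq)
      qed
      also have "\<dots> = proj w y" using proj_incl[OF w w HomD(1)[OF proj_Hom[OF w] y]] y by (simp add: compose_eq)
      finally show ?thesis .
    qed
    have uc: "unstd M y' \<in> carrier M" if "y' \<in> carrier SM" for y' by (rule HomD(1)[OF coord_unstd(2)[OF M] that])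
    have "\<Delta> (unstd M (?s y)) = \<Delta> (unstd M y)"
    proof (rule extensionalityI[where A = V])
      show "\<Delta> (unstd M (?s y)) \<in> extensional V" "\<Delta> (unstd M y) \<in> extensional V"
        using HomD(1)[OF \<Delta>_inv(1) uc[OF sy]] HomD(1)[OF \<Delta>_inv(1) uc[OF y]] by (auto simp: direct_sum_def PiE_iff)
      fix w assume "w \<in> V"
      then show "\<Delta> (unstd M (?s y)) w = \<Delta> (unstd M y) w" using pp[of w] y sy by (simp add: proj_map_def)
    qed
    then have "inv_into (carrier M) \<Delta> (\<Delta> (unstd M (?s y))) = inv_into (carrier M) \<Delta> (\<Delta> (unstd M y))" by (rule arg_cong)
    then have "unstd M (?s y) = unstd M y" unfolding \<Delta>_inv(3)[OF uc[OF sy]] \<Delta>_inv(3)[OF uc[OF y]] .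
    then show "?s y = id_map SM y" using unstd_coord(2)[OF M sy] unstd_coord(2)[OF M y] y by simp
  qed
qed

lemma std_map_surj:
  assumes f: "f \<in> Hom K A SM SM"
  shows "\<exists>g\<in>Hom K A M M. std_map K M M g = f"
proof
  let ?g = "compose (carrier M) (compose (carrier SM) (unstd M) f) (coord K M)"
  show g: "?g \<in> Hom K A M M"
    by (rule compose_Hom[OF fdmodD(1)[OF M] coord_unstd(1)[OF M] compose_Hom[OF fdmodD(1)[OF SM] f coord_unstd(2)[OF M]]])
  show "std_map K M M ?g = f"
  proof (rule Hom_eqI[OF std_map_Hom[OF M M g] f])
    fix y assume y: "y \<in> carrier SM"
    then show "std_map K M M ?g y = f y"
      using HomD(1)[OF coord_unstd(2)[OF M] y] unstd_coord(2)[OF M y] unstd_coord(2)[OF M HomD(1)[OF f y]]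
      by (simp add: std_map_apply compose_eq)
  qed
qed

lemma std_map_inj:
  assumes g: "g \<in> Hom K A M M" and z: "std_map K M M g = zero_map SM SM"
  shows "g = zero_map M M"
proof (rule Hom_eqI[OF g zero_map_Hom[OF fdmodD(1)[OF M] fdmodD(1)[OF M]]])
  fix m assume m: "m \<in> carrier M"
  note c = HomD(1)[OF coord_unstd(1)[OF M] m]
  have "coord K M (g m) = \<zero>\<^bsub>SM\<^esub>"
    using fun_cong[OF z, of "coord K M m"] c unstd_coord(1)[OF M m] by (simp add: std_map_apply)
  then have "g m = unstd M \<zero>\<^bsub>SM\<^esub>" using unstd_coord(1)[OF M HomD(1)[OF g m]] by simp
  then show "g m = zero_map M M m"
    using linear_maps_zero[OF fdmodD(3)[OF SM] fdmodD(3)[OF M] Hom_linear[OF coord_unstd(2)[OF M]]] m by simp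
qed

lemma summand_to_end_Hom:
  assumes v: "v \<in> V" and w: "w \<in> V" and f: "f \<in> Hom K A (X v) (X w)"
  shows "summand_to_end M V X \<Delta> v w f \<in> Hom K A M M"
proof -
  let ?D = "direct_sum V X"
  note rM = fdmodD(1)[OF M]
  note i = \<Delta>_inv(1,2) and p = proj_summand_Hom[OF v] and j = inj_summand_Hom[OF w]
  have "summand_to_end M V X \<Delta> v w f = compose (carrier M) (restrict (inv_into (carrier M) \<Delta>) (carrier ?D))
    (compose (carrier M) (inj_summand V X w) (compose (carrier M) f (compose (carrier M) (\<lambda>z\<in>carrier ?D. z v) \<Delta>)))"
    using HomD(1)[OF i(1)] HomD(1)[OF p] HomD(1)[OF f] HomD(1)[OF j]
    unfolding summand_to_end_def proj_summand_def compose_def by (intro restrict_ext) simp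
  also have "\<dots> \<in> Hom K A M M"
    by (rule compose_Hom[OF rM compose_Hom[OF rM compose_Hom[OF rM compose_Hom[OF rM i(1) p] f] j] i(2)])
  finally show ?thesis .
qed

end

end

theorem theorem1p7:
  fixes K :: "('k, 'z) ring_scheme" and \<Lambda> :: "('k, 'a, 'y) module_scheme" and d :: nat
    and Q :: "('v, 'e) pre_digraph" and I :: "('v \<times> 'e list \<Rightarrow> 'k) set"
    and X :: "'v \<Rightarrow> ('k, 'a, nat \<Rightarrow> 'k) rmod"
    and \<Delta> :: "(nat \<Rightarrow> (nat \<Rightarrow> 'k) \<Rightarrow> (nat \<Rightarrow> 'k)) \<Rightarrow> 'v \<Rightarrow> nat \<Rightarrow> 'k"
    and t :: "'v \<Rightarrow> 'v" and \<theta> :: "'v \<Rightarrow> (nat \<Rightarrow> 'k) \<Rightarrow> nat \<Rightarrow> 'k"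
  assumes "d \<ge> 1"
    and "d_representation_finite K \<Lambda> d"
    and "quiver_presentation K \<Lambda> (preprojective_module K \<Lambda> d) Q I X \<Delta> \<Phi>"
    and "tau_identification K \<Lambda> d (verts Q) X t \<theta>"
  shows "\<exists>F. F \<in> alg_iso K (total_preprojective K \<Lambda> d)
    (alg_quot (ext_path_algebra K \<Lambda> Q X t)
      (rel_ideal K \<Lambda> d (preprojective_module K \<Lambda> d) Q I X \<Delta> \<Phi> t \<theta>))"
proof -
  let ?M = "preprojective_module K \<Lambda> d" and ?P = "path_algebra K Q"
  let ?C = "alg_quot ?P I" and ?c = "\<lambda>y. I +>\<^bsub>?P\<^esub> y"
  have fd: "field K" "k_algebra K \<Lambda>" "fin_dim K \<Lambda>"
    using assms(2) by (auto simp: d_representation_finite_def fd_algebra_def)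
  have sf: "scalar_field K" using fd(1) by (simp add: scalar_field_def)
  have fa: "fd_alg K \<Lambda>" by (intro fd_alg.intro sf fd_alg_axioms.intro fd)
  have E: "ext_functor K \<Lambda> d" by (intro ext_functor.intro fa ext_functor_axioms.intro assms(1))
  interpret E: ext_functor K \<Lambda> d by (rule E)
  have fin: "fin_digraph Q" and Xfg: "\<And>v. v \<in> verts Q \<Longrightarrow> fg_module K \<Lambda> (X v)"
    and \<Delta>: "\<Delta> \<in> mod_iso K \<Lambda> ?M (direct_sum (verts Q) X)" and I: "ideal I ?P"
    and \<Phi>: "\<Phi> \<in> alg_iso K ?C (End_algebra K \<Lambda> ?M)"
    and \<Phi>v: "\<And>v. v \<in> verts Q \<Longrightarrow> \<Phi> (?c (vertex_elt K v)) = summand_to_end ?M (verts Q) X \<Delta> v v (id_map (X v))"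
    using assms(3) unfolding quiver_presentation_def by auto
  have QA: "quiver_alg K Q" by (intro quiver_alg.intro sf fin)
  interpret QA: quiver_alg K Q by (rule QA)
  have X: "E.fdmod (X v)" if "v \<in> verts Q" for v by (rule E.fg_fdmod[OF Xfg[OF that]])
  then have XX: "\<forall>v\<in>verts Q. E.fdmod (X v)" by blast
  have V: "finite (verts Q)" by simp
  have "E.fdmod (direct_sum (verts Q) X)" by (rule E.direct_sum_fdmod[OF V X])
  then have M: "E.fdmod ?M" by (rule E.preprojective_fdmod[OF _ \<Delta>])
  note rM = E.fdmodD(1)[OF M]
  \<comment> \<open>The decomposition and the presentation are transported to the copy \<open>S\<close> of \<open>\<Pi>\<close> on some \<open>K\<^sup>n\<close>,
    for which the total preprojective algebra is defined.\<close>
  define S where "S = std_module K ?M"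
  define inc where "inc = E.incl_map ?M (verts Q) X \<Delta>"
  define pr where "pr = E.proj_map ?M \<Delta>"
  have S: "E.fdmod S" unfolding S_def by (rule E.SM[OF M V XX \<Delta>])
  have inc: "inc v \<in> Hom K \<Lambda> (X v) S" if "v \<in> verts Q" for v
    unfolding inc_def S_def by (rule E.incl_Hom[OF M V XX \<Delta> that])
  have pr: "pr v \<in> Hom K \<Lambda> S (X v)" if "v \<in> verts Q" for v
    unfolding pr_def S_def by (rule E.proj_Hom[OF M V XX \<Delta> that])
  note Ca = E.alg_quot_algebra[OF QA.P_k_algebra I]
  have cC: "?c y \<in> carrier ?C" if "y \<in> carrier ?P" for y using that by (auto simp: E.alg_quot_sel(1))
  have \<Phi>h: "\<Phi> \<in> ring_hom ?C (End_algebra K \<Lambda> ?M)" and \<Phi>b: "bij_betw \<Phi> (carrier ?C) (Hom K \<Lambda> ?M ?M)"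
    and \<Phi>s: "\<And>c x. c \<in> carrier K \<Longrightarrow> x \<in> carrier ?C \<Longrightarrow> \<Phi> (c \<odot>\<^bsub>?C\<^esub> x) = c \<odot>\<^bsub>hom_space K \<Lambda> ?M ?M\<^esub> \<Phi> x"
    using \<Phi> by (auto simp: alg_iso_def ring_iso_def End_algebra_def hom_space_def)
  have \<Phi>H: "\<Phi> x \<in> Hom K \<Lambda> ?M ?M" if "x \<in> carrier ?C" for x using bij_betwE[OF \<Phi>b] that by blast
  have \<Phi>a: "\<Phi> (x \<oplus>\<^bsub>?C\<^esub> y) = \<Phi> x \<oplus>\<^bsub>hom_space K \<Lambda> ?M ?M\<^esub> \<Phi> y"
    "\<Phi> (x \<otimes>\<^bsub>?C\<^esub> y) = compose (carrier ?M) (\<Phi> x) (\<Phi> y)" if "x \<in> carrier ?C" "y \<in> carrier ?C" for x y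
    using ring_hom_add[OF \<Phi>h that] ring_hom_mult[OF \<Phi>h that] by (simp_all add: End_algebra_def hom_space_def)
  have \<Phi>1: "\<Phi> \<one>\<^bsub>?C\<^esub> = id_map ?M" using ring_hom_one[OF \<Phi>h] by (simp add: End_algebra_def)
  have cs: "\<exists>y\<in>carrier ?P. x = ?c y" if "x \<in> carrier ?C" for x using that by (auto simp: E.alg_quot_sel(1))
  define h where "h y = std_map K ?M ?M (\<Phi> (?c y))" for y
  have hH: "h y \<in> Hom K \<Lambda> S S" if "y \<in> carrier ?P" for y
    unfolding h_def S_def by (rule E.std_map_Hom[OF M M \<Phi>H[OF cC[OF that]]])
  have h_summand: "std_map K ?M ?M (summand_to_end ?M (verts Q) X \<Delta> v w f) y = inc w (f (pr v y))"
    if "v \<in> verts Q" "w \<in> verts Q" "\<And>x. x \<in> carrier (X v) \<Longrightarrow> f x \<in> carrier (X w)" "y \<in> carrier S" for v w f y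
    unfolding inc_def pr_def by (rule E.std_summand_to_end[OF M V XX \<Delta> that(1,2)]) (use that in \<open>auto simp: S_def\<close>)
  interpret B: summand_quiver K \<Lambda> d Q S X inc pr t \<theta> h
  proof (intro summand_quiver.intro E QA summand_quiver_axioms.intro S X inc pr hH)
    show "pr w (inc v x) = (if v = w then x else \<zero>\<^bsub>X w\<^esub>)"
      if "v \<in> verts Q" "w \<in> verts Q" "x \<in> carrier (X v)" for v w x
      unfolding pr_def inc_def by (rule E.proj_incl[OF M V XX \<Delta> that])
    show "(\<Oplus>\<^bsub>hom_space K \<Lambda> S S\<^esub>v\<in>verts Q. compose (carrier S) (inc v) (pr v)) = id_map S"
      unfolding pr_def inc_def S_def by (rule E.incl_proj_sum[OF M V XX \<Delta>])
    show "t v \<in> verts Q \<and> \<theta> v \<in> mod_iso K \<Lambda> (tau K \<Lambda> d (X v)) (X (t v))"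
      if "v \<in> verts Q" "\<not> injective K \<Lambda> (X v)" for v
      using assms(4) that by (auto simp: tau_identification_def)
    show "h (y \<oplus>\<^bsub>?P\<^esub> z) = h y \<oplus>\<^bsub>hom_space K \<Lambda> S S\<^esub> h z" if "y \<in> carrier ?P" "z \<in> carrier ?P" for y z
      using E.std_map_linear(1)[OF M M \<Phi>H[OF cC[OF that(1)]] \<Phi>H[OF cC[OF that(2)]] E.K.one_closed]
        \<Phi>a(1)[OF cC[OF that(1)] cC[OF that(2)]] that by (simp add: h_def S_def Ca(2))
    show "h (y \<otimes>\<^bsub>?P\<^esub> z) = compose (carrier S) (h y) (h z)" if "y \<in> carrier ?P" "z \<in> carrier ?P" for y z
      using E.std_map_compose[OF M M M \<Phi>H[OF cC[OF that(2)]] \<Phi>H[OF cC[OF that(1)]]]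
        \<Phi>a(2)[OF cC[OF that(1)] cC[OF that(2)]] that by (simp add: h_def S_def Ca(3))
    show "h (c \<odot>\<^bsub>?P\<^esub> y) = c \<odot>\<^bsub>hom_space K \<Lambda> S S\<^esub> h y" if "c \<in> carrier K" "y \<in> carrier ?P" for c y
      using E.std_map_linear(2)[OF M M \<Phi>H[OF cC[OF that(2)]] \<Phi>H[OF cC[OF that(2)]] that(1)]
        \<Phi>s[OF that(1) cC[OF that(2)]] that by (simp add: h_def S_def Ca(5))
    show "h \<one>\<^bsub>?P\<^esub> = id_map S" using \<Phi>1 E.std_map_id[OF M] by (simp add: h_def S_def Ca(4))
    show "\<exists>y\<in>carrier ?P. h y = f" if f: "f \<in> Hom K \<Lambda> S S" for f
    proof -
      obtain g where g: "g \<in> Hom K \<Lambda> ?M ?M" "std_map K ?M ?M g = f"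
        using E.std_map_surj[OF M V XX \<Delta> f[unfolded S_def]] by blast
      then obtain x where "x \<in> carrier ?C" "g = \<Phi> x" using \<Phi>b by (auto simp: bij_betw_def)
      then show ?thesis using cs[of x] g(2) by (auto simp: h_def)
    qed
    show "h (vertex_elt K v) = compose (carrier S) (inc v) (pr v)" if v: "v \<in> verts Q" for v
    proof (rule Hom_eqI[OF hH[OF QA.vertex_closed[OF v]] compose_Hom[OF E.fdmodD(1)[OF S] pr[OF v] inc[OF v]]])
      fix x assume x: "x \<in> carrier S"
      show "h (vertex_elt K v) x = compose (carrier S) (inc v) (pr v) x"
        using h_summand[OF v v, of "id_map (X v)" x] x HomD(1)[OF pr[OF v] x] by (simp add: h_def \<Phi>v[OF v] compose_eq)
    qed
  qed
  have ker: "h y = zero_map S S \<longleftrightarrow> y \<in> I" if y: "y \<in> carrier ?P" for y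
  proof -
    have mP: "module K ?P" by (rule QA.P_module)
    note sub = E.ideal_subspace[OF QA.P_k_algebra I]
    have 0: "\<Phi> I = zero_map ?M ?M"
    proof -
      interpret C: module K ?C using Ca(1) by (simp add: k_algebra_def)
      have "\<Phi> (\<zero>\<^bsub>K\<^esub> \<odot>\<^bsub>?C\<^esub> \<zero>\<^bsub>?C\<^esub>) = \<zero>\<^bsub>K\<^esub> \<odot>\<^bsub>hom_space K \<Lambda> ?M ?M\<^esub> \<Phi> \<zero>\<^bsub>?C\<^esub>" by (rule \<Phi>s) auto
      also have "\<dots> = zero_map ?M ?M" by (rule E.hom_space_zero_smult[OF rM rM \<Phi>H]) simp
      finally show ?thesis using C.smult_r_null[OF E.K.zero_closed] by (simp add: E.alg_quot_sel(2))
    qed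
    have cI: "?c y = I \<longleftrightarrow> y \<in> I"
    proof
      assume "y \<in> I"
      then have "?c y = ?c \<zero>\<^bsub>?P\<^esub>"
        using y abelian_groupE(2,5)[OF module_abelian_group[OF mP]]
          abelian_monoid.r_zero[OF abelian_group.axioms(1)[OF module_abelian_group[OF mP]]]
        by (intro coset_eqI[OF mP sub]) auto
      then show "?c y = I" using coset_zero[OF mP sub] by simp
    qed (rule coset_eqD[OF mP sub y])
    have IC: "I \<in> carrier ?C" using cC[of "\<zero>\<^bsub>?P\<^esub>"] coset_zero[OF mP sub] abelian_groupE(2)[OF module_abelian_group[OF mP]] by simp
    have "h y = zero_map S S \<longleftrightarrow> \<Phi> (?c y) = zero_map ?M ?M"
    proof
      show "h y = zero_map S S \<Longrightarrow> \<Phi> (?c y) = zero_map ?M ?M"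
        unfolding h_def S_def by (rule E.std_map_inj[OF M V XX \<Delta> \<Phi>H[OF cC[OF y]]])
      assume "\<Phi> (?c y) = zero_map ?M ?M"
      then have "h y = std_map K ?M ?M (\<zero>\<^bsub>K\<^esub> \<odot>\<^bsub>hom_space K \<Lambda> ?M ?M\<^esub> \<Phi> (?c y))"
        using E.hom_space_zero_smult[OF rM rM \<Phi>H[OF cC[OF y]]] by (simp add: h_def)
      then show "h y = zero_map S S"
        using E.std_map_linear(2)[OF M M \<Phi>H[OF cC[OF y]] \<Phi>H[OF cC[OF y]] E.K.zero_closed]
          E.hom_space_zero_smult[OF E.fdmodD(1)[OF S] E.fdmodD(1)[OF S] hH[OF y]] by (simp add: h_def S_def)
    qed
    also have "\<dots> \<longleftrightarrow> ?c y = I"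
      using inj_onD[OF bij_betw_imp_inj_on[OF \<Phi>b] _ cC[OF y] IC] 0 by auto
    finally show ?thesis using cI by simp
  qed
  define g where "g a = (\<lambda>x\<in>carrier (X (t (tail Q a))). \<theta> (head Q a) (tau_map K \<Lambda> d (X (tail Q a)) (X (head Q a)) (B.amap a)
    (inv_into (carrier (tau K \<Lambda> d (X (tail Q a)))) (\<theta> (tail Q a)) x)))" for a
  define G where "G a = summand_to_end ?M (verts Q) X \<Delta> (t (tail Q a)) (t (head Q a)) (g a)" for a
  \<comment> \<open>A representative in the path algebra of the element \<open>\<tau>\<^sup>-(a)\<close> of \<open>KQ/I\<close>.\<close>
  define z where "z a = (SOME y. y \<in> carrier ?P \<and> ?c y = inv_into (carrier ?C) \<Phi> (G a))" for a
  have z: "z a \<in> carrier ?P" "?c (z a) = inv_into (carrier ?C) \<Phi> (G a)"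
    and hz: "\<And>x. x \<in> carrier S \<Longrightarrow> h (z a) x = inc (t (head Q a)) (\<theta> (head Q a)
      (tau_map K \<Lambda> d (X (tail Q a)) (X (head Q a)) (B.amap a) (B.\<theta>inv (tail Q a) (pr (t (tail Q a)) x))))"
    if a: "a \<in> arcs Q" "tail Q a \<in> B.N" "head Q a \<in> B.N" for a
  proof -
    let ?v = "tail Q a" and ?w = "head Q a"
    note tv = B.N(3)[OF a(2)] and tw = B.N(3)[OF a(3)] and v = B.N(2)[OF a(2)] and w = B.N(2)[OF a(3)]
    note am = E.tau_map_Hom[OF X[OF v] X[OF w] B.amap_Hom[OF a(1)]]
    have "g a = compose (carrier (X (t ?v))) (compose (carrier (tau K \<Lambda> d (X ?v))) (\<theta> ?w)
      (tau_map K \<Lambda> d (X ?v) (X ?w) (B.amap a))) (B.\<theta>inv ?v)"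
      using HomD(1)[OF B.\<theta>(2)[OF a(2)]] unfolding g_def compose_def B.\<theta>inv_def by (intro restrict_ext) simp
    then have gH: "g a \<in> Hom K \<Lambda> (X (t ?v)) (X (t ?w))"
      using compose_Hom[OF B.rX(1)[OF tv] B.\<theta>(2)[OF a(2)] compose_Hom[OF B.rX(3)[OF v] am B.\<theta>(1)[OF a(3)]]] by simp
    have GH: "G a \<in> Hom K \<Lambda> ?M ?M" unfolding G_def by (rule E.summand_to_end_Hom[OF M V XX \<Delta> tv tw gH])
    then have "inv_into (carrier ?C) \<Phi> (G a) \<in> carrier ?C" and \<Phi>G: "\<Phi> (inv_into (carrier ?C) \<Phi> (G a)) = G a"
      using \<Phi>b by (auto simp: bij_betw_def inv_into_into f_inv_into_f)
    then have "\<exists>y. y \<in> carrier ?P \<and> ?c y = inv_into (carrier ?C) \<Phi> (G a)" using cs by blast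
    from someI_ex[OF this] show z: "z a \<in> carrier ?P" "?c (z a) = inv_into (carrier ?C) \<Phi> (G a)" by (auto simp: z_def)
    fix x assume x: "x \<in> carrier S"
    have "h (z a) x = inc (t ?w) (g a (pr (t ?v) x))"
      unfolding h_def z(2) \<Phi>G unfolding G_def by (rule h_summand[OF tv tw HomD(1)[OF gH] x])
    then show "h (z a) x = inc (t ?w) (\<theta> ?w (tau_map K \<Lambda> d (X ?v) (X ?w) (B.amap a) (B.\<theta>inv ?v (pr (t ?v) x))))"
      using HomD(1)[OF pr[OF tv] x] by (simp add: g_def B.\<theta>inv_def)
  qed
  define I' where "I' = genideal B.PE (ext_elt K ` I)"
  have ee: "QA.alg_hom ?P B.PE (ext_elt K)" by (rule QA.ext_elt_alg_hom[OF B.N(1)]) (rule B.N(3))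
  note e = QA.alg_homD[OF ee]
  interpret Y: quiver_alg K B.QE by (rule QA.ext_quiver_alg[OF B.N(1)]) (rule B.N(3))
  interpret PE: ring B.PE by (rule Y.P_mod_alg)
  have Ic: "I \<subseteq> carrier ?P" using ideal.Icarr[OF I] by blast
  have eI: "ext_elt K ` I \<subseteq> carrier B.PE" using e(1) Ic by blast
  have I': "ideal I' B.PE" unfolding I'_def by (rule PE.genideal_ideal[OF eI])
  note Qa = E.alg_quot_algebra[OF Y.P_k_algebra I'] and Qm = E.alg_quot_minus[OF Y.P_k_algebra I']
  have defs: "ext_path_algebra K \<Lambda> Q X t = B.PE" "ext_ideal K \<Lambda> Q I X t = I'"
    by (simp_all add: ext_path_algebra_def ext_ideal_def I'_def)
  have lc: "B.old_arrow a \<in> carrier B.PE" if "a \<in> arcs Q" for a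
    using that by (intro Y.arrow_closed) (simp add: ext_quiver_def)
  have rc: "B.new_arrow v \<in> carrier B.PE" if "v \<in> B.N" for v
    using that by (intro Y.arrow_closed) (simp add: ext_quiver_def)
  have tau_arrow: "tau_arrow K \<Lambda> d ?M Q I X \<Delta> \<Phi> t \<theta> a = I' +>\<^bsub>B.PE\<^esub> ext_elt K (z a)"
    if a: "a \<in> arcs Q" "tail Q a \<in> B.N" "head Q a \<in> B.N" for a
  proof -
    let ?v = "tail Q a" and ?w = "head Q a"
    note v = B.N(2)[OF a(2)] and w = B.N(2)[OF a(3)]
    have f: "end_to_summand ?M (verts Q) X \<Delta> ?v ?w (\<Phi> (?c (arrow_elt K Q a))) = B.amap a"
    proof
      fix x show "end_to_summand ?M (verts Q) X \<Delta> ?v ?w (\<Phi> (?c (arrow_elt K Q a))) x = B.amap a x"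
      proof (cases "x \<in> carrier (X ?v)")
        case True
        then show ?thesis
          using E.end_to_summand_std[OF M V XX \<Delta> v w \<Phi>H[OF cC[OF QA.arrow_closed[OF a(1)]]] True]
          unfolding B.amap_def by (simp add: h_def inc_def pr_def)
      qed (simp add: end_to_summand_def B.amap_def)
    qed
    have "tau_arrow K \<Lambda> d ?M Q I X \<Delta> \<Phi> t \<theta> a = coset_map B.PE I' (ext_elt K) (?c (z a))"
      unfolding tau_arrow_def Let_def defs f z(2)[OF a] G_def g_def ..
    also have "\<dots> = I' +>\<^bsub>B.PE\<^esub> ext_elt K (z a)"
    proof (rule coset_map_coset[OF QA.P_module E.ideal_subspace[OF QA.P_k_algebra I] Y.P_module
          E.ideal_subspace[OF Y.P_k_algebra I']])
      show "ext_elt K x \<in> I'" if "x \<in> I" for x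
        using that PE.genideal_self[OF eI] by (auto simp: I'_def)
    qed (use e z(1)[OF a] in auto)
    finally show ?thesis .
  qed
  have inj: "injective K \<Lambda> (X v) \<longleftrightarrow> v \<notin> B.N" if "v \<in> verts Q" for v using that by (auto simp: noninj_verts_def)
  have "\<exists>F. F \<in> alg_iso K (Psi K \<Lambda> d S) (alg_quot B.PE (genideal B.PE (ext_elt K ` I \<union>
    (\<Union>a\<in>arcs Q. rel K \<Lambda> d ?M Q I X \<Delta> \<Phi> t \<theta> a))))"
  proof (rule B.Psi_iso_relations[OF I ker, where z = z, folded I'_def])
    fix a assume a: "a \<in> arcs Q"
    note av = B.arrow_verts[OF a]
    show "z a \<in> carrier ?P \<and> (\<forall>x\<in>carrier S. h (z a) x = inc (t (head Q a)) (\<theta> (head Q a)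
        (tau_map K \<Lambda> d (X (tail Q a)) (X (head Q a)) (B.amap a) (B.\<theta>inv (tail Q a) (pr (t (tail Q a)) x)))))"
      if "tail Q a \<in> B.N" "head Q a \<in> B.N"
      using z(1)[OF a that] hz[OF a that] by blast
    show "rel K \<Lambda> d ?M Q I X \<Delta> \<Phi> t \<theta> a = I' +>\<^bsub>B.PE\<^esub>
        (B.old_arrow a \<otimes>\<^bsub>B.PE\<^esub> B.new_arrow (tail Q a) \<ominus>\<^bsub>B.PE\<^esub>
         B.new_arrow (head Q a) \<otimes>\<^bsub>B.PE\<^esub> ext_elt K (z a))"
      if n: "tail Q a \<in> B.N" "head Q a \<in> B.N"
      unfolding rel_def Let_def defs tau_arrow[OF a n]
      using n inj[OF av(1)] inj[OF av(2)] lc[OF a] rc[OF n(1)] rc[OF n(2)] e(1)[OF z(1)[OF a n]] by (simp add: Qa(3) Qm)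
    show "rel K \<Lambda> d ?M Q I X \<Delta> \<Phi> t \<theta> a = I' +>\<^bsub>B.PE\<^esub>
        (B.old_arrow a \<otimes>\<^bsub>B.PE\<^esub> B.new_arrow (tail Q a))"
      if n: "tail Q a \<in> B.N" "head Q a \<notin> B.N"
      unfolding rel_def Let_def defs
      using n inj[OF av(1)] inj[OF av(2)] lc[OF a] rc[OF n(1)] by (simp add: Qa(3))
    show "rel K \<Lambda> d ?M Q I X \<Delta> \<Phi> t \<theta> a = I'" if n: "tail Q a \<notin> B.N"
      unfolding rel_def Let_def defs using n inj[OF av(1)] by (simp add: E.alg_quot_sel(2))
  qed
  then show ?thesis by (simp add: total_preprojective_def S_def rel_ideal_def defs)
qed

end
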